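(* Let $r=3$. Let $(u^*,U^* )\in\mathscr A_{\mathrm{ad}}$ be a feasible pair, let $p$ be the weak solution of the adjoint system associated with $u^*$, and assume that the first order necessary condition $$U^*=-p(0)$$ holds. Assume also that for any $(u,U)\in\mathcal M_{u^*,U^*}$, $$\frac12\int_0^T\left(\|u(t)\|_{\mathbb H}^2+\|\nabla u(t)\|_{\mathbb H}^2\right)dt+\frac12\|U\|_{\mathbb H}^2+\frac12\|u(T)\|_{\mathbb H}^2-\int_0^T\langle B(u(t),u(t)),p(t)\rangle dt$$ $$-\beta\int_0^T\left\langle2(u^*(t)\cdot u(t))u(t)+|u(t)|^2(u(t)+u^*(t)),p(t)\right\rangle dt\ \ge0.$$ Then $(u^*,U^* )$ is an optimal pair, i.e. it minimizes $\mathscr J$ over $\mathscr A_{\mathrm{ad}}$.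
   Context: Setting. $\mathcal O\subset\mathbb R^2$ is a bounded domain with smooth boundary, $T>0$, $\mu,\alpha,\beta>0$ and $r=3$. Let $\mathcal V=\{u\in C_0^\infty(\mathcal O;\mathbb R^2):\nabla\cdot u=0\}$; $\mathbb H$, $\mathbb V$, $\widetilde{\mathbb L}^4$ are the closures of $\mathcal V$ in $L^2(\mathcal O;\mathbb R^2)$, $H^1_0(\mathcal O;\mathbb R^2)$, $L^4(\mathcal O;\mathbb R^2)$, with $\|u\|_{\mathbb H}^2=\int_{\mathcal O}|u|^2dx$, $\|u\|_{\mathbb V}^2=\int_{\mathcal O}|\nabla u|^2dx$, $\|u\|_{\widetilde{\mathbb L}^4}^4=\int_{\mathcal O}|u|^4dx$. $(\cdot,\cdot)$ is the inner product of $\mathbb H$; $\mathbb H$ is identified with its dual, $\mathbb V\subset\mathbb H\subset\mathbb V'$, and $\langle\cdot,\cdot\rangle$ is the induced duality (between $\mathbb V'$ and $\mathbb V$, and between $L^{4/3}$ and $L^4$). $\mathcal P$ is the Helmholtz–Hodge projection onto divergence-free fields. $A:\mathbb V\to\mathbb V'$ is $\langle Au,v\rangle=\int_{\mathcal O}\nabla u:\nabla v\,dx$ (so $A=-\mathcal P\Delta$; for $u\in\mathbb V$, $-\Delta u\in\mathbb V'$ denotes the same functional); $B(u,v)\in\mathbb V'$ is $\langle B(u,v),w\rangle=\int_{\mathcal O}(u\cdot\nabla)v\cdot w\,dx$, $B(u)=B(u,u)$, $B'(u)w=B(u,w)+B(w,u)$, $\langle(B'(u))^*p,q\rangle=\langle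 B(u,q),p\rangle+\langle B(q,u),p\rangle$. $\mathcal C(u)=\mathcal P(|u|^2u)$, $\mathcal C'(u)v=\mathcal P(|u|^2v+2u(u\cdot v))$. State system with initial-data control $U\in\mathbb H$, for given $f\in L^2(0,T;\mathbb V')$: $\partial_tu+\mu Au+B(u)+\alpha u+\beta\mathcal C(u)=f$ in $\mathbb V'$ for a.e. $t\in[0,T]$, $u(0)=U$. A weak solution is $u\in L^\infty(0,T;\mathbb H)\cap L^2(0,T;\mathbb V)$ with $\partial_tu\in L^{4/3}(0,T;\mathbb V')$, satisfying the equation tested against every $v\in\mathbb V$, $\lim_{t\downarrow0}(u(t),v)=(U,v)$ for $v\in\mathbb V$, and the energy equality $\|u(t)\|_{\mathbb H}^2+2\mu\int_0^t\|u\|_{\mathbb V}^2ds+2\alpha\int_0^t\|u\|_{\mathbb H}^2ds+2\beta\int_0^t\|u\|_{\widetilde{\mathbb L}^4}^4ds=\|U\|_{\mathbb H}^2+2\int_0^t\langle f,u\rangle ds$ for all $t\in[0,T]$. For each $U\in\mathbb H$ it is known that there is a unique weak solution, and it lies in $C([0,T];\mathbb H)\cap L^2(0,T;\mathbb V)$. Admissible class: $\mathscr A_{\mathrm{ad}}$ (also written $\mathcal A_{\mathrm{ad}}$) is the set of pairs $(u,U)$ with $U\in\mathbb H$ and $u$ the unique weak solution with $u(0)=U$; its elements are called feasible pairs. $\mathcal M_{u^*,U^*}=\{(z-u^*,W-U^* ):(z,W)\in\mathscr A_{\mathrm{ad}}\}$. Cost: given $u_M\in L^2(0,T;\mathbb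 H)$ and $u_M^f\in\mathbb H$, $$\mathscr J(u,U)=\tfrac12\|U\|_{\mathbb H}^2+\tfrac12\int_0^T\|u(t)-u_M(t)\|_{\mathbb H}^2dt+\tfrac12\int_0^T\|\nabla u(t)\|_{\mathbb H}^2dt+\tfrac12\|u(T)-u_M^f\|_{\mathbb H}^2.$$ Adjoint system associated with $u^*$: $-\partial_tp+\mu Ap+(B'(u^* ))^*p+\alpha p+\beta\mathcal C'(u^* )p=(u^*-u_M)-\Delta u^*$ in $\mathbb V'$ for a.e. $t\in[0,T]$, $p(T)=u^*(T)-u_M^f$; its weak solution $p\in C([0,T];\mathbb H)\cap L^2(0,T;\mathbb V)$, with $\partial_tp\in L^{4/3}(0,T;\mathbb V')$, is unique. *)

theory Defs
  imports "HOL-Analysis.Analysis"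
begin

text \<open>
  Elements of Lebesgue and Sobolev spaces are represented by functions on the whole plane, of
  which only the almost-everywhere class on the domain \<open>\<Omega>\<close> matters.  Consequently norms are
  seminorms on representatives, and equality in such a space is equality a.e. on \<open>\<Omega>\<close>.
\<close>

type_synonym plane = "real^2"
type_synonym vfield = "plane \<Rightarrow> real^2"
type_synonym functional = "vfield \<Rightarrow> real"


section \<open>Smooth functions and domains\<close>

primrec Ck_on :: "nat \<Rightarrow> 'a::real_normed_vector set \<Rightarrow> ('a \<Rightarrow> 'b::real_normed_vector) \<Rightarrow> bool" where
  "Ck_on 0 S f \<longleftrightarrow> continuous_on S f"
| "Ck_on (Suc k) S f \<longleftrightarrow> (\<forall>x\<in>S. f differentiable (at x)) \<and>
     (\<forall>v. Ck_on k S (\<lambda>x. frechet_derivative f (at x) v))"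

definition smooth :: "('a::real_normed_vector \<Rightarrow> 'b::real_normed_vector) \<Rightarrow> bool" where
  "smooth f \<longleftrightarrow> (\<forall>k. Ck_on k UNIV f)"

definition test_functions :: "'a::real_normed_vector set \<Rightarrow> ('a \<Rightarrow> 'b::real_normed_vector) set" where
  "test_functions S = {\<phi>. smooth \<phi> \<and> compact (closure {x. \<phi> x \<noteq> 0}) \<and> closure {x. \<phi> x \<noteq> 0} \<subseteq> S}"

text \<open>The boundary is smooth if, in suitable orthonormal coordinates \<open>(e, \<nu>)\<close> around each of its
  points, the domain is locally the set above the graph of a smooth function.\<close>

definition smooth_bounded_domain :: "plane set \<Rightarrow> bool" where
  "smooth_bounded_domain \<Omega> \<longleftrightarrow> open \<Omega> \<and> connected \<Omega> \<and> \<Omega> \<noteq> {} \<and> bounded \<Omega> \<and>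
     (\<forall>x0\<in>frontier \<Omega>. \<exists>r>0. \<exists>e \<nu>. \<exists>\<gamma>::real \<Rightarrow> real.
        norm e = 1 \<and> norm \<nu> = 1 \<and> e \<bullet> \<nu> = 0 \<and> smooth \<gamma> \<and>
        \<Omega> \<inter> ball x0 r = {x \<in> ball x0 r. x \<bullet> \<nu> > \<gamma> (x \<bullet> e)})"


section \<open>Lebesgue and Sobolev spaces\<close>

definition Lp :: "real \<Rightarrow> plane set \<Rightarrow> (plane \<Rightarrow> 'b::euclidean_space) set" where
  "Lp q \<Omega> = {u \<in> borel_measurable (lebesgue_on \<Omega>).
     integrable (lebesgue_on \<Omega>) (\<lambda>x. norm (u x) powr q)}"

definition Lp_norm :: "real \<Rightarrow> plane set \<Rightarrow> (plane \<Rightarrow> 'b::euclidean_space) \<Rightarrow> real" where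
  "Lp_norm q \<Omega> u = (LINT x|lebesgue_on \<Omega>. norm (u x) powr q) powr (1 / q)"

text \<open>The entry \<open>G x $ i $ j\<close> is the weak derivative of the \<open>i\<close>-th component in direction \<open>j\<close>.\<close>

definition has_weak_grad :: "plane set \<Rightarrow> vfield \<Rightarrow> (plane \<Rightarrow> real^2^2) \<Rightarrow> bool" where
  "has_weak_grad \<Omega> u G \<longleftrightarrow> u \<in> Lp 2 \<Omega> \<and> G \<in> Lp 2 \<Omega> \<and>
     (\<forall>\<phi>\<in>test_functions \<Omega>. \<forall>i j.
        (LINT x|lebesgue_on \<Omega>. u x $ i * frechet_derivative \<phi> (at x) (axis j 1)) =
        - (LINT x|lebesgue_on \<Omega>. G x $ i $ j * \<phi> x))"

definition wgrad :: "plane set \<Rightarrow> vfield \<Rightarrow> plane \<Rightarrow> real^2^2" where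
  "wgrad \<Omega> u = (SOME G. has_weak_grad \<Omega> u G)"

definition H1 :: "plane set \<Rightarrow> vfield set" where
  "H1 \<Omega> = {u. \<exists>G. has_weak_grad \<Omega> u G}"

definition H1_norm :: "plane set \<Rightarrow> vfield \<Rightarrow> real" where
  "H1_norm \<Omega> u = sqrt ((Lp_norm 2 \<Omega> u)\<^sup>2 + (Lp_norm 2 \<Omega> (wgrad \<Omega> u))\<^sup>2)"

definition norm_closure :: "'e::minus set \<Rightarrow> ('e \<Rightarrow> real) \<Rightarrow> 'e set \<Rightarrow> 'e set" where
  "norm_closure X N S = {u\<in>X. \<exists>\<phi>. (\<forall>n. \<phi> n \<in> S) \<and> (\<lambda>n::nat. N (u - \<phi> n)) \<longlonglongrightarrow> 0}"

definition H10 :: "plane set \<Rightarrow> vfield set" where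
  "H10 \<Omega> = norm_closure (H1 \<Omega>) (H1_norm \<Omega>) (test_functions \<Omega>)"


section \<open>Spaces of divergence-free fields\<close>

definition solenoidal_tests :: "plane set \<Rightarrow> vfield set" where
  "solenoidal_tests \<Omega> = {u \<in> test_functions \<Omega>. \<forall>x. trace (jacobian u (at x)) = 0}"

definition H_space :: "plane set \<Rightarrow> vfield set" where
  "H_space \<Omega> = norm_closure (Lp 2 \<Omega>) (Lp_norm 2 \<Omega>) (solenoidal_tests \<Omega>)"

definition H_norm :: "plane set \<Rightarrow> vfield \<Rightarrow> real" where
  "H_norm \<Omega> u = Lp_norm 2 \<Omega> u"

definition H_inner :: "plane set \<Rightarrow> vfield \<Rightarrow> vfield \<Rightarrow> real" where
  "H_inner \<Omega> u v = (LINT x|lebesgue_on \<Omega>. u x \<bullet> v x)"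

definition V_space :: "plane set \<Rightarrow> vfield set" where
  "V_space \<Omega> = norm_closure (H10 \<Omega>) (H1_norm \<Omega>) (solenoidal_tests \<Omega>)"

definition V_norm :: "plane set \<Rightarrow> vfield \<Rightarrow> real" where
  "V_norm \<Omega> u = Lp_norm 2 \<Omega> (wgrad \<Omega> u)"

definition V_dual :: "plane set \<Rightarrow> functional set" where
  "V_dual \<Omega> = {F.
     (\<forall>u\<in>V_space \<Omega>. \<forall>v\<in>V_space \<Omega>. \<forall>a b. F (\<lambda>x. a *\<^sub>R u x + b *\<^sub>R v x) = a * F u + b * F v) \<and>
     (\<exists>C. \<forall>v\<in>V_space \<Omega>. \<bar>F v\<bar> \<le> C * V_norm \<Omega> v)}"

definition V_dual_norm :: "plane set \<Rightarrow> functional \<Rightarrow> real" where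
  "V_dual_norm \<Omega> F = (SUP v\<in>{v\<in>V_space \<Omega>. V_norm \<Omega> v \<le> 1}. \<bar>F v\<bar>)"

text \<open>The Helmholtz--Hodge projection, as the orthogonal projection of \<open>L\<^sup>2\<close> onto \<open>H\<close>.  It is only
  applied to cubic expressions in elements of \<open>V\<close>, which belong to \<open>L\<^sup>2\<close> in two dimensions.\<close>

definition helmholtz :: "plane set \<Rightarrow> vfield \<Rightarrow> vfield" where
  "helmholtz \<Omega> g = (SOME w. w \<in> H_space \<Omega> \<and> (\<forall>v\<in>H_space \<Omega>. H_inner \<Omega> (g - w) v = 0))"


section \<open>Operators\<close>

definition A_op :: "plane set \<Rightarrow> vfield \<Rightarrow> functional" where
  "A_op \<Omega> u = (\<lambda>v. LINT x|lebesgue_on \<Omega>. wgrad \<Omega> u x \<bullet> wgrad \<Omega> v x)"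

text \<open>By the index convention for \<open>wgrad\<close>, \<open>(u \<cdot> \<nabla>) v\<close> is the matrix-vector product of
  \<open>\<nabla> v\<close> and \<open>u\<close>.\<close>

definition B_op :: "plane set \<Rightarrow> vfield \<Rightarrow> vfield \<Rightarrow> functional" where
  "B_op \<Omega> u v = (\<lambda>w. LINT x|lebesgue_on \<Omega>. (wgrad \<Omega> v x *v u x) \<bullet> w x)"

definition B_deriv :: "plane set \<Rightarrow> vfield \<Rightarrow> vfield \<Rightarrow> functional" where
  "B_deriv \<Omega> u w = (\<lambda>v. B_op \<Omega> u w v + B_op \<Omega> w u v)"

definition B_deriv_adj :: "plane set \<Rightarrow> vfield \<Rightarrow> vfield \<Rightarrow> functional" where
  "B_deriv_adj \<Omega> u p = (\<lambda>q. B_deriv \<Omega> u q p)"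

definition C_op :: "plane set \<Rightarrow> vfield \<Rightarrow> vfield" where
  "C_op \<Omega> u = helmholtz \<Omega> (\<lambda>x. (norm (u x))\<^sup>2 *\<^sub>R u x)"

definition C_deriv :: "plane set \<Rightarrow> vfield \<Rightarrow> vfield \<Rightarrow> vfield" where
  "C_deriv \<Omega> u v = helmholtz \<Omega> (\<lambda>x. (norm (u x))\<^sup>2 *\<^sub>R v x + (2 * (u x \<bullet> v x)) *\<^sub>R u x)"


section \<open>Spaces of functions of time\<close>

text \<open>Bochner measurability: a.e. limit of simple functions, for a space with carrier \<open>X\<close> and
  (semi)norm \<open>N\<close>.\<close>

definition strongly_measurable :: "real \<Rightarrow> 'e::minus set \<Rightarrow> ('e \<Rightarrow> real) \<Rightarrow> (real \<Rightarrow> 'e) \<Rightarrow> bool" where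
  "strongly_measurable T X N u \<longleftrightarrow>
     (\<exists>s. (\<forall>n. simple_function (lebesgue_on {0..T}) (s n) \<and> s n ` {0..T} \<subseteq> X) \<and>
          (AE t in lebesgue_on {0..T}. (\<lambda>n::nat. N (u t - s n t)) \<longlonglongrightarrow> 0))"

definition Bochner_Lp :: "real \<Rightarrow> real \<Rightarrow> 'e::minus set \<Rightarrow> ('e \<Rightarrow> real) \<Rightarrow> (real \<Rightarrow> 'e) set" where
  "Bochner_Lp q T X N = {u. strongly_measurable T X N u \<and>
     (AE t in lebesgue_on {0..T}. u t \<in> X) \<and>
     integrable (lebesgue_on {0..T}) (\<lambda>t. N (u t) powr q)}"

definition Bochner_Linf :: "real \<Rightarrow> 'e::minus set \<Rightarrow> ('e \<Rightarrow> real) \<Rightarrow> (real \<Rightarrow> 'e) set" where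
  "Bochner_Linf T X N = {u. strongly_measurable T X N u \<and>
     (AE t in lebesgue_on {0..T}. u t \<in> X) \<and>
     (\<exists>C. AE t in lebesgue_on {0..T}. N (u t) \<le> C)}"

definition continuous_in :: "real \<Rightarrow> 'e::minus set \<Rightarrow> ('e \<Rightarrow> real) \<Rightarrow> (real \<Rightarrow> 'e) set" where
  "continuous_in T X N = {u. \<forall>t\<in>{0..T}. u t \<in> X \<and>
     ((\<lambda>s. N (u s - u t)) \<longlongrightarrow> 0) (at t within {0..T})}"

text \<open>Distributional derivative on \<open>(0,T)\<close> of an \<open>H\<close>-valued function as an element of
  \<open>V'\<close>; both sides are elements of \<open>V'\<close>, evaluated at \<open>v\<close>.\<close>

definition has_time_deriv :: "plane set \<Rightarrow> real \<Rightarrow> (real \<Rightarrow> vfield) \<Rightarrow> (real \<Rightarrow> functional) \<Rightarrow> bool" where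
  "has_time_deriv \<Omega> T u g \<longleftrightarrow>
     (\<forall>\<psi>\<in>test_functions {0<..<T}. \<forall>v\<in>V_space \<Omega>.
        (LINT t|lebesgue_on {0..T}. deriv \<psi> t * H_inner \<Omega> (u t) v) =
        - (LINT t|lebesgue_on {0..T}. \<psi> t * g t v))"


section \<open>State system, cost and adjoint system\<close>

definition weak_solution ::
  "plane set \<Rightarrow> real \<Rightarrow> real \<Rightarrow> real \<Rightarrow> real \<Rightarrow> (real \<Rightarrow> functional) \<Rightarrow> vfield \<Rightarrow> (real \<Rightarrow> vfield) \<Rightarrow> bool"
where
  "weak_solution \<Omega> T \<mu> \<alpha> \<beta> f U u \<longleftrightarrow>
     u \<in> Bochner_Linf T (H_space \<Omega>) (H_norm \<Omega>) \<and>
     u \<in> Bochner_Lp 2 T (V_space \<Omega>) (V_norm \<Omega>) \<and>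
     (\<exists>du \<in> Bochner_Lp (4/3) T (V_dual \<Omega>) (V_dual_norm \<Omega>).
        has_time_deriv \<Omega> T u du \<and>
        (AE t in lebesgue_on {0..T}. \<forall>v\<in>V_space \<Omega>.
           du t v + \<mu> * A_op \<Omega> (u t) v + B_op \<Omega> (u t) (u t) v
             + \<alpha> * H_inner \<Omega> (u t) v + \<beta> * H_inner \<Omega> (C_op \<Omega> (u t)) v = f t v)) \<and>
     (\<forall>v\<in>V_space \<Omega>. ((\<lambda>t. H_inner \<Omega> (u t) v) \<longlongrightarrow> H_inner \<Omega> U v) (at_right 0)) \<and>
     (\<forall>t\<in>{0..T}.
        (H_norm \<Omega> (u t))\<^sup>2
          + 2 * \<mu> * (LINT s|lebesgue_on {0..t}. (V_norm \<Omega> (u s))\<^sup>2)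
          + 2 * \<alpha> * (LINT s|lebesgue_on {0..t}. (H_norm \<Omega> (u s))\<^sup>2)
          + 2 * \<beta> * (LINT s|lebesgue_on {0..t}. (Lp_norm 4 \<Omega> (u s)) ^ 4)
        = (H_norm \<Omega> U)\<^sup>2 + 2 * (LINT s|lebesgue_on {0..t}. f s (u s)))"

text \<open>Membership in \<open>C([0,T];H)\<close> selects the continuous representative in time of the weak
  solution (the unique one for its initial datum), so that \<open>u T\<close> is meaningful.\<close>

definition admissible ::
  "plane set \<Rightarrow> real \<Rightarrow> real \<Rightarrow> real \<Rightarrow> real \<Rightarrow> (real \<Rightarrow> functional) \<Rightarrow> ((real \<Rightarrow> vfield) \<times> vfield) set"
where
  "admissible \<Omega> T \<mu> \<alpha> \<beta> f = {(u, U). U \<in> H_space \<Omega> \<and> weak_solution \<Omega> T \<mu> \<alpha> \<beta> f U u \<and>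
     u \<in> continuous_in T (H_space \<Omega>) (H_norm \<Omega>)}"

definition feasible_differences ::
  "plane set \<Rightarrow> real \<Rightarrow> real \<Rightarrow> real \<Rightarrow> real \<Rightarrow> (real \<Rightarrow> functional) \<Rightarrow> (real \<Rightarrow> vfield) \<Rightarrow> vfield \<Rightarrow>
   ((real \<Rightarrow> vfield) \<times> vfield) set"
where
  "feasible_differences \<Omega> T \<mu> \<alpha> \<beta> f us Us =
     {(z - us, W - Us) | z W. (z, W) \<in> admissible \<Omega> T \<mu> \<alpha> \<beta> f}"

definition cost ::
  "plane set \<Rightarrow> real \<Rightarrow> (real \<Rightarrow> vfield) \<Rightarrow> vfield \<Rightarrow> (real \<Rightarrow> vfield) \<Rightarrow> vfield \<Rightarrow> real"
where
  "cost \<Omega> T uM uMf u U =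
     1/2 * (H_norm \<Omega> U)\<^sup>2
     + 1/2 * (LINT t|lebesgue_on {0..T}. (H_norm \<Omega> (u t - uM t))\<^sup>2)
     + 1/2 * (LINT t|lebesgue_on {0..T}. (Lp_norm 2 \<Omega> (wgrad \<Omega> (u t)))\<^sup>2)
     + 1/2 * (H_norm \<Omega> (u T - uMf))\<^sup>2"

definition optimal_pair ::
  "plane set \<Rightarrow> real \<Rightarrow> real \<Rightarrow> real \<Rightarrow> real \<Rightarrow> (real \<Rightarrow> functional) \<Rightarrow>
   (real \<Rightarrow> vfield) \<Rightarrow> vfield \<Rightarrow> (real \<Rightarrow> vfield) \<Rightarrow> vfield \<Rightarrow> bool"
where
  "optimal_pair \<Omega> T \<mu> \<alpha> \<beta> f uM uMf us Us \<longleftrightarrow>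
     (us, Us) \<in> admissible \<Omega> T \<mu> \<alpha> \<beta> f \<and>
     (\<forall>(z, W) \<in> admissible \<Omega> T \<mu> \<alpha> \<beta> f. cost \<Omega> T uM uMf us Us \<le> cost \<Omega> T uM uMf z W)"

text \<open>As a functional on \<open>V\<close>, \<open>-\<Delta> (us t)\<close> is \<open>A_op \<Omega> (us t)\<close>.\<close>

definition adjoint_solution ::
  "plane set \<Rightarrow> real \<Rightarrow> real \<Rightarrow> real \<Rightarrow> real \<Rightarrow> (real \<Rightarrow> vfield) \<Rightarrow> vfield \<Rightarrow>
   (real \<Rightarrow> vfield) \<Rightarrow> (real \<Rightarrow> vfield) \<Rightarrow> bool"
where
  "adjoint_solution \<Omega> T \<mu> \<alpha> \<beta> uM uMf us p \<longleftrightarrow>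
     p \<in> continuous_in T (H_space \<Omega>) (H_norm \<Omega>) \<and>
     p \<in> Bochner_Lp 2 T (V_space \<Omega>) (V_norm \<Omega>) \<and>
     (\<exists>dp \<in> Bochner_Lp (4/3) T (V_dual \<Omega>) (V_dual_norm \<Omega>).
        has_time_deriv \<Omega> T p dp \<and>
        (AE t in lebesgue_on {0..T}. \<forall>v\<in>V_space \<Omega>.
           - dp t v + \<mu> * A_op \<Omega> (p t) v + B_deriv_adj \<Omega> (us t) (p t) v
             + \<alpha> * H_inner \<Omega> (p t) v + \<beta> * H_inner \<Omega> (C_deriv \<Omega> (us t) (p t)) v
           = H_inner \<Omega> (us t - uM t) v + A_op \<Omega> (us t) v)) \<and>
     (AE x in lebesgue_on \<Omega>. p T x = us T x - uMf x)"

end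

theory Submission
  imports Defs "HOL-Computational_Algebra.Polynomial"
begin

text \<open>
  The cost is quadratic and the state equation is polynomial, so the difference of the costs of two
  feasible pairs can be computed exactly.  Let \<open>(z, W)\<close> be a competitor of \<open>(us, Us)\<close>, and let
  \<open>w = z - us\<close>, \<open>D = W - Us\<close>.  Expanding the squares, the difference of the costs is the sum of
  \<open>1/2 \<integral> (\<bar>w\<bar>\<^sup>2 + \<bar>\<nabla>w\<bar>\<^sup>2) + 1/2 \<bar>D\<bar>\<^sup>2 + 1/2 \<bar>w(T)\<bar>\<^sup>2\<close> and of the linear term
  \<open>\<integral> (us - uM, w) + \<integral> (\<nabla>us, \<nabla>w) + (Us, D) + (us(T) - uMf, w(T))\<close>.
  The convection term is bilinear and the damping term is cubic, so subtracting the two state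
  equations shows that \<open>w\<close> solves the equation linearised at \<open>us\<close>, up to the remainder
  \<open>- B(w,w) - \<beta> (2 (us \<cdot> w) w + \<bar>w\<bar>\<^sup>2 (w + us))\<close>.  Test this equation with the adjoint state \<open>p\<close>, test
  the adjoint equation with \<open>w\<close>, and integrate by parts in time.  All linear terms cancel except for
  the right-hand side of the adjoint equation, so that the two integrals in the linear term equal the
  integral of the remainder against \<open>p\<close> and the boundary terms \<open>- (w(T), p(T)) + (w(0), p(0))\<close>.  The
  final condition \<open>p(T) = us(T) - uMf\<close> and the first order condition \<open>p(0) = - Us\<close> cancel these
  against the other two linear terms.  Hence the difference of the costs is the left-hand side of the
  second order condition, and this is nonnegative.  The algebra is \<open>remainder_identity\<close>, and
  \<open>duality_identity\<close> integrates it over time.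

  The analytical core is the integration by parts (\<open>integration_by_parts\<close>).  The pairing
  \<open>\<langle>\<partial>\<^sub>t u, p\<rangle>\<close> is not controlled by the norms in which the solutions are given:
  \<open>\<partial>\<^sub>t u\<close> lies in \<open>L\<^sup>4\<^sup>/\<^sup>3(0,T;V')\<close>, whereas \<open>p\<close> lies in \<open>L\<^sup>2(0,T;V)\<close> only.  The equation, however, shows
  more.  By Young's inequality, every term of it, and hence \<open>\<langle>\<partial>\<^sub>t u(t), v\<rangle>\<close>, is at most
  \<open>A(t) + K (\<bar>\<nabla>v\<bar>\<^sub>2\<^sup>2 + \<bar>v\<bar>\<^sub>4\<^sup>4)\<close> with an integrable \<open>A\<close> (\<open>state_derivative_bound\<close>,
  \<open>adjoint_derivative_bound\<close>).  The quantity in parentheses, the \<open>energy\<close> of \<open>v\<close>, is integrable in time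
  along a function in \<open>C(0,T;H) \<inter> L\<^sup>2(0,T;V)\<close>, by Ladyzhenskaya's inequality
  \<open>\<bar>v\<bar>\<^sub>4\<^sup>4 \<le> 8 \<bar>v\<bar>\<^sub>2\<^sup>2 \<bar>\<nabla>v\<bar>\<^sub>2\<^sup>2\<close> (\<open>V_inequalities\<close>, \<open>energy_integrable\<close>).  With such a bound for the
  derivatives, the difference quotients of \<open>(u, p)\<close> converge to the sum of the two pairings, because the
  averages of \<open>\<langle>\<partial>\<^sub>t u(s), p(t)\<rangle>\<close> over strips shrinking to the diagonal converge to its integral on
  the diagonal (\<open>pairing_diagonal\<close>).

  In space, the Sobolev inequalities come from the embedding of \<open>W\<^sup>1\<^sup>,\<^sup>1\<close> of the plane into \<open>L\<^sup>2\<close>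
  (\<open>planar_W11\<close>), applied to powers of a test function; they bound \<open>\<bar>v\<bar>\<^sub>4\<close> and give the integrability of
  \<open>\<bar>v\<bar>\<^sup>6\<close>.  By the latter, cubic expressions in elements of \<open>V\<close> are square integrable, so the
  Helmholtz projection may be dropped when they are tested with elements of \<open>V\<close> (\<open>C_op_inner\<close>,
  \<open>C_deriv_inner\<close>).
\<close>

section \<open>Smooth steps and bumps\<close>

lemma frechet_derivative_worksI:
  "f differentiable (at x) \<Longrightarrow> (f has_derivative frechet_derivative f (at x)) (at x)"
  by (simp add: frechet_derivative_works)

lemma Ck_on_Suc_imp: "Ck_on (Suc k) S f \<Longrightarrow> Ck_on k S f"
proof (induction k arbitrary: f)
  case 0
  then show ?case
    by (auto simp: continuous_at_imp_continuous_on differentiable_imp_continuous_within)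
next
  case (Suc k)
  from Suc.prems have d: "\<forall>x\<in>S. f differentiable (at x)"
    and D: "\<forall>v. Ck_on (Suc k) S (\<lambda>x. frechet_derivative f (at x) v)"
    using Ck_on.simps(2)[of "Suc k" S f] by blast+
  show ?case unfolding Ck_on.simps(2)[of k S f] using d D Suc.IH by blast
qed

lemma Ck_on_const: "Ck_on k S (\<lambda>x. c)"
  by (induction k arbitrary: c) auto

lemma Ck_on_add:
  "Ck_on k UNIV f \<Longrightarrow> Ck_on k UNIV g \<Longrightarrow> Ck_on k UNIV (\<lambda>x. f x + g x)"
proof (induction k arbitrary: f g)
  case 0
  then show ?case by (simp add: continuous_on_add)
next
  case (Suc k)
  have d: "f differentiable (at x)" "g differentiable (at x)" for x using Suc.prems by auto
  have "frechet_derivative (\<lambda>x. f x + g x) (at x)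
      = (\<lambda>v. frechet_derivative f (at x) v + frechet_derivative g (at x) v)" for x
    by (intro frechet_derivative_at[symmetric] has_derivative_add)
       (use d in \<open>auto simp: frechet_derivative_works[symmetric]\<close>)
  then show ?case using Suc d by (auto intro!: differentiable_add)
qed

lemma Ck_on_bounded_linear_left:
  assumes L: "bounded_linear L"
  shows "Ck_on k UNIV f \<Longrightarrow> Ck_on k UNIV (\<lambda>x. L (f x))"
proof (induction k arbitrary: f)
  case 0
  then show ?case using L by (simp add: bounded_linear.continuous_on)
next
  case (Suc k)
  have d: "f differentiable (at x)" for x using Suc.prems by auto
  have D: "((\<lambda>x. L (f x)) has_derivative (\<lambda>v. L (frechet_derivative f (at x) v))) (at x)" for x
    using bounded_linear.has_derivative[OF L] d frechet_derivative_works by blast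
  have "frechet_derivative (\<lambda>x. L (f x)) (at x) = (\<lambda>v. L (frechet_derivative f (at x) v))" for x
    using frechet_derivative_at[OF D] by simp
  then show ?case using Suc D by (auto simp: differentiable_def)
qed

lemma Ck_on_affine_right:
  assumes L: "bounded_linear L"
  shows "Ck_on k UNIV f \<Longrightarrow> Ck_on k UNIV (\<lambda>x. f (c + L x))"
proof (induction k arbitrary: f)
  case 0
  have "continuous_on UNIV (\<lambda>x. c + L x)"
    by (intro continuous_intros bounded_linear.continuous_on[OF L])
  then show ?case using 0 continuous_on_compose2[of UNIV f UNIV] by auto
next
  case (Suc k)
  have d: "f differentiable (at x)" for x using Suc.prems by auto
  have LD: "((\<lambda>x. c + L x) has_derivative L) (at x)" for x
    using has_derivative_add[OF has_derivative_const bounded_linear_imp_has_derivative[OF L]]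
    by simp
  have D: "((\<lambda>x. f (c + L x)) has_derivative
      (\<lambda>v. frechet_derivative f (at (c + L x)) (L v))) (at x)" for x
    by (rule has_derivative_compose[OF LD d[THEN frechet_derivative_worksI]])
  have "frechet_derivative (\<lambda>x. f (c + L x)) (at x)
      = (\<lambda>v. frechet_derivative f (at (c + L x)) (L v))" for x
    using frechet_derivative_at[OF D] by simp
  moreover have "Ck_on k UNIV (\<lambda>x. frechet_derivative f (at (c + L x)) w)" for w
    using Suc.IH[of "\<lambda>y. frechet_derivative f (at y) w"] Suc.prems by auto
  ultimately show ?case using D by (auto simp: differentiable_def)
qed

lemma Ck_on_mult:
  fixes f g :: "'a::real_normed_vector \<Rightarrow> real"
  shows "Ck_on k UNIV f \<Longrightarrow> Ck_on k UNIV g \<Longrightarrow> Ck_on k UNIV (\<lambda>x. f x * g x)"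
proof (induction k arbitrary: f g)
  case 0
  then show ?case by (simp add: continuous_on_mult)
next
  case (Suc k)
  have d: "f differentiable (at x)" "g differentiable (at x)" for x using Suc.prems by auto
  have D: "((\<lambda>x. f x * g x) has_derivative
      (\<lambda>v. f x * frechet_derivative g (at x) v + frechet_derivative f (at x) v * g x)) (at x)" for x
    by (intro has_derivative_mult) (use d in \<open>auto simp: frechet_derivative_works[symmetric]\<close>)
  have "frechet_derivative (\<lambda>x. f x * g x) (at x)
      = (\<lambda>v. f x * frechet_derivative g (at x) v + frechet_derivative f (at x) v * g x)" for x
    using frechet_derivative_at[OF D] by simp
  moreover have "Ck_on k UNIV (\<lambda>x. f x * frechet_derivative g (at x) v + frechet_derivative f (at x) v * g x)" for v
    using Suc.prems Ck_on_Suc_imp[OF Suc.prems(1)] Ck_on_Suc_imp[OF Suc.prems(2)]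
    by (intro Ck_on_add Suc.IH) (simp_all only: Ck_on.simps)
  ultimately show ?case using D by (auto simp: differentiable_def)
qed

lemma Ck_on_prod:
  fixes f :: "'i \<Rightarrow> 'a::real_normed_vector \<Rightarrow> real"
  shows "(\<And>i. i \<in> I \<Longrightarrow> Ck_on k UNIV (f i)) \<Longrightarrow> Ck_on k UNIV (\<lambda>x. \<Prod>i\<in>I. f i x)"
  by (induction I rule: infinite_finite_induct) (auto intro: Ck_on_const Ck_on_mult)

text \<open>
  The one-dimensional case in terms of ordinary derivatives, which lets smoothness be proved by
  computing derivatives as in calculus.
\<close>

lemma Ck_on_real_primitive:
  fixes f :: "real \<Rightarrow> real"
  assumes D: "\<And>t. (f has_real_derivative f' t) (at t)" and C: "Ck_on k UNIV f'"
  shows "Ck_on (Suc k) UNIV f"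
proof -
  have "frechet_derivative f (at t) = (\<lambda>v. v * f' t)" for t
    using frechet_derivative_at[OF D[of t, unfolded has_field_derivative_def]]
    by (metis (no_types) mult.commute)
  then show ?thesis
    using Ck_on_mult[OF Ck_on_const C] D by (auto simp: real_differentiable_def)
qed


text \<open>
  The derivatives of \<open>exp (- 1/t)\<close>, extended by zero to \<open>t \<le> 0\<close>,
  have this form with polynomials \<open>P\<close> in \<open>1/t\<close>; the class is closed
  under differentiation, which makes all its members smooth.
\<close>

definition flat :: "real poly \<Rightarrow> real \<Rightarrow> real" where
  "flat P t = (if t \<le> 0 then 0 else poly P (1 / t) * exp (- (1 / t)))"

lemma tendsto_poly_exp_0:
  fixes P :: "real poly"
  shows "((\<lambda>s. poly P s * exp (- s)) \<longlongrightarrow> 0) at_top"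
proof -
  have "((\<lambda>s. \<Sum>i\<le>degree P. coeff P i * (s ^ i / exp s)) \<longlongrightarrow> (\<Sum>i\<le>degree P. coeff P i * 0)) at_top"
    by (intro tendsto_sum tendsto_mult tendsto_const tendsto_power_div_exp_0)
  then show ?thesis
    by (simp add: poly_altdef exp_minus field_simps sum_distrib_left sum_divide_distrib)
qed

lemma flat_has_derivative:
  "(flat P has_real_derivative flat ([:0, 0, 1:] * (P - pderiv P)) t) (at t)"
proof -
  consider "t < 0" | "t > 0" | "t = 0" by linarith
  then show ?thesis
  proof cases
    case 1
    have "((\<lambda>t. 0) has_real_derivative 0) (at t)" by simp
    then have "(flat P has_real_derivative 0) (at t)"
      by (rule has_field_derivative_transform_within_open[where S = "{..<0}"])
        (use 1 in \<open>auto simp: flat_def\<close>)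
    then show ?thesis using 1 by (simp add: flat_def)
  next
    case 2
    have "((\<lambda>t. poly P (1 / t) * exp (- (1 / t))) has_real_derivative
        flat ([:0, 0, 1:] * (P - pderiv P)) t) (at t)"
      using 2 by (auto intro!: derivative_eq_intros DERIV_chain'[OF _ poly_DERIV]
          simp: flat_def field_simps power2_eq_square)
    then show ?thesis
      by (rule has_field_derivative_transform_within_open[where S = "{0<..}"])
        (use 2 in \<open>auto simp: flat_def\<close>)
  next
    case 3
    have "((\<lambda>s. poly (pCons 0 P) s * exp (- s)) \<longlongrightarrow> 0) at_top" by (rule tendsto_poly_exp_0)
    then have "((\<lambda>t. poly (pCons 0 P) (inverse t) * exp (- inverse t)) \<longlongrightarrow> 0) (at_right 0)"
      by (rule filterlim_compose) (rule filterlim_inverse_at_top_right)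
    then have R: "((\<lambda>t. flat P t / t) \<longlongrightarrow> 0) (at_right 0)"
      by (rule tendsto_cong[THEN iffD1, rotated])
         (auto simp: flat_def eventually_at_filter field_simps)
    have L: "((\<lambda>t. flat P t / t) \<longlongrightarrow> 0) (at_left 0)"
      by (rule tendsto_eventually) (auto simp: flat_def eventually_at_filter)
    have "((\<lambda>t. flat P t / t) \<longlongrightarrow> 0) (at 0)"
      using L R by (simp add: filterlim_split_at)
    then show ?thesis using 3 by (simp add: DERIV_def flat_def)
  qed
qed

lemma Ck_on_flat: "Ck_on k UNIV (flat P)"
proof (induction k arbitrary: P)
  case 0
  then show ?case using flat_has_derivative
    by (auto intro!: continuous_at_imp_continuous_on DERIV_isCont)
next
  case (Suc k)
  then show ?case using Ck_on_real_primitive flat_has_derivative by blast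
qed

text \<open>
  The normalised primitive of \<open>exp (- 1/t) exp (- 1/(1 - t))\<close>, a smooth function
  supported in the unit interval.
\<close>

lemma smooth_step:
  obtains S s :: "real \<Rightarrow> real" where
    "smooth S" "\<And>t. (S has_real_derivative s t) (at t)" "continuous_on UNIV s"
    "\<And>t. 0 \<le> s t" "\<And>t. t \<le> 0 \<Longrightarrow> S t = 0" "\<And>t. t \<ge> 1 \<Longrightarrow> S t = 1"
proof -
  define \<phi> where "\<phi> t = flat [:1:] t * flat [:1:] (1 + (- 1) * t)" for t
  have C: "Ck_on k UNIV \<phi>" for k
    unfolding \<phi>_def
    by (intro Ck_on_mult Ck_on_flat Ck_on_affine_right bounded_linear_mult_right)
  have cont: "continuous_on UNIV \<phi>" using C[of 0] by simp
  have nn: "\<phi> t \<ge> 0" for t by (simp add: \<phi>_def flat_def)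
  have pos: "\<phi> t > 0" if "0 < t" "t < 1" for t using that by (simp add: \<phi>_def flat_def)
  have z: "\<phi> t = 0" if "t \<le> 0 \<or> t \<ge> 1" for t using that by (auto simp: \<phi>_def flat_def)
  have "\<exists>F. \<forall>x. - \<infinity> < ereal x \<longrightarrow> ereal x < \<infinity> \<longrightarrow> (F has_vector_derivative \<phi> x) (at x)"
    by (rule einterval_antiderivative) (use cont in \<open>auto simp: continuous_on_eq_continuous_at\<close>)
  then obtain F where F: "\<And>t. (F has_real_derivative \<phi> t) (at t)"
    by (auto simp: has_real_derivative_iff_has_vector_derivative)
  have cF: "continuous_on A F" for A
    using F by (auto intro!: continuous_at_imp_continuous_on DERIV_isCont)
  have lt: "F 0 < F 1"
  proof (rule DERIV_pos_imp_increasing_open[of 0 1 F])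
    fix x :: real assume "0 < x" "x < 1"
    then show "\<exists>y. DERIV F x :> y \<and> 0 < y"
      using F[of x] pos by blast
  qed (use cF in auto)
  have low: "F t = F 0" if "t \<le> 0" for t
  proof (cases "t = 0")
    case False
    then have "(F has_real_derivative 0) (at x)" if "x < 0" for x
      using F[of x] z[of x] that by simp
    then show ?thesis
      using DERIV_isconst_end[of t 0 F] that False cF by simp
  qed simp
  have high: "F t = F 1" if "t \<ge> 1" for t
  proof (cases "t = 1")
    case False
    then have "(F has_real_derivative 0) (at x)" if "1 < x" for x
      using F[of x] z[of x] that by simp
    then show ?thesis
      using DERIV_isconst_end[of 1 t F] that False cF by simp
  qed simp
  define c where "c = inverse (F 1 - F 0)"
  have c: "c > 0" using lt by (simp add: c_def)
  define S where "S t = c * (F t - F 0)" for t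
  have D: "(S has_real_derivative c * \<phi> t) (at t)" for t
    unfolding S_def by (auto intro!: derivative_eq_intros F)
  have "Ck_on k UNIV S" for k
    by (rule Ck_on_Suc_imp, rule Ck_on_real_primitive[OF D]) (intro Ck_on_mult Ck_on_const C)
  then have "smooth S" by (simp add: smooth_def)
  moreover have "continuous_on UNIV (\<lambda>t. c * \<phi> t)" using cont by (intro continuous_intros)
  moreover have "S t = 0" if "t \<le> 0" for t using low[OF that] by (simp add: S_def)
  moreover have "S t = 1" if "t \<ge> 1" for t using high[OF that] lt by (simp add: S_def c_def)
  ultimately show ?thesis using D c nn by (intro that[of S "\<lambda>t. c * \<phi> t"]) auto
qed

lemma smooth_imp_differentiable: "smooth f \<Longrightarrow> f differentiable (at x)"
  unfolding smooth_def using Ck_on.simps(2)[of 0 UNIV f] by blast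

lemma smooth_continuous: "smooth f \<Longrightarrow> continuous_on A f"
  unfolding smooth_def using Ck_on.simps(1)[of UNIV f] continuous_on_subset by blast

lemma smooth_derivative_continuous:
  "smooth f \<Longrightarrow> continuous_on A (\<lambda>x. frechet_derivative f (at x) v)"
  unfolding smooth_def using Ck_on.simps(2)[of 0 UNIV f] continuous_on_subset by fastforce

lemma smooth_affine: 
  "smooth f \<Longrightarrow> bounded_linear L \<Longrightarrow> smooth (\<lambda>x. f (c + L x))"
  by (simp add: smooth_def Ck_on_affine_right)

lemma smooth_bounded_linear: "bounded_linear L \<Longrightarrow> smooth f \<Longrightarrow> smooth (\<lambda>x. L (f x))"
  by (simp add: smooth_def Ck_on_bounded_linear_left)

lemma smooth_lincomb:
  "smooth f \<Longrightarrow> smooth g \<Longrightarrow> smooth (\<lambda>x. a *\<^sub>R f x + b *\<^sub>R g x)"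
  unfolding smooth_def
  by (auto intro!: Ck_on_add Ck_on_bounded_linear_left[OF bounded_linear_scaleR_right])

lemma smooth_prod:
  fixes f :: "'i \<Rightarrow> 'a::real_normed_vector \<Rightarrow> real"
  shows "(\<And>i. i \<in> I \<Longrightarrow> smooth (f i)) \<Longrightarrow> smooth (\<lambda>x. \<Prod>i\<in>I. f i x)"
  by (simp add: smooth_def Ck_on_prod)

lemma smooth_mult:
  fixes f g :: "'a::real_normed_vector \<Rightarrow> real"
  shows "smooth f \<Longrightarrow> smooth g \<Longrightarrow> smooth (\<lambda>x. f x * g x)"
  by (simp add: smooth_def Ck_on_mult)

lemma compact_closed_subset: "compact K \<Longrightarrow> closed C \<Longrightarrow> C \<subseteq> K \<Longrightarrow> compact C"
  by (metis compact_Int_closed inf.absorb_iff2)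

lemma test_functions_lincomb:
  assumes "f \<in> test_functions S" "g \<in> test_functions S"
  shows "(\<lambda>x. a *\<^sub>R f x + b *\<^sub>R g x) \<in> test_functions S"
proof -
  let ?h = "\<lambda>x. a *\<^sub>R f x + b *\<^sub>R g x"
  have sub: "closure {x. ?h x \<noteq> 0} \<subseteq> closure {x. f x \<noteq> 0} \<union> closure {x. g x \<noteq> 0}"
    unfolding closure_Un[symmetric] by (rule closure_mono) auto
  have "compact (closure {x. f x \<noteq> 0} \<union> closure {x. g x \<noteq> 0})"
    using assms by (auto simp: test_functions_def)
  then have "compact (closure {x. ?h x \<noteq> 0})"
    using closed_closure sub by (rule compact_closed_subset)
  then show ?thesis
    using assms sub smooth_lincomb by (auto simp: test_functions_def)
qed

text \<open>
  Multiply, over the coordinates, two smooth steps that climb within distance \<open>1/n\<close>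
  of the faces of the box. The steps climb inside the box, so the bumps vanish outside it.
\<close>

lemma box_bumps:
  fixes a b :: "'a::euclidean_space"
  assumes "cbox a b \<subseteq> U"
  obtains \<phi> :: "nat \<Rightarrow> 'a \<Rightarrow> real" where "\<And>n. \<phi> n \<in> test_functions U"
    "\<And>n x. 0 \<le> \<phi> n x \<and> \<phi> n x \<le> 1" "\<And>x. (\<lambda>n. \<phi> n x) \<longlonglongrightarrow> indicator (box a b) x"
proof -
  obtain S s where S: "smooth S" "\<And>t. (S has_real_derivative s t) (at t)" "continuous_on UNIV s"
    "\<And>t. 0 \<le> s t" and S0: "\<And>t. t \<le> 0 \<Longrightarrow> S t = 0" and S1: "\<And>t. t \<ge> 1 \<Longrightarrow> S t = 1"
    using smooth_step by metis
  have mono: "S x \<le> S y" if "x \<le> y" for x y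
    using DERIV_nonneg_imp_nondecreasing[of x y S] S that by blast
  have S01: "0 \<le> S t \<and> S t \<le> 1" for t
    using mono[of "min 0 t" t] mono[of t "max 1 t"] S0[of "min 0 t"] S1[of "max 1 t"] by auto
  define \<phi> where "\<phi> n x = (\<Prod>i\<in>Basis. S (- real n * (a \<bullet> i) + real n * (x \<bullet> i)) *
      S (real n * (b \<bullet> i) + (- real n) * (x \<bullet> i)))" for n :: nat and x :: 'a
  have sm: "smooth (\<phi> n)" for n
    unfolding \<phi>_def
    by (intro smooth_prod smooth_mult smooth_affine S(1) bounded_linear_const_mult
        bounded_linear_inner_left)
  have out: "\<phi> n x = 0" if nb: "x \<notin> box a b" for n x
  proof -
    obtain i where i: "i \<in> Basis" "x \<bullet> i \<le> a \<bullet> i \<or> b \<bullet> i \<le> x \<bullet> i"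
      using nb by (auto simp: mem_box not_less)
    then have "- real n * (a \<bullet> i) + real n * (x \<bullet> i) \<le> 0 \<or> real n * (b \<bullet> i) + (- real n) * (x \<bullet> i) \<le> 0"
      by (auto simp: mult_left_mono)
    then have "S (- real n * (a \<bullet> i) + real n * (x \<bullet> i)) * S (real n * (b \<bullet> i) + (- real n) * (x \<bullet> i)) = 0"
      using S0 by fastforce
    then show ?thesis unfolding \<phi>_def using i(1) by (intro prod_zero) auto
  qed
  have sup: "closure {x. \<phi> n x \<noteq> 0} \<subseteq> cbox a b" for n
    by (rule closure_minimal) (use out box_subset_cbox in blast)+
  have "compact (closure {x. \<phi> n x \<noteq> 0})" for n
    by (rule compact_closed_subset[OF compact_cbox closed_closure sup])
  then have "\<phi> n \<in> test_functions U" for n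
    using sup[of n] assms sm by (auto simp: test_functions_def)
  moreover have "0 \<le> \<phi> n x \<and> \<phi> n x \<le> 1" for n x
    unfolding \<phi>_def using S01 by (auto intro!: prod_nonneg prod_le_1 mult_nonneg_nonneg mult_le_one)
  moreover have "(\<lambda>n. \<phi> n x) \<longlonglongrightarrow> indicator (box a b) x" for x
  proof (cases "x \<in> box a b")
    case True
    have ev: "\<forall>\<^sub>F n in sequentially. S (- real n * (a \<bullet> i) + real n * (x \<bullet> i)) *
        S (real n * (b \<bullet> i) + (- real n) * (x \<bullet> i)) = 1" if i: "i \<in> Basis" for i
    proof -
      have p: "x \<bullet> i - a \<bullet> i > 0" "b \<bullet> i - x \<bullet> i > 0" using True i by (auto simp: mem_box)
      have "\<forall>\<^sub>F n in sequentially. real n * d \<ge> 1" if "d > 0" for d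
      proof -
        have "\<forall>\<^sub>F n in sequentially. real n \<ge> 1 / d"
          using filterlim_real_sequentially by (simp add: filterlim_at_top)
        then show ?thesis
          by eventually_elim (use that in \<open>simp add: field_simps\<close>)
      qed
      from eventually_conj[OF this[OF p(1)] this[OF p(2)]] show ?thesis
        by eventually_elim (simp add: S1 algebra_simps)
    qed
    have "\<forall>\<^sub>F n in sequentially. \<forall>i\<in>Basis. S (- real n * (a \<bullet> i) + real n * (x \<bullet> i)) *
        S (real n * (b \<bullet> i) + (- real n) * (x \<bullet> i)) = 1"
      using ev by (simp add: eventually_ball_finite_distrib)
    then have "\<forall>\<^sub>F n in sequentially. \<phi> n x = 1"
      by eventually_elim (simp add: \<phi>_def)
    then show ?thesis using True by (simp add: tendsto_eventually)
  qed (simp add: out)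
  ultimately show ?thesis by (intro that[of \<phi>]) auto
qed

section \<open>Square integrable functions\<close>

text \<open>
  Fatou's lemma for real integrals, with the integrability of the limit as part of the
  conclusion.
\<close>

lemma fatou_bound:
  fixes f :: "nat \<Rightarrow> 'a \<Rightarrow> real"
  assumes [measurable]: "\<And>n. f n \<in> borel_measurable M" "g \<in> borel_measurable M"
    and nn: "\<And>n x. 0 \<le> f n x" "\<And>x. 0 \<le> g x"
    and int: "\<And>n. integrable M (f n)"
    and lim: "AE x in M. (\<lambda>n. f n x) \<longlonglongrightarrow> g x"
    and bound: "\<And>n. (LINT x|M. f n x) \<le> c n" and c: "c \<longlonglongrightarrow> C"
  shows "integrable M g" "(LINT x|M. g x) \<le> C"
proof -
  have "0 \<le> c n" for n
    using bound[of n] Bochner_Integration.integral_nonneg[of M "f n"] nn by fastforce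
  then have C: "0 \<le> C" using c by (intro LIMSEQ_le_const[OF c]) auto
  have "(\<integral>\<^sup>+x. ennreal (g x) \<partial>M) = (\<integral>\<^sup>+x. liminf (\<lambda>n. ennreal (f n x)) \<partial>M)"
    using lim
    by (intro nn_integral_cong_AE, eventually_elim)
       (auto intro!: lim_imp_Liminf[symmetric] tendsto_ennrealI)
  also have "\<dots> \<le> liminf (\<lambda>n. \<integral>\<^sup>+x. ennreal (f n x) \<partial>M)"
    by (rule nn_integral_liminf) auto
  also have "\<dots> \<le> liminf (\<lambda>n. ennreal (c n))"
    by (intro Liminf_mono always_eventually allI)
       (simp add: nn_integral_eq_integral[OF int] nn bound ennreal_leI)
  also have "\<dots> = ennreal C"
    by (rule lim_imp_Liminf) (auto intro: tendsto_ennrealI c)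
  finally have le: "(\<integral>\<^sup>+x. ennreal (g x) \<partial>M) \<le> ennreal C" .
  then have "(\<integral>\<^sup>+x. ennreal (g x) \<partial>M) < \<infinity>"
    using ennreal_less_top le_less_trans infinity_ennreal_def by metis
  then show i: "integrable M g"
    using nn by (intro integrableI_nonneg) auto
  show "(LINT x|M. g x) \<le> C"
    using le nn_integral_eq_integral[OF i] nn C by (simp add: ennreal_le_iff)
qed

definition sq_integrable :: "'a measure \<Rightarrow> ('a \<Rightarrow> 'b::euclidean_space) \<Rightarrow> bool" where
  "sq_integrable M u \<longleftrightarrow> u \<in> borel_measurable M \<and> integrable M (\<lambda>x. (norm (u x))\<^sup>2)"

definition L2norm :: "'a measure \<Rightarrow> ('a \<Rightarrow> 'b::euclidean_space) \<Rightarrow> real" where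
  "L2norm M u = sqrt (LINT x|M. (norm (u x))\<^sup>2)"

lemma sq_integrableD [dest]:
  "sq_integrable M u \<Longrightarrow> u \<in> borel_measurable M"
  "sq_integrable M u \<Longrightarrow> integrable M (\<lambda>x. (norm (u x))\<^sup>2)"
  by (auto simp: sq_integrable_def)

lemma L2norm_nonneg [simp]: "0 \<le> L2norm M u"
  by (simp add: L2norm_def)

lemma L2norm_power2: "(L2norm M u)\<^sup>2 = (LINT x|M. (norm (u x))\<^sup>2)"
  by (simp add: L2norm_def)

lemma sq_integrable_inner:
  assumes "sq_integrable M u" "sq_integrable M v"
  shows "integrable M (\<lambda>x. u x \<bullet> v x)" "integrable M (\<lambda>x. norm (u x) * norm (v x))"
proof -
  have [measurable]: "u \<in> borel_measurable M" "v \<in> borel_measurable M" using assms by auto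
  have *: "integrable M (\<lambda>x. (norm (u x))\<^sup>2 + (norm (v x))\<^sup>2)" using assms by auto
  have b: "norm a * norm b \<le> (norm a)\<^sup>2 + (norm b)\<^sup>2" for a b :: 'b
  proof -
    have "0 \<le> norm a * norm b" by simp
    then show ?thesis using sum_squares_bound[of "norm a" "norm b"] by linarith
  qed
  show "integrable M (\<lambda>x. norm (u x) * norm (v x))"
    by (rule Bochner_Integration.integrable_bound[OF *]) (use b in auto)
  show "integrable M (\<lambda>x. u x \<bullet> v x)"
    by (rule Bochner_Integration.integrable_bound[OF *])
       (use b norm_cauchy_schwarz order_trans[OF Cauchy_Schwarz_ineq2 b] in auto)
qed

lemma sq_integrable_lincomb:
  assumes "sq_integrable M u" "sq_integrable M v"
  shows "sq_integrable M (\<lambda>x. a *\<^sub>R u x + b *\<^sub>R v x)"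
    and "(LINT x|M. (norm (a *\<^sub>R u x + b *\<^sub>R v x))\<^sup>2)
      = a\<^sup>2 * (L2norm M u)\<^sup>2 + 2 * a * b * (LINT x|M. u x \<bullet> v x) + b\<^sup>2 * (L2norm M v)\<^sup>2"
proof -
  have [measurable]: "u \<in> borel_measurable M" "v \<in> borel_measurable M" using assms by auto
  have e: "(norm (a *\<^sub>R u x + b *\<^sub>R v x))\<^sup>2
      = a\<^sup>2 * (norm (u x))\<^sup>2 + 2 * a * b * (u x \<bullet> v x) + b\<^sup>2 * (norm (v x))\<^sup>2" for x
    unfolding power2_norm_eq_inner
    by (simp only: inner_add_left inner_add_right inner_scaleR_left inner_scaleR_right
        inner_commute[of "v x" "u x"] power2_eq_square) algebra
  have i: "integrable M (\<lambda>x. (norm (u x))\<^sup>2)" "integrable M (\<lambda>x. (norm (v x))\<^sup>2)"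
    "integrable M (\<lambda>x. u x \<bullet> v x)"
    using assms sq_integrable_inner by auto
  then show "sq_integrable M (\<lambda>x. a *\<^sub>R u x + b *\<^sub>R v x)"
    by (auto simp: sq_integrable_def e)
  show "(LINT x|M. (norm (a *\<^sub>R u x + b *\<^sub>R v x))\<^sup>2)
      = a\<^sup>2 * (L2norm M u)\<^sup>2 + 2 * a * b * (LINT x|M. u x \<bullet> v x) + b\<^sup>2 * (L2norm M v)\<^sup>2"
    using i by (simp add: e L2norm_power2)
qed

lemma sq_integrable_add: "sq_integrable M u \<Longrightarrow> sq_integrable M v \<Longrightarrow> sq_integrable M (\<lambda>x. u x + v x)"
  using sq_integrable_lincomb(1)[of M u v 1 1] by simp

lemma sq_integrable_diff: "sq_integrable M u \<Longrightarrow> sq_integrable M v \<Longrightarrow> sq_integrable M (\<lambda>x. u x - v x)"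
  using sq_integrable_lincomb(1)[of M u v 1 "-1"] by simp

lemma sq_integrable_scale: "sq_integrable M u \<Longrightarrow> sq_integrable M (\<lambda>x. c *\<^sub>R u x)"
  using sq_integrable_lincomb(1)[of M u u c 0] by simp

lemma L2norm_scale: "L2norm M (\<lambda>x. c *\<^sub>R u x) = \<bar>c\<bar> * L2norm M u"
  by (simp add: L2norm_def power_mult_distrib real_sqrt_mult)

text \<open>
  Nonpositivity of the discriminant. It yields both the Cauchy--Schwarz inequality and, in the
  projection theorem, the orthogonality of the residual.
\<close>

lemma discriminant_le:
  fixes a b c :: real
  assumes q: "\<And>t. 0 \<le> a - 2 * t * b + t\<^sup>2 * c" and c: "0 \<le> c"
  shows "b\<^sup>2 \<le> a * c"
proof (cases "c = 0")
  case True
  have "b = 0"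
  proof (rule ccontr)
    assume "b \<noteq> 0"
    then show False using q[of "(a + 1) / (2 * b)"] True by (simp add: field_simps)
  qed
  then show ?thesis using True by simp
next
  case False
  then have "0 < c" using c by simp
  moreover have "0 \<le> a - b\<^sup>2 / c"
    using q[of "b / c"] False by (simp add: power2_eq_square field_simps)
  ultimately show ?thesis by (simp add: field_simps)
qed

lemma L2_Cauchy_Schwarz:
  assumes "sq_integrable M u" "sq_integrable M v"
  shows "\<bar>LINT x|M. u x \<bullet> v x\<bar> \<le> L2norm M u * L2norm M v"
proof -
  have "(LINT x|M. u x \<bullet> v x)\<^sup>2 \<le> (L2norm M u)\<^sup>2 * (L2norm M v)\<^sup>2"
  proof (rule discriminant_le)
    fix t :: real
    show "0 \<le> (L2norm M u)\<^sup>2 - 2 * t * (LINT x|M. u x \<bullet> v x) + t\<^sup>2 * (L2norm M v)\<^sup>2"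
      using sq_integrable_lincomb(2)[OF assms, of 1 "- t"]
        Bochner_Integration.integral_nonneg[of M "\<lambda>x. (norm (1 *\<^sub>R u x + (- t) *\<^sub>R v x))\<^sup>2"]
      by simp
  qed auto
  then show ?thesis
    by (simp add: power_mult_distrib[symmetric] abs_le_square_iff[symmetric] abs_mult)
qed

lemma L2_Cauchy_Schwarz_norm:
  assumes "sq_integrable M u" "sq_integrable M v"
  shows "(LINT x|M. norm (u x) * norm (v x)) \<le> L2norm M u * L2norm M v"
proof -
  have "sq_integrable M (\<lambda>x. norm (u x))" "sq_integrable M (\<lambda>x. norm (v x))"
    using assms by (auto simp: sq_integrable_def)
  from L2_Cauchy_Schwarz[OF this] show ?thesis by (simp add: L2norm_def)
qed

lemma L2norm_triangle:
  assumes "sq_integrable M u" "sq_integrable M v"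
  shows "L2norm M (\<lambda>x. u x + v x) \<le> L2norm M u + L2norm M v"
proof -
  have "(L2norm M (\<lambda>x. u x + v x))\<^sup>2 \<le> (L2norm M u + L2norm M v)\<^sup>2"
    using sq_integrable_lincomb(2)[OF assms, of 1 1] L2_Cauchy_Schwarz[OF assms]
    by (simp add: L2norm_power2[of M "\<lambda>x. u x + v x"] power2_sum)
  then show ?thesis by (rule power2_le_imp_le) simp
qed

lemma L2norm_triangle_diff:
  assumes "sq_integrable M u" "sq_integrable M v"
  shows "L2norm M (\<lambda>x. u x - v x) \<le> L2norm M u + L2norm M v"
    and "\<bar>L2norm M u - L2norm M v\<bar> \<le> L2norm M (\<lambda>x. u x - v x)"
proof -
  have s: "L2norm M (\<lambda>x. v x - u x) = L2norm M (\<lambda>x. u x - v x)"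
    by (simp add: L2norm_def norm_minus_commute)
  show "L2norm M (\<lambda>x. u x - v x) \<le> L2norm M u + L2norm M v"
    using L2norm_triangle[OF assms(1) sq_integrable_scale[OF assms(2), of "-1"]]
      L2norm_scale[of M "-1" v] by simp
  show "\<bar>L2norm M u - L2norm M v\<bar> \<le> L2norm M (\<lambda>x. u x - v x)"
    using L2norm_triangle[OF sq_integrable_diff[OF assms] assms(2)]
      L2norm_triangle[OF sq_integrable_diff[OF assms(2,1)] assms(1)] s by simp
qed

lemma L2norm_eq_0_iff:
  assumes "sq_integrable M u"
  shows "L2norm M u = 0 \<longleftrightarrow> (AE x in M. u x = 0)"
  using integral_nonneg_eq_0_iff_AE[OF sq_integrableD(2)[OF assms]] by (simp add: L2norm_def)

lemma L2norm_cong_AE: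
  assumes "u \<in> borel_measurable M" "v \<in> borel_measurable M" "AE x in M. u x = v x"
  shows "L2norm M u = L2norm M v"
  unfolding L2norm_def
  by (rule arg_cong[where f = sqrt], rule integral_cong_AE) (use assms in auto)

lemma (in finite_measure) sq_integrable_integrable:
  assumes "sq_integrable M u"
  shows "integrable M u" "(LINT x|M. norm (u x)) \<le> sqrt (measure M (space M)) * L2norm M u"
proof -
  have [measurable]: "u \<in> borel_measurable M" using assms by auto
  have one: "sq_integrable M (\<lambda>x. 1::real)" by (simp add: sq_integrable_def)
  have n: "sq_integrable M (\<lambda>x. norm (u x))" using assms by (auto simp: sq_integrable_def)
  from sq_integrable_inner(1)[OF this one] have i: "integrable M (\<lambda>x. norm (u x))" by simp
  then show "integrable M u" by (subst (asm) integrable_norm_iff) auto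
  show "(LINT x|M. norm (u x)) \<le> sqrt (measure M (space M)) * L2norm M u"
    using L2_Cauchy_Schwarz[OF n one] by (simp add: L2norm_def mult.commute)
qed

lemma (in finite_measure) L2_convergence_AE_subseq:
  assumes u: "\<And>n. sq_integrable M (u n)" "sq_integrable M v"
    and lim: "(\<lambda>n. L2norm M (\<lambda>x. v x - u n x)) \<longlonglongrightarrow> 0"
  obtains r :: "nat \<Rightarrow> nat" where "strict_mono r" "AE x in M. (\<lambda>n. u (r n) x) \<longlonglongrightarrow> v x"
proof -
  have d: "sq_integrable M (\<lambda>x. v x - u n x)" for n using u sq_integrable_diff by blast
  have "(\<lambda>n. LINT x|M. norm (v x - u n x)) \<longlonglongrightarrow> 0"
  proof (rule tendsto_sandwich[OF _ _ tendsto_const])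
    show "(\<lambda>n. sqrt (measure M (space M)) * L2norm M (\<lambda>x. v x - u n x)) \<longlonglongrightarrow> 0"
      using tendsto_mult[OF tendsto_const lim] by simp
  qed (use sq_integrable_integrable(2)[OF d] in auto)
  from tendsto_L1_AE_subseq[OF sq_integrable_integrable(1)[OF d] this]
  obtain r where r: "strict_mono r" "AE x in M. (\<lambda>n. v x - u (r n) x) \<longlonglongrightarrow> 0" by auto
  have "AE x in M. (\<lambda>n. u (r n) x) \<longlonglongrightarrow> v x"
    using r(2)
  proof eventually_elim
    case (elim x)
    from tendsto_diff[OF tendsto_const[of "v x"] elim] show ?case by simp
  qed
  with r(1) show thesis by (rule that)
qed

text \<open>
  A nonnegative continuous functional stays bounded under convergence in the quadratic mean:
  pass to a subsequence that converges almost everywhere. This carries integral inequalities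
  from test functions to their closure.
\<close>

lemma (in finite_measure) fatou_L2:
  fixes u :: "nat \<Rightarrow> 'a \<Rightarrow> 'b::euclidean_space" and g :: "'b \<Rightarrow> real"
  assumes u: "\<And>n. sq_integrable M (u n)" "sq_integrable M v"
    and lim: "(\<lambda>n. L2norm M (\<lambda>x. v x - u n x)) \<longlonglongrightarrow> 0"
    and g: "continuous_on UNIV g" "\<And>y. 0 \<le> g y"
    and int: "\<And>n. integrable M (\<lambda>x. g (u n x))"
    and bound: "\<And>n. (LINT x|M. g (u n x)) \<le> c n" and c: "c \<longlonglongrightarrow> C"
  shows "integrable M (\<lambda>x. g (v x))" "(LINT x|M. g (v x)) \<le> C"
proof -
  obtain r where r: "strict_mono r" "AE x in M. (\<lambda>n. u (r n) x) \<longlonglongrightarrow> v x"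
    using L2_convergence_AE_subseq[OF u lim] .
  have gm: "g \<in> borel_measurable borel" using g(1) by (rule borel_measurable_continuous_onI)
  have m: "(\<lambda>x. g (u n x)) \<in> borel_measurable M" "(\<lambda>x. g (v x)) \<in> borel_measurable M" for n
    using u measurable_compose[OF _ gm] by blast+
  have l: "AE x in M. (\<lambda>n. g (u (r n) x)) \<longlonglongrightarrow> g (v x)"
    using r(2) by eventually_elim
      (use g(1) continuous_on_tendsto_compose[OF g(1)] in auto)
  note * = fatou_bound[OF m(1) m(2) g(2) g(2) int l bound LIMSEQ_subseq_LIMSEQ[OF c r(1), unfolded comp_def]]
  show "integrable M (\<lambda>x. g (v x))" "(LINT x|M. g (v x)) \<le> C" using * by auto
qed

text \<open>
  The Riesz--Fischer theorem, for functions rather than classes: along a subsequence with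
  summable increments the functions converge almost everywhere, and the limit is the desired
  one.
\<close>

lemma (in finite_measure) L2_complete:
  fixes u :: "nat \<Rightarrow> 'a \<Rightarrow> 'b::euclidean_space"
  assumes u: "\<And>n. sq_integrable M (u n)"
    and Cauchy: "\<And>e. e > 0 \<Longrightarrow> \<exists>N. \<forall>m\<ge>N. \<forall>n\<ge>N. L2norm M (\<lambda>x. u m x - u n x) < e"
  obtains v where "sq_integrable M v" "(\<lambda>n. L2norm M (\<lambda>x. v x - u n x)) \<longlonglongrightarrow> 0"
proof -
  have [measurable]: "u n \<in> borel_measurable M" for n using u by auto
  have d: "sq_integrable M (\<lambda>x. u m x - u n x)" for m n using u sq_integrable_diff by blast
  have "\<exists>N. \<forall>m\<ge>N. \<forall>n\<ge>N. L2norm M (\<lambda>x. u m x - u n x) < (1/2)^k" for k :: nat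
    using Cauchy[of "(1/2)^k"] by simp
  then obtain N where N: "\<And>k m n. m \<ge> N k \<Longrightarrow> n \<ge> N k \<Longrightarrow> L2norm M (\<lambda>x. u m x - u n x) < (1/2)^k"
    by metis
  (* The sum makes the subsequence strictly increasing and keeps it above N. *)
  define r where "r k = (\<Sum>i\<le>k. N i) + k" for k
  have rN: "r k \<ge> N k" for k
    unfolding r_def using member_le_sum[of k "{..k}" N] by (simp add: trans_le_add1)
  have rm: "r k < r (Suc k)" for k by (simp add: r_def)
  have rmono: "strict_mono r" using rm by (simp add: strict_mono_Suc_iff)
  define K where "K = sqrt (measure M (space M))"
  define g where "g k x = norm (u (r (Suc k)) x - u (r k) x)" for k x
  have gint: "integrable M (g k)" for k
    unfolding g_def using sq_integrable_integrable(1)[OF d] by auto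
  have "r (Suc k) \<ge> N k" for k using rN[of k] rm[of k] by linarith
  then have gle: "(LINT x|M. g k x) \<le> K * (1/2)^k" for k
    unfolding g_def K_def
    using sq_integrable_integrable(2)[OF d, of "r (Suc k)" "r k"] N[of k "r (Suc k)" "r k"] rN[of k]
    by (meson less_imp_le mult_left_mono order_trans real_sqrt_ge_zero measure_nonneg)
  have sum: "summable (\<lambda>k. K * (1/2)^k)" by (intro summable_mult) simp
  have "(\<integral>\<^sup>+x. (\<Sum>k. ennreal (g k x)) \<partial>M) = (\<Sum>k. \<integral>\<^sup>+x. ennreal (g k x) \<partial>M)"
    by (rule nn_integral_suminf) (simp add: g_def)
  also have "\<dots> \<le> (\<Sum>k. ennreal (K * (1/2)^k))"
  proof (intro suminf_le allI)
    show "(\<integral>\<^sup>+x. ennreal (g k x) \<partial>M) \<le> ennreal (K * (1/2)^k)" for k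
    proof -
      have "AE x in M. 0 \<le> g k x" by (simp add: g_def)
      from nn_integral_eq_integral[OF gint this] show ?thesis
        using gle[of k] by (simp add: ennreal_leI)
    qed
  qed auto
  also have "\<dots> = ennreal (\<Sum>k. K * (1/2)^k)"
    by (rule suminf_ennreal2[OF _ sum]) (simp add: K_def)
  also have "\<dots> < \<infinity>" by simp
  finally have "AE x in M. (\<Sum>k. ennreal (g k x)) \<noteq> \<infinity>"
    by (intro nn_integral_PInf_AE) (auto simp: g_def)
  then have "AE x in M. convergent (\<lambda>k. u (r k) x)"
  proof eventually_elim
    case (elim x)
    have "summable (\<lambda>k. g k x)"
      by (rule summable_suminf_not_top) (use elim in \<open>auto simp: g_def\<close>)
    then have "summable (\<lambda>k. u (r (Suc k)) x - u (r k) x)"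
      unfolding g_def by (rule summable_norm_cancel)
    then have "convergent (\<lambda>n. \<Sum>k<n. u (r (Suc k)) x - u (r k) x)"
      by (simp add: summable_iff_convergent)
    then have "convergent (\<lambda>n. u (r n) x - u (r 0) x)"
      using sum_lessThan_telescope[of "\<lambda>k. u (r k) x"] by simp
    from convergent_add[OF this convergent_const[of "u (r 0) x"]] show ?case by simp
  qed
  then have lim: "AE x in M. (\<lambda>k. u (r k) x) \<longlonglongrightarrow> lim (\<lambda>k. u (r k) x)"
    by (simp add: convergent_LIMSEQ_iff)
  define v where "v x = lim (\<lambda>k. u (r k) x)" for x
  have [measurable]: "v \<in> borel_measurable M"
    unfolding v_def by (rule borel_measurable_lim_metric) simp
  have est: "sq_integrable M (\<lambda>x. v x - u n x) \<and> L2norm M (\<lambda>x. v x - u n x) \<le> e"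
    if "e > 0" and n: "\<And>m. m \<ge> n \<Longrightarrow> L2norm M (\<lambda>x. u m x - u n x) \<le> e" for n e
  proof -
    define f where "f k x = (norm (u (r (k + n)) x - u n x))\<^sup>2" for k x
    have l: "AE x in M. (\<lambda>k. f k x) \<longlonglongrightarrow> (norm (v x - u n x))\<^sup>2"
      using lim
    proof eventually_elim
      case (elim x)
      then show ?case unfolding f_def v_def
        by (intro tendsto_intros LIMSEQ_ignore_initial_segment)
    qed
    have b: "(LINT x|M. f k x) \<le> e\<^sup>2" for k
    proof -
      have "r (k + n) \<ge> n" using strict_mono_imp_increasing[OF rmono, of "k + n"] by simp
      then show ?thesis
        unfolding f_def L2norm_power2[symmetric] by (intro power_mono n) auto
    qed
    have fint: "integrable M (f k)" for k unfolding f_def using d by auto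
    have "integrable M (\<lambda>x. (norm (v x - u n x))\<^sup>2) \<and> (LINT x|M. (norm (v x - u n x))\<^sup>2) \<le> e\<^sup>2"
      using fatou_bound[OF _ _ _ _ fint l b tendsto_const] by (auto simp: f_def)
    then show ?thesis
      using \<open>e > 0\<close> real_le_lsqrt by (auto simp: sq_integrable_def L2norm_def)
  qed
  have conv: "\<exists>N. \<forall>n\<ge>N. sq_integrable M (\<lambda>x. v x - u n x) \<and> L2norm M (\<lambda>x. v x - u n x) \<le> e"
    if "e > 0" for e
  proof -
    obtain N where N: "\<And>m n. m \<ge> N \<Longrightarrow> n \<ge> N \<Longrightarrow> L2norm M (\<lambda>x. u m x - u n x) < e"
      using Cauchy[OF \<open>e > 0\<close>] by blast
    have "sq_integrable M (\<lambda>x. v x - u n x) \<and> L2norm M (\<lambda>x. v x - u n x) \<le> e" if "n \<ge> N" for n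
      by (rule est[OF \<open>e > 0\<close>]) (use N that in \<open>meson less_imp_le order_trans\<close>)
    then show ?thesis by blast
  qed
  have "sq_integrable M v"
  proof -
    obtain n where "sq_integrable M (\<lambda>x. v x - u n x)" using conv[of 1] by auto
    from sq_integrable_add[OF this u[of n]] show ?thesis by simp
  qed
  moreover have "(\<lambda>n. L2norm M (\<lambda>x. v x - u n x)) \<longlonglongrightarrow> 0"
  proof (rule LIMSEQ_I)
    fix e :: real assume "e > 0"
    then obtain N where "\<forall>n\<ge>N. L2norm M (\<lambda>x. v x - u n x) \<le> e / 2"
      using conv[of "e/2"] by auto
    with \<open>e > 0\<close> have "\<forall>n\<ge>N. norm (L2norm M (\<lambda>x. v x - u n x) - 0) < e"
      by fastforce
    then show "\<exists>N. \<forall>n\<ge>N. norm (L2norm M (\<lambda>x. v x - u n x) - 0) < e" by blast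
  qed
  ultimately show thesis by (rule that)
qed

text \<open>
  The best approximation in the closure of a subspace, reached along a minimising sequence,
  which is Cauchy by the parallelogram identity. The subspace itself need not be closed, so the
  projection is given by its approximating sequence.
\<close>

lemma (in finite_measure) L2_projection:
  fixes g :: "'a \<Rightarrow> 'b::euclidean_space"
  assumes S: "\<And>v. v \<in> S \<Longrightarrow> sq_integrable M v" "S \<noteq> {}"
    and lin: "\<And>u v a b. u \<in> S \<Longrightarrow> v \<in> S \<Longrightarrow> (\<lambda>x. a *\<^sub>R u x + b *\<^sub>R v x) \<in> S"
    and g: "sq_integrable M g"
  obtains w \<phi> where "sq_integrable M w" "\<And>n::nat. \<phi> n \<in> S"
    "(\<lambda>n. L2norm M (\<lambda>x. w x - \<phi> n x)) \<longlonglongrightarrow> 0"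
    "\<And>v. v \<in> S \<Longrightarrow> (LINT x|M. (g x - w x) \<bullet> v x) = 0"
proof -
  define D where "D v = (L2norm M (\<lambda>x. g x - v x))\<^sup>2" for v
  define d where "d = Inf (D ` S)"
  have bdd: "bdd_below (D ` S)" by (rule bdd_belowI[of _ 0]) (auto simp: D_def)
  have dle: "d \<le> D v" if "v \<in> S" for v unfolding d_def using bdd that by (simp add: cINF_lower)
  have "\<exists>v\<in>S. D v < d + 1 / real (Suc n)" for n
    using cInf_lessD[of "D ` S" "d + 1 / real (Suc n)"] S(2) by (auto simp: d_def)
  then obtain \<phi> where \<phi>: "\<And>n. \<phi> n \<in> S" "\<And>n. D (\<phi> n) < d + 1 / real (Suc n)" by metis
  have sg: "sq_integrable M (\<lambda>x. g x - \<phi> n x)" for n using S \<phi> g sq_integrable_diff by blast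
  have para: "(L2norm M (\<lambda>x. \<phi> m x - \<phi> n x))\<^sup>2 \<le> 2 / real (Suc m) + 2 / real (Suc n)" for m n
  proof -
    define mid where "mid = (\<lambda>x. (1/2) *\<^sub>R \<phi> m x + (1/2) *\<^sub>R \<phi> n x)"
    have "mid \<in> S" unfolding mid_def using lin \<phi> by blast
    then have "4 * d \<le> 4 * D mid" using dle by simp
    also have "4 * D mid = (LINT x|M. (norm (1 *\<^sub>R (g x - \<phi> m x) + 1 *\<^sub>R (g x - \<phi> n x)))\<^sup>2)"
    proof -
      have "4 * (norm (g x - mid x))\<^sup>2 = (norm (1 *\<^sub>R (g x - \<phi> m x) + 1 *\<^sub>R (g x - \<phi> n x)))\<^sup>2" for x
      proof -
        have "1 *\<^sub>R (g x - \<phi> m x) + 1 *\<^sub>R (g x - \<phi> n x) = 2 *\<^sub>R (g x - mid x)"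
          by (simp add: mid_def scaleR_right_diff_distrib scaleR_add_right scaleR_2)
        then show ?thesis by (simp only: norm_scaleR power_mult_distrib) simp
      qed
      note e = this
      have "4 * D mid = (LINT x|M. 4 * (norm (g x - mid x))\<^sup>2)"
        by (simp add: D_def L2norm_power2)
      then show ?thesis by (simp only: e)
    qed
    also have "\<dots> = D (\<phi> m) + 2 * (LINT x|M. (g x - \<phi> m x) \<bullet> (g x - \<phi> n x)) + D (\<phi> n)"
      using sq_integrable_lincomb(2)[OF sg sg, of 1 m 1 n] by (simp add: D_def)
    finally have 1: "4 * d \<le> D (\<phi> m) + 2 * (LINT x|M. (g x - \<phi> m x) \<bullet> (g x - \<phi> n x)) + D (\<phi> n)" .
    have "(L2norm M (\<lambda>x. \<phi> m x - \<phi> n x))\<^sup>2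
        = D (\<phi> m) - 2 * (LINT x|M. (g x - \<phi> m x) \<bullet> (g x - \<phi> n x)) + D (\<phi> n)"
      using sq_integrable_lincomb(2)[OF sg sg, of 1 m "-1" n]
      by (simp add: D_def L2norm_power2[of M "\<lambda>x. \<phi> m x - \<phi> n x"] norm_minus_commute)
    moreover have "2 / real (Suc k) = 2 * (1 / real (Suc k))" for k by simp
    ultimately show ?thesis using 1 \<phi>(2)[of m] \<phi>(2)[of n] by linarith
  qed
  have "\<exists>N. \<forall>m\<ge>N. \<forall>n\<ge>N. L2norm M (\<lambda>x. \<phi> m x - \<phi> n x) < e" if "e > 0" for e
  proof -
    obtain N where N: "real N > 4 / e\<^sup>2" using reals_Archimedean2 by blast
    have "L2norm M (\<lambda>x. \<phi> m x - \<phi> n x) < e" if "m \<ge> N" "n \<ge> N" for m n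
    proof -
      have "2 / real (Suc m) \<le> 2 / real (Suc N)" "2 / real (Suc n) \<le> 2 / real (Suc N)"
        using that by (auto intro!: divide_left_mono)
      moreover have "4 / real (Suc N) < e\<^sup>2" using N \<open>e > 0\<close> by (simp add: field_simps add_pos_nonneg less_le_trans[of 4])
      ultimately have "(L2norm M (\<lambda>x. \<phi> m x - \<phi> n x))\<^sup>2 < e\<^sup>2" using para[of m n] by simp
      then show ?thesis using \<open>e > 0\<close> by (auto intro: power2_less_imp_less)
    qed
    then show ?thesis by blast
  qed
  then obtain w where w: "sq_integrable M w" "(\<lambda>n. L2norm M (\<lambda>x. w x - \<phi> n x)) \<longlonglongrightarrow> 0"
    using L2_complete[of \<phi>] S(1) \<phi>(1) by blast
  have sgw: "sq_integrable M (\<lambda>x. g x - w x)" using g w sq_integrable_diff by blast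
  have "(LINT x|M. (g x - w x) \<bullet> v x) = 0" if v: "v \<in> S" for v
  proof -
    have sv: "sq_integrable M v" using S v by blast
    (* Moving from a near-minimiser in the direction v lowers the squared distance by at most
       1/(n+1). *)
    have le: "((LINT x|M. (g x - \<phi> n x) \<bullet> v x))\<^sup>2 \<le> (1 / real (Suc n)) * (L2norm M v)\<^sup>2" for n
    proof (rule discriminant_le)
      fix t
      have "d \<le> D (\<lambda>x. 1 *\<^sub>R \<phi> n x + t *\<^sub>R v x)" using dle lin \<phi> v by blast
      also have "\<dots> = (LINT x|M. (norm (1 *\<^sub>R (g x - \<phi> n x) + (- t) *\<^sub>R v x))\<^sup>2)"
        by (simp add: D_def L2norm_power2 diff_diff_eq)
      also have "\<dots> = D (\<phi> n) - 2 * t * (LINT x|M. (g x - \<phi> n x) \<bullet> v x) + t\<^sup>2 * (L2norm M v)\<^sup>2"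
        using sq_integrable_lincomb(2)[OF sg sv, of 1 n "- t"] by (simp add: D_def)
      finally show "0 \<le> 1 / real (Suc n) - 2 * t * (LINT x|M. (g x - \<phi> n x) \<bullet> v x) + t\<^sup>2 * (L2norm M v)\<^sup>2"
        using \<phi>(2)[of n] by simp
    qed simp
    have z: "(\<lambda>n. (1 / real (Suc n)) * (L2norm M v)\<^sup>2) \<longlonglongrightarrow> 0"
      using tendsto_mult[OF LIMSEQ_inverse_real_of_nat tendsto_const, of "(L2norm M v)\<^sup>2"]
      by (simp only: inverse_eq_divide mult_zero_left)
    have "(\<lambda>n. (LINT x|M. (g x - \<phi> n x) \<bullet> v x)\<^sup>2) \<longlonglongrightarrow> 0"
    proof (rule Lim_null_comparison[OF always_eventually z], rule allI)
      show "norm ((LINT x|M. (g x - \<phi> n x) \<bullet> v x)\<^sup>2) \<le> 1 / real (Suc n) * (L2norm M v)\<^sup>2" for n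
        using le[of n] by (simp only: real_norm_def abs_power2)
    qed
    from tendsto_real_sqrt[OF this] have A: "(\<lambda>n. LINT x|M. (g x - \<phi> n x) \<bullet> v x) \<longlonglongrightarrow> 0"
      by (simp add: tendsto_rabs_zero_iff)
    have B: "(\<lambda>n. LINT x|M. (w x - \<phi> n x) \<bullet> v x) \<longlonglongrightarrow> 0"
    proof (rule Lim_null_comparison)
      show "(\<lambda>n. L2norm M (\<lambda>x. w x - \<phi> n x) * L2norm M v) \<longlonglongrightarrow> 0"
        using tendsto_mult[OF w(2) tendsto_const] by simp
      show "\<forall>\<^sub>F n in sequentially. norm (LINT x|M. (w x - \<phi> n x) \<bullet> v x) \<le> L2norm M (\<lambda>x. w x - \<phi> n x) * L2norm M v"
        using L2_Cauchy_Schwarz[OF sq_integrable_diff[OF w(1) S(1)[OF \<phi>(1)]] sv] by simp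
    qed
    have "(LINT x|M. (g x - \<phi> n x) \<bullet> v x) - (LINT x|M. (w x - \<phi> n x) \<bullet> v x) = (LINT x|M. (g x - w x) \<bullet> v x)" for n
    proof -
      have "(LINT x|M. (g x - w x) \<bullet> v x) = (LINT x|M. (g x - \<phi> n x) \<bullet> v x - (w x - \<phi> n x) \<bullet> v x)"
        by (rule Bochner_Integration.integral_cong) (auto simp: inner_diff_left)
      also have "\<dots> = (LINT x|M. (g x - \<phi> n x) \<bullet> v x) - (LINT x|M. (w x - \<phi> n x) \<bullet> v x)"
        by (rule Bochner_Integration.integral_diff)
           (rule sq_integrable_inner(1)[OF sg sv],
            rule sq_integrable_inner(1)[OF sq_integrable_diff[OF w(1) S(1)[OF \<phi>(1)]] sv])
      finally show ?thesis by simp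
    qed
    then show ?thesis using tendsto_diff[OF A B] by (simp add: LIMSEQ_const_iff)
  qed
  then show thesis using that[OF w(1) \<phi>(1) w(2)] by blast
qed

section \<open>The fundamental lemma of the calculus of variations\<close>

text \<open>
  The boxes are a generator of the Borel sets that is closed under intersection, so the integral
  of \<open>g\<close> vanishes over every Borel set, and hence over the sets where
  \<open>g\<close> is positive or negative.
\<close>

lemma AE_zero_of_box_integrals:
  fixes g :: "'a::euclidean_space \<Rightarrow> real"
  assumes int: "integrable lebesgue g"
    and box: "\<And>a b. (LINT x:box a b|lebesgue. g x) = 0" and all: "(LINT x|lebesgue. g x) = 0"
  shows "AE x in lebesgue. g x = 0"
proof -
  have si: "set_integrable lebesgue A g" if "A \<in> sets lebesgue" for A
    using integrable_mult_indicator[OF that int] by (simp add: set_integrable_def)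
  have bor: "(LINT x:A|lebesgue. g x) = 0" if "A \<in> sets borel" for A :: "'a set"
  proof -
    let ?E = "range (\<lambda>(a, b). box a b :: 'a set)"
    have "Int_stable ?E"
      by (auto simp: Int_stable_def box_Int_box)
    moreover have "?E \<subseteq> Pow UNIV" by simp
    moreover have "A \<in> sigma_sets UNIV ?E" using that by (simp add: borel_eq_box)
    ultimately show ?thesis
    proof (induction rule: sigma_sets_induct_disjoint)
      case (basic A)
      then show ?case using box by auto
    next
      case empty
      then show ?case by (simp add: set_lebesgue_integral_def)
    next
      case (compl A)
      then have A: "A \<in> sets lebesgue" by (metis borel_eq_box sets_completionI_sets sets_lborel sets_measure_of top_greatest Pow_UNIV)
      have "(LINT x:(UNIV - A)|lebesgue. g x) = (LINT x|lebesgue. g x - indicator A x *\<^sub>R g x)"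
        unfolding set_lebesgue_integral_def
        by (rule Bochner_Integration.integral_cong) (auto simp: indicator_def)
      also have "\<dots> = (LINT x|lebesgue. g x) - (LINT x:A|lebesgue. g x)"
        unfolding set_lebesgue_integral_def
        by (rule Bochner_Integration.integral_diff) (use int si[OF A] in \<open>auto simp: set_integrable_def\<close>)
      finally show ?case using compl all by simp
    next
      case (union A)
      then have "A i \<in> sets lebesgue" for i
        by (metis borel_eq_box sets_completionI_sets sets_lborel sets_measure_of top_greatest Pow_UNIV rangeI subset_iff)
      then show ?case using union
        by (subst lebesgue_integral_countable_add) (auto intro!: si simp: disjoint_family_on_def)
    qed
  qed
  have leb: "(LINT x:A|lebesgue. g x) = 0" if As: "A \<in> sets lebesgue" for A
  proof -
    obtain S N N' where A: "A = S \<union> N" "N \<subseteq> N'" "N' \<in> null_sets lborel" "S \<in> sets lborel"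
      using sets_completionE[OF As] by metis
    have "AE x in lebesgue. x \<notin> N'"
      using A(3) by (intro AE_not_in null_sets_completionI) auto
    then have "AE x in lebesgue. (x \<in> A \<longleftrightarrow> x \<in> S)"
      by eventually_elim (use A in auto)
    then have ae: "AE x in lebesgue. indicator A x *\<^sub>R g x = indicator S x *\<^sub>R g x"
      by eventually_elim (auto simp: indicator_def)
    have S: "S \<in> sets lebesgue" using A(4) by auto
    have "(LINT x:A|lebesgue. g x) = (LINT x:S|lebesgue. g x)"
      unfolding set_lebesgue_integral_def
      by (rule integral_cong_AE)
         (use si[OF As] si[OF S] ae in \<open>auto simp: set_integrable_def\<close>)
    then show ?thesis using bor A(4) by auto
  qed
  have [measurable]: "g \<in> borel_measurable lebesgue" using int by auto
  have "{x \<in> space lebesgue. g x > 0} \<in> sets lebesgue" "{x \<in> space lebesgue. g x < 0} \<in> sets lebesgue"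
    by measurable
  then have sets: "{x. g x > 0} \<in> sets lebesgue" "{x. g x < 0} \<in> sets lebesgue" by simp_all
  have "integrable lebesgue (\<lambda>x. indicator {x. g x > 0} x *\<^sub>R g x)"
    using si[OF sets(1)] by (simp only: set_integrable_def)
  moreover have "AE x in lebesgue. 0 \<le> indicator {x. g x > 0} x *\<^sub>R g x"
    by (auto simp: indicator_def)
  ultimately have "AE x in lebesgue. indicator {x. g x > 0} x *\<^sub>R g x = 0"
    using leb[OF sets(1)] integral_nonneg_eq_0_iff_AE unfolding set_lebesgue_integral_def by blast
  moreover have "AE x in lebesgue. - (indicator {x. g x < 0} x *\<^sub>R g x) = 0"
  proof -
    have "integrable lebesgue (\<lambda>x. - (indicator {x. g x < 0} x *\<^sub>R g x))"
      using si[OF sets(2)] unfolding set_integrable_def by (rule Bochner_Integration.integrable_minus)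
    moreover have "AE x in lebesgue. 0 \<le> - (indicator {x. g x < 0} x *\<^sub>R g x)"
      by (auto simp: indicator_def)
    moreover have "(LINT x|lebesgue. - (indicator {x. g x < 0} x *\<^sub>R g x)) = 0"
      using leb[OF sets(2)] by (simp add: set_lebesgue_integral_def)
    ultimately show ?thesis using integral_nonneg_eq_0_iff_AE by blast
  qed
  ultimately show ?thesis
    by eventually_elim (auto simp: indicator_def split: if_splits)
qed

text \<open>
  Bumps turn the vanishing of all test integrals into the vanishing of the integrals over small
  boxes in \<open>U\<close>, and \<open>U\<close> is a countable union of boxes.
\<close>

lemma fundamental_lemma:
  fixes f :: "'a::euclidean_space \<Rightarrow> real"
  assumes U: "open U" and int: "integrable (lebesgue_on U) f"
    and tests: "\<And>\<phi>. \<phi> \<in> test_functions U \<Longrightarrow> (LINT x|lebesgue_on U. f x * \<phi> x) = 0"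
  shows "AE x in lebesgue_on U. f x = 0"
proof -
  have Us: "U \<inter> space lebesgue \<in> sets lebesgue" "U \<in> sets lebesgue" using U by auto
  have fm: "f \<in> borel_measurable (lebesgue_on U)" using int by auto
  define F where "F x = indicator U x * f x" for x
  have Fint: "integrable lebesgue F"
    using int unfolding F_def by (subst (asm) integrable_restrict_space[OF Us(1)]) simp
  have box0: "(LINT x:box a b|lebesgue. F x) = 0" if ab: "cbox a b \<subseteq> U" for a b
  proof -
    obtain \<phi> :: "nat \<Rightarrow> 'a \<Rightarrow> real" where \<phi>: "\<And>n. \<phi> n \<in> test_functions U"
      "\<And>n x. 0 \<le> \<phi> n x \<and> \<phi> n x \<le> 1" "\<And>x. (\<lambda>n. \<phi> n x) \<longlonglongrightarrow> indicator (box a b) x"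
      using box_bumps[OF ab] by blast
    have \<phi>m: "\<phi> n \<in> borel_measurable borel" for n
      using \<phi>(1)[of n] by (intro borel_measurable_continuous_onI smooth_continuous) (simp add: test_functions_def)
    then have [measurable]: "\<phi> n \<in> borel_measurable lebesgue" for n by (simp add: measurable_completion)
    have [measurable]: "F \<in> borel_measurable lebesgue" using Fint by auto
    have [measurable]: "box a b \<in> sets lebesgue" by simp
    have "(\<lambda>n. LINT x|lebesgue. F x * \<phi> n x) \<longlonglongrightarrow> (LINT x|lebesgue. F x * indicator (box a b) x)"
    proof (rule integral_dominated_convergence[where w = "\<lambda>x. \<bar>F x\<bar>"])
      show "AE x in lebesgue. (\<lambda>n. F x * \<phi> n x) \<longlonglongrightarrow> F x * indicator (box a b) x"
        using \<phi>(3) by (intro AE_I2 tendsto_intros)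
      show "AE x in lebesgue. norm (F x * \<phi> n x) \<le> \<bar>F x\<bar>" for n
        using \<phi>(2) by (auto simp: abs_mult mult_left_le)
    qed (use Fint in auto)
    moreover have "(LINT x|lebesgue. F x * \<phi> n x) = 0" for n
      using tests[OF \<phi>(1)[of n]] by (subst (asm) integral_restrict_space[OF Us(1)]) (simp add: F_def mult.assoc)
    ultimately show ?thesis by (simp add: LIMSEQ_const_iff set_lebesgue_integral_def mult.commute)
  qed
  have loc: "AE x in lebesgue. x \<in> box a b \<longrightarrow> F x = 0" if ab: "cbox a b \<subseteq> U" for a b
  proof -
    have "AE x in lebesgue. indicator (box a b) x * F x = 0"
    proof (rule AE_zero_of_box_integrals)
      show "integrable lebesgue (\<lambda>x. indicator (box a b) x * F x)"
        using integrable_mult_indicator[OF _ Fint, of "box a b"] by simp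
      show "(LINT x|lebesgue. indicator (box a b) x * F x) = 0"
        using box0[OF ab] by (simp add: set_lebesgue_integral_def)
      fix c d :: 'a
      obtain c' d' where e: "box c d \<inter> box a b = box c' d'" unfolding box_Int_box by blast
      have "closure (box c' d') \<subseteq> cbox a b"
        using e box_subset_cbox[of a b] by (intro closure_minimal) auto
      then have "box c' d' = {} \<or> cbox c' d' \<subseteq> U"
        using ab closure_box[of c' d'] by (cases "box c' d' = {}") auto
      then have "(LINT x:box c' d'|lebesgue. F x) = 0"
        using box0[of c' d'] by (auto simp: set_lebesgue_integral_def)
      moreover have "indicator (box c d) x *\<^sub>R (indicator (box a b) x * F x) = indicator (box c' d') x *\<^sub>R F x" for x
        unfolding e[symmetric] by (simp add: indicator_inter_arith)
      ultimately show "(LINT x:box c d|lebesgue. indicator (box a b) x * F x) = 0"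
        unfolding set_lebesgue_integral_def by (simp only:)
    qed
    then show ?thesis by eventually_elim (auto simp: indicator_def)
  qed
  obtain D where D: "countable D" "D \<subseteq> Pow U" "\<And>X. X \<in> D \<Longrightarrow> \<exists>a b. X = cbox a b" "\<Union>D = U"
    using open_countable_Union_open_cbox[OF U] by metis
  have "AE x in lebesgue. x \<in> U \<longrightarrow> F x = 0"
  proof -
    have "AE x in lebesgue. x \<in> X \<longrightarrow> F x = 0" if X: "X \<in> D" for X
    proof -
      obtain a b where ab: "X = cbox a b" using D(3) X by blast
      have "AE x in lebesgue. x \<notin> cbox a b - box a b"
        by (intro AE_not_in) (use negligible_frontier_interval in \<open>auto simp: negligible_iff_null_sets\<close>)
      moreover have "AE x in lebesgue. x \<in> box a b \<longrightarrow> F x = 0" using loc D(2) X ab by auto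
      ultimately show ?thesis by eventually_elim (auto simp: ab)
    qed
    then have "AE x in lebesgue. \<forall>X\<in>D. x \<in> X \<longrightarrow> F x = 0"
      using AE_ball_countable[OF D(1), of "\<lambda>x X. x \<in> X \<longrightarrow> F x = 0" lebesgue] by blast
    then show ?thesis by eventually_elim (use D(4) in blast)
  qed
  then show ?thesis
    by (subst AE_restrict_space_iff[OF Us(1)], eventually_elim) (auto simp: F_def)
qed

section \<open>A Sobolev inequality in the plane\<close>

definition pt :: "real \<times> real \<Rightarrow> real^2" where
  "pt z = (\<chi> i. if i = 1 then fst z else snd z)"

lemma pt_nth [simp]: "pt z $ 1 = fst z" "pt z $ 2 = snd z"
  by (auto simp: pt_def)

lemma pt_continuous: "continuous_on UNIV pt"
  unfolding pt_def
proof (rule continuous_on_vec_lambda)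
  show "continuous_on UNIV (\<lambda>z :: real \<times> real. if i = 1 then fst z else snd z)" for i :: 2
    by (cases "i = 1") (auto intro!: continuous_intros)
qed

lemma pt_measurable [measurable]: "pt \<in> borel_measurable borel"
  by (rule borel_measurable_continuous_onI[OF pt_continuous])

text \<open>
  Lebesgue measure on \<open>real^2\<close> as a product measure, so that Tonelli's theorem
  applies.
\<close>

lemma lborel_plane: "(lborel :: (real^2) measure) = distr (lborel \<Otimes>\<^sub>M lborel) borel pt"
proof (rule lborel_eqI)
  fix l u :: "real^2"
  assume le: "\<And>b. b \<in> Basis \<Longrightarrow> l \<bullet> b \<le> u \<bullet> b"
  have le': "l $ i \<le> u $ i" for i using le[of "axis i 1"] by (simp add: inner_axis)
  have "pt -` box l u \<inter> space (lborel \<Otimes>\<^sub>M lborel) = {l$1<..<u$1} \<times> {l$2<..<u$2}"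
    by (auto simp: mem_box_cart pt_def forall_2 space_pair_measure)
  then have "emeasure (distr (lborel \<Otimes>\<^sub>M lborel) borel pt) (box l u)
      = emeasure (lborel \<Otimes>\<^sub>M lborel) ({l$1<..<u$1} \<times> {l$2<..<u$2})"
    by (subst emeasure_distr) (auto simp: lborel_prod)
  also have "\<dots> = ennreal ((u$1 - l$1) * (u$2 - l$2))"
    using le'[of 1] le'[of 2] by (subst lborel.emeasure_pair_measure_Times) (auto simp: ennreal_mult)
  also have "(u$1 - l$1) * (u$2 - l$2) = (\<Prod>b\<in>Basis. (u - l) \<bullet> b)"
  proof -
    have B: "(Basis :: (real^2) set) = {axis 1 1, axis 2 1}"
      by (auto simp: Basis_vec_def exhaust_2 UNIV_2)
    show ?thesis unfolding B by (simp add: axis_eq_axis inner_axis)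
  qed
  finally show "emeasure (distr (lborel \<Otimes>\<^sub>M lborel) borel pt) (box l u) = (\<Prod>b\<in>Basis. (u - l) \<bullet> b)" .
qed auto

lemma nn_integral_plane:
  assumes [measurable]: "h \<in> borel_measurable borel"
  shows "(\<integral>\<^sup>+x. h x \<partial>lborel) = (\<integral>\<^sup>+s. \<integral>\<^sup>+t. h (pt (s, t)) \<partial>lborel \<partial>lborel)"
    and "(\<integral>\<^sup>+x. h x \<partial>lborel) = (\<integral>\<^sup>+t. \<integral>\<^sup>+s. h (pt (s, t)) \<partial>lborel \<partial>lborel)"
proof -
  have [measurable]: "pt \<in> borel_measurable (lborel \<Otimes>\<^sub>M lborel)" by (simp add: lborel_prod)
  have 1: "(\<integral>\<^sup>+x. h x \<partial>lborel) = (\<integral>\<^sup>+z. h (pt z) \<partial>(lborel \<Otimes>\<^sub>M lborel))"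
    by (subst lborel_plane, subst nn_integral_distr) auto
  show "(\<integral>\<^sup>+x. h x \<partial>lborel) = (\<integral>\<^sup>+s. \<integral>\<^sup>+t. h (pt (s, t)) \<partial>lborel \<partial>lborel)"
    unfolding 1 by (subst lborel.nn_integral_fst[symmetric]) auto
  show "(\<integral>\<^sup>+x. h x \<partial>lborel) = (\<integral>\<^sup>+t. \<integral>\<^sup>+s. h (pt (s, t)) \<partial>lborel \<partial>lborel)"
    unfolding 1 by (subst lborel_pair.nn_integral_snd[symmetric]) auto
qed

text \<open>
  Integrate the derivative from a point to the left of the support.
\<close>

lemma line_bound:
  fixes g :: "real \<Rightarrow> real"
  assumes g: "\<And>t. (g has_real_derivative g' t) (at t)" "continuous_on UNIV g'"
    and supp: "\<And>t. \<bar>t\<bar> > R \<Longrightarrow> g t = 0"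
  shows "ennreal \<bar>g s\<bar> \<le> (\<integral>\<^sup>+t. ennreal \<bar>g' t\<bar> \<partial>lborel)" "(LINT t|lborel. g' t) = 0"
proof -
  define a b where "a = - (\<bar>R\<bar> + \<bar>s\<bar> + 1)" and "b = \<bar>R\<bar> + \<bar>s\<bar> + 1"
  have ab: "a \<le> s" "s \<le> b" "g a = 0" "g b = 0" by (auto simp: a_def b_def intro!: supp)
  have out: "g' t = 0" if "t \<notin> {a..b}" for t
  proof -
    have "(g has_real_derivative 0) (at t)"
    proof (rule has_field_derivative_transform_within_open[where f = "\<lambda>_. 0" and S = "- {-\<bar>R\<bar>..\<bar>R\<bar>}"])
      show "t \<in> - {-\<bar>R\<bar>..\<bar>R\<bar>}" using that by (auto simp: a_def b_def)
      show "0 = g x" if "x \<in> - {-\<bar>R\<bar>..\<bar>R\<bar>}" for x using that supp[of x] by auto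
    qed auto
    then show ?thesis using g(1) DERIV_unique by blast
  qed
  have ft: "has_bochner_integral lborel (\<lambda>t. g' t * indicator {c..d} t) (g d - g c)" if "c \<le> d" for c d
    by (rule has_bochner_integral_FTC_Icc_real)
       (use that g continuous_on_eq_continuous_at[of UNIV g'] in auto)
  have "(\<lambda>t. g' t * indicator {a..b} t) = g'"
    using out by (auto simp: indicator_def fun_eq_iff)
  then have *: "has_bochner_integral lborel g' 0" using ft[of a b] ab by simp
  then show "(LINT t|lborel. g' t) = 0" by (rule has_bochner_integral_integral_eq)
  have i: "integrable lborel g'" using * by (rule integrable.intros)
  have "\<bar>g s\<bar> = \<bar>LINT t|lborel. g' t * indicator {a..s} t\<bar>"
    using has_bochner_integral_integral_eq[OF ft[of a s]] ab by simp
  also have "\<dots> \<le> (LINT t|lborel. \<bar>g' t\<bar>)"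
  proof -
    have "\<bar>LINT t|lborel. g' t * indicator {a..s} t\<bar> \<le> (LINT t|lborel. \<bar>g' t * indicator {a..s} t\<bar>)"
      by (rule integral_abs_bound)
    also have "\<dots> \<le> (LINT t|lborel. \<bar>g' t\<bar>)"
      by (rule Bochner_Integration.integral_mono) (use i ft[of a s] ab in \<open>auto simp: indicator_def integrable.intros intro!: integrable_abs integrable_real_mult_indicator\<close>)
    finally show ?thesis .
  qed
  finally have "ennreal \<bar>g s\<bar> \<le> ennreal (LINT t|lborel. \<bar>g' t\<bar>)" by (rule ennreal_leI)
  then show "ennreal \<bar>g s\<bar> \<le> (\<integral>\<^sup>+t. ennreal \<bar>g' t\<bar> \<partial>lborel)"
    using i by (subst nn_integral_eq_integral) auto
qed

lemma pt_has_derivative: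
  "((\<lambda>s. pt (s, t)) has_derivative (\<lambda>h. h *\<^sub>R axis 1 1)) (at s)"
  "((\<lambda>t. pt (s, t)) has_derivative (\<lambda>h. h *\<^sub>R axis 2 1)) (at t)"
proof -
  have e: "pt (s, t) = s *\<^sub>R axis 1 1 + t *\<^sub>R axis 2 1" for s t
    by (simp add: pt_def vec_eq_iff axis_def forall_2)
  show "((\<lambda>s. pt (s, t)) has_derivative (\<lambda>h. h *\<^sub>R axis 1 1)) (at s)"
    "((\<lambda>t. pt (s, t)) has_derivative (\<lambda>h. h *\<^sub>R axis 2 1)) (at t)"
    unfolding e by (auto intro!: derivative_eq_intros)
qed

text \<open>
  Gagliardo's argument. By the fundamental theorem of calculus \<open>\<bar>f (s,
  t)\<bar>\<close> is at most the integral of \<open>\<bar>\<partial>\<^sub>1 f\<bar>\<close>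
  over the horizontal line and at most the integral of \<open>\<bar>\<partial>\<^sub>2
  f\<bar>\<close> over the vertical line through the point. The first bound depends on
  \<open>t\<close> only and the second on \<open>s\<close> only, so their product integrates to
  a product. The second claim is the vanishing of the integral of the derivative over each line.
\<close>

lemma planar_W11:
  fixes f :: "real^2 \<Rightarrow> real"
  assumes f: "\<And>x. (f has_derivative f' x) (at x)" "\<And>v. continuous_on UNIV (\<lambda>x. f' x v)"
    and supp: "\<And>x. norm x > R \<Longrightarrow> f x = 0"
  shows "(\<integral>\<^sup>+x. ennreal ((f x)\<^sup>2) \<partial>lborel)
      \<le> (\<integral>\<^sup>+x. ennreal \<bar>f' x (axis 1 1)\<bar> \<partial>lborel) * (\<integral>\<^sup>+x. ennreal \<bar>f' x (axis 2 1)\<bar> \<partial>lborel)"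
    and "(LINT x|lborel. f' x (axis j 1)) = 0"
proof -
  have lin: "f' x (h *\<^sub>R v) = h * f' x v" for x h v
    using linear_scale[OF has_derivative_linear[OF f(1)[of x]]] by simp
  have d1: "((\<lambda>s. f (pt (s, t))) has_real_derivative f' (pt (s, t)) (axis 1 1)) (at s)" for s t
    unfolding has_field_derivative_def
    by (rule has_derivative_eq_rhs[OF has_derivative_compose[OF pt_has_derivative(1) f(1)]])
       (simp add: lin fun_eq_iff)
  have d2: "((\<lambda>t. f (pt (s, t))) has_real_derivative f' (pt (s, t)) (axis 2 1)) (at t)" for s t
    unfolding has_field_derivative_def
    by (rule has_derivative_eq_rhs[OF has_derivative_compose[OF pt_has_derivative(2) f(1)]])
       (simp add: lin fun_eq_iff)
  have ct: "continuous_on UNIV (\<lambda>s. pt (s, t))" "continuous_on UNIV (\<lambda>t. pt (s, t))" for s t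
    by (intro continuous_on_compose2[OF pt_continuous] continuous_intros; simp)+
  have c1: "continuous_on UNIV (\<lambda>s. f' (pt (s, t)) v)" for t v
    by (rule continuous_on_compose2[OF f(2) ct(1)]) simp
  have c2: "continuous_on UNIV (\<lambda>t. f' (pt (s, t)) v)" for s v
    by (rule continuous_on_compose2[OF f(2) ct(2)]) simp
  have big: "norm (pt (s, t)) > R" if "\<bar>s\<bar> > R \<or> \<bar>t\<bar> > R" for s t
    using component_le_norm_cart[of "pt (s, t)" 1] component_le_norm_cart[of "pt (s, t)" 2] that by auto
  have [measurable]: "(\<lambda>x. f' x v) \<in> borel_measurable borel" for v
    using f(2) by (rule borel_measurable_continuous_onI)
  have cf: "continuous_on UNIV f"
    using f(1) has_derivative_continuous by (intro continuous_at_imp_continuous_on) blast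
  then have [measurable]: "f \<in> borel_measurable borel" by (rule borel_measurable_continuous_onI)
  have [measurable]: "pt \<in> borel_measurable (lborel \<Otimes>\<^sub>M lborel)" by (simp add: lborel_prod)
  define F1 where "F1 t = (\<integral>\<^sup>+s. ennreal \<bar>f' (pt (s, t)) (axis 1 1)\<bar> \<partial>lborel)" for t
  define F2 where "F2 s = (\<integral>\<^sup>+t. ennreal \<bar>f' (pt (s, t)) (axis 2 1)\<bar> \<partial>lborel)" for s
  have m2: "F2 \<in> borel_measurable lborel"
    unfolding F2_def by (intro lborel.borel_measurable_nn_integral) (simp add: case_prod_beta)
  have m1: "F1 \<in> borel_measurable lborel"
    unfolding F1_def
    by (intro lborel.borel_measurable_nn_integral)
       (auto simp: case_prod_beta intro!: measurable_compose[OF measurable_compose[OF _ pt_measurable]] simp: lborel_prod borel_prod[symmetric])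
  have le1: "ennreal \<bar>f (pt (s, t))\<bar> \<le> F1 t" for s t
    unfolding F1_def by (rule line_bound(1)[OF d1 c1, of R]) (use big supp in auto)
  have le2: "ennreal \<bar>f (pt (s, t))\<bar> \<le> F2 s" for s t
    unfolding F2_def by (rule line_bound(1)[OF d2 c2, of R]) (use big supp in auto)
  have "(\<integral>\<^sup>+x. ennreal ((f x)\<^sup>2) \<partial>lborel) = (\<integral>\<^sup>+s. \<integral>\<^sup>+t. ennreal ((f (pt (s, t)))\<^sup>2) \<partial>lborel \<partial>lborel)"
    by (rule nn_integral_plane) simp
  also have "\<dots> \<le> (\<integral>\<^sup>+s. \<integral>\<^sup>+t. F2 s * F1 t \<partial>lborel \<partial>lborel)"
  proof (intro nn_integral_mono)
    fix s t :: real
    have "ennreal ((f (pt (s, t)))\<^sup>2) = ennreal \<bar>f (pt (s, t))\<bar> * ennreal \<bar>f (pt (s, t))\<bar>"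
      by (simp add: ennreal_mult[symmetric] power2_eq_square)
    also have "\<dots> \<le> F2 s * F1 t" by (intro mult_mono le1 le2) auto
    finally show "ennreal ((f (pt (s, t)))\<^sup>2) \<le> F2 s * F1 t" .
  qed
  also have "\<dots> = (\<integral>\<^sup>+t. F1 t \<partial>lborel) * (\<integral>\<^sup>+s. F2 s \<partial>lborel)"
    using m1 m2 by (simp add: nn_integral_cmult nn_integral_multc mult.commute)
  also have "(\<integral>\<^sup>+t. F1 t \<partial>lborel) = (\<integral>\<^sup>+x. ennreal \<bar>f' x (axis 1 1)\<bar> \<partial>lborel)"
    unfolding F1_def by (rule nn_integral_plane(2)[symmetric]) simp
  also have "(\<integral>\<^sup>+s. F2 s \<partial>lborel) = (\<integral>\<^sup>+x. ennreal \<bar>f' x (axis 2 1)\<bar> \<partial>lborel)"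
    unfolding F2_def by (rule nn_integral_plane(1)[symmetric]) simp
  finally show "(\<integral>\<^sup>+x. ennreal ((f x)\<^sup>2) \<partial>lborel)
      \<le> (\<integral>\<^sup>+x. ennreal \<bar>f' x (axis 1 1)\<bar> \<partial>lborel) * (\<integral>\<^sup>+x. ennreal \<bar>f' x (axis 2 1)\<bar> \<partial>lborel)" .
  define h where "h x = f' x (axis j 1)" for x
  have out: "h x = 0" if "x \<notin> cball 0 \<bar>R\<bar>" for x
  proof -
    have "(f has_derivative (\<lambda>_. 0)) (at x)"
    proof (rule has_derivative_transform_within_open[OF has_derivative_const open_Compl[OF closed_cball]])
      show "0 = f y" if "y \<in> - cball 0 \<bar>R\<bar>" for y using that supp[of y] by auto
    qed (use that in auto)
    then show ?thesis using has_derivative_unique[OF f(1)] unfolding h_def by metis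
  qed
  have hi: "integrable lborel h"
  proof -
    have "integrable lborel (\<lambda>x. indicator (cball 0 \<bar>R\<bar>) x *\<^sub>R h x)"
      unfolding h_def
      by (rule borel_integrable_compact[OF compact_cball continuous_on_subset[OF f(2) subset_UNIV]])
    also have "(\<lambda>x. indicator (cball 0 \<bar>R\<bar>) x *\<^sub>R h x) = h"
      using out by (auto simp: indicator_def fun_eq_iff)
    finally show ?thesis .
  qed
  then have hi2: "integrable (lborel \<Otimes>\<^sub>M lborel) (\<lambda>(s, t). h (pt (s, t)))"
    by (subst (asm) lborel_plane, subst (asm) integrable_distr_eq)
       (auto simp: h_def split_def)
  have "(LINT x|lborel. h x) = (LINT z|(lborel \<Otimes>\<^sub>M lborel). h (pt z))"
    by (subst lborel_plane, subst integral_distr) (auto simp: h_def[abs_def])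
  also have "\<dots> = 0"
  proof (cases "j = 1")
    case True
    then have "(LINT s|lborel. h (pt (s, t))) = 0" for t
      unfolding h_def using line_bound(2)[OF d1 c1, of R] big supp by auto
    then show ?thesis using lborel_pair.integral_snd[OF hi2] by (simp add: split_def)
  next
    case False
    then have "j = 2" using exhaust_2 by blast
    then have "(LINT t|lborel. h (pt (s, t))) = 0" for s
      unfolding h_def using line_bound(2)[OF d2 c2, of R] big supp by auto
    then show ?thesis using lborel_pair.integral_fst[OF hi2] by (simp add: split_def)
  qed
  finally show "(LINT x|lborel. f' x (axis j 1)) = 0" by (simp add: h_def)
qed

section \<open>Weak gradients and divergence-free fields\<close>

lemma Lp2_iff: "u \<in> Lp 2 \<Omega> \<longleftrightarrow> sq_integrable (lebesgue_on \<Omega>) u"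
  by (simp add: Lp_def sq_integrable_def)

lemma Lp_norm2: "Lp_norm 2 \<Omega> u = L2norm (lebesgue_on \<Omega>) u"
  by (simp add: Lp_norm_def L2norm_def powr_half_sqrt)

lemma L2norm_lincomb_le:
  assumes "sq_integrable M u" "sq_integrable M v"
  shows "L2norm M (\<lambda>x. a *\<^sub>R u x + b *\<^sub>R v x) \<le> \<bar>a\<bar> * L2norm M u + \<bar>b\<bar> * L2norm M v"
  using L2norm_triangle[OF sq_integrable_scale[OF assms(1)] sq_integrable_scale[OF assms(2)], of a b]
  by (simp add: L2norm_scale)

lemma L2norm_tendsto:
  assumes u: "\<And>n. sq_integrable M (u n)" "sq_integrable M v"
    and lim: "(\<lambda>n. L2norm M (\<lambda>x. v x - u n x)) \<longlonglongrightarrow> 0"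
  shows "(\<lambda>n. L2norm M (u n)) \<longlonglongrightarrow> L2norm M v"
proof -
  have "(\<lambda>n. L2norm M v - L2norm M (u n)) \<longlonglongrightarrow> 0"
    by (rule Lim_null_comparison[OF always_eventually lim])
       (use L2norm_triangle_diff(2)[OF u(2,1)] in auto)
  from tendsto_diff[OF tendsto_const[of "L2norm M v"] this] show ?thesis by simp
qed

lemma sq_integrable_component:
  fixes u :: "'a \<Rightarrow> ('b::euclidean_space)^'n"
  assumes "sq_integrable M u"
  shows "sq_integrable M (\<lambda>x. u x $ i)" "L2norm M (\<lambda>x. u x $ i) \<le> L2norm M u"
proof -
  have [measurable]: "u \<in> borel_measurable M" using assms by auto
  have m [measurable]: "(\<lambda>x. u x $ i) \<in> borel_measurable M"
    by (rule measurable_compose[OF \<open>u \<in> borel_measurable M\<close>])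
       (intro borel_measurable_continuous_onI continuous_intros)
  have le: "(norm (u x $ i))\<^sup>2 \<le> (norm (u x))\<^sup>2" for x
    by (intro power_mono Finite_Cartesian_Product.norm_nth_le norm_ge_zero)
  have i: "integrable M (\<lambda>x. (norm (u x $ i))\<^sup>2)"
    by (rule Bochner_Integration.integrable_bound[OF sq_integrableD(2)[OF assms]]) (use le in auto)
  then show "sq_integrable M (\<lambda>x. u x $ i)" by (simp add: sq_integrable_def)
  show "L2norm M (\<lambda>x. u x $ i) \<le> L2norm M u"
    unfolding L2norm_def
    by (intro real_sqrt_le_mono Bochner_Integration.integral_mono i sq_integrableD(2)[OF assms] le)
qed

definition lin_closed :: "('a \<Rightarrow> 'b::real_vector) set \<Rightarrow> bool" where
  "lin_closed S \<longleftrightarrow> (\<forall>u\<in>S. \<forall>v\<in>S. \<forall>a b. (\<lambda>x. a *\<^sub>R u x + b *\<^sub>R v x) \<in> S)"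

text \<open>
  Subadditivity and homogeneity in a single inequality, which is the form needed for closures of
  subspaces.
\<close>

definition seminorm_on :: "('a \<Rightarrow> 'b::real_vector) set \<Rightarrow> (('a \<Rightarrow> 'b) \<Rightarrow> real) \<Rightarrow> bool" where
  "seminorm_on X N \<longleftrightarrow> (\<forall>u\<in>X. \<forall>v\<in>X. \<forall>a b.
     N (\<lambda>x. a *\<^sub>R u x + b *\<^sub>R v x) \<le> \<bar>a\<bar> * N u + \<bar>b\<bar> * N v) \<and> (\<forall>u. 0 \<le> N u)"

lemma lin_closedD: "lin_closed S \<Longrightarrow> u \<in> S \<Longrightarrow> v \<in> S \<Longrightarrow> (\<lambda>x. a *\<^sub>R u x + b *\<^sub>R v x) \<in> S"
  by (simp add: lin_closed_def)

lemma seminorm_onD: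
  "seminorm_on X N \<Longrightarrow> u \<in> X \<Longrightarrow> v \<in> X \<Longrightarrow>
     N (\<lambda>x. a *\<^sub>R u x + b *\<^sub>R v x) \<le> \<bar>a\<bar> * N u + \<bar>b\<bar> * N v"
  "seminorm_on X N \<Longrightarrow> 0 \<le> N u"
  by (simp_all add: seminorm_on_def)

locale planar_domain =
  fixes \<Omega> :: "plane set"
  assumes open_domain: "open \<Omega>" and bounded_domain: "bounded \<Omega>"
begin

abbreviation M where "M \<equiv> lebesgue_on \<Omega>"

lemma domain_lmeasurable: "\<Omega> \<in> lmeasurable"
  using open_domain bounded_domain by (simp add: lmeasurable_open)

sublocale finite_measure M
  by (rule finite_measure_lebesgue_on[OF domain_lmeasurable])

lemma domain_sets: "\<Omega> \<inter> space lebesgue \<in> sets lebesgue"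
  using open_domain by auto

text \<open>
  Such a function lives on a compact set, so integrals over the plane, for which Tonelli's
  theorem is available, and over the domain agree.
\<close>

lemma continuous_vanishing_outside:
  fixes h :: "plane \<Rightarrow> 'b::euclidean_space"
  assumes h: "continuous_on UNIV h" and out: "\<And>x. x \<notin> \<Omega> \<Longrightarrow> h x = 0"
  shows "integral\<^sup>L lborel h = integral\<^sup>L M h" "integrable M h" "sq_integrable M h"
    "(\<integral>\<^sup>+x. ennreal (norm (h x)) \<partial>lborel) = ennreal (LINT x|M. norm (h x))"
proof -
  have hb [measurable]: "h \<in> borel_measurable borel" using h by (rule borel_measurable_continuous_onI)
  then have hl [measurable]: "h \<in> borel_measurable lebesgue"
    by (intro measurable_completion) simp
  have [measurable]: "h \<in> borel_measurable M"
    using hl by (rule measurable_restrict_space1)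
  have "compact (closure \<Omega>)" using bounded_domain by (simp add: compact_closure)
  then have "bounded (h ` closure \<Omega>)"
    using h continuous_on_subset compact_continuous_image compact_imp_bounded by (metis subset_UNIV)
  then obtain B where B: "norm (h x) \<le> B" if "x \<in> \<Omega>" for x
    unfolding bounded_iff using closure_subset[of \<Omega>] by blast
  have ae: "AE x in M. norm (h x) \<le> B" using B by (intro AE_I2) simp
  show i: "integrable M h" by (rule integrable_const_bound[OF ae]) simp
  have "integrable M (\<lambda>x. (norm (h x))\<^sup>2)"
    by (rule integrable_const_bound[where B = "B\<^sup>2"])
       (use ae in \<open>auto elim!: eventually_mono intro: power_mono\<close>)
  then show "sq_integrable M h" by (simp add: sq_integrable_def)
  have e: "indicator \<Omega> x *\<^sub>R h x = h x" for x using out by (auto simp: indicator_def)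
  show "integral\<^sup>L lborel h = integral\<^sup>L M h"
    using integral_restrict_space[OF domain_sets, of h] integral_completion[of h lborel] hb
    by (simp add: e)
  have "(\<integral>\<^sup>+x. ennreal (norm (h x)) \<partial>M) = (\<integral>\<^sup>+x. ennreal (norm (h x)) * indicator \<Omega> x \<partial>lebesgue)"
    using nn_integral_restrict_space[OF domain_sets] by simp
  also have "\<dots> = (\<integral>\<^sup>+x. ennreal (norm (h x)) \<partial>lborel)"
    unfolding nn_integral_completion by (intro nn_integral_cong) (use out in \<open>auto simp: indicator_def\<close>)
  finally show "(\<integral>\<^sup>+x. ennreal (norm (h x)) \<partial>lborel) = ennreal (LINT x|M. norm (h x))"
    using nn_integral_eq_integral[of M "\<lambda>x. norm (h x)"] i by simp
qed

lemma test_function_facts: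
  fixes \<phi> :: "plane \<Rightarrow> 'b::euclidean_space"
  assumes "\<phi> \<in> test_functions \<Omega>"
  shows "(\<phi> has_derivative frechet_derivative \<phi> (at x)) (at x)"
    "continuous_on UNIV \<phi>" "continuous_on UNIV (\<lambda>x. frechet_derivative \<phi> (at x) v)"
    "x \<notin> \<Omega> \<Longrightarrow> \<phi> x = 0" "x \<notin> \<Omega> \<Longrightarrow> frechet_derivative \<phi> (at x) v = 0"
proof -
  have s: "smooth \<phi>" and sub: "closure {x. \<phi> x \<noteq> 0} \<subseteq> \<Omega>"
    using assms by (auto simp: test_functions_def)
  show d: "(\<phi> has_derivative frechet_derivative \<phi> (at x)) (at x)" for x
    using smooth_imp_differentiable[OF s] by (rule frechet_derivative_worksI)
  show "continuous_on UNIV \<phi>" "continuous_on UNIV (\<lambda>x. frechet_derivative \<phi> (at x) v)"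
    by (rule smooth_continuous[OF s], rule smooth_derivative_continuous[OF s])
  have sub': "{x. \<phi> x \<noteq> 0} \<subseteq> \<Omega>" using sub closure_subset by (rule order_trans[rotated])
  show "\<phi> x = 0" if "x \<notin> \<Omega>" using sub' that by auto
  assume x: "x \<notin> \<Omega>"
  have "(\<phi> has_derivative (\<lambda>_. 0)) (at x)"
  proof (rule has_derivative_transform_within_open[OF has_derivative_const open_Compl[OF closed_closure]])
    show "x \<in> - closure {x. \<phi> x \<noteq> 0}" using x sub by blast
    show "0 = \<phi> y" if "y \<in> - closure {x. \<phi> x \<noteq> 0}" for y
      using that closure_subset[of "{x. \<phi> x \<noteq> 0}"] by auto
  qed
  from fun_cong[OF has_derivative_unique[OF d this]]
  show "frechet_derivative \<phi> (at x) v = 0" by simp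
qed

lemma test_component:
  fixes \<phi> :: vfield
  assumes "\<phi> \<in> test_functions \<Omega>"
  shows "(\<lambda>x. \<phi> x $ i) \<in> test_functions \<Omega>"
    "frechet_derivative (\<lambda>x. \<phi> x $ i) (at x) v = frechet_derivative \<phi> (at x) v $ i"
proof -
  have sm: "smooth (\<lambda>x. \<phi> x $ i)"
    using assms by (intro smooth_bounded_linear[OF bounded_linear_vec_nth]) (simp add: test_functions_def)
  have sub: "closure {x. \<phi> x $ i \<noteq> 0} \<subseteq> closure {x. \<phi> x \<noteq> 0}"
    by (rule closure_mono) auto
  then show "(\<lambda>x. \<phi> x $ i) \<in> test_functions \<Omega>"
    using assms sm compact_closed_subset[OF _ closed_closure sub] by (auto simp: test_functions_def)
  have "((\<lambda>x. \<phi> x $ i) has_derivative (\<lambda>v. frechet_derivative \<phi> (at x) v $ i)) (at x)"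
    by (rule bounded_linear.has_derivative[OF bounded_linear_vec_nth test_function_facts(1)[OF assms]])
  then show "frechet_derivative (\<lambda>x. \<phi> x $ i) (at x) v = frechet_derivative \<phi> (at x) v $ i"
    by (rule fun_cong[OF frechet_derivative_at, symmetric])
qed

lemma jacobian_nth: "jacobian \<phi> (at x) $ i $ j = frechet_derivative \<phi> (at x) (axis j 1) $ i"
  by (simp add: jacobian_def matrix_def)

lemma domain_norm_bound: obtains R where "\<And>x. norm x > R \<Longrightarrow> x \<notin> \<Omega>"
  using bounded_domain unfolding bounded_iff by (metis not_le)

text \<open>
  Apply \<open>planar_W11(2)\<close> to the product of the two functions.
\<close>

lemma test_by_parts:
  fixes \<phi> \<psi> :: "plane \<Rightarrow> real"
  assumes p: "\<phi> \<in> test_functions \<Omega>" "\<psi> \<in> test_functions \<Omega>"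
  shows "(LINT x|M. \<phi> x * frechet_derivative \<psi> (at x) (axis j 1))
    = - (LINT x|M. frechet_derivative \<phi> (at x) (axis j 1) * \<psi> x)"
proof -
  note f = test_function_facts[OF p(1)] and g = test_function_facts[OF p(2)]
  obtain R where R: "\<And>x. norm x > R \<Longrightarrow> x \<notin> \<Omega>" using domain_norm_bound by metis
  define h where "h x v = \<phi> x * frechet_derivative \<psi> (at x) v + frechet_derivative \<phi> (at x) v * \<psi> x" for x v
  have "(LINT x|lborel. h x (axis j 1)) = 0"
  proof (rule planar_W11(2))
    show "((\<lambda>x. \<phi> x * \<psi> x) has_derivative h x) (at x)" for x
      unfolding h_def by (intro has_derivative_mult f g)
    show "continuous_on UNIV (\<lambda>x. h x v)" for v
      unfolding h_def by (intro continuous_intros f g)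
  qed (use R f(4) in auto)
  moreover have "(LINT x|lborel. h x (axis j 1)) = (LINT x|M. h x (axis j 1))"
    unfolding h_def using f g
    by (intro continuous_vanishing_outside) (auto intro!: continuous_intros)
  moreover have "(LINT x|M. h x (axis j 1)) = (LINT x|M. \<phi> x * frechet_derivative \<psi> (at x) (axis j 1))
      + (LINT x|M. frechet_derivative \<phi> (at x) (axis j 1) * \<psi> x)"
    unfolding h_def using f g
    by (intro Bochner_Integration.integral_add continuous_vanishing_outside(2))
       (auto intro!: continuous_intros)
  ultimately show ?thesis by simp
qed

lemma jacobian_continuous:
  assumes "\<phi> \<in> test_functions \<Omega>"
  shows "continuous_on UNIV (\<lambda>x. jacobian \<phi> (at x))" "x \<notin> \<Omega> \<Longrightarrow> jacobian \<phi> (at x) = 0"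
proof -
  have "continuous_on UNIV (\<lambda>x. \<chi> i j. frechet_derivative \<phi> (at x) (axis j 1) $ i)"
    by (intro continuous_on_vec_lambda continuous_on_component test_function_facts[OF assms])
  then show "continuous_on UNIV (\<lambda>x. jacobian \<phi> (at x))"
    by (simp add: jacobian_def matrix_def)
  show "x \<notin> \<Omega> \<Longrightarrow> jacobian \<phi> (at x) = 0"
    using test_function_facts(5)[OF assms] by (simp add: vec_eq_iff jacobian_nth)
qed

lemma test_sq_integrable:
  fixes \<phi> :: vfield
  assumes "\<phi> \<in> test_functions \<Omega>"
  shows "sq_integrable M \<phi>" "sq_integrable M (\<lambda>x. jacobian \<phi> (at x))"
  by (rule continuous_vanishing_outside(3)[OF test_function_facts(2,4)[OF assms]], assumption,
      rule continuous_vanishing_outside(3)[OF jacobian_continuous[OF assms]])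

lemma test_has_weak_grad:
  assumes "\<phi> \<in> test_functions \<Omega>"
  shows "has_weak_grad \<Omega> \<phi> (\<lambda>x. jacobian \<phi> (at x))"
  unfolding has_weak_grad_def Lp2_iff
  using test_sq_integrable[OF assms] test_by_parts[OF test_component(1)[OF assms]]
  by (simp add: test_component(2)[OF assms] jacobian_nth)

lemma weak_grad_lincomb:
  assumes "has_weak_grad \<Omega> u G" "has_weak_grad \<Omega> v G'"
  shows "has_weak_grad \<Omega> (\<lambda>x. a *\<^sub>R u x + b *\<^sub>R v x) (\<lambda>x. a *\<^sub>R G x + b *\<^sub>R G' x)"
proof -
  have s: "sq_integrable M u" "sq_integrable M v" "sq_integrable M G" "sq_integrable M G'"
    using assms by (auto simp: has_weak_grad_def Lp2_iff)
  have t: "(LINT x|M. (a * u x $ i + b * v x $ i) * frechet_derivative \<phi> (at x) (axis j 1))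
      = - (LINT x|M. (a * G x $ i $ j + b * G' x $ i $ j) * \<phi> x)" if p: "\<phi> \<in> test_functions \<Omega>" for \<phi> :: "plane \<Rightarrow> real" and i j
  proof -
    have sp: "sq_integrable M \<phi>" "sq_integrable M (\<lambda>x. frechet_derivative \<phi> (at x) (axis j 1))"
      by (rule continuous_vanishing_outside(3)[OF test_function_facts(2,4)[OF p]], assumption,
          rule continuous_vanishing_outside(3)[OF test_function_facts(3,5)[OF p]])
    have I: "integrable M (\<lambda>x. h x * k x)" if "sq_integrable M h" "sq_integrable M k" for h k :: "plane \<Rightarrow> real"
      using sq_integrable_inner(1)[OF that] by simp
    have e: "(LINT x|M. (a * h x + b * h' x) * k x) = a * (LINT x|M. h x * k x) + b * (LINT x|M. h' x * k x)"
      if "sq_integrable M h" "sq_integrable M h'" "sq_integrable M k" for h h' k :: "plane \<Rightarrow> real"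
      using I[OF that(1,3)] I[OF that(2,3)] by (simp add: distrib_right mult.assoc)
    have c: "sq_integrable M (\<lambda>x. u x $ i)" "sq_integrable M (\<lambda>x. v x $ i)"
      "sq_integrable M (\<lambda>x. G x $ i $ j)" "sq_integrable M (\<lambda>x. G' x $ i $ j)"
      by (intro sq_integrable_component(1) s)+
    show ?thesis
      unfolding e[OF c(1,2) sp(2)] e[OF c(3,4) sp(1)]
      using assms p by (simp add: has_weak_grad_def)
  qed
  show ?thesis
    using s t by (simp add: has_weak_grad_def Lp2_iff sq_integrable_lincomb)
qed

text \<open>
  Weak gradients are only determined almost everywhere; by uniqueness, the chosen gradient
  \<open>wgrad\<close> is linear and agrees with the Jacobian on test functions, in each case
  almost everywhere.
\<close>

lemma weak_grad_unique:
  assumes "has_weak_grad \<Omega> u G" "has_weak_grad \<Omega> u G'"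
  shows "AE x in M. G x = G' x"
proof -
  have s: "sq_integrable M (\<lambda>x. G x - G' x)"
    using assms by (auto simp: has_weak_grad_def Lp2_iff intro: sq_integrable_diff)
  have "AE x in M. (G x - G' x) $ i $ j = 0" for i j
  proof (rule fundamental_lemma[OF open_domain])
    have c: "sq_integrable M (\<lambda>x. (G x - G' x) $ i $ j)"
      by (intro sq_integrable_component(1) s)
    then show "integrable M (\<lambda>x. (G x - G' x) $ i $ j)" by (rule sq_integrable_integrable)
    fix \<phi> :: "plane \<Rightarrow> real" assume p: "\<phi> \<in> test_functions \<Omega>"
    have "has_weak_grad \<Omega> (\<lambda>x. 1 *\<^sub>R u x + (-1) *\<^sub>R u x) (\<lambda>x. 1 *\<^sub>R G x + (-1) *\<^sub>R G' x)"
      by (rule weak_grad_lincomb[OF assms])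
    then show "(LINT x|M. (G x - G' x) $ i $ j * \<phi> x) = 0"
      using p by (simp add: has_weak_grad_def)
  qed
  then have "AE x in M. \<forall>i j. (G x - G' x) $ i $ j = 0"
    by (simp add: AE_all_countable)
  then show ?thesis by eventually_elim (simp add: vec_eq_iff)
qed

lemma wgrad_works: "u \<in> H1 \<Omega> \<Longrightarrow> has_weak_grad \<Omega> u (wgrad \<Omega> u)"
  unfolding H1_def wgrad_def mem_Collect_eq by (elim exE) (rule someI[of "has_weak_grad \<Omega> u"])

lemma H1_sq_integrable:
  assumes "u \<in> H1 \<Omega>" shows "sq_integrable M u" "sq_integrable M (wgrad \<Omega> u)"
  using wgrad_works[OF assms] by (auto simp: has_weak_grad_def Lp2_iff)

lemma H1_lincomb: "u \<in> H1 \<Omega> \<Longrightarrow> v \<in> H1 \<Omega> \<Longrightarrow> (\<lambda>x. a *\<^sub>R u x + b *\<^sub>R v x) \<in> H1 \<Omega>"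
  unfolding H1_def using weak_grad_lincomb by blast

lemma wgrad_lincomb:
  assumes "u \<in> H1 \<Omega>" "v \<in> H1 \<Omega>"
  shows "AE x in M. wgrad \<Omega> (\<lambda>x. a *\<^sub>R u x + b *\<^sub>R v x) x = a *\<^sub>R wgrad \<Omega> u x + b *\<^sub>R wgrad \<Omega> v x"
  by (rule weak_grad_unique[OF wgrad_works[OF H1_lincomb[OF assms]]
        weak_grad_lincomb[OF wgrad_works[OF assms(1)] wgrad_works[OF assms(2)]]])

lemma test_H1: "\<phi> \<in> test_functions \<Omega> \<Longrightarrow> \<phi> \<in> H1 \<Omega>"
  unfolding H1_def using test_has_weak_grad by blast

lemma wgrad_test:
  "\<phi> \<in> test_functions \<Omega> \<Longrightarrow> AE x in M. wgrad \<Omega> \<phi> x = jacobian \<phi> (at x)"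
  using weak_grad_unique[OF wgrad_works[OF test_H1] test_has_weak_grad] by blast

lemma L2norm_wgrad_lincomb:
  assumes "u \<in> H1 \<Omega>" "v \<in> H1 \<Omega>"
  shows "L2norm M (wgrad \<Omega> (\<lambda>x. a *\<^sub>R u x + b *\<^sub>R v x)) = L2norm M (\<lambda>x. a *\<^sub>R wgrad \<Omega> u x + b *\<^sub>R wgrad \<Omega> v x)"
proof (rule L2norm_cong_AE[OF _ _ wgrad_lincomb[OF assms]])
  show "wgrad \<Omega> (\<lambda>x. a *\<^sub>R u x + b *\<^sub>R v x) \<in> borel_measurable M"
    by (rule sq_integrableD(1)[OF H1_sq_integrable(2)[OF H1_lincomb[OF assms]]])
  show "(\<lambda>x. a *\<^sub>R wgrad \<Omega> u x + b *\<^sub>R wgrad \<Omega> v x) \<in> borel_measurable M"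
    by (rule sq_integrableD(1)[OF sq_integrable_lincomb(1)[OF H1_sq_integrable(2)[OF assms(1)] H1_sq_integrable(2)[OF assms(2)]]])
qed

lemma H1_norm_alt: "H1_norm \<Omega> u = sqrt ((L2norm M u)\<^sup>2 + (L2norm M (wgrad \<Omega> u))\<^sup>2)"
  by (simp add: H1_norm_def Lp_norm2)

lemma H1_norm_ge: "L2norm M u \<le> H1_norm \<Omega> u" "L2norm M (wgrad \<Omega> u) \<le> H1_norm \<Omega> u"
  unfolding H1_norm_alt by (rule real_le_rsqrt, simp)+

lemma H1_norm_lincomb:
  assumes "u \<in> H1 \<Omega>" "v \<in> H1 \<Omega>"
  shows "H1_norm \<Omega> (\<lambda>x. a *\<^sub>R u x + b *\<^sub>R v x) \<le> \<bar>a\<bar> * H1_norm \<Omega> u + \<bar>b\<bar> * H1_norm \<Omega> v"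
proof -
  note s = H1_sq_integrable[OF assms(1)] H1_sq_integrable[OF assms(2)]
  have h: "\<bar>c\<bar> * H1_norm \<Omega> w = sqrt ((\<bar>c\<bar> * L2norm M w)\<^sup>2 + (\<bar>c\<bar> * L2norm M (wgrad \<Omega> w))\<^sup>2)" for c w
    by (simp add: H1_norm_alt power_mult_distrib real_sqrt_mult flip: distrib_left)
  have "H1_norm \<Omega> (\<lambda>x. a *\<^sub>R u x + b *\<^sub>R v x)
      \<le> sqrt ((\<bar>a\<bar> * L2norm M u + \<bar>b\<bar> * L2norm M v)\<^sup>2
        + (\<bar>a\<bar> * L2norm M (wgrad \<Omega> u) + \<bar>b\<bar> * L2norm M (wgrad \<Omega> v))\<^sup>2)"
    unfolding H1_norm_alt L2norm_wgrad_lincomb[OF assms]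
    by (intro real_sqrt_le_mono add_mono power_mono L2norm_lincomb_le L2norm_nonneg s)
  also have "\<dots> \<le> \<bar>a\<bar> * H1_norm \<Omega> u + \<bar>b\<bar> * H1_norm \<Omega> v"
    unfolding h by (rule real_sqrt_sum_squares_triangle_ineq)
  finally show ?thesis .
qed

lemma H1_norm_nonneg: "0 \<le> H1_norm \<Omega> u"
  by (simp add: H1_norm_alt)

lemma H1_norm_diff_self: "u \<in> H1 \<Omega> \<Longrightarrow> H1_norm \<Omega> (u - u) = 0"
  using H1_norm_lincomb[of u u 0 0] H1_norm_nonneg[of "u - u"] by (simp add: fun_diff_def)

lemma norm_closureE:
  assumes "u \<in> norm_closure X N S"
  obtains \<phi> where "u \<in> X" "\<And>n. \<phi> n \<in> S" "(\<lambda>n::nat. N (u - \<phi> n)) \<longlonglongrightarrow> 0"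
proof -
  from assms obtain \<phi> where "u \<in> X" "\<forall>n. \<phi> n \<in> S" "(\<lambda>n::nat. N (u - \<phi> n)) \<longlonglongrightarrow> 0"
    unfolding norm_closure_def mem_Collect_eq by (elim exE conjE)
  then show thesis by (intro that[of \<phi>]) simp_all
qed

lemma norm_closure_lincomb:
  fixes X :: "vfield set"
  assumes X: "lin_closed X" and S: "lin_closed S" "S \<subseteq> X" and N: "seminorm_on X N"
  shows "lin_closed (norm_closure X N S)"
  unfolding lin_closed_def
proof (intro ballI allI)
  fix u v :: vfield and a b
  assume u: "u \<in> norm_closure X N S" and v: "v \<in> norm_closure X N S"
  obtain \<phi> where p: "u \<in> X" "\<And>n. \<phi> n \<in> S" "(\<lambda>n. N (u - \<phi> n)) \<longlonglongrightarrow> 0"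
    by (rule norm_closureE[OF u], rule that)
  obtain \<psi> where q: "v \<in> X" "\<And>n. \<psi> n \<in> S" "(\<lambda>n. N (v - \<psi> n)) \<longlonglongrightarrow> 0"
    by (rule norm_closureE[OF v], rule that)
  let ?w = "\<lambda>n x. a *\<^sub>R \<phi> n x + b *\<^sub>R \<psi> n x"
  have d: "w - z \<in> X" if "w \<in> X" "z \<in> X" for w z
    using lin_closedD[OF X that, of 1 "-1"] by (simp add: fun_diff_def)
  have le: "N ((\<lambda>x. a *\<^sub>R u x + b *\<^sub>R v x) - ?w n) \<le> \<bar>a\<bar> * N (u - \<phi> n) + \<bar>b\<bar> * N (v - \<psi> n)" for n
  proof -
    have e: "(\<lambda>x. a *\<^sub>R u x + b *\<^sub>R v x) - ?w n = (\<lambda>x. a *\<^sub>R (u - \<phi> n) x + b *\<^sub>R (v - \<psi> n) x)"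
      by (simp add: fun_eq_iff scaleR_right_diff_distrib)
    have "u - \<phi> n \<in> X" "v - \<psi> n \<in> X" using d p q S(2) by blast+
    then show ?thesis unfolding e by (rule seminorm_onD(1)[OF N])
  qed
  have z: "(\<lambda>n. \<bar>a\<bar> * N (u - \<phi> n) + \<bar>b\<bar> * N (v - \<psi> n)) \<longlonglongrightarrow> 0"
    using tendsto_add[OF tendsto_mult[OF tendsto_const p(3)] tendsto_mult[OF tendsto_const q(3)]] by simp
  have "(\<lambda>n. N ((\<lambda>x. a *\<^sub>R u x + b *\<^sub>R v x) - ?w n)) \<longlonglongrightarrow> 0"
    by (rule Lim_null_comparison[OF always_eventually z])
       (simp only: real_norm_def abs_of_nonneg[OF seminorm_onD(2)[OF N]] le simp_thms)
  moreover have "?w n \<in> S" for n by (rule lin_closedD[OF S(1) p(2) q(2)])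
  moreover have "(\<lambda>x. a *\<^sub>R u x + b *\<^sub>R v x) \<in> X" by (rule lin_closedD[OF X p(1) q(1)])
  ultimately show "(\<lambda>x. a *\<^sub>R u x + b *\<^sub>R v x) \<in> norm_closure X N S"
    unfolding norm_closure_def mem_Collect_eq by (intro conjI exI[of _ ?w] allI)
qed

lemma solenoidal_test: "\<phi> \<in> solenoidal_tests \<Omega> \<Longrightarrow> \<phi> \<in> test_functions \<Omega>"
  by (simp add: solenoidal_tests_def)

lemma solenoidal_lincomb:
  assumes "\<phi> \<in> solenoidal_tests \<Omega>" "\<psi> \<in> solenoidal_tests \<Omega>"
  shows "(\<lambda>x. a *\<^sub>R \<phi> x + b *\<^sub>R \<psi> x) \<in> solenoidal_tests \<Omega>"
proof -
  note t = solenoidal_test[OF assms(1)] solenoidal_test[OF assms(2)]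
  have D: "((\<lambda>x. a *\<^sub>R \<phi> x + b *\<^sub>R \<psi> x) has_derivative
      (\<lambda>v. a *\<^sub>R frechet_derivative \<phi> (at x) v + b *\<^sub>R frechet_derivative \<psi> (at x) v)) (at x)" for x
    by (intro derivative_intros test_function_facts(1) t)
  have "jacobian (\<lambda>x. a *\<^sub>R \<phi> x + b *\<^sub>R \<psi> x) (at x) = a *\<^sub>R jacobian \<phi> (at x) + b *\<^sub>R jacobian \<psi> (at x)" for x
    by (simp add: vec_eq_iff jacobian_nth frechet_derivative_at[OF D, symmetric])
  moreover have "trace (a *\<^sub>R A + b *\<^sub>R B) = a * trace A + b * trace B" for A B :: "real^2^2"
    by (simp add: trace_def sum.distrib sum_distrib_left)
  ultimately show ?thesis
    using assms test_functions_lincomb[OF t] by (simp add: solenoidal_tests_def)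
qed

lemma zero_solenoidal: "(\<lambda>x. 0) \<in> solenoidal_tests \<Omega>"
proof -
  have "smooth (\<lambda>x :: plane. 0 :: real^2)" by (simp add: smooth_def Ck_on_const)
  moreover have "jacobian (\<lambda>x :: plane. 0 :: real^2) (at x) = 0" for x
    by (simp add: vec_eq_iff jacobian_nth)
  ultimately show ?thesis by (simp add: solenoidal_tests_def test_functions_def trace_def)
qed

lemma H_lincomb:
  assumes "u \<in> H_space \<Omega>" "v \<in> H_space \<Omega>"
  shows "(\<lambda>x. a *\<^sub>R u x + b *\<^sub>R v x) \<in> H_space \<Omega>"
proof -
  have "lin_closed (H_space \<Omega>)"
    unfolding H_space_def
  proof (rule norm_closure_lincomb)
    show "lin_closed (Lp 2 \<Omega> :: vfield set)"
      unfolding lin_closed_def by (simp add: Lp2_iff sq_integrable_lincomb(1))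
    show "seminorm_on (Lp 2 \<Omega> :: vfield set) (Lp_norm 2 \<Omega>)"
      unfolding seminorm_on_def by (simp add: Lp2_iff Lp_norm2 L2norm_lincomb_le)
    show "solenoidal_tests \<Omega> \<subseteq> Lp 2 \<Omega>"
      using solenoidal_test test_sq_integrable(1) by (auto simp: Lp2_iff)
  qed (simp add: lin_closed_def solenoidal_lincomb)
  then show ?thesis using assms by (rule lin_closedD)
qed

lemma H10_lincomb: "lin_closed (H10 \<Omega>)"
  unfolding H10_def
proof (rule norm_closure_lincomb)
  show "lin_closed (H1 \<Omega>)"
    unfolding lin_closed_def by (simp add: H1_lincomb)
  show "seminorm_on (H1 \<Omega>) (H1_norm \<Omega>)"
    unfolding seminorm_on_def by (simp add: H1_norm_lincomb H1_norm_nonneg)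
  show "test_functions \<Omega> \<subseteq> H1 \<Omega>" using test_H1 by blast
qed (simp add: lin_closed_def test_functions_lincomb)

lemma H10_H1: "u \<in> H10 \<Omega> \<Longrightarrow> u \<in> H1 \<Omega>"
  by (simp add: H10_def norm_closure_def)

lemma test_H10: "\<phi> \<in> test_functions \<Omega> \<Longrightarrow> \<phi> \<in> H10 \<Omega>"
proof -
  assume p: "\<phi> \<in> test_functions \<Omega>"
  from H1_norm_diff_self[OF test_H1[OF p]] show ?thesis
    using p test_H1[OF p] unfolding H10_def norm_closure_def
    by (intro CollectI conjI exI[where x = "\<lambda>_. \<phi>"]) auto
qed

lemma V_lincomb:
  assumes "u \<in> V_space \<Omega>" "v \<in> V_space \<Omega>"
  shows "(\<lambda>x. a *\<^sub>R u x + b *\<^sub>R v x) \<in> V_space \<Omega>"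
proof -
  have "lin_closed (V_space \<Omega>)"
    unfolding V_space_def
  proof (rule norm_closure_lincomb[OF H10_lincomb])
    show "seminorm_on (H10 \<Omega>) (H1_norm \<Omega>)"
      unfolding seminorm_on_def by (simp add: H10_H1 H1_norm_lincomb H1_norm_nonneg)
    show "solenoidal_tests \<Omega> \<subseteq> H10 \<Omega>" using test_H10 solenoidal_test by blast
  qed (simp add: lin_closed_def solenoidal_lincomb)
  then show ?thesis using assms by (rule lin_closedD)
qed

lemma V_H1: "u \<in> V_space \<Omega> \<Longrightarrow> u \<in> H1 \<Omega>"
  unfolding V_space_def by (erule norm_closureE) (rule H10_H1)

text \<open>
  The form in which membership in \<open>V\<close> is used: approximation by solenoidal test
  functions together with their gradients.
\<close>

lemma V_approx:
  assumes "u \<in> V_space \<Omega>"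
  obtains \<phi> where "\<And>n::nat. \<phi> n \<in> solenoidal_tests \<Omega>"
    "(\<lambda>n. L2norm M (\<lambda>x. u x - \<phi> n x)) \<longlonglongrightarrow> 0"
    "(\<lambda>n. L2norm M (\<lambda>x. wgrad \<Omega> u x - jacobian (\<phi> n) (at x))) \<longlonglongrightarrow> 0"
proof -
  obtain \<phi> where p: "\<And>n. \<phi> n \<in> solenoidal_tests \<Omega>" "(\<lambda>n. H1_norm \<Omega> (u - \<phi> n)) \<longlonglongrightarrow> 0"
    by (rule norm_closureE[OF assms[unfolded V_space_def]], rule that)
  have 1: "(\<lambda>n. L2norm M (u - \<phi> n)) \<longlonglongrightarrow> 0"
    by (rule tendsto_sandwich[OF _ _ tendsto_const p(2)]) (use H1_norm_ge in auto)
  have 2: "(\<lambda>n. L2norm M (wgrad \<Omega> (u - \<phi> n))) \<longlonglongrightarrow> 0"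
    by (rule tendsto_sandwich[OF _ _ tendsto_const p(2)]) (use H1_norm_ge in auto)
  have e: "L2norm M (wgrad \<Omega> (u - \<phi> n)) = L2norm M (\<lambda>x. wgrad \<Omega> u x - jacobian (\<phi> n) (at x))" for n
  proof (rule L2norm_cong_AE)
    note t = solenoidal_test[OF p(1)[of n]]
    have uH: "u \<in> H1 \<Omega>" using V_H1 assms .
    have "u - \<phi> n = (\<lambda>x. 1 *\<^sub>R u x + (-1) *\<^sub>R \<phi> n x)" by (simp add: fun_eq_iff)
    then have w: "AE x in M. wgrad \<Omega> (u - \<phi> n) x = wgrad \<Omega> u x - wgrad \<Omega> (\<phi> n) x"
      and h: "u - \<phi> n \<in> H1 \<Omega>"
      using wgrad_lincomb[OF uH test_H1[OF t], of 1 "-1"] H1_lincomb[OF uH test_H1[OF t], of 1 "-1"] by simp_all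
    show "AE x in M. wgrad \<Omega> (u - \<phi> n) x = wgrad \<Omega> u x - jacobian (\<phi> n) (at x)"
      using w wgrad_test[OF t] by eventually_elim simp
    show "wgrad \<Omega> (u - \<phi> n) \<in> borel_measurable M" using H1_sq_integrable(2)[OF h] by auto
    show "(\<lambda>x. wgrad \<Omega> u x - jacobian (\<phi> n) (at x)) \<in> borel_measurable M"
      using sq_integrable_diff[OF H1_sq_integrable(2)[OF uH] test_sq_integrable(2)[OF t]] by auto
  qed
  show thesis using that[OF p(1)] 1 2 e by (simp add: fun_diff_def)
qed

lemma H_spaceI:
  assumes "sq_integrable M u" "\<And>n::nat. \<phi> n \<in> solenoidal_tests \<Omega>"
    "(\<lambda>n. L2norm M (\<lambda>x. u x - \<phi> n x)) \<longlonglongrightarrow> 0"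
  shows "u \<in> H_space \<Omega>"
proof -
  have "(\<lambda>n. Lp_norm 2 \<Omega> (u - \<phi> n)) \<longlonglongrightarrow> 0" using assms(3) by (simp add: Lp_norm2 fun_diff_def)
  then show ?thesis
    unfolding H_space_def norm_closure_def mem_Collect_eq Lp2_iff
    by (intro conjI exI[of _ \<phi>] allI) (rule assms(1), rule assms(2))
qed

lemma V_H: "u \<in> V_space \<Omega> \<Longrightarrow> u \<in> H_space \<Omega>"
proof -
  assume u: "u \<in> V_space \<Omega>"
  show ?thesis
  proof (rule V_approx[OF u])
    fix \<phi> :: "nat \<Rightarrow> vfield"
    assume "\<And>n. \<phi> n \<in> solenoidal_tests \<Omega>" "(\<lambda>n. L2norm M (\<lambda>x. u x - \<phi> n x)) \<longlonglongrightarrow> 0"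
    with H1_sq_integrable(1)[OF V_H1[OF u]] show "u \<in> H_space \<Omega>" by (rule H_spaceI)
  qed
qed

lemma H_sq_integrable: "u \<in> H_space \<Omega> \<Longrightarrow> sq_integrable M u"
  by (simp add: H_space_def norm_closure_def Lp2_iff)

lemma solenoidal_V: "\<phi> \<in> solenoidal_tests \<Omega> \<Longrightarrow> \<phi> \<in> V_space \<Omega>"
proof -
  assume p: "\<phi> \<in> solenoidal_tests \<Omega>"
  note t = solenoidal_test[OF p]
  from H1_norm_diff_self[OF test_H1[OF t]] show ?thesis
    using p test_H10[OF t] unfolding V_space_def norm_closure_def
    by (intro CollectI conjI exI[where x = "\<lambda>_. \<phi>"]) auto
qed

text \<open>
  The projection theorem shows that the Helmholtz projection exists for square integrable
  fields; it disappears under the inner product with divergence-free fields.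
\<close>

lemma helmholtz_inner:
  assumes g: "sq_integrable M g" and v: "v \<in> H_space \<Omega>"
  shows "H_inner \<Omega> (helmholtz \<Omega> g) v = H_inner \<Omega> g v" "helmholtz \<Omega> g \<in> H_space \<Omega>"
proof -
  have S: "\<phi> \<in> solenoidal_tests \<Omega> \<Longrightarrow> sq_integrable M \<phi>" for \<phi>
    using solenoidal_test test_sq_integrable by blast
  obtain w \<phi> where w: "sq_integrable M w" "\<And>n::nat. \<phi> n \<in> solenoidal_tests \<Omega>"
    "(\<lambda>n. L2norm M (\<lambda>x. w x - \<phi> n x)) \<longlonglongrightarrow> 0"
    "\<And>v. v \<in> solenoidal_tests \<Omega> \<Longrightarrow> (LINT x|M. (g x - w x) \<bullet> v x) = 0"
    using L2_projection[OF S _ solenoidal_lincomb g] zero_solenoidal by blast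
  have wH: "w \<in> H_space \<Omega>"
    by (rule H_spaceI[OF w(1-3)])
  have "H_inner \<Omega> (g - w) v = 0" if v: "v \<in> H_space \<Omega>" for v
  proof -
    obtain \<psi> where p: "\<And>n. \<psi> n \<in> solenoidal_tests \<Omega>" "(\<lambda>n. L2norm M (\<lambda>x. v x - \<psi> n x)) \<longlonglongrightarrow> 0"
      by (rule norm_closureE[OF v[unfolded H_space_def]], rule that) (auto simp: Lp_norm2 fun_diff_def)
    have sv: "sq_integrable M v" using H_sq_integrable v .
    have sg: "sq_integrable M (\<lambda>x. g x - w x)" using sq_integrable_diff[OF g w(1)] .
    have e: "(LINT x|M. (g x - w x) \<bullet> v x) = (LINT x|M. (g x - w x) \<bullet> (v x - \<psi> n x))" for n
    proof -
      have "(LINT x|M. (g x - w x) \<bullet> (v x - \<psi> n x)) = (LINT x|M. (g x - w x) \<bullet> v x) - (LINT x|M. (g x - w x) \<bullet> \<psi> n x)"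
        unfolding inner_diff_right
        by (rule Bochner_Integration.integral_diff) (intro sq_integrable_inner(1) sg sv S p(1))+
      then show ?thesis using w(4)[OF p(1)] by simp
    qed
    have "\<bar>LINT x|M. (g x - w x) \<bullet> v x\<bar> \<le> L2norm M (\<lambda>x. g x - w x) * L2norm M (\<lambda>x. v x - \<psi> n x)" for n
      unfolding e[of n] by (rule L2_Cauchy_Schwarz[OF sg sq_integrable_diff[OF sv S[OF p(1)]]])
    moreover have "(\<lambda>n. L2norm M (\<lambda>x. g x - w x) * L2norm M (\<lambda>x. v x - \<psi> n x)) \<longlonglongrightarrow> 0"
      using tendsto_mult[OF tendsto_const p(2)] by simp
    ultimately have "\<bar>LINT x|M. (g x - w x) \<bullet> v x\<bar> \<le> 0"
      by (intro LIMSEQ_le_const) auto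
    then show ?thesis by (simp add: H_inner_def)
  qed
  then have ex: "\<exists>w. w \<in> H_space \<Omega> \<and> (\<forall>v\<in>H_space \<Omega>. H_inner \<Omega> (g - w) v = 0)" using wH by blast
  have h: "helmholtz \<Omega> g \<in> H_space \<Omega> \<and> (\<forall>v\<in>H_space \<Omega>. H_inner \<Omega> (g - helmholtz \<Omega> g) v = 0)"
    unfolding helmholtz_def by (rule someI_ex[OF ex])
  then show "helmholtz \<Omega> g \<in> H_space \<Omega>" ..
  have "H_inner \<Omega> (g - helmholtz \<Omega> g) v = H_inner \<Omega> g v - H_inner \<Omega> (helmholtz \<Omega> g) v"
    unfolding H_inner_def minus_apply inner_diff_left
    by (rule Bochner_Integration.integral_diff)
       (intro sq_integrable_inner(1) g H_sq_integrable; use h v in blast)+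
  then show "H_inner \<Omega> (helmholtz \<Omega> g) v = H_inner \<Omega> g v" using h v by simp
qed

end

section \<open>Sobolev inequalities in the space V\<close>

text \<open>
  In terms of the square integrability of \<open>\<bar>u\<bar>\<^sup>2\<close>, so that
  estimates in \<open>L\<^sup>4\<close> reduce to the Cauchy--Schwarz inequality for squares.
\<close>

definition L4_integrable :: "'a measure \<Rightarrow> ('a \<Rightarrow> 'b::euclidean_space) \<Rightarrow> bool" where
  "L4_integrable M u \<longleftrightarrow> u \<in> borel_measurable M \<and> sq_integrable M (\<lambda>x. (norm (u x))\<^sup>2)"

definition L4norm :: "'a measure \<Rightarrow> ('a \<Rightarrow> 'b::euclidean_space) \<Rightarrow> real" where
  "L4norm M u = sqrt (L2norm M (\<lambda>x. (norm (u x))\<^sup>2))"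

lemma L4norm_nonneg [simp]: "0 \<le> L4norm M u"
  by (simp add: L4norm_def)

lemma L4norm_power4: "L4norm M u ^ 4 = (LINT x|M. norm (u x) ^ 4)"
proof -
  have "L4norm M u ^ 4 = (L2norm M (\<lambda>x. (norm (u x))\<^sup>2))\<^sup>2"
    by (simp add: L4norm_def power4_eq_xxxx power2_eq_square real_sqrt_mult_self flip: mult.assoc)
  then show ?thesis by (simp add: L2norm_power2 flip: power_mult)
qed

lemma L4_product:
  fixes u :: "'a \<Rightarrow> 'b::euclidean_space" and v :: "'a \<Rightarrow> 'c::euclidean_space"
  assumes "L4_integrable M u" "L4_integrable M v"
  shows "sq_integrable M (\<lambda>x. norm (u x) * norm (v x))"
    "L2norm M (\<lambda>x. norm (u x) * norm (v x)) \<le> L4norm M u * L4norm M v"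
proof -
  have [measurable]: "u \<in> borel_measurable M" "v \<in> borel_measurable M"
    and s: "sq_integrable M (\<lambda>x. (norm (u x))\<^sup>2)" "sq_integrable M (\<lambda>x. (norm (v x))\<^sup>2)"
    using assms by (auto simp: L4_integrable_def)
  have e: "(norm (norm (u x) * norm (v x)))\<^sup>2 = (norm (u x))\<^sup>2 \<bullet> (norm (v x))\<^sup>2" for x
    by (simp add: power_mult_distrib)
  show "sq_integrable M (\<lambda>x. norm (u x) * norm (v x))"
    unfolding sq_integrable_def e using sq_integrable_inner(1)[OF s] by simp
  have "L2norm M (\<lambda>x. norm (u x) * norm (v x))
      \<le> sqrt (L2norm M (\<lambda>x. (norm (u x))\<^sup>2) * L2norm M (\<lambda>x. (norm (v x))\<^sup>2))"
    unfolding L2norm_def[of M "\<lambda>x. norm (u x) * norm (v x)"] e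
    using L2_Cauchy_Schwarz[OF s] by (intro real_sqrt_le_mono) linarith
  then show "L2norm M (\<lambda>x. norm (u x) * norm (v x)) \<le> L4norm M u * L4norm M v"
    by (simp add: L4norm_def real_sqrt_mult)
qed

lemma plane_norm_power:
  fixes y :: "real^2"
  shows "(norm y)\<^sup>2 = (y$1)^2 + (y$2)^2" "norm y ^ 4 \<le> 2 * ((y$1)^4 + (y$2)^4)"
    "norm y ^ 6 \<le> 4 * ((y$1)^6 + (y$2)^6)" "(y$1)^4 + (y$2)^4 \<le> norm y ^ 4"
proof -
  show e: "(norm y)\<^sup>2 = (y$1)^2 + (y$2)^2"
    by (simp add: norm_vec_def L2_set_def sum_2)
  define a b where "a = (y$1)^2" and "b = (y$2)^2"
  have ab: "0 \<le> a" "0 \<le> b" by (auto simp: a_def b_def)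
  have n4: "norm y ^ 4 = (a + b)^2" and n6: "norm y ^ 6 = (a + b)^3"
    using power_mult[of "norm y" 2 2] power_mult[of "norm y" 2 3] e by (simp_all add: a_def b_def)
  have p: "(y$1)^4 = a^2" "(y$2)^4 = b^2" "(y$1)^6 = a^3" "(y$2)^6 = b^3"
    by (simp_all add: a_def b_def flip: power_mult)
  have d: "0 \<le> (a + b) * (a - b)^2" using ab by simp
  show "norm y ^ 4 \<le> 2 * ((y$1)^4 + (y$2)^4)"
    unfolding n4 p using sum_squares_bound[of a b] by (simp add: power2_sum)
  show "norm y ^ 6 \<le> 4 * ((y$1)^6 + (y$2)^6)"
    unfolding n6 p using d by (simp add: power2_eq_square power3_eq_cube algebra_simps)
  show "(y$1)^4 + (y$2)^4 \<le> norm y ^ 4"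
    unfolding n4 p using ab by (simp add: power2_sum)
qed

context planar_domain
begin

text \<open>
  Apply the embedding of \<open>W\<^sup>1\<^sup>,\<^sup>1\<close> into \<open>L\<^sup>2\<close>
  to \<open>\<phi>\<^sup>k\<^sup>+\<^sup>1\<close>, whose derivative is \<open>(k + 1)
  \<phi>\<^sup>k \<nabla>\<phi>\<close>, and the Cauchy--Schwarz inequality to the resulting
  product. The cases \<open>k = 0, 1, 2\<close> are the inequalities of Poincare and
  Ladyzhenskaya and a bound for the sixth powers.
\<close>

lemma test_power_inequality:
  fixes \<phi> :: "plane \<Rightarrow> real"
  assumes p: "\<phi> \<in> test_functions \<Omega>"
  shows "(LINT x|M. \<phi> x ^ (2 * Suc k)) \<le> (real (Suc k))\<^sup>2 * (LINT x|M. \<phi> x ^ (2 * k)) *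
     (L2norm M (\<lambda>x. frechet_derivative \<phi> (at x) (axis 1 1)) *
      L2norm M (\<lambda>x. frechet_derivative \<phi> (at x) (axis 2 1)))"
proof -
  note f = test_function_facts[OF p]
  obtain R where R: "\<And>x. norm x > R \<Longrightarrow> x \<notin> \<Omega>" using domain_norm_bound by metis
  define D where "D j x = frechet_derivative \<phi> (at x) (axis j 1)" for j x
  define h where "h x v = real (Suc k) * (\<phi> x ^ k * frechet_derivative \<phi> (at x) v)" for x v
  have D: "sq_integrable M (D j)" for j
    unfolding D_def by (rule continuous_vanishing_outside(3)[OF f(3) f(5)])
  have k: "continuous_on UNIV (\<lambda>x. \<phi> x ^ k)" by (intro continuous_intros f)
  have pk: "sq_integrable M (\<lambda>x. \<phi> x ^ k)"
  proof (cases "k = 0")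
    case True
    then show ?thesis by (simp add: sq_integrable_def)
  next
    case False
    then show ?thesis using f(4) by (intro continuous_vanishing_outside(3) k) auto
  qed
  have e2: "(a ^ k)\<^sup>2 = a ^ (2 * k)" for a :: real by (simp add: mult.commute flip: power_mult)
  have hj: "(\<integral>\<^sup>+x. ennreal \<bar>h x (axis j 1)\<bar> \<partial>lborel)
      \<le> ennreal (real (Suc k) * (L2norm M (\<lambda>x. \<phi> x ^ k) * L2norm M (D j)))" for j
  proof -
    have "(\<integral>\<^sup>+x. ennreal (norm (h x (axis j 1))) \<partial>lborel) = ennreal (LINT x|M. norm (h x (axis j 1)))"
      by (rule continuous_vanishing_outside(4))
         (use f(5) in \<open>auto simp: h_def intro!: continuous_intros f k\<close>)
    also have "(LINT x|M. norm (h x (axis j 1))) = real (Suc k) * (LINT x|M. norm (\<phi> x ^ k) * norm (D j x))"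
      unfolding h_def D_def by (simp only: norm_mult Bochner_Integration.integral_mult_right_zero) simp
    also have "\<dots> \<le> real (Suc k) * (L2norm M (\<lambda>x. \<phi> x ^ k) * L2norm M (D j))"
      by (intro mult_left_mono L2_Cauchy_Schwarz_norm pk D) simp
    finally show ?thesis by (simp add: ennreal_leI)
  qed
  have "(\<integral>\<^sup>+x. ennreal (norm ((\<phi> x ^ Suc k)\<^sup>2)) \<partial>lborel) = ennreal (LINT x|M. norm ((\<phi> x ^ Suc k)\<^sup>2))"
    by (rule continuous_vanishing_outside(4)) (use f(4) in \<open>auto intro!: continuous_intros f\<close>)
  moreover have "norm ((a ^ Suc k)\<^sup>2) = (a ^ Suc k)\<^sup>2" for a :: real
    by (simp only: real_norm_def abs_power2)
  moreover have "a ^ (2 * Suc k) = (a ^ Suc k)\<^sup>2" for a :: real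
    by (simp only: power_mult[symmetric] mult.commute[of "Suc k" 2])
  ultimately have "ennreal (LINT x|M. \<phi> x ^ (2 * Suc k)) = (\<integral>\<^sup>+x. ennreal ((\<phi> x ^ Suc k)\<^sup>2) \<partial>lborel)"
    by (simp only:)
  also have "\<dots> \<le> (\<integral>\<^sup>+x. ennreal \<bar>h x (axis 1 1)\<bar> \<partial>lborel) * (\<integral>\<^sup>+x. ennreal \<bar>h x (axis 2 1)\<bar> \<partial>lborel)"
  proof (rule planar_W11(1))
    show "((\<lambda>x. \<phi> x ^ Suc k) has_derivative h x) (at x)" for x
      by (rule has_derivative_eq_rhs[OF has_derivative_power[OF f(1)]])
         (simp add: h_def fun_eq_iff mult_ac)
    show "continuous_on UNIV (\<lambda>x. h x v)" for v
      unfolding h_def by (intro continuous_intros k f)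
  qed (use R f(4) in auto)
  also have "\<dots> \<le> ennreal (real (Suc k) * (L2norm M (\<lambda>x. \<phi> x ^ k) * L2norm M (D 1)))
      * ennreal (real (Suc k) * (L2norm M (\<lambda>x. \<phi> x ^ k) * L2norm M (D 2)))"
    by (intro mult_mono hj) auto
  also have "\<dots> = ennreal ((real (Suc k))\<^sup>2 * (L2norm M (\<lambda>x. \<phi> x ^ k))\<^sup>2 * (L2norm M (D 1) * L2norm M (D 2)))"
    by (subst ennreal_mult[symmetric]) (simp_all add: power2_eq_square mult_ac)
  finally have "(LINT x|M. \<phi> x ^ (2 * Suc k))
      \<le> (real (Suc k))\<^sup>2 * (L2norm M (\<lambda>x. \<phi> x ^ k))\<^sup>2 * (L2norm M (D 1) * L2norm M (D 2))"
    by (subst (asm) ennreal_le_iff) simp_all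
  then show ?thesis unfolding L2norm_power2 D_def by (simp add: e2)
qed

abbreviation area where "area \<equiv> measure M (space M)"

lemma test_component_power:
  fixes \<phi> :: vfield
  assumes p: "\<phi> \<in> test_functions \<Omega>"
  shows "(LINT x|M. (\<phi> x $ i) ^ (2 * Suc k))
    \<le> (real (Suc k))\<^sup>2 * (LINT x|M. (\<phi> x $ i) ^ (2 * k)) * (L2norm M (\<lambda>x. jacobian \<phi> (at x)))\<^sup>2"
proof -
  let ?J = "\<lambda>x. jacobian \<phi> (at x)"
  have J: "sq_integrable M ?J" by (rule test_sq_integrable(2)[OF p])
  have c: "L2norm M (\<lambda>x. frechet_derivative (\<lambda>x. \<phi> x $ i) (at x) (axis j 1)) \<le> L2norm M ?J" for j
    unfolding test_component(2)[OF p] jacobian_nth[symmetric]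
    by (rule order_trans[OF sq_integrable_component(2)[OF sq_integrable_component(1)[OF J]]
          sq_integrable_component(2)[OF J]])
  have nn: "0 \<le> (LINT x|M. (\<phi> x $ i) ^ (2 * k))"
    by (intro Bochner_Integration.integral_nonneg) (simp add: power_mult)
  have "(LINT x|M. (\<phi> x $ i) ^ (2 * Suc k)) \<le> (real (Suc k))\<^sup>2 * (LINT x|M. (\<phi> x $ i) ^ (2 * k)) *
     (L2norm M (\<lambda>x. frechet_derivative (\<lambda>x. \<phi> x $ i) (at x) (axis 1 1)) *
      L2norm M (\<lambda>x. frechet_derivative (\<lambda>x. \<phi> x $ i) (at x) (axis 2 1)))"
    by (rule test_power_inequality[OF test_component(1)[OF p]])
  also have "\<dots> \<le> (real (Suc k))\<^sup>2 * (LINT x|M. (\<phi> x $ i) ^ (2 * k)) * (L2norm M ?J * L2norm M ?J)"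
    by (intro mult_left_mono mult_mono c mult_nonneg_nonneg nn) simp_all
  finally show ?thesis by (simp add: power2_eq_square)
qed

lemma test_inequalities:
  fixes \<phi> :: vfield
  assumes p: "\<phi> \<in> test_functions \<Omega>"
  defines "J \<equiv> L2norm M (\<lambda>x. jacobian \<phi> (at x))"
  shows "(L2norm M \<phi>)\<^sup>2 \<le> 2 * area * J\<^sup>2"
    "(LINT x|M. norm (\<phi> x) ^ 4) \<le> 8 * (L2norm M \<phi>)\<^sup>2 * J\<^sup>2"
    "(LINT x|M. norm (\<phi> x) ^ 6) \<le> 36 * (LINT x|M. norm (\<phi> x) ^ 4) * J\<^sup>2"
    "\<And>k. 0 < k \<Longrightarrow> integrable M (\<lambda>x. norm (\<phi> x) ^ k)"
proof -
  note f = test_function_facts[OF p]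
  have i: "integrable M (\<lambda>x. (\<phi> x $ i) ^ k)" if "0 < k" for i k
    by (rule continuous_vanishing_outside(2)) (use f(4) that in \<open>auto intro!: continuous_intros f\<close>)
  have n: "integrable M (\<lambda>x. norm (\<phi> x) ^ k)" if "0 < k" for k
    by (rule continuous_vanishing_outside(2)) (use f(4) that in \<open>auto intro!: continuous_intros f\<close>)
  show "integrable M (\<lambda>x. norm (\<phi> x) ^ k)" if "0 < k" for k using n[OF that] .
  have s: "(LINT x|M. (\<phi> x $ 1) ^ k + (\<phi> x $ 2) ^ k) = (LINT x|M. (\<phi> x $ 1) ^ k) + (LINT x|M. (\<phi> x $ 2) ^ k)"
    if "0 < k" for k
    by (intro Bochner_Integration.integral_add i that)
  have 2: "(L2norm M \<phi>)\<^sup>2 = (LINT x|M. (\<phi> x $ 1) ^ 2) + (LINT x|M. (\<phi> x $ 2) ^ 2)"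
    unfolding L2norm_power2 plane_norm_power(1) by (rule s) simp
  have 1: "(LINT x|M. (\<phi> x $ i) ^ 2) \<le> area * J\<^sup>2" for i
    using test_component_power[OF p, of i 0] by (simp add: J_def)
  show "(L2norm M \<phi>)\<^sup>2 \<le> 2 * area * J\<^sup>2" unfolding 2 using 1[of 1] 1[of 2] by simp
  have "(LINT x|M. norm (\<phi> x) ^ 4) \<le> (LINT x|M. 2 * ((\<phi> x $ 1) ^ 4 + (\<phi> x $ 2) ^ 4))"
    by (intro Bochner_Integration.integral_mono plane_norm_power n
        Bochner_Integration.integrable_mult_right Bochner_Integration.integrable_add i) simp_all
  also have "\<dots> = 2 * (LINT x|M. (\<phi> x $ 1) ^ 4) + 2 * (LINT x|M. (\<phi> x $ 2) ^ 4)"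
    unfolding Bochner_Integration.integral_mult_right_zero by (subst s) simp_all
  also have "\<dots> \<le> 2 * (4 * (LINT x|M. (\<phi> x $ 1) ^ 2) * J\<^sup>2) + 2 * (4 * (LINT x|M. (\<phi> x $ 2) ^ 2) * J\<^sup>2)"
    using test_component_power[OF p, of 1 1] test_component_power[OF p, of 2 1] by (simp add: J_def)
  finally show "(LINT x|M. norm (\<phi> x) ^ 4) \<le> 8 * (L2norm M \<phi>)\<^sup>2 * J\<^sup>2"
    unfolding 2 by (simp add: algebra_simps)
  have q: "(LINT x|M. (\<phi> x $ 1) ^ 4) + (LINT x|M. (\<phi> x $ 2) ^ 4) \<le> (LINT x|M. norm (\<phi> x) ^ 4)"
    unfolding s[symmetric, of 4, simplified]
    by (intro Bochner_Integration.integral_mono plane_norm_power n Bochner_Integration.integrable_add i) simp_all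
  have "(LINT x|M. norm (\<phi> x) ^ 6) \<le> (LINT x|M. 4 * ((\<phi> x $ 1) ^ 6 + (\<phi> x $ 2) ^ 6))"
    by (intro Bochner_Integration.integral_mono plane_norm_power n
        Bochner_Integration.integrable_mult_right Bochner_Integration.integrable_add i) simp_all
  also have "\<dots> = 4 * (LINT x|M. (\<phi> x $ 1) ^ 6) + 4 * (LINT x|M. (\<phi> x $ 2) ^ 6)"
    unfolding Bochner_Integration.integral_mult_right_zero by (subst s) simp_all
  also have "\<dots> \<le> 4 * (9 * (LINT x|M. (\<phi> x $ 1) ^ 4) * J\<^sup>2) + 4 * (9 * (LINT x|M. (\<phi> x $ 2) ^ 4) * J\<^sup>2)"
    using test_component_power[OF p, of 1 2] test_component_power[OF p, of 2 2] by (simp add: J_def)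
  also have "\<dots> = 36 * ((LINT x|M. (\<phi> x $ 1) ^ 4) + (LINT x|M. (\<phi> x $ 2) ^ 4)) * J\<^sup>2"
    by (simp add: algebra_simps)
  also have "\<dots> \<le> 36 * (LINT x|M. norm (\<phi> x) ^ 4) * J\<^sup>2"
    by (intro mult_right_mono mult_left_mono q) simp_all
  finally show "(LINT x|M. norm (\<phi> x) ^ 6) \<le> 36 * (LINT x|M. norm (\<phi> x) ^ 4) * J\<^sup>2" .
qed

lemma V_sq_integrable:
  assumes "u \<in> V_space \<Omega>" shows "sq_integrable M u" "sq_integrable M (wgrad \<Omega> u)"
  using H1_sq_integrable[OF V_H1[OF assms]] by auto

lemma V_norm_alt: "V_norm \<Omega> u = L2norm M (wgrad \<Omega> u)"
  by (simp add: V_norm_def Lp_norm2)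

lemma V_norm_nonneg [simp]: "0 \<le> V_norm \<Omega> u"
  by (simp add: V_norm_alt)

text \<open>
  The inequalities for test functions survive the closure, by lower semicontinuity. The third
  one is Ladyzhenskaya's inequality; it is special to the plane and is what makes the cubic
  terms integrable in time.
\<close>

lemma V_inequalities:
  assumes u: "u \<in> V_space \<Omega>"
  shows "(L2norm M u)\<^sup>2 \<le> 2 * area * (V_norm \<Omega> u)\<^sup>2"
    "L4_integrable M u" "L4norm M u ^ 4 \<le> 8 * (L2norm M u)\<^sup>2 * (V_norm \<Omega> u)\<^sup>2"
    "integrable M (\<lambda>x. norm (u x) ^ 6)"
proof -
  obtain \<phi> where p: "\<And>n::nat. \<phi> n \<in> solenoidal_tests \<Omega>"
    and l: "(\<lambda>n. L2norm M (\<lambda>x. u x - \<phi> n x)) \<longlonglongrightarrow> 0"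
    and g: "(\<lambda>n. L2norm M (\<lambda>x. wgrad \<Omega> u x - jacobian (\<phi> n) (at x))) \<longlonglongrightarrow> 0"
    by (rule V_approx[OF u], rule that)
  define J where "J n = L2norm M (\<lambda>x. jacobian (\<phi> n) (at x))" for n
  have t: "\<phi> n \<in> test_functions \<Omega>" for n by (rule solenoidal_test[OF p])
  note s = V_sq_integrable[OF u]
  have L: "(\<lambda>n. L2norm M (\<phi> n)) \<longlonglongrightarrow> L2norm M u"
    by (rule L2norm_tendsto[OF test_sq_integrable(1)[OF t] s(1) l])
  have J: "J \<longlonglongrightarrow> V_norm \<Omega> u"
    unfolding V_norm_alt J_def by (rule L2norm_tendsto[OF test_sq_integrable(2)[OF t] s(2) g])
  note ti = test_inequalities[OF t, folded J_def]
  show "(L2norm M u)\<^sup>2 \<le> 2 * area * (V_norm \<Omega> u)\<^sup>2"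
    by (rule LIMSEQ_le[OF tendsto_power[OF L] tendsto_mult[OF tendsto_const tendsto_power[OF J]]])
       (use ti(1) in auto)
  have c4: "continuous_on UNIV (\<lambda>y :: real^2. norm y ^ 4)" "continuous_on UNIV (\<lambda>y :: real^2. norm y ^ 6)"
    by (intro continuous_intros)+
  have lim4: "(\<lambda>n. 8 * (L2norm M (\<phi> n))\<^sup>2 * (J n)\<^sup>2) \<longlonglongrightarrow> 8 * (L2norm M u)\<^sup>2 * (V_norm \<Omega> u)\<^sup>2"
    by (intro tendsto_intros L J)
  have f4: "integrable M (\<lambda>x. norm (u x) ^ 4)" "(LINT x|M. norm (u x) ^ 4) \<le> 8 * (L2norm M u)\<^sup>2 * (V_norm \<Omega> u)\<^sup>2"
    using fatou_L2[OF test_sq_integrable(1)[OF t] s(1) l c4(1) _ ti(4) ti(2) lim4] by auto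
  have m: "u \<in> borel_measurable M" using s(1) by auto
  show "L4norm M u ^ 4 \<le> 8 * (L2norm M u)\<^sup>2 * (V_norm \<Omega> u)\<^sup>2"
    using f4(2) by (simp add: L4norm_power4)
  show "L4_integrable M u"
    using m f4(1) by (simp add: L4_integrable_def sq_integrable_def flip: power_mult)
  have b6: "(LINT x|M. norm (\<phi> n x) ^ 6) \<le> 36 * (8 * (L2norm M (\<phi> n))\<^sup>2 * (J n)\<^sup>2) * (J n)\<^sup>2" for n
    by (rule order_trans[OF ti(3)]) (intro mult_right_mono mult_left_mono ti(2); simp)
  have lim6: "(\<lambda>n. 36 * (8 * (L2norm M (\<phi> n))\<^sup>2 * (J n)\<^sup>2) * (J n)\<^sup>2)
      \<longlonglongrightarrow> 36 * (8 * (L2norm M u)\<^sup>2 * (V_norm \<Omega> u)\<^sup>2) * (V_norm \<Omega> u)\<^sup>2"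
    by (intro tendsto_intros L J)
  show "integrable M (\<lambda>x. norm (u x) ^ 6)"
    by (rule fatou_L2(1)[OF test_sq_integrable(1)[OF t] s(1) l c4(2) _ ti(4) b6 lim6]) simp_all
qed

text \<open>
  The constant exceeds both \<open>2 area\<close> and \<open>16 area\<close> and is at least
  one, so its powers bound all the embedding constants.
\<close>

definition V_const where "V_const = 1 + 16 * area"

lemma V_const_ge1: "1 \<le> V_const"
  by (simp add: V_const_def)

lemma V_embeddings:
  assumes u: "u \<in> V_space \<Omega>"
  shows "L2norm M u \<le> V_const * V_norm \<Omega> u" "L4norm M u \<le> V_const * V_norm \<Omega> u"
proof -
  note V = V_inequalities[OF u]
  have a: "2 * area \<le> V_const\<^sup>2" "16 * area \<le> V_const ^ 4"
  proof -
    have "0 \<le> area" by (rule measure_nonneg)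
    then have "2 * area \<le> V_const" "16 * area \<le> V_const"
      unfolding V_const_def by linarith+
    then show "2 * area \<le> V_const\<^sup>2" "16 * area \<le> V_const ^ 4"
      using self_le_power[OF V_const_ge1, of 2] self_le_power[OF V_const_ge1, of 4] by linarith+
  qed
  have "(L2norm M u)\<^sup>2 \<le> V_const\<^sup>2 * (V_norm \<Omega> u)\<^sup>2"
    by (rule order_trans[OF V(1)]) (intro mult_right_mono a zero_le_power2)
  then have "(L2norm M u)\<^sup>2 \<le> (V_const * V_norm \<Omega> u)\<^sup>2" by (simp add: power_mult_distrib)
  then show "L2norm M u \<le> V_const * V_norm \<Omega> u"
    by (rule power2_le_imp_le) (use V_const_ge1 in simp)
  have "L4norm M u ^ 4 \<le> 8 * (2 * area * (V_norm \<Omega> u)\<^sup>2) * (V_norm \<Omega> u)\<^sup>2"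
    by (rule order_trans[OF V(3)]) (intro mult_right_mono mult_left_mono V(1); simp)
  also have "\<dots> = 16 * area * V_norm \<Omega> u ^ 4" by (simp add: power2_eq_square power4_eq_xxxx)
  also have "\<dots> \<le> V_const ^ 4 * V_norm \<Omega> u ^ 4"
    by (intro mult_right_mono a) simp
  finally have "L4norm M u ^ 4 \<le> (V_const * V_norm \<Omega> u) ^ 4" by (simp add: power_mult_distrib)
  then show "L4norm M u \<le> V_const * V_norm \<Omega> u"
    by (rule power_le_imp_le_base[of _ 3, simplified]) (use V_const_ge1 in simp)
qed

end

section \<open>Continuity of the operators of the state system\<close>

text \<open>
  Limits almost everywhere are measurable because Lebesgue measure is complete.
\<close>

lemma lebesgue_on_AE_limit:
  fixes f :: "'a::euclidean_space \<Rightarrow> real"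
  assumes S: "S \<in> sets lebesgue" and g: "\<And>n. g n \<in> borel_measurable (lebesgue_on S)"
    and lim: "AE x in lebesgue_on S. (\<lambda>n::nat. g n x) \<longlonglongrightarrow> f x"
  shows "f \<in> borel_measurable (lebesgue_on S)"
proof -
  have Ss: "S \<inter> space lebesgue \<in> sets lebesgue" using S by simp
  have gm: "(\<lambda>x. indicator S x *\<^sub>R g n x) \<in> borel_measurable lebesgue" for n
    using g[of n] by (subst (asm) borel_measurable_restrict_space_iff[OF Ss])
  have "AE x in lebesgue. x \<in> S \<longrightarrow> (\<lambda>n. g n x) \<longlonglongrightarrow> f x"
    using lim by (subst (asm) AE_restrict_space_iff[OF Ss])
  then obtain N where N: "N \<in> null_sets lebesgue" "\<And>x. x \<notin> N \<Longrightarrow> x \<in> S \<Longrightarrow> (\<lambda>n. g n x) \<longlonglongrightarrow> f x"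
    by (elim AE_E3) auto
  have Nm [measurable]: "N \<in> sets lebesgue" using N(1) by auto
  have "(\<lambda>x. indicator (- N) x *\<^sub>R (indicator S x *\<^sub>R f x)) \<in> borel_measurable lebesgue"
  proof (rule borel_measurable_LIMSEQ_real)
    show "(\<lambda>n. indicator (- N) x *\<^sub>R (indicator S x *\<^sub>R g n x)) \<longlonglongrightarrow> indicator (- N) x *\<^sub>R (indicator S x *\<^sub>R f x)" for x
      using N(2)[of x] by (cases "x \<in> N"; cases "x \<in> S") auto
    have "- N \<in> sets lebesgue" using Nm by (metis Compl_in_sets_lebesgue)
    then show "(\<lambda>x. indicator (- N) x *\<^sub>R (indicator S x *\<^sub>R g n x)) \<in> borel_measurable lebesgue" for n
      by (rule borel_measurable_scaleR[OF borel_measurable_indicator gm])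
  qed
  moreover have "AE x in lebesgue. indicator (- N) x *\<^sub>R (indicator S x *\<^sub>R f x) = indicator S x *\<^sub>R f x"
    using AE_not_in[OF N(1)] by eventually_elim (simp add: indicator_def)
  ultimately have "(\<lambda>x. indicator S x *\<^sub>R f x) \<in> borel_measurable lebesgue"
    by (rule borel_measurable_AE)
  then show ?thesis by (subst borel_measurable_restrict_space_iff[OF Ss])
qed

text \<open>
  Continuity along sequences is enough: the function is an almost everywhere limit of simple
  functions.
\<close>

lemma strongly_measurable_compose:
  fixes \<Phi> :: "'e::minus \<Rightarrow> real"
  assumes u: "strongly_measurable T X N u" "AE t in lebesgue_on {0..T}. u t \<in> X"
    and cont: "\<And>x xs. x \<in> X \<Longrightarrow> (\<And>n. xs n \<in> X) \<Longrightarrow> (\<lambda>n::nat. N (x - xs n)) \<longlonglongrightarrow> 0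
      \<Longrightarrow> (\<lambda>n. \<Phi> (xs n)) \<longlonglongrightarrow> \<Phi> x"
  shows "(\<lambda>t. \<Phi> (u t)) \<in> borel_measurable (lebesgue_on {0..T})"
proof -
  obtain s where s: "\<And>n. simple_function (lebesgue_on {0..T}) (s n)" "\<And>n. s n ` {0..T} \<subseteq> X"
    "AE t in lebesgue_on {0..T}. (\<lambda>n::nat. N (u t - s n t)) \<longlonglongrightarrow> 0"
    using u(1) unfolding strongly_measurable_def by blast
  show ?thesis
  proof (rule lebesgue_on_AE_limit)
    show "(\<lambda>t. \<Phi> (s n t)) \<in> borel_measurable (lebesgue_on {0..T})" for n
      by (rule borel_measurable_simple_function[OF simple_function_compose1[OF s(1)]])
    have "AE t in lebesgue_on {0..T}. t \<in> {0..T}" by (rule AE_I2) simp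
    with u(2) s(3) show "AE t in lebesgue_on {0..T}. (\<lambda>n. \<Phi> (s n t)) \<longlonglongrightarrow> \<Phi> (u t)"
    proof eventually_elim
      case (elim t)
      show ?case by (rule cont[OF elim(1) _ elim(2)]) (use s(2) elim(3) in blast)
    qed
  qed simp
qed

lemma strongly_measurable_Pair:
  assumes "strongly_measurable T X N u" "strongly_measurable T Y N' v"
  shows "strongly_measurable T (X \<times> Y) (\<lambda>z. N (fst z) + N' (snd z)) (\<lambda>t. (u t, v t))"
proof -
  obtain s where s: "\<And>n. simple_function (lebesgue_on {0..T}) (s n)" "\<And>n. s n ` {0..T} \<subseteq> X"
    "AE t in lebesgue_on {0..T}. (\<lambda>n::nat. N (u t - s n t)) \<longlonglongrightarrow> 0"
    using assms(1) unfolding strongly_measurable_def by blast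
  obtain r where r: "\<And>n. simple_function (lebesgue_on {0..T}) (r n)" "\<And>n. r n ` {0..T} \<subseteq> Y"
    "AE t in lebesgue_on {0..T}. (\<lambda>n::nat. N' (v t - r n t)) \<longlonglongrightarrow> 0"
    using assms(2) unfolding strongly_measurable_def by blast
  have "AE t in lebesgue_on {0..T}. (\<lambda>n. N (fst ((u t, v t) - (s n t, r n t))) + N' (snd ((u t, v t) - (s n t, r n t)))) \<longlonglongrightarrow> 0"
    using s(3) r(3) by eventually_elim (simp add: tendsto_add_zero)
  then show ?thesis
    unfolding strongly_measurable_def
  proof (intro exI[of _ "\<lambda>n t. (s n t, r n t)"] conjI allI simple_function_Pair s(1) r(1))
    show "(\<lambda>t. (s n t, r n t)) ` {0..T} \<subseteq> X \<times> Y" for n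
      using s(2)[of n] r(2)[of n] by auto
  qed
qed

text \<open>
  Minkowski's inequality, obtained from the one for square integrable functions by squaring
  \<open>\<bar>u + v\<bar>\<^sup>2 \<le> \<bar>u\<bar>\<^sup>2 + 2 \<bar>u\<bar> \<bar>v\<bar> +
  \<bar>v\<bar>\<^sup>2\<close>.
\<close>

lemma L4_triangle:
  fixes u v :: "'a \<Rightarrow> 'b::euclidean_space"
  assumes u: "L4_integrable M u" and v: "L4_integrable M v"
  shows "L4_integrable M (\<lambda>x. u x + v x)" "L4norm M (\<lambda>x. u x + v x) \<le> L4norm M u + L4norm M v"
proof -
  have m [measurable]: "u \<in> borel_measurable M" "v \<in> borel_measurable M"
    and su: "sq_integrable M (\<lambda>x. (norm (u x))\<^sup>2)" and sv: "sq_integrable M (\<lambda>x. (norm (v x))\<^sup>2)"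
    using u v by (auto simp: L4_integrable_def)
  note p = L4_product[OF u v]
  define q where "q x = ((norm (u x))\<^sup>2 + 2 *\<^sub>R (norm (u x) * norm (v x))) + (norm (v x))\<^sup>2" for x
  note s1 = sq_integrable_add[OF su sq_integrable_scale[OF p(1), of 2]]
  have sq: "sq_integrable M q" unfolding q_def by (rule sq_integrable_add[OF s1 sv])
  have le: "(norm (u x + v x))\<^sup>2 \<le> q x" for x
  proof -
    have "(norm (u x + v x))\<^sup>2 \<le> (norm (u x) + norm (v x))\<^sup>2"
      by (intro power_mono norm_triangle_ineq) simp
    then show ?thesis by (simp add: q_def power2_sum)
  qed
  have le2: "((norm (u x + v x))\<^sup>2)\<^sup>2 \<le> (q x)\<^sup>2" for x
    by (intro power_mono le) simp
  have i: "integrable M (\<lambda>x. ((norm (u x + v x))\<^sup>2)\<^sup>2)"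
    by (rule Bochner_Integration.integrable_bound[OF sq_integrableD(2)[OF sq]]) (use le2 in auto)
  then show "L4_integrable M (\<lambda>x. u x + v x)"
    by (simp add: L4_integrable_def sq_integrable_def)
  have "L2norm M (\<lambda>x. (norm (u x + v x))\<^sup>2) \<le> L2norm M q"
    unfolding L2norm_def real_norm_def power2_abs
    by (intro real_sqrt_le_mono Bochner_Integration.integral_mono i le2)
       (use sq_integrableD(2)[OF sq] in simp)
  also have "\<dots> \<le> (L2norm M (\<lambda>x. (norm (u x))\<^sup>2) + 2 * L2norm M (\<lambda>x. norm (u x) * norm (v x)))
      + L2norm M (\<lambda>x. (norm (v x))\<^sup>2)"
    unfolding q_def
    using L2norm_triangle[OF s1 sv] L2norm_triangle[OF su sq_integrable_scale[OF p(1), of 2]]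
    by (simp only: L2norm_scale abs_numeral)
  also have "\<dots> \<le> ((L4norm M u)\<^sup>2 + 2 * (L4norm M u * L4norm M v)) + (L4norm M v)\<^sup>2"
    using p(2) by (simp add: L4norm_def)
  also have "\<dots> = (L4norm M u + L4norm M v)\<^sup>2" by (simp add: power2_sum)
  finally have "(L4norm M (\<lambda>x. u x + v x))\<^sup>2 \<le> (L4norm M u + L4norm M v)\<^sup>2"
    by (simp add: L4norm_def)
  then show "L4norm M (\<lambda>x. u x + v x) \<le> L4norm M u + L4norm M v"
    by (rule power2_le_imp_le) simp
qed

lemma L4_uminus: "L4norm M (\<lambda>x. - u x) = L4norm M u" "L4_integrable M u \<Longrightarrow> L4_integrable M (\<lambda>x. - u x)"
  by (auto simp: L4norm_def L4_integrable_def)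

lemma L4_diff:
  assumes u: "L4_integrable M u" and v: "L4_integrable M v"
  shows "L4_integrable M (\<lambda>x. u x - v x)" "L4norm M (\<lambda>x. u x - v x) \<le> L4norm M u + L4norm M v"
  using L4_triangle[OF u L4_uminus(2)[OF v]] by (simp_all add: L4_uminus(1))

lemma L2_bounded_product:
  fixes B :: "'b::euclidean_space \<Rightarrow> 'c::euclidean_space \<Rightarrow> 'd::euclidean_space"
  assumes B: "bounded_bilinear B" "\<And>x y. norm (B x y) \<le> norm x * norm y"
    and u: "L4_integrable M u" and v: "L4_integrable M v"
  shows "sq_integrable M (\<lambda>x. B (u x) (v x))"
    "L2norm M (\<lambda>x. B (u x) (v x)) \<le> L4norm M u * L4norm M v"
proof -
  interpret bounded_bilinear B by fact
  have [measurable]: "u \<in> borel_measurable M" "v \<in> borel_measurable M"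
    using u v by (auto simp: L4_integrable_def)
  have c: "continuous_on UNIV (\<lambda>z. B (fst z) (snd z))"
    by (intro continuous_on continuous_intros)
  have m [measurable]: "(\<lambda>x. B (u x) (v x)) \<in> borel_measurable M"
    by (rule borel_measurable_continuous_Pair[OF _ _ c]) simp_all
  note p = L4_product[OF u v]
  have le: "(norm (B (u x) (v x)))\<^sup>2 \<le> (norm (norm (u x) * norm (v x)))\<^sup>2" for x
    by (intro power_mono) (use B(2) in simp_all)
  have i: "integrable M (\<lambda>x. (norm (B (u x) (v x)))\<^sup>2)"
    by (rule Bochner_Integration.integrable_bound[OF sq_integrableD(2)[OF p(1)]]) (use le in auto)
  then show "sq_integrable M (\<lambda>x. B (u x) (v x))" by (simp add: sq_integrable_def)
  have "L2norm M (\<lambda>x. B (u x) (v x)) \<le> L2norm M (\<lambda>x. norm (u x) * norm (v x))"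
    unfolding L2norm_def
    by (intro real_sqrt_le_mono Bochner_Integration.integral_mono i le sq_integrableD(2)[OF p(1)])
  with p(2) show "L2norm M (\<lambda>x. B (u x) (v x)) \<le> L4norm M u * L4norm M v" by linarith
qed

lemma L2_tendsto_product:
  fixes B :: "'b::euclidean_space \<Rightarrow> 'c::euclidean_space \<Rightarrow> 'd::euclidean_space"
  assumes B: "bounded_bilinear B" "\<And>x y. norm (B x y) \<le> norm x * norm y"
    and u: "\<And>n. L4_integrable M (us n)" "L4_integrable M u"
    and v: "\<And>n. L4_integrable M (vs n)" "L4_integrable M v"
    and lim: "(\<lambda>n::nat. L4norm M (\<lambda>x. u x - us n x)) \<longlonglongrightarrow> 0" "(\<lambda>n. L4norm M (\<lambda>x. v x - vs n x)) \<longlonglongrightarrow> 0"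
  shows "(\<lambda>n. L2norm M (\<lambda>x. B (u x) (v x) - B (us n x) (vs n x))) \<longlonglongrightarrow> 0"
proof -
  interpret bounded_bilinear B by fact
  have d: "L4_integrable M (\<lambda>x. u x - us n x)" "L4_integrable M (\<lambda>x. v x - vs n x)" for n
    using L4_diff u v by blast+
  have vb: "L4norm M (vs n) \<le> L4norm M v + L4norm M (\<lambda>x. v x - vs n x)" for n
    using L4_diff(2)[OF v(2) d(2)] by simp
  have le: "L2norm M (\<lambda>x. B (u x) (v x) - B (us n x) (vs n x))
      \<le> L4norm M (\<lambda>x. u x - us n x) * (L4norm M v + L4norm M (\<lambda>x. v x - vs n x))
        + L4norm M u * L4norm M (\<lambda>x. v x - vs n x)" for n
  proof -
    have "L2norm M (\<lambda>x. B (u x) (v x) - B (us n x) (vs n x))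
        = L2norm M (\<lambda>x. B (u x - us n x) (vs n x) + B (u x) (v x - vs n x))"
      by (simp add: diff_left diff_right algebra_simps)
    also have "\<dots> \<le> L2norm M (\<lambda>x. B (u x - us n x) (vs n x)) + L2norm M (\<lambda>x. B (u x) (v x - vs n x))"
      by (intro L2norm_triangle L2_bounded_product(1)[OF B] d u v)
    also have "\<dots> \<le> L4norm M (\<lambda>x. u x - us n x) * L4norm M (vs n) + L4norm M u * L4norm M (\<lambda>x. v x - vs n x)"
      by (intro add_mono L2_bounded_product(2)[OF B] d u v)
    also have "\<dots> \<le> L4norm M (\<lambda>x. u x - us n x) * (L4norm M v + L4norm M (\<lambda>x. v x - vs n x))
        + L4norm M u * L4norm M (\<lambda>x. v x - vs n x)"
      by (intro add_right_mono mult_left_mono vb) simp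
    finally show ?thesis .
  qed
  have z: "(\<lambda>n. L4norm M (\<lambda>x. u x - us n x) * (L4norm M v + L4norm M (\<lambda>x. v x - vs n x))
        + L4norm M u * L4norm M (\<lambda>x. v x - vs n x)) \<longlonglongrightarrow> 0 * (L4norm M v + 0) + L4norm M u * 0"
    by (intro tendsto_add tendsto_mult tendsto_const lim)
  then have z': "(\<lambda>n. L4norm M (\<lambda>x. u x - us n x) * (L4norm M v + L4norm M (\<lambda>x. v x - vs n x))
        + L4norm M u * L4norm M (\<lambda>x. v x - vs n x)) \<longlonglongrightarrow> 0"
    by (simp only: mult_zero_left mult_zero_right add_0)
  show ?thesis
    by (rule Lim_null_comparison[OF always_eventually z'], rule allI)
       (simp only: real_norm_def abs_of_nonneg[OF L2norm_nonneg] le)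
qed

lemma L2_tendsto_inner:
  assumes u: "\<And>n. sq_integrable M (us n)" "sq_integrable M u"
    and v: "\<And>n. sq_integrable M (vs n)" "sq_integrable M v"
    and lim: "(\<lambda>n::nat. L2norm M (\<lambda>x. u x - us n x)) \<longlonglongrightarrow> 0" "(\<lambda>n. L2norm M (\<lambda>x. v x - vs n x)) \<longlonglongrightarrow> 0"
  shows "(\<lambda>n. LINT x|M. us n x \<bullet> vs n x) \<longlonglongrightarrow> (LINT x|M. u x \<bullet> v x)"
proof -
  have d: "sq_integrable M (\<lambda>x. u x - us n x)" "sq_integrable M (\<lambda>x. v x - vs n x)" for n
    using sq_integrable_diff u v by blast+
  have e: "(LINT x|M. u x \<bullet> v x) - (LINT x|M. us n x \<bullet> vs n x)
      = (LINT x|M. (u x - us n x) \<bullet> vs n x) + (LINT x|M. u x \<bullet> (v x - vs n x))" for n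
  proof -
    have "(LINT x|M. u x \<bullet> v x) - (LINT x|M. us n x \<bullet> vs n x) = (LINT x|M. u x \<bullet> v x - us n x \<bullet> vs n x)"
      by (rule Bochner_Integration.integral_diff[symmetric]) (intro sq_integrable_inner(1) u v)+
    also have "\<dots> = (LINT x|M. (u x - us n x) \<bullet> vs n x + u x \<bullet> (v x - vs n x))"
      by (simp add: inner_diff_left inner_diff_right)
    also have "\<dots> = (LINT x|M. (u x - us n x) \<bullet> vs n x) + (LINT x|M. u x \<bullet> (v x - vs n x))"
      by (rule Bochner_Integration.integral_add) (intro sq_integrable_inner(1) d u v)+
    finally show ?thesis .
  qed
  have le: "norm ((LINT x|M. u x \<bullet> v x) - (LINT x|M. us n x \<bullet> vs n x))
      \<le> L2norm M (\<lambda>x. u x - us n x) * L2norm M (vs n) + L2norm M u * L2norm M (\<lambda>x. v x - vs n x)" for n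
    unfolding e real_norm_def
    by (intro order_trans[OF abs_triangle_ineq] add_mono L2_Cauchy_Schwarz d u v)
  have vl: "(\<lambda>n. L2norm M (vs n)) \<longlonglongrightarrow> L2norm M v" by (rule L2norm_tendsto[OF v lim(2)])
  have "(\<lambda>n. L2norm M (\<lambda>x. u x - us n x) * L2norm M (vs n) + L2norm M u * L2norm M (\<lambda>x. v x - vs n x))
      \<longlonglongrightarrow> 0 * L2norm M v + L2norm M u * 0"
    by (intro tendsto_add tendsto_mult tendsto_const lim vl)
  then have z: "(\<lambda>n. L2norm M (\<lambda>x. u x - us n x) * L2norm M (vs n) + L2norm M u * L2norm M (\<lambda>x. v x - vs n x)) \<longlonglongrightarrow> 0"
    by simp
  have "(\<lambda>n. (LINT x|M. u x \<bullet> v x) - (LINT x|M. us n x \<bullet> vs n x)) \<longlonglongrightarrow> 0"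
    by (rule Lim_null_comparison[OF always_eventually z]) (use le in blast)
  from tendsto_diff[OF tendsto_const[of "LINT x|M. u x \<bullet> v x"] this] show ?thesis by simp
qed

text \<open>
  The trilinear form of the convection term is then an inner product in the space of matrices,
  so that it is covered by the estimates for products of two functions.
\<close>

definition outer :: "real^2 \<Rightarrow> real^2 \<Rightarrow> real^2^2" where
  "outer a b = (\<chi> i j. a $ i * b $ j)"

lemma outer_norm: "norm (outer a b) = norm a * norm b"
proof -
  have "(norm (outer a b))\<^sup>2 = (norm a * norm b)\<^sup>2"
    by (simp add: power2_norm_eq_inner power_mult_distrib)
       (simp add: inner_vec_def outer_def sum_2 algebra_simps)
  then show ?thesis by (simp add: power2_eq_iff_nonneg)
qed

lemma outer_bilinear: "bounded_bilinear outer"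
proof
  show "outer (a + a') b = outer a b + outer a' b" "outer a (b + b') = outer a b + outer a b'"
    "outer (r *\<^sub>R a) b = r *\<^sub>R outer a b" "outer a (r *\<^sub>R b) = r *\<^sub>R outer a b" for a a' b b' r
    by (simp_all add: outer_def vec_eq_iff algebra_simps)
  show "\<exists>K. \<forall>a b. norm (outer a b) \<le> norm a * norm b * K"
    by (rule exI[of _ 1]) (simp add: outer_norm)
qed

lemma matrix_vector_inner: "(A *v u) \<bullet> w = A \<bullet> outer w u"
  for A :: "real^2^2"
  by (simp add: inner_vec_def outer_def matrix_vector_mult_def sum_2 algebra_simps)

context planar_domain
begin

text \<open>
  All quartic expressions arising from the damping term, from its derivative and from its Taylor
  remainder are of this form.
\<close>

definition quad :: "vfield \<Rightarrow> vfield \<Rightarrow> vfield \<Rightarrow> vfield \<Rightarrow> real" where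
  "quad a b c d = (LINT x|M. (a x \<bullet> b x) * (c x \<bullet> d x))"

lemma inner_norm_le: "norm (a \<bullet> b) \<le> norm a * norm b"
  using Cauchy_Schwarz_ineq2 by simp

lemma V_minus: "u \<in> V_space \<Omega> \<Longrightarrow> v \<in> V_space \<Omega> \<Longrightarrow> u - v \<in> V_space \<Omega>"
  using V_lincomb[of u v 1 "-1"] by (simp add: fun_diff_def)

lemma V_L4: "u \<in> V_space \<Omega> \<Longrightarrow> L4_integrable M u"
  by (rule V_inequalities(2))

lemma quad_bound:
  assumes "L4_integrable M a" "L4_integrable M b" "L4_integrable M c" "L4_integrable M d"
  shows "integrable M (\<lambda>x. (a x \<bullet> b x) * (c x \<bullet> d x))"
    "\<bar>quad a b c d\<bar> \<le> L4norm M a * L4norm M b * (L4norm M c * L4norm M d)"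
proof -
  note s = L2_bounded_product[OF bounded_bilinear_inner inner_norm_le assms(1,2)]
  note t = L2_bounded_product[OF bounded_bilinear_inner inner_norm_le assms(3,4)]
  show "integrable M (\<lambda>x. (a x \<bullet> b x) * (c x \<bullet> d x))"
    using sq_integrable_inner(1)[OF s(1) t(1)] by simp
  have "\<bar>quad a b c d\<bar> \<le> L2norm M (\<lambda>x. a x \<bullet> b x) * L2norm M (\<lambda>x. c x \<bullet> d x)"
    using L2_Cauchy_Schwarz[OF s(1) t(1)] by (simp add: quad_def)
  also have "\<dots> \<le> L4norm M a * L4norm M b * (L4norm M c * L4norm M d)"
    by (intro mult_mono s t mult_nonneg_nonneg) simp_all
  finally show "\<bar>quad a b c d\<bar> \<le> L4norm M a * L4norm M b * (L4norm M c * L4norm M d)" .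
qed

lemma B_op_alt: "B_op \<Omega> u v w = (LINT x|M. wgrad \<Omega> v x \<bullet> outer (w x) (u x))"
  by (simp add: B_op_def matrix_vector_inner)

lemma B_op_bound:
  assumes "u \<in> V_space \<Omega>" "v \<in> V_space \<Omega>" "w \<in> V_space \<Omega>"
  shows "integrable M (\<lambda>x. (wgrad \<Omega> v x *v u x) \<bullet> w x)"
    "\<bar>B_op \<Omega> u v w\<bar> \<le> V_norm \<Omega> v * (L4norm M u * L4norm M w)"
proof -
  note s = L2_bounded_product[OF outer_bilinear eq_refl[OF outer_norm] V_L4[OF assms(3)] V_L4[OF assms(1)]]
  note g = V_sq_integrable(2)[OF assms(2)]
  show "integrable M (\<lambda>x. (wgrad \<Omega> v x *v u x) \<bullet> w x)"
    unfolding matrix_vector_inner by (rule sq_integrable_inner(1)[OF g s(1)])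
  have "\<bar>B_op \<Omega> u v w\<bar> \<le> V_norm \<Omega> v * L2norm M (\<lambda>x. outer (w x) (u x))"
    unfolding B_op_alt V_norm_alt by (rule L2_Cauchy_Schwarz[OF g s(1)])
  also have "\<dots> \<le> V_norm \<Omega> v * (L4norm M w * L4norm M u)"
    by (intro mult_left_mono s) simp
  finally show "\<bar>B_op \<Omega> u v w\<bar> \<le> V_norm \<Omega> v * (L4norm M u * L4norm M w)"
    by (simp add: mult.commute)
qed

lemma A_op_bound:
  assumes "u \<in> V_space \<Omega>" "v \<in> V_space \<Omega>"
  shows "integrable M (\<lambda>x. wgrad \<Omega> u x \<bullet> wgrad \<Omega> v x)" "\<bar>A_op \<Omega> u v\<bar> \<le> V_norm \<Omega> u * V_norm \<Omega> v"
  unfolding A_op_def V_norm_alt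
  by (rule sq_integrable_inner(1)[OF V_sq_integrable(2)[OF assms(1)] V_sq_integrable(2)[OF assms(2)]],
      rule L2_Cauchy_Schwarz[OF V_sq_integrable(2)[OF assms(1)] V_sq_integrable(2)[OF assms(2)]])

lemma wgrad_diff:
  assumes "u \<in> V_space \<Omega>" "v \<in> V_space \<Omega>"
  shows "AE x in M. wgrad \<Omega> (u - v) x = wgrad \<Omega> u x - wgrad \<Omega> v x"
    "V_norm \<Omega> (u - v) = L2norm M (\<lambda>x. wgrad \<Omega> u x - wgrad \<Omega> v x)"
proof -
  show *: "AE x in M. wgrad \<Omega> (u - v) x = wgrad \<Omega> u x - wgrad \<Omega> v x"
    using wgrad_lincomb[OF assms[THEN V_H1], of 1 "-1"] by (simp add: fun_diff_def)
  show "V_norm \<Omega> (u - v) = L2norm M (\<lambda>x. wgrad \<Omega> u x - wgrad \<Omega> v x)"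
    unfolding V_norm_alt
    by (rule L2norm_cong_AE[OF sq_integrableD(1)[OF V_sq_integrable(2)[OF V_minus[OF assms]]]
          sq_integrableD(1)[OF sq_integrable_diff[OF V_sq_integrable(2)[OF assms(1)] V_sq_integrable(2)[OF assms(2)]]] *])
qed

lemma V_norm_diff_le:
  assumes "u \<in> V_space \<Omega>" "v \<in> V_space \<Omega>"
  shows "V_norm \<Omega> (u - v) \<le> V_norm \<Omega> u + V_norm \<Omega> v"
  unfolding wgrad_diff(2)[OF assms] unfolding V_norm_alt
  by (rule L2norm_triangle_diff(1)[OF V_sq_integrable(2)[OF assms(1)] V_sq_integrable(2)[OF assms(2)]])

text \<open>
  Convergence in \<open>V\<close> implies convergence in all norms in which the operators are
  continuous.
\<close>

lemma V_tendsto: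
  assumes u: "u \<in> V_space \<Omega>" "\<And>n. us n \<in> V_space \<Omega>" and lim: "(\<lambda>n::nat. V_norm \<Omega> (u - us n)) \<longlonglongrightarrow> 0"
  shows "(\<lambda>n. L2norm M (\<lambda>x. wgrad \<Omega> u x - wgrad \<Omega> (us n) x)) \<longlonglongrightarrow> 0"
    "(\<lambda>n. L4norm M (\<lambda>x. u x - us n x)) \<longlonglongrightarrow> 0"
    "(\<lambda>n. L2norm M (\<lambda>x. u x - us n x)) \<longlonglongrightarrow> 0"
    "(\<lambda>n. V_norm \<Omega> (us n)) \<longlonglongrightarrow> V_norm \<Omega> u"
    "(\<lambda>n. L4norm M (us n)) \<longlonglongrightarrow> L4norm M u"
proof -
  have d: "u - us n \<in> V_space \<Omega>" for n by (rule V_minus[OF u])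
  have z: "(\<lambda>n. V_const * V_norm \<Omega> (u - us n)) \<longlonglongrightarrow> 0"
    using tendsto_mult[OF tendsto_const lim] by simp
  show g: "(\<lambda>n. L2norm M (\<lambda>x. wgrad \<Omega> u x - wgrad \<Omega> (us n) x)) \<longlonglongrightarrow> 0"
    using lim by (simp only: wgrad_diff(2)[OF u])
  show l4: "(\<lambda>n. L4norm M (\<lambda>x. u x - us n x)) \<longlonglongrightarrow> 0"
    by (rule Lim_null_comparison[OF always_eventually z])
       (use V_embeddings(2)[OF d] in \<open>simp add: fun_diff_def\<close>)
  show "(\<lambda>n. L2norm M (\<lambda>x. u x - us n x)) \<longlonglongrightarrow> 0"
    by (rule Lim_null_comparison[OF always_eventually z])
       (use V_embeddings(1)[OF d] in \<open>simp add: fun_diff_def\<close>)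
  show "(\<lambda>n. V_norm \<Omega> (us n)) \<longlonglongrightarrow> V_norm \<Omega> u"
    unfolding V_norm_alt by (rule L2norm_tendsto[OF V_sq_integrable(2)[OF u(2)] V_sq_integrable(2)[OF u(1)] g])
  have "(\<lambda>n. L2norm M (\<lambda>x. u x \<bullet> u x - us n x \<bullet> us n x)) \<longlonglongrightarrow> 0"
    by (rule L2_tendsto_product[OF bounded_bilinear_inner inner_norm_le V_L4[OF u(2)] V_L4[OF u(1)]
          V_L4[OF u(2)] V_L4[OF u(1)] l4 l4])
  then have "(\<lambda>n. L2norm M (\<lambda>x. us n x \<bullet> us n x)) \<longlonglongrightarrow> L2norm M (\<lambda>x. u x \<bullet> u x)"
    by (rule L2norm_tendsto[rotated 2])
       (rule L2_bounded_product(1)[OF bounded_bilinear_inner inner_norm_le V_L4 V_L4], rule u, rule u)+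
  then show "(\<lambda>n. L4norm M (us n)) \<longlonglongrightarrow> L4norm M u"
    unfolding L4norm_def power2_norm_eq_inner by (rule tendsto_real_sqrt)
qed

lemma B_op_tendsto:
  assumes u: "u \<in> V_space \<Omega>" "\<And>n. us n \<in> V_space \<Omega>" "(\<lambda>n::nat. V_norm \<Omega> (u - us n)) \<longlonglongrightarrow> 0"
    and v: "v \<in> V_space \<Omega>" "\<And>n. vs n \<in> V_space \<Omega>" "(\<lambda>n::nat. V_norm \<Omega> (v - vs n)) \<longlonglongrightarrow> 0"
    and w: "w \<in> V_space \<Omega>" "\<And>n. ws n \<in> V_space \<Omega>" "(\<lambda>n::nat. V_norm \<Omega> (w - ws n)) \<longlonglongrightarrow> 0"
  shows "(\<lambda>n. B_op \<Omega> (us n) (vs n) (ws n)) \<longlonglongrightarrow> B_op \<Omega> u v w"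
proof -
  have O: "norm (outer x y) \<le> norm x * norm y" for x y by (simp add: outer_norm)
  note i = L2_bounded_product(1)[OF outer_bilinear O] and t = L2_tendsto_product[OF outer_bilinear O]
  have 1: "sq_integrable M (\<lambda>x. outer (ws n x) (us n x))" for n
    by (rule i[OF V_L4[OF w(2)] V_L4[OF u(2)]])
  have 2: "sq_integrable M (\<lambda>x. outer (w x) (u x))"
    by (rule i[OF V_L4[OF w(1)] V_L4[OF u(1)]])
  have 3: "(\<lambda>n. L2norm M (\<lambda>x. outer (w x) (u x) - outer (ws n x) (us n x))) \<longlonglongrightarrow> 0"
    by (rule t[OF V_L4[OF w(2)] V_L4[OF w(1)] V_L4[OF u(2)] V_L4[OF u(1)] V_tendsto(2)[OF w] V_tendsto(2)[OF u]])
  show ?thesis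
    unfolding B_op_alt
    by (rule L2_tendsto_inner[OF V_sq_integrable(2)[OF v(2)] V_sq_integrable(2)[OF v(1)] 1 2 V_tendsto(1)[OF v] 3])
qed

lemma quad_tendsto:
  assumes a: "a \<in> V_space \<Omega>" "\<And>n. as n \<in> V_space \<Omega>" "(\<lambda>n::nat. V_norm \<Omega> (a - as n)) \<longlonglongrightarrow> 0"
    and b: "b \<in> V_space \<Omega>" "\<And>n. bs n \<in> V_space \<Omega>" "(\<lambda>n::nat. V_norm \<Omega> (b - bs n)) \<longlonglongrightarrow> 0"
    and c: "c \<in> V_space \<Omega>" "\<And>n. cs n \<in> V_space \<Omega>" "(\<lambda>n::nat. V_norm \<Omega> (c - cs n)) \<longlonglongrightarrow> 0"
    and d: "d \<in> V_space \<Omega>" "\<And>n. ds n \<in> V_space \<Omega>" "(\<lambda>n::nat. V_norm \<Omega> (d - ds n)) \<longlonglongrightarrow> 0"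
  shows "(\<lambda>n. quad (as n) (bs n) (cs n) (ds n)) \<longlonglongrightarrow> quad a b c d"
proof -
  note O = bounded_bilinear_inner inner_norm_le
  note i = L2_bounded_product(1)[OF O] and t = L2_tendsto_product[OF O]
  have 1: "sq_integrable M (\<lambda>x. as n x \<bullet> bs n x)" "sq_integrable M (\<lambda>x. cs n x \<bullet> ds n x)" for n
    by (rule i[OF V_L4[OF a(2)] V_L4[OF b(2)]], rule i[OF V_L4[OF c(2)] V_L4[OF d(2)]])
  have 2: "sq_integrable M (\<lambda>x. a x \<bullet> b x)" "sq_integrable M (\<lambda>x. c x \<bullet> d x)"
    by (rule i[OF V_L4[OF a(1)] V_L4[OF b(1)]], rule i[OF V_L4[OF c(1)] V_L4[OF d(1)]])
  have 3: "(\<lambda>n. L2norm M (\<lambda>x. a x \<bullet> b x - as n x \<bullet> bs n x)) \<longlonglongrightarrow> 0"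
    by (rule t[OF V_L4[OF a(2)] V_L4[OF a(1)] V_L4[OF b(2)] V_L4[OF b(1)] V_tendsto(2)[OF a] V_tendsto(2)[OF b]])
  have 4: "(\<lambda>n. L2norm M (\<lambda>x. c x \<bullet> d x - cs n x \<bullet> ds n x)) \<longlonglongrightarrow> 0"
    by (rule t[OF V_L4[OF c(2)] V_L4[OF c(1)] V_L4[OF d(2)] V_L4[OF d(1)] V_tendsto(2)[OF c] V_tendsto(2)[OF d]])
  show ?thesis
    using L2_tendsto_inner[OF 1(1) 2(1) 1(2) 2(2) 3 4] by (simp add: quad_def)
qed

lemma A_op_tendsto:
  assumes u: "u \<in> V_space \<Omega>" "\<And>n. us n \<in> V_space \<Omega>" "(\<lambda>n::nat. V_norm \<Omega> (u - us n)) \<longlonglongrightarrow> 0"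
    and v: "v \<in> V_space \<Omega>" "\<And>n. vs n \<in> V_space \<Omega>" "(\<lambda>n::nat. V_norm \<Omega> (v - vs n)) \<longlonglongrightarrow> 0"
  shows "(\<lambda>n. A_op \<Omega> (us n) (vs n)) \<longlonglongrightarrow> A_op \<Omega> u v"
  unfolding A_op_def
  by (rule L2_tendsto_inner[OF V_sq_integrable(2)[OF u(2)] V_sq_integrable(2)[OF u(1)]
        V_sq_integrable(2)[OF v(2)] V_sq_integrable(2)[OF v(1)] V_tendsto(1)[OF u] V_tendsto(1)[OF v]])

text \<open>
  A consequence of the integrability of sixth powers.
\<close>

lemma cubic_sq_integrable:
  assumes "u \<in> V_space \<Omega>" "v \<in> V_space \<Omega>" "w \<in> V_space \<Omega>"
  shows "sq_integrable M (\<lambda>x. (u x \<bullet> v x) *\<^sub>R w x)"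
proof -
  have [measurable]: "u \<in> borel_measurable M" "v \<in> borel_measurable M" "w \<in> borel_measurable M"
    using V_sq_integrable(1) assms by blast+
  have i: "integrable M (\<lambda>x. norm (u x) ^ 6 + norm (v x) ^ 6 + norm (w x) ^ 6)"
    by (intro Bochner_Integration.integrable_add V_inequalities(4) assms)
  have le: "(norm ((a \<bullet> b) *\<^sub>R c))\<^sup>2 \<le> norm a ^ 6 + norm b ^ 6 + norm c ^ 6" for a b c :: "real^2"
  proof -
    define m where "m = max (norm a) (max (norm b) (norm c))"
    have m: "norm a \<le> m" "norm b \<le> m" "norm c \<le> m" "0 \<le> m" by (auto simp: m_def le_max_iff_disj)
    have "norm ((a \<bullet> b) *\<^sub>R c) \<le> (norm a * norm b) * norm c"
      using Cauchy_Schwarz_ineq2[of a b] by (simp add: mult_right_mono)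
    also have "\<dots> \<le> (m * m) * m" by (intro mult_mono m mult_nonneg_nonneg) simp_all
    finally have "(norm ((a \<bullet> b) *\<^sub>R c))\<^sup>2 \<le> ((m * m) * m)\<^sup>2" by (rule power_mono) simp
    also have "\<dots> = m ^ 6" by (simp add: power2_eq_square numeral_eq_Suc)
    also have "\<dots> \<le> norm a ^ 6 + norm b ^ 6 + norm c ^ 6"
      unfolding m_def max_def by (auto intro: add_increasing add_increasing2)
    finally show ?thesis .
  qed
  have "integrable M (\<lambda>x. (norm ((u x \<bullet> v x) *\<^sub>R w x))\<^sup>2)"
    by (rule Bochner_Integration.integrable_bound[OF i]) (use le in auto)
  then show ?thesis by (simp add: sq_integrable_def)
qed

text \<open>
  The cubic field is square integrable, so the projection can be dropped.
\<close>

lemma C_op_inner: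
  assumes "u \<in> V_space \<Omega>" "v \<in> V_space \<Omega>"
  shows "H_inner \<Omega> (C_op \<Omega> u) v = quad u u u v"
proof -
  have "H_inner \<Omega> (C_op \<Omega> u) v = H_inner \<Omega> (\<lambda>x. (u x \<bullet> u x) *\<^sub>R u x) v"
    unfolding C_op_def power2_norm_eq_inner
    by (rule helmholtz_inner(1)[OF cubic_sq_integrable[OF assms(1,1,1)] V_H[OF assms(2)]])
  then show ?thesis by (simp add: H_inner_def quad_def)
qed

lemma C_deriv_inner:
  assumes "u \<in> V_space \<Omega>" "p \<in> V_space \<Omega>" "v \<in> V_space \<Omega>"
  shows "H_inner \<Omega> (C_deriv \<Omega> u p) v = quad u u p v + 2 * quad u p u v"
proof -
  have "sq_integrable M (\<lambda>x. 1 *\<^sub>R ((u x \<bullet> u x) *\<^sub>R p x) + 2 *\<^sub>R ((u x \<bullet> p x) *\<^sub>R u x))"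
    by (intro sq_integrable_lincomb(1) cubic_sq_integrable assms)
  then have s: "sq_integrable M (\<lambda>x. (norm (u x))\<^sup>2 *\<^sub>R p x + (2 * (u x \<bullet> p x)) *\<^sub>R u x)"
    by (simp add: power2_norm_eq_inner)
  have "H_inner \<Omega> (C_deriv \<Omega> u p) v = H_inner \<Omega> (\<lambda>x. (norm (u x))\<^sup>2 *\<^sub>R p x + (2 * (u x \<bullet> p x)) *\<^sub>R u x) v"
    unfolding C_deriv_def by (rule helmholtz_inner(1)[OF s V_H[OF assms(3)]])
  also have "\<dots> = (LINT x|M. (u x \<bullet> u x) * (p x \<bullet> v x) + 2 * ((u x \<bullet> p x) * (u x \<bullet> v x)))"
    by (simp add: H_inner_def inner_add_left power2_norm_eq_inner mult.assoc)
  also have "\<dots> = quad u u p v + 2 * quad u p u v"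
    unfolding quad_def
    by (subst Bochner_Integration.integral_add)
       (auto intro!: quad_bound(1) V_L4 assms)
  finally show ?thesis .
qed

end

section \<open>Averages concentrating on the diagonal\<close>

lemma finite_measure_interval: "finite_measure (lebesgue_on {a..b::real})"
  by (intro finite_measure_lebesgue_on) (simp add: lmeasurable_cbox[of a b, simplified])

text \<open>
  The weights are an approximate identity on the square: they have mass at most one in each row
  and in each column, and they concentrate on the diagonal.
\<close>

locale diagonal_weights =
  fixes T :: real and \<rho> :: "nat \<Rightarrow> real \<Rightarrow> real \<Rightarrow> real"
  assumes weight_measurable: "\<And>n. (\<lambda>z. \<rho> n (fst z) (snd z)) \<in> borel_measurable (lebesgue_on {0..T} \<Otimes>\<^sub>M lebesgue_on {0..T})"
    and weight_nonneg: "\<And>n s t. 0 \<le> \<rho> n s t"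
    and row_mass: "\<And>n s. (\<integral>\<^sup>+t. \<rho> n s t \<partial>lebesgue_on {0..T}) \<le> 1"
    and column_mass: "\<And>n t. (\<integral>\<^sup>+s. \<rho> n s t \<partial>lebesgue_on {0..T}) \<le> 1"
    and row_limit: "AE s in lebesgue_on {0..T}. (\<lambda>n. LINT t|lebesgue_on {0..T}. \<rho> n s t) \<longlonglongrightarrow> 1"
    and concentrates: "\<And>\<delta>. 0 < \<delta> \<Longrightarrow> \<forall>\<^sub>F n in sequentially. \<forall>s t. \<rho> n s t \<noteq> 0 \<longrightarrow> \<bar>s - t\<bar> < \<delta>"
begin

abbreviation I where "I \<equiv> lebesgue_on {0..T}"

sublocale finite_measure I
  by (rule finite_measure_interval)

sublocale P: pair_sigma_finite I I ..

definition average :: "nat \<Rightarrow> (real \<Rightarrow> real \<Rightarrow> real) \<Rightarrow> real" where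
  "average n k = (LINT z|(I \<Otimes>\<^sub>M I). \<rho> n (fst z) (snd z) * k (fst z) (snd z))"

text \<open>
  A majorant that splits into a function of \<open>s\<close> and a function of \<open>t\<close>.
  With rows and columns of mass at most one, it controls all averages at once and also the
  integral over the diagonal, although the diagonal is a null set.
\<close>

definition dominated :: "(real \<Rightarrow> real \<Rightarrow> real) \<Rightarrow> (real \<Rightarrow> real) \<Rightarrow> (real \<Rightarrow> real) \<Rightarrow> bool" where
  "dominated k A Q \<longleftrightarrow> (\<lambda>z. k (fst z) (snd z)) \<in> borel_measurable (I \<Otimes>\<^sub>M I) \<and>
     integrable I A \<and> integrable I Q \<and> (\<forall>t. 0 \<le> A t \<and> 0 \<le> Q t) \<and>
     (\<forall>s\<in>{0..T}. \<forall>t\<in>{0..T}. \<bar>k s t\<bar> \<le> A s + Q t)"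

definition diagonal_convergent :: "(real \<Rightarrow> real \<Rightarrow> real) \<Rightarrow> bool" where
  "diagonal_convergent k \<longleftrightarrow> (\<exists>A Q. dominated k A Q) \<and> (\<lambda>n. average n k) \<longlonglongrightarrow> (LINT t|I. k t t)"

lemma row_measurable: "\<rho> n s \<in> borel_measurable I" if "s \<in> {0..T}"
proof -
  have "(\<lambda>t. (s, t)) \<in> I \<rightarrow>\<^sub>M I \<Otimes>\<^sub>M I" using that by simp
  from measurable_compose[OF this weight_measurable[of n]] show ?thesis by simp
qed

lemma row_integrable:
  assumes "s \<in> {0..T}"
  shows "integrable I (\<rho> n s)" "(LINT t|I. \<rho> n s t) \<le> 1"
proof -
  have b: "(\<integral>\<^sup>+t. ennreal (\<rho> n s t) \<partial>I) \<le> 1" by (rule row_mass)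
  then have "(\<integral>\<^sup>+t. ennreal (\<rho> n s t) \<partial>I) < \<infinity>" by (rule le_less_trans) simp
  then show i: "integrable I (\<rho> n s)"
    using row_measurable[OF assms] weight_nonneg by (intro integrableI_nonneg) auto
  have "AE t in I. 0 \<le> \<rho> n s t" using weight_nonneg by simp
  from nn_integral_eq_integral[OF i this] b show "(LINT t|I. \<rho> n s t) \<le> 1"
    by (simp add: ennreal_le_1)
qed

text \<open>
  Integrate the part that depends on \<open>s\<close> over the rows and the part that depends on
  \<open>t\<close> over the columns.
\<close>

lemma nn_average_le:
  assumes A: "integrable I A" "integrable I Q" "\<And>t. 0 \<le> A t" "\<And>t. 0 \<le> Q t"
  shows "(\<integral>\<^sup>+z. ennreal (\<rho> n (fst z) (snd z) * (A (fst z) + Q (snd z))) \<partial>(I \<Otimes>\<^sub>M I))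
    \<le> ennreal ((LINT t|I. A t) + (LINT t|I. Q t))"
proof -
  have [measurable]: "A \<in> borel_measurable I" "Q \<in> borel_measurable I" using A by auto
  have \<rho>m [measurable]: "(\<lambda>z. \<rho> n (fst z) (snd z)) \<in> borel_measurable (I \<Otimes>\<^sub>M I)" by (rule weight_measurable)
  have "(\<integral>\<^sup>+z. ennreal (\<rho> n (fst z) (snd z) * (A (fst z) + Q (snd z))) \<partial>(I \<Otimes>\<^sub>M I))
      = (\<integral>\<^sup>+z. ennreal (\<rho> n (fst z) (snd z)) * ennreal (A (fst z)) + ennreal (\<rho> n (fst z) (snd z)) * ennreal (Q (snd z)) \<partial>(I \<Otimes>\<^sub>M I))"
    by (intro nn_integral_cong)
       (simp add: weight_nonneg A distrib_left ennreal_mult ennreal_plus)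
  also have "\<dots> = (\<integral>\<^sup>+z. ennreal (\<rho> n (fst z) (snd z)) * ennreal (A (fst z)) \<partial>(I \<Otimes>\<^sub>M I))
      + (\<integral>\<^sup>+z. ennreal (\<rho> n (fst z) (snd z)) * ennreal (Q (snd z)) \<partial>(I \<Otimes>\<^sub>M I))"
    by (rule nn_integral_add) measurable
  also have "(\<integral>\<^sup>+z. ennreal (\<rho> n (fst z) (snd z)) * ennreal (A (fst z)) \<partial>(I \<Otimes>\<^sub>M I))
      = (\<integral>\<^sup>+s. \<integral>\<^sup>+t. ennreal (\<rho> n s t) * ennreal (A s) \<partial>I \<partial>I)"
    by (subst nn_integral_fst[symmetric]) simp_all
  also have "\<dots> \<le> (\<integral>\<^sup>+s. ennreal (A s) \<partial>I)"
  proof (rule nn_integral_mono)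
    fix s assume "s \<in> space I"
    then have s: "s \<in> {0..T}" by simp
    have "(\<integral>\<^sup>+t. ennreal (\<rho> n s t) * ennreal (A s) \<partial>I) = (\<integral>\<^sup>+t. ennreal (\<rho> n s t) \<partial>I) * ennreal (A s)"
      using row_measurable[OF s] by (intro nn_integral_multc) simp
    also have "\<dots> \<le> 1 * ennreal (A s)" by (intro mult_right_mono row_mass) simp
    finally show "(\<integral>\<^sup>+t. ennreal (\<rho> n s t) * ennreal (A s) \<partial>I) \<le> ennreal (A s)" by simp
  qed
  also have "(\<integral>\<^sup>+z. ennreal (\<rho> n (fst z) (snd z)) * ennreal (Q (snd z)) \<partial>(I \<Otimes>\<^sub>M I))
      = (\<integral>\<^sup>+t. \<integral>\<^sup>+s. ennreal (\<rho> n s t) * ennreal (Q t) \<partial>I \<partial>I)"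
    by (subst P.nn_integral_snd[symmetric]) simp_all
  also have "\<dots> \<le> (\<integral>\<^sup>+t. ennreal (Q t) \<partial>I)"
  proof (rule nn_integral_mono)
    fix t assume "t \<in> space I"
    then have t: "t \<in> {0..T}" by simp
    have "(\<lambda>s. (s, t)) \<in> I \<rightarrow>\<^sub>M I \<Otimes>\<^sub>M I" using t by simp
    from measurable_compose[OF this weight_measurable[of n]] have [measurable]: "(\<lambda>s. \<rho> n s t) \<in> borel_measurable I" by simp
    have "(\<integral>\<^sup>+s. ennreal (\<rho> n s t) * ennreal (Q t) \<partial>I) = (\<integral>\<^sup>+s. ennreal (\<rho> n s t) \<partial>I) * ennreal (Q t)"
      by (intro nn_integral_multc) simp
    also have "\<dots> \<le> 1 * ennreal (Q t)" by (intro mult_right_mono column_mass) simp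
    finally show "(\<integral>\<^sup>+s. ennreal (\<rho> n s t) * ennreal (Q t) \<partial>I) \<le> ennreal (Q t)" by simp
  qed
  also have "(\<integral>\<^sup>+s. ennreal (A s) \<partial>I) + (\<integral>\<^sup>+t. ennreal (Q t) \<partial>I) = ennreal ((LINT t|I. A t) + (LINT t|I. Q t))"
    using A by (simp add: nn_integral_eq_integral ennreal_plus Bochner_Integration.integral_nonneg)
  finally show ?thesis by (simp add: add_mono add_left_mono add_right_mono)
qed

lemma dominated_average:
  assumes k: "dominated k A Q"
  shows "integrable (I \<Otimes>\<^sub>M I) (\<lambda>z. \<rho> n (fst z) (snd z) * k (fst z) (snd z))"
    "\<bar>average n k\<bar> \<le> (LINT t|I. A t) + (LINT t|I. Q t)"
    "integrable I (\<lambda>t. k t t)" "\<bar>LINT t|I. k t t\<bar> \<le> (LINT t|I. A t) + (LINT t|I. Q t)"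
proof -
  have km [measurable]: "(\<lambda>z. k (fst z) (snd z)) \<in> borel_measurable (I \<Otimes>\<^sub>M I)"
    and A: "integrable I A" "integrable I Q" "\<And>t. 0 \<le> A t" "\<And>t. 0 \<le> Q t"
    and le: "\<And>s t. s \<in> {0..T} \<Longrightarrow> t \<in> {0..T} \<Longrightarrow> \<bar>k s t\<bar> \<le> A s + Q t"
    using k by (auto simp: dominated_def)
  have [measurable]: "(\<lambda>z. \<rho> n (fst z) (snd z)) \<in> borel_measurable (I \<Otimes>\<^sub>M I)" by (rule weight_measurable)
  have nn: "0 \<le> (LINT t|I. A t) + (LINT t|I. Q t)"
    using A by (intro add_nonneg_nonneg Bochner_Integration.integral_nonneg)
  have b: "(\<integral>\<^sup>+z. ennreal (norm (\<rho> n (fst z) (snd z) * k (fst z) (snd z))) \<partial>(I \<Otimes>\<^sub>M I))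
      \<le> ennreal ((LINT t|I. A t) + (LINT t|I. Q t))"
  proof (rule order_trans[OF nn_integral_mono nn_average_le[OF A]])
    fix z assume "z \<in> space (I \<Otimes>\<^sub>M I)"
    then have z: "fst z \<in> {0..T}" "snd z \<in> {0..T}" by (auto simp: space_pair_measure)
    show "ennreal (norm (\<rho> n (fst z) (snd z) * k (fst z) (snd z)))
        \<le> ennreal (\<rho> n (fst z) (snd z) * (A (fst z) + Q (snd z)))"
      using le[OF z] by (intro ennreal_leI) (simp add: abs_mult weight_nonneg mult_left_mono)
  qed
  show i: "integrable (I \<Otimes>\<^sub>M I) (\<lambda>z. \<rho> n (fst z) (snd z) * k (fst z) (snd z))"
    by (rule integrableI_bounded) (use b le_less_trans in \<open>auto simp: less_top[symmetric] top_unique\<close>)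
  have "ennreal \<bar>average n k\<bar> \<le> ennreal ((LINT t|I. A t) + (LINT t|I. Q t))"
    unfolding average_def using integral_norm_bound_ennreal[OF i] b by simp
  then show "\<bar>average n k\<bar> \<le> (LINT t|I. A t) + (LINT t|I. Q t)" using nn by simp
  have "(\<lambda>t. (t, t)) \<in> I \<rightarrow>\<^sub>M I \<Otimes>\<^sub>M I" by simp
  from measurable_compose[OF this km] have dm: "(\<lambda>t. k t t) \<in> borel_measurable I" by simp
  have AQ: "integrable I (\<lambda>t. A t + Q t)" using A by simp
  have ae: "AE t in I. norm (k t t) \<le> A t + Q t" by (rule AE_I2) (simp add: le)
  show di: "integrable I (\<lambda>t. k t t)"
    by (rule Bochner_Integration.integrable_bound[OF AQ dm]) (use ae A in auto)
  have "\<bar>LINT t|I. k t t\<bar> \<le> (LINT t|I. A t + Q t)"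
    using Bochner_Integration.integral_norm_bound_integral[OF di AQ] le by simp
  then show "\<bar>LINT t|I. k t t\<bar> \<le> (LINT t|I. A t) + (LINT t|I. Q t)" using A by simp
qed

lemma dominated_lincomb:
  assumes "dominated k A Q" "dominated k' A' Q'"
  shows "dominated (\<lambda>s t. k s t + c * k' s t) (\<lambda>t. A t + \<bar>c\<bar> * A' t) (\<lambda>t. Q t + \<bar>c\<bar> * Q' t)"
proof -
  have "\<bar>k s t + c * k' s t\<bar> \<le> A s + \<bar>c\<bar> * A' s + (Q t + \<bar>c\<bar> * Q' t)" if "s \<in> {0..T}" "t \<in> {0..T}" for s t
  proof -
    have "\<bar>k s t\<bar> \<le> A s + Q t" "\<bar>k' s t\<bar> \<le> A' s + Q' t" using assms that by (auto simp: dominated_def)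
    then have "\<bar>c\<bar> * \<bar>k' s t\<bar> \<le> \<bar>c\<bar> * (A' s + Q' t)" by (intro mult_left_mono) auto
    then show ?thesis
      using \<open>\<bar>k s t\<bar> \<le> A s + Q t\<close> abs_triangle_ineq[of "k s t" "c * k' s t"]
      by (simp add: abs_mult distrib_left)
  qed
  then show ?thesis using assms by (auto simp: dominated_def)
qed

lemma average_lincomb:
  assumes "dominated k A Q" "dominated k' A' Q'"
  shows "average n (\<lambda>s t. k s t + c * k' s t) = average n k + c * average n k'"
    "(LINT t|I. k t t + c * k' t t) = (LINT t|I. k t t) + c * (LINT t|I. k' t t)"
proof -
  have "average n (\<lambda>s t. k s t + c * k' s t)
    = (LINT z|(I \<Otimes>\<^sub>M I). \<rho> n (fst z) (snd z) * k (fst z) (snd z) + c * (\<rho> n (fst z) (snd z) * k' (fst z) (snd z)))"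
    unfolding average_def by (simp add: algebra_simps)
  also have "\<dots> = average n k + c * average n k'"
    unfolding average_def
    by (subst Bochner_Integration.integral_add) (simp_all add: dominated_average(1)[OF assms(1)] dominated_average(1)[OF assms(2)])
  finally show "average n (\<lambda>s t. k s t + c * k' s t) = average n k + c * average n k'" .
  show "(LINT t|I. k t t + c * k' t t) = (LINT t|I. k t t) + c * (LINT t|I. k' t t)"
    by (subst Bochner_Integration.integral_add) (simp_all add: dominated_average(3)[OF assms(1)] dominated_average(3)[OF assms(2)])
qed

text \<open>
  Both the averages and the diagonal integral are bounded by the mass of a split majorant, hence
  convergence passes to limits for which the mass of the majorant of the error tends to zero.
\<close>

lemma diagonal_convergent_closed:
  assumes k: "dominated k A Q"
    and approx: "\<And>e. 0 < e \<Longrightarrow> \<exists>k' A' Q'. diagonal_convergent k' \<and>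
      dominated (\<lambda>s t. k s t - k' s t) A' Q' \<and> (LINT t|I. A' t) + (LINT t|I. Q' t) \<le> e"
  shows "diagonal_convergent k"
proof -
  have "(\<lambda>n. average n k) \<longlonglongrightarrow> (LINT t|I. k t t)"
  proof (rule LIMSEQ_I)
    fix e :: real assume "0 < e"
    then obtain k' A' Q' where k': "diagonal_convergent k'"
      and d: "dominated (\<lambda>s t. k s t - k' s t) A' Q'" and small: "(LINT t|I. A' t) + (LINT t|I. Q' t) \<le> e / 4"
      using approx[of "e / 4"] by auto
    obtain A2 Q2 where k'd: "dominated k' A2 Q2" using k' by (auto simp: diagonal_convergent_def)
    have "(\<lambda>n. average n k') \<longlonglongrightarrow> (LINT t|I. k' t t)" using k' by (simp add: diagonal_convergent_def)
    then obtain N where N: "\<And>n. n \<ge> N \<Longrightarrow> norm (average n k' - (LINT t|I. k' t t)) < e / 4"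
      using LIMSEQ_D[of "\<lambda>n. average n k'" _ "e/4"] \<open>0 < e\<close> by (metis zero_less_divide_iff zero_less_numeral)
    have a: "average n k = average n k' + 1 * average n (\<lambda>s t. k s t - k' s t)" for n
      using average_lincomb(1)[OF k'd d, of n 1] by simp
    have b: "(LINT t|I. k t t) = (LINT t|I. k' t t) + 1 * (LINT t|I. k t t - k' t t)"
      using average_lincomb(2)[OF k'd d, of 1] by simp
    have "norm (average n k - (LINT t|I. k t t)) < e" if "n \<ge> N" for n
      using N[OF that] dominated_average(2)[OF d, of n] dominated_average(4)[OF d] small \<open>0 < e\<close>
      unfolding a b real_norm_def by linarith
    then show "\<exists>N. \<forall>n\<ge>N. norm (average n k - (LINT t|I. k t t)) < e" by blast
  qed
  then show ?thesis using k by (auto simp: diagonal_convergent_def)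
qed

lemma diagonal_convergent_sum:
  assumes "finite J" "\<And>j. j \<in> J \<Longrightarrow> diagonal_convergent (k j)"
  shows "diagonal_convergent (\<lambda>s t. \<Sum>j\<in>J. k j s t)"
  using assms
proof (induction J rule: finite_induct)
  case empty
  have "dominated (\<lambda>s t. 0) (\<lambda>_. 0) (\<lambda>_. 0)" by (simp add: dominated_def)
  then show ?case by (auto simp: diagonal_convergent_def average_def)
next
  case (insert j J)
  let ?k = "\<lambda>s t. \<Sum>j\<in>J. k j s t"
  have K: "diagonal_convergent ?k" "diagonal_convergent (k j)" using insert by auto
  then obtain A Q A' Q' where d: "dominated ?k A Q" "dominated (k j) A' Q'"
    by (auto simp: diagonal_convergent_def)
  have l: "(\<lambda>n. average n ?k + 1 * average n (k j)) \<longlonglongrightarrow> (LINT t|I. ?k t t) + 1 * (LINT t|I. k j t t)"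
    using K unfolding diagonal_convergent_def by (intro tendsto_add tendsto_mult tendsto_const) auto
  have "diagonal_convergent (\<lambda>s t. ?k s t + 1 * k j s t)"
    unfolding diagonal_convergent_def average_lincomb[OF d]
    using dominated_lincomb[OF d, of 1] l by blast
  then show ?case using insert by (simp add: add.commute)
qed

text \<open>
  The averages of \<open>e\<close> along the rows converge to \<open>e\<close>, and they are
  bounded by one.
\<close>

lemma diagonal_convergent_continuous:
  assumes g: "integrable I g" and e: "continuous_on UNIV e" "\<And>t. \<bar>e t\<bar> \<le> 1"
  shows "diagonal_convergent (\<lambda>s t. g s * e t)"
proof -
  have [measurable]: "g \<in> borel_measurable I" using g by auto
  have em: "e \<in> borel_measurable borel" using e(1) by (rule borel_measurable_continuous_onI)
  have [measurable]: "e \<in> borel_measurable I"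
    by (intro measurable_restrict_space1 measurable_completion) (use em in simp)
  have dom: "dominated (\<lambda>s t. g s * e t) (\<lambda>s. \<bar>g s\<bar>) (\<lambda>_. 0)"
    using g e(2) by (auto simp: dominated_def abs_mult mult_left_le)
  define E where "E n s = (LINT t|I. \<rho> n s t * e t)" for n s
  have fub: "average n (\<lambda>s t. g s * e t) = (LINT s|I. g s * E n s)" for n
  proof -
    have "average n (\<lambda>s t. g s * e t) = (LINT s|I. LINT t|I. \<rho> n s t * (g s * e t))"
      unfolding average_def using P.integral_fst'[OF dominated_average(1)[OF dom, of n]] by simp
    also have "\<dots> = (LINT s|I. g s * E n s)"
      unfolding E_def by (simp add: mult.left_commute[of _ "g _"])
    finally show ?thesis .
  qed
  have row: "integrable I (\<lambda>t. \<rho> n s t * e t)" "\<bar>E n s\<bar> \<le> 1" if s: "s \<in> {0..T}" for n s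
  proof -
    have [measurable]: "\<rho> n s \<in> borel_measurable I" by (rule row_measurable[OF s])
    have le: "\<bar>\<rho> n s t * e t\<bar> \<le> \<rho> n s t" for t
      using e(2)[of t] weight_nonneg[of n s t] by (simp add: abs_mult mult_left_le)
    show i: "integrable I (\<lambda>t. \<rho> n s t * e t)"
      by (rule Bochner_Integration.integrable_bound[OF row_integrable(1)[OF s]]) (use le weight_nonneg in auto)
    have "\<bar>E n s\<bar> \<le> (LINT t|I. \<rho> n s t)"
      unfolding E_def using Bochner_Integration.integral_norm_bound_integral[OF i row_integrable(1)[OF s]] le by simp
    with row_integrable(2)[OF s] show "\<bar>E n s\<bar> \<le> 1" by (rule order_trans[rotated])
  qed
  have Em [measurable]: "E n \<in> borel_measurable I" for n
    unfolding E_def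
    by (rule borel_measurable_lebesgue_integral) (use weight_measurable[of n] in \<open>simp add: split_def\<close>)
  have lim: "AE s in I. (\<lambda>n. E n s) \<longlonglongrightarrow> e s"
  proof -
    have "AE s in I. s \<in> {0..T}" by (rule AE_I2) simp
    with row_limit show ?thesis
    proof eventually_elim
      case (elim s)
      have "(\<lambda>n. E n s - e s * (LINT t|I. \<rho> n s t)) \<longlonglongrightarrow> 0"
      proof (rule LIMSEQ_I)
        fix r :: real assume "0 < r"
        have "isCont e s" using e(1) by (simp add: continuous_on_eq_continuous_at)
        then obtain \<delta> where \<delta>: "0 < \<delta>" "\<And>t. \<bar>t - s\<bar> < \<delta> \<Longrightarrow> \<bar>e t - e s\<bar> < r / 2"
          using \<open>0 < r\<close> unfolding continuous_at_eps_delta dist_real_def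
          by (metis half_gt_zero)
        obtain N where N: "\<And>n t. n \<ge> N \<Longrightarrow> \<rho> n s t \<noteq> 0 \<Longrightarrow> \<bar>s - t\<bar> < \<delta>"
          using concentrates[OF \<delta>(1)] unfolding eventually_sequentially by blast
        have "norm (E n s - e s * (LINT t|I. \<rho> n s t) - 0) < r" if n: "n \<ge> N" for n
        proof -
          have "E n s - e s * (LINT t|I. \<rho> n s t) = (LINT t|I. \<rho> n s t * e t - e s * \<rho> n s t)"
            unfolding E_def
            by (subst Bochner_Integration.integral_diff)
               (simp_all add: row(1)[OF elim(2)] row_integrable(1)[OF elim(2)])
          also have "\<bar>\<dots>\<bar> \<le> (LINT t|I. (r / 2) * \<rho> n s t)"
          proof -
            have le: "norm (\<rho> n s t * e t - e s * \<rho> n s t) \<le> (r / 2) * \<rho> n s t" for t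
            proof (cases "\<rho> n s t = 0")
              case False
              have "\<bar>t - s\<bar> < \<delta>" using N[OF n False] by (simp add: abs_minus_commute)
              from less_imp_le[OF \<delta>(2)[OF this]] have "\<rho> n s t * \<bar>e t - e s\<bar> \<le> \<rho> n s t * (r / 2)" by (intro mult_left_mono weight_nonneg)
              then show ?thesis
                using weight_nonneg[of n s t]
                by (simp add: abs_mult mult.commute[of "e s"] mult.commute[of r] flip: right_diff_distrib)
            qed simp
            have i1: "integrable I (\<lambda>t. \<rho> n s t * e t - e s * \<rho> n s t)"
              "integrable I (\<lambda>t. (r / 2) * \<rho> n s t)"
              by (intro Bochner_Integration.integrable_diff Bochner_Integration.integrable_mult_right
                  row(1)[OF elim(2)] row_integrable(1)[OF elim(2)])+
            show ?thesis
              by (rule Bochner_Integration.integral_norm_bound_integral[OF i1, unfolded real_norm_def])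
                 (rule le[unfolded real_norm_def])
          qed
          also have "\<dots> \<le> r / 2" using row_integrable(2)[OF elim(2), of n] \<open>0 < r\<close> by simp
          finally show ?thesis using \<open>0 < r\<close> by simp
        qed
        then show "\<exists>N. \<forall>n\<ge>N. norm (E n s - e s * (LINT t|I. \<rho> n s t) - 0) < r" by blast
      qed
      from tendsto_add[OF this tendsto_mult[OF tendsto_const[of "e s"] elim(1)]] show ?case by simp
    qed
  qed
  have "(\<lambda>n. LINT s|I. g s * E n s) \<longlonglongrightarrow> (LINT s|I. g s * e s)"
  proof (rule integral_dominated_convergence[where w = "\<lambda>s. \<bar>g s\<bar>"])
    show "AE s in I. (\<lambda>n. g s * E n s) \<longlonglongrightarrow> g s * e s"
      using lim by eventually_elim (intro tendsto_intros)
    show "AE s in I. norm (g s * E n s) \<le> \<bar>g s\<bar>" for n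
      by (rule AE_I2) (use row(2) in \<open>simp add: abs_mult mult_left_le\<close>)
  qed (use g in auto)
  then show ?thesis using dom by (auto simp: diagonal_convergent_def fub)
qed

text \<open>
  Approximate the indicator by continuous functions almost everywhere. Since \<open>g\<close>
  may be unbounded, the error is split where \<open>\<bar>g\<bar>\<close> exceeds a level
  \<open>m\<close>: there it is bounded by \<open>\<bar>g\<bar>\<close>, which has a small
  integral, and elsewhere by \<open>m\<close> times the error of the approximation. This is how
  the majorant splits into functions of \<open>s\<close> and of \<open>t\<close>.
\<close>

lemma diagonal_convergent_indicator:
  assumes g: "integrable I g" and E: "E \<in> sets I"
  shows "diagonal_convergent (\<lambda>s t. g s * indicator E t)"
proof -
  have gm [measurable]: "g \<in> borel_measurable I" using g by auto
  note E[measurable]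
  have dom: "dominated (\<lambda>s t. g s * indicator E t) (\<lambda>s. \<bar>g s\<bar>) (\<lambda>_. 0)"
    using g by (auto simp: dominated_def indicator_def)
  have EL: "E \<in> sets lebesgue" "E \<subseteq> {0..T}"
    using E by (auto simp: sets_restrict_space)
  have "(indicator E :: real \<Rightarrow> real) \<in> borel_measurable lebesgue" using EL(1) by simp
  then have "(indicator E :: real \<Rightarrow> real) measurable_on UNIV"
    by (rule lebesgue_measurable_imp_measurable_on) (use sets.top[of "lebesgue :: real measure"] in simp)
  then obtain N and c :: "nat \<Rightarrow> real \<Rightarrow> real" where N: "negligible N"
    and c: "\<And>n. continuous_on UNIV (c n)" "\<And>x. x \<notin> N \<Longrightarrow> (\<lambda>n. c n x) \<longlonglongrightarrow> indicator E x"
    unfolding measurable_on_def by auto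
  define e where "e n t = max 0 (min 1 (c n t))" for n t
  have ec: "continuous_on UNIV (e n)" for n unfolding e_def by (intro continuous_intros c)
  have e1: "\<bar>e n t\<bar> \<le> 1" "\<bar>indicator E t - e n t\<bar> \<le> 1" for n t
    by (auto simp: e_def indicator_def max_def min_def)
  have [measurable]: "e n \<in> borel_measurable I" for n
    by (intro measurable_restrict_space1 measurable_completion)
       (use borel_measurable_continuous_onI[OF ec] in simp)
  have "AE t in lebesgue. t \<notin> N"
    using N by (intro AE_not_in) (simp add: negligible_iff_null_sets)
  then have "AE t in I. t \<notin> N"
    by (subst AE_restrict_space_iff) (auto elim: eventually_mono)
  then have el: "AE t in I. (\<lambda>n. \<bar>indicator E t - e n t\<bar>) \<longlonglongrightarrow> 0"
  proof eventually_elim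
    case (elim t)
    have "(\<lambda>n. e n t) \<longlonglongrightarrow> max 0 (min 1 (indicator E t))"
      unfolding e_def by (intro tendsto_intros c(2)[OF elim])
    also have "max 0 (min 1 (indicator E t)) = (indicator E t :: real)" by (simp add: indicator_def)
    finally have "(\<lambda>n. indicator E t - e n t) \<longlonglongrightarrow> indicator E t - indicator E t"
      by (intro tendsto_intros)
    then show ?case by (simp add: tendsto_rabs_zero)
  qed
  have L1: "(\<lambda>n. LINT t|I. \<bar>indicator E t - e n t\<bar>) \<longlonglongrightarrow> (LINT t|I. 0)"
    by (rule integral_dominated_convergence[where w = "\<lambda>_. 1"]) (use el e1 in auto)
  have trunc: "(\<lambda>m. LINT s|I. \<bar>g s\<bar> * indicator {s. real m < \<bar>g s\<bar>} s) \<longlonglongrightarrow> (LINT s|I. 0)"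
  proof (rule integral_dominated_convergence[where w = "\<lambda>s. \<bar>g s\<bar>"])
    show "AE s in I. (\<lambda>m. \<bar>g s\<bar> * indicator {s. real m < \<bar>g s\<bar>} s) \<longlonglongrightarrow> 0"
    proof (rule AE_I2)
      fix s
      obtain m0 where "\<bar>g s\<bar> \<le> real m0" using real_arch_simple by blast
      then have "\<forall>\<^sub>F m in sequentially. \<bar>g s\<bar> * indicator {s. real m < \<bar>g s\<bar>} s = 0"
        by (intro eventually_sequentiallyI[of m0]) (auto simp: indicator_def)
      then show "(\<lambda>m. \<bar>g s\<bar> * indicator {s. real m < \<bar>g s\<bar>} s) \<longlonglongrightarrow> 0" by (rule tendsto_eventually)
    qed
    show "(\<lambda>s. \<bar>g s\<bar> * indicator {s. real m < \<bar>g s\<bar>} s) \<in> borel_measurable I" for m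
      using gm by measurable
  qed (use g in \<open>auto simp: indicator_def\<close>)
  show ?thesis
  proof (rule diagonal_convergent_closed[OF dom])
    fix r :: real assume r: "0 < r"
    obtain m where m: "(LINT s|I. \<bar>g s\<bar> * indicator {s. real m < \<bar>g s\<bar>} s) < r / 2"
      using order_tendstoD(2)[OF trunc, of "r / 2"] r unfolding eventually_sequentially by auto
    obtain n where n: "(LINT t|I. \<bar>indicator E t - e n t\<bar>) < r / (2 * (real m + 1))"
      using order_tendstoD(2)[OF L1, of "r / (2 * (real m + 1))"] r unfolding eventually_sequentially by auto
    let ?A = "\<lambda>s. \<bar>g s\<bar> * indicator {s. real m < \<bar>g s\<bar>} s" and ?Q = "\<lambda>t. (real m + 1) * \<bar>indicator E t - e n t\<bar>"
    have Am [measurable]: "?A \<in> borel_measurable I" using gm by measurable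
    have Ai: "integrable I ?A"
      by (rule Bochner_Integration.integrable_bound[OF g]) (auto simp: indicator_def)
    have Qi: "integrable I ?Q"
      by (intro Bochner_Integration.integrable_mult_right integrable_const_bound[where B = 1]) (use e1 in auto)
    have le: "\<bar>g s * indicator E t - g s * e n t\<bar> \<le> ?A s + ?Q t" for s t
    proof -
      have eq: "\<bar>g s * indicator E t - g s * e n t\<bar> = \<bar>g s\<bar> * \<bar>indicator E t - e n t\<bar>"
        by (simp add: abs_mult flip: right_diff_distrib)
      show ?thesis
      proof (cases "real m < \<bar>g s\<bar>")
        case True
        then show ?thesis unfolding eq using e1(2)[of t n] by (simp add: mult_left_le add_increasing2)
      next
        case False
        then have "\<bar>g s\<bar> * \<bar>indicator E t - e n t\<bar> \<le> (real m + 1) * \<bar>indicator E t - e n t\<bar>"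
          by (intro mult_right_mono) auto
        then show ?thesis unfolding eq using False by simp
      qed
    qed
    have "dominated (\<lambda>s t. g s * indicator E t - g s * e n t) ?A ?Q"
      unfolding dominated_def using Ai Qi le by (auto simp: measurable_split_conv)
    moreover have "(LINT t|I. ?A t) + (LINT t|I. ?Q t) \<le> r"
    proof -
      have "(LINT t|I. ?Q t) = (real m + 1) * (LINT t|I. \<bar>indicator E t - e n t\<bar>)"
        by (rule Bochner_Integration.integral_mult_right_zero)
      also have "\<dots> \<le> (real m + 1) * (r / (2 * (real m + 1)))"
        using n by (intro mult_left_mono) simp_all
      also have "\<dots> = r / 2" by (simp add: field_simps)
      finally show ?thesis using m by linarith
    qed
    ultimately show "\<exists>k' A' Q'. diagonal_convergent k' \<and>
      dominated (\<lambda>s t. g s * indicator E t - k' s t) A' Q' \<and> (LINT t|I. A' t) + (LINT t|I. Q' t) \<le> r"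
      using diagonal_convergent_continuous[OF g ec e1(1)] by blast
  qed
qed

end

section \<open>Pairings with an energy bound\<close>

lemma strip_mass:
  fixes a b T c :: real
  assumes "0 \<le> c" "c * (b - a) \<le> 1" "a \<le> b"
  shows "(\<integral>\<^sup>+t. ennreal (c * indicator {a..b} t) \<partial>lebesgue_on {0..T}) \<le> 1"
proof -
  have "(\<integral>\<^sup>+t. ennreal (c * indicator {a..b} t) \<partial>lebesgue_on {0..T})
      = (\<integral>\<^sup>+t. ennreal (c * indicator {a..b} t) * indicator {0..T} t \<partial>lebesgue)"
    by (rule nn_integral_restrict_space) simp
  also have "\<dots> \<le> (\<integral>\<^sup>+t. ennreal c * indicator {a..b} t \<partial>lebesgue)"
    by (rule nn_integral_mono) (auto simp: indicator_def)
  also have "\<dots> = ennreal c * emeasure lebesgue {a..b}"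
    by (rule nn_integral_cmult_indicator) simp
  also have "\<dots> = ennreal (c * (b - a))"
    using assms by (simp add: ennreal_mult)
  also have "\<dots> \<le> 1" using assms by (simp add: ennreal_le_1)
  finally show ?thesis .
qed

lemma strip_integral:
  fixes a b T c :: real
  assumes "0 \<le> a" "a \<le> b" "b \<le> T"
  shows "(LINT t|lebesgue_on {0..T}. c * indicator {a..b} t) = c * (b - a)"
proof -
  have "(LINT t|lebesgue_on {0..T}. indicator {a..b} t) = measure (lebesgue_on {0..T}) {a..b}"
    using assms by (subst Bochner_Integration.integral_indicator) (auto simp: Int_absorb1)
  also have "\<dots> = b - a"
    using assms by (subst measure_restrict_space) auto
  finally show ?thesis by simp
qed

definition step_size :: "real \<Rightarrow> nat \<Rightarrow> real" where
  "step_size T n = T / (real n + 2)"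

text \<open>
  The kernels of the Steklov averages: with \<open>h\<close> the step size, they average in \<open>s\<close> over
  \<open>[t - h, t]\<close> and over \<open>[t, t + h]\<close>, and vanish for those \<open>t\<close> for
  which this interval leaves \<open>[0, T]\<close>.
\<close>

definition backward_weight :: "real \<Rightarrow> nat \<Rightarrow> real \<Rightarrow> real \<Rightarrow> real" where
  "backward_weight T n s t = (if step_size T n \<le> t \<and> t - step_size T n \<le> s \<and> s \<le> t then 1 / step_size T n else 0)"

definition forward_weight :: "real \<Rightarrow> nat \<Rightarrow> real \<Rightarrow> real \<Rightarrow> real" where
  "forward_weight T n s t = (if t \<le> T - step_size T n \<and> t \<le> s \<and> s \<le> t + step_size T n then 1 / step_size T n else 0)"

lemma step_size:
  assumes "0 < T"
  shows "0 < step_size T n" "step_size T n < T" "step_size T \<longlonglongrightarrow> 0"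
proof -
  show "0 < step_size T n" "step_size T n < T" using assms by (auto simp: step_size_def field_simps intro: add_pos_nonneg)
  have "filterlim (\<lambda>n. real n + 2) at_top sequentially"
    by (rule filterlim_tendsto_add_at_top[OF tendsto_const filterlim_real_sequentially, of 2, simplified add.commute])
  then show "step_size T \<longlonglongrightarrow> 0"
    unfolding step_size_def by (rule tendsto_divide_0[OF tendsto_const filterlim_at_top_imp_at_infinity])
qed

lemma AE_interior: "AE s in lebesgue_on {0..T::real}. 0 < s \<and> s < T"
proof -
  have "AE s in lebesgue. s \<notin> {0, T}" by (intro AE_not_in) (auto simp: negligible_iff_null_sets[symmetric])
  then have "AE s in lebesgue. s \<in> {0..T} \<longrightarrow> 0 < s \<and> s < T"
    by eventually_elim auto
  then show ?thesis by (subst AE_restrict_space_iff) simp_all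
qed

lemma pair_fst_snd_measurable:
  "fst \<in> borel_measurable (lebesgue_on {0..T::real} \<Otimes>\<^sub>M lebesgue_on {0..T})"
  "snd \<in> borel_measurable (lebesgue_on {0..T::real} \<Otimes>\<^sub>M lebesgue_on {0..T})"
proof -
  have i: "(\<lambda>x. x) \<in> borel_measurable (lebesgue_on {0..T})"
    by (intro measurable_restrict_space1 measurable_completion) simp
  show "fst \<in> borel_measurable (lebesgue_on {0..T::real} \<Otimes>\<^sub>M lebesgue_on {0..T})"
    by (rule measurable_compose[OF measurable_fst i])
  show "snd \<in> borel_measurable (lebesgue_on {0..T::real} \<Otimes>\<^sub>M lebesgue_on {0..T})"
    by (rule measurable_compose[OF measurable_snd i])
qed

lemma weights_concentrate:
  assumes T: "0 < T" and \<delta>: "0 < \<delta>"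
  shows "\<forall>\<^sub>F n in sequentially. step_size T n < \<delta>"
  using order_tendstoD(2)[OF step_size(3)[OF T] \<delta>] .

lemma diagonal_weights_backward:
  assumes T: "0 < T"
  shows "diagonal_weights T (backward_weight T)"
proof
  note h = step_size[OF T] and m [measurable] = pair_fst_snd_measurable[of T]
  show "(\<lambda>z. backward_weight T n (fst z) (snd z)) \<in> borel_measurable (lebesgue_on {0..T} \<Otimes>\<^sub>M lebesgue_on {0..T})" for n
    unfolding backward_weight_def by measurable
  show "0 \<le> backward_weight T n s t" for n s t using h(1)[of n] by (simp add: backward_weight_def)
  show "(\<integral>\<^sup>+t. backward_weight T n s t \<partial>lebesgue_on {0..T}) \<le> 1" for n s
    by (rule order_trans[OF nn_integral_mono strip_mass[of "1 / step_size T n" "s + step_size T n" s T]])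
       (use h(1)[of n] in \<open>auto simp: backward_weight_def indicator_def\<close>)
  show "(\<integral>\<^sup>+s. backward_weight T n s t \<partial>lebesgue_on {0..T}) \<le> 1" for n t
    by (rule order_trans[OF nn_integral_mono strip_mass[of "1 / step_size T n" t "t - step_size T n" T]])
       (use h(1)[of n] in \<open>auto simp: backward_weight_def indicator_def\<close>)
  show "AE s in lebesgue_on {0..T}. (\<lambda>n. LINT t|lebesgue_on {0..T}. backward_weight T n s t) \<longlonglongrightarrow> 1"
    using AE_interior
  proof eventually_elim
    case (elim s)
    have "\<forall>\<^sub>F n in sequentially. step_size T n < s \<and> step_size T n < T - s"
      using elim by (intro eventually_conj weights_concentrate[OF T]) auto
    then have "\<forall>\<^sub>F n in sequentially. (LINT t|lebesgue_on {0..T}. backward_weight T n s t) = 1"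
    proof eventually_elim
      case (elim n)
      have "backward_weight T n s t = 1 / step_size T n * indicator {s..s + step_size T n} t" for t
        using elim by (auto simp: backward_weight_def indicator_def)
      then show ?case
        using strip_integral[of s "s + step_size T n" T "1 / step_size T n"] elim h(1)[of n] by simp
    qed
    then show ?case by (rule tendsto_eventually)
  qed
  show "\<forall>\<^sub>F n in sequentially. \<forall>s t. backward_weight T n s t \<noteq> 0 \<longrightarrow> \<bar>s - t\<bar> < \<delta>" if "0 < \<delta>" for \<delta>
    using weights_concentrate[OF T that] by eventually_elim (auto simp: backward_weight_def)
qed

lemma diagonal_weights_forward:
  assumes T: "0 < T"
  shows "diagonal_weights T (forward_weight T)"
proof
  note h = step_size[OF T] and m [measurable] = pair_fst_snd_measurable[of T]
  show "(\<lambda>z. forward_weight T n (fst z) (snd z)) \<in> borel_measurable (lebesgue_on {0..T} \<Otimes>\<^sub>M lebesgue_on {0..T})" for n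
    unfolding forward_weight_def by measurable
  show "0 \<le> forward_weight T n s t" for n s t using h(1)[of n] by (simp add: forward_weight_def)
  show "(\<integral>\<^sup>+t. forward_weight T n s t \<partial>lebesgue_on {0..T}) \<le> 1" for n s
    by (rule order_trans[OF nn_integral_mono strip_mass[of "1 / step_size T n" s "s - step_size T n" T]])
       (use h(1)[of n] in \<open>auto simp: forward_weight_def indicator_def\<close>)
  show "(\<integral>\<^sup>+s. forward_weight T n s t \<partial>lebesgue_on {0..T}) \<le> 1" for n t
    by (rule order_trans[OF nn_integral_mono strip_mass[of "1 / step_size T n" "t + step_size T n" t T]])
       (use h(1)[of n] in \<open>auto simp: forward_weight_def indicator_def\<close>)
  show "AE s in lebesgue_on {0..T}. (\<lambda>n. LINT t|lebesgue_on {0..T}. forward_weight T n s t) \<longlonglongrightarrow> 1"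
    using AE_interior
  proof eventually_elim
    case (elim s)
    have "\<forall>\<^sub>F n in sequentially. step_size T n < s \<and> step_size T n < T - s"
      using elim by (intro eventually_conj weights_concentrate[OF T]) auto
    then have "\<forall>\<^sub>F n in sequentially. (LINT t|lebesgue_on {0..T}. forward_weight T n s t) = 1"
    proof eventually_elim
      case (elim n)
      have "forward_weight T n s t = 1 / step_size T n * indicator {s - step_size T n..s} t" for t
        using elim by (auto simp: forward_weight_def indicator_def)
      then show ?case
        using strip_integral[of "s - step_size T n" s T "1 / step_size T n"] elim h(1)[of n] \<open>0 < s \<and> s < T\<close> by simp
    qed
    then show ?case by (rule tendsto_eventually)
  qed
  show "\<forall>\<^sub>F n in sequentially. \<forall>s t. forward_weight T n s t \<noteq> 0 \<longrightarrow> \<bar>s - t\<bar> < \<delta>" if "0 < \<delta>" for \<delta>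
    using weights_concentrate[OF T that] by eventually_elim (auto simp: forward_weight_def)
qed

context planar_domain
begin

text \<open>
  The quantity which Young's inequality leaves on the test function in the equation. It contains
  the fourth power, so it grows faster than linearly; but its value along a function in
  \<open>C(0,T;H) \<inter> L\<^sup>2(0,T;V)\<close> is integrable in time.
\<close>

definition energy :: "vfield \<Rightarrow> real" where
  "energy v = (V_norm \<Omega> v)\<^sup>2 + L4norm M v ^ 4"

lemma energy_nonneg [simp]: "0 \<le> energy v"
  by (simp add: energy_def)

lemma V_scale: "v \<in> V_space \<Omega> \<Longrightarrow> (\<lambda>x. c *\<^sub>R v x) \<in> V_space \<Omega>"
  using V_lincomb[of v v c 0] by simp

lemma V_norm_scale:
  assumes "v \<in> V_space \<Omega>"
  shows "V_norm \<Omega> (\<lambda>x. c *\<^sub>R v x) = \<bar>c\<bar> * V_norm \<Omega> v"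
  using L2norm_wgrad_lincomb[OF V_H1[OF assms] V_H1[OF assms], of c 0]
  by (simp add: V_norm_alt L2norm_scale)

lemma L4norm_scale: "L4norm M (\<lambda>x. c *\<^sub>R v x) = \<bar>c\<bar> * L4norm M v"
  using L2norm_scale[of M "c\<^sup>2" "\<lambda>x. (norm (v x))\<^sup>2"]
  by (simp add: L4norm_def power_mult_distrib real_sqrt_mult)

lemma energy_scale_le:
  assumes "v \<in> V_space \<Omega>" "1 \<le> c"
  shows "energy (\<lambda>x. c *\<^sub>R v x) \<le> c ^ 4 * energy v"
proof -
  have "c\<^sup>2 \<le> c ^ 4" using assms(2) by (intro power_increasing) simp_all
  then have "c\<^sup>2 * (V_norm \<Omega> v)\<^sup>2 \<le> c ^ 4 * (V_norm \<Omega> v)\<^sup>2" by (intro mult_right_mono) simp_all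
  then show ?thesis
    by (simp add: energy_def V_norm_scale[OF assms(1)] L4norm_scale power_mult_distrib distrib_left)
qed

lemma energy_tendsto:
  assumes u: "u \<in> V_space \<Omega>" "\<And>n. us n \<in> V_space \<Omega>" and lim: "(\<lambda>n::nat. V_norm \<Omega> (u - us n)) \<longlonglongrightarrow> 0"
  shows "(\<lambda>n. energy (us n)) \<longlonglongrightarrow> energy u" "(\<lambda>n. energy (u - us n)) \<longlonglongrightarrow> 0"
proof -
  show "(\<lambda>n. energy (us n)) \<longlonglongrightarrow> energy u"
    unfolding energy_def by (intro tendsto_intros V_tendsto[OF u lim])
  have "(\<lambda>n. energy (u - us n)) \<longlonglongrightarrow> 0\<^sup>2 + 0 ^ 4"
    unfolding energy_def using V_tendsto(2)[OF u lim]
    by (intro tendsto_intros lim) (simp add: fun_diff_def)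
  then show "(\<lambda>n. energy (u - us n)) \<longlonglongrightarrow> 0" by simp
qed

lemma zero_V: "(\<lambda>x. 0) \<in> V_space \<Omega>"
  by (rule solenoidal_V[OF zero_solenoidal])

definition linear_on_V :: "functional \<Rightarrow> bool" where
  "linear_on_V F \<longleftrightarrow> (\<forall>u\<in>V_space \<Omega>. \<forall>v\<in>V_space \<Omega>. \<forall>a b.
     F (\<lambda>x. a *\<^sub>R u x + b *\<^sub>R v x) = a * F u + b * F v)"

lemma linear_on_VD:
  assumes "linear_on_V F" "u \<in> V_space \<Omega>" "v \<in> V_space \<Omega>"
  shows "F (u - v) = F u - F v" "F (\<lambda>x. c *\<^sub>R u x) = c * F u"
proof -
  have "F (\<lambda>x. 1 *\<^sub>R u x + (-1) *\<^sub>R v x) = 1 * F u + (-1) * F v"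
    using assms unfolding linear_on_V_def by blast
  then show "F (u - v) = F u - F v" by (simp add: fun_diff_def)
  have "F (\<lambda>x. c *\<^sub>R u x + 0 *\<^sub>R u x) = c * F u + 0 * F u"
    using assms unfolding linear_on_V_def by blast
  then show "F (\<lambda>x. c *\<^sub>R u x) = c * F u" by simp
qed

text \<open>
  The bound for \<open>F v\<close> is not homogeneous in \<open>v\<close> while \<open>F\<close>
  is linear. Applying it to a large multiple of \<open>v\<close> trades a small share of
  \<open>A\<close> for a large multiple of the energy; so \<open>F v\<close> is small if the
  energy of \<open>v\<close> is small.
\<close>

lemma rescaled_bound:
  assumes F: "linear_on_V F" "\<And>v. v \<in> V_space \<Omega> \<Longrightarrow> \<bar>F v\<bar> \<le> A + K * energy v"
    and v: "v \<in> V_space \<Omega>" and c: "1 \<le> c" and K: "0 \<le> K"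
  shows "\<bar>F v\<bar> \<le> A / c + K * c ^ 3 * energy v"
proof -
  have "c * \<bar>F v\<bar> = \<bar>F (\<lambda>x. c *\<^sub>R v x)\<bar>"
    using linear_on_VD(2)[OF F(1) v v, of c] c by (simp add: abs_mult)
  also have "\<dots> \<le> A + K * energy (\<lambda>x. c *\<^sub>R v x)" by (rule F(2)[OF V_scale[OF v]])
  also have "\<dots> \<le> A + K * (c ^ 4 * energy v)"
    by (intro add_left_mono mult_left_mono energy_scale_le v c K)
  finally have "c * \<bar>F v\<bar> / c \<le> (A + K * (c ^ 4 * energy v)) / c"
    using c by (intro divide_right_mono) simp_all
  then show ?thesis using c by (simp add: add_divide_distrib power4_eq_xxxx power3_eq_cube mult_ac)
qed

text \<open>
  Approximating simple functions with a dominated error: where the energy of the error exceeds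
  that of \<open>p\<close>, use zero instead.
\<close>

lemma truncated_approximation:
  assumes p: "\<And>t. t \<in> {0..T} \<Longrightarrow> p t \<in> V_space \<Omega>"
    and s: "\<And>n. simple_function (lebesgue_on {0..T}) (s n)" "\<And>n t. t \<in> {0..T} \<Longrightarrow> s n t \<in> V_space \<Omega>"
    and lim: "\<And>t. t \<in> {0..T} \<Longrightarrow> (\<lambda>n::nat. V_norm \<Omega> (p t - s n t)) \<longlonglongrightarrow> 0"
    and int: "integrable (lebesgue_on {0..T}) (\<lambda>t. energy (p t))"
  obtains q where "\<And>n. simple_function (lebesgue_on {0..T}) (q n)" "\<And>n t. t \<in> {0..T} \<Longrightarrow> q n t \<in> V_space \<Omega>"
    "\<And>t. t \<in> {0..T} \<Longrightarrow> (\<lambda>n::nat. energy (p t - q n t)) \<longlonglongrightarrow> 0"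
    "\<And>n. integrable (lebesgue_on {0..T}) (\<lambda>t. energy (p t - q n t))"
    "(\<lambda>n. LINT t|lebesgue_on {0..T}. energy (p t - q n t)) \<longlonglongrightarrow> 0"
proof -
  let ?I = "lebesgue_on {0..T}"
  define q where "q n t = (if energy (p t - s n t) \<le> energy (p t) then s n t else (\<lambda>x. 0))" for n t
  have pm [measurable]: "(\<lambda>t. energy (p t)) \<in> borel_measurable ?I" using int by auto
  have em [measurable]: "(\<lambda>t. energy (p t - s n t)) \<in> borel_measurable ?I" for n
  proof (rule borel_measurable_LIMSEQ_real)
    show "(\<lambda>t. energy (s m t - s n t)) \<in> borel_measurable ?I" for m
      using borel_measurable_simple_function[OF simple_function_compose1[OF simple_function_Pair[OF s(1)[of m] s(1)[of n]],
          of "\<lambda>z. energy (fst z - snd z)"]] by simp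
    fix t assume "t \<in> space ?I"
    then have t: "t \<in> {0..T}" by simp
    have e: "(p t - s n t) - (s m t - s n t) = p t - s m t" for m by (simp add: fun_eq_iff)
    show "(\<lambda>m. energy (s m t - s n t)) \<longlonglongrightarrow> energy (p t - s n t)"
      by (rule energy_tendsto(1)) (simp_all add: V_minus p[OF t] s(2)[OF t] lim[OF t] e)
  qed
  have "{t \<in> space ?I. energy (p t - s n t) \<le> energy (p t)} \<in> sets ?I" for n by measurable
  then have q1: "simple_function ?I (q n)" for n
    unfolding q_def by (intro simple_function_If s(1) simple_function_const)
  have q2: "q n t \<in> V_space \<Omega>" if "t \<in> {0..T}" for n t
    using s(2)[OF that] zero_V by (simp add: q_def)
  have p0: "p t - (\<lambda>x. 0) = p t" for t by (simp add: fun_eq_iff)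
  have q_eq: "energy (p t - q n t) = (if energy (p t - s n t) \<le> energy (p t) then energy (p t - s n t) else energy (p t))" for n t
    by (simp add: q_def p0)
  then have q_le: "energy (p t - q n t) \<le> energy (p t)" for n t by simp
  have q3: "(\<lambda>n. energy (p t - q n t)) \<longlonglongrightarrow> 0" if t: "t \<in> {0..T}" for t
  proof (rule Lim_null_comparison[OF always_eventually])
    show "(\<lambda>n. energy (p t - s n t)) \<longlonglongrightarrow> 0"
      by (rule energy_tendsto(2)[OF p[OF t] s(2)[OF t] lim[OF t]])
    show "\<forall>n. norm (energy (p t - q n t)) \<le> energy (p t - s n t)"
      by (simp add: q_eq)
  qed
  have qm [measurable]: "(\<lambda>t. energy (p t - q n t)) \<in> borel_measurable ?I" for n
    unfolding q_eq by measurable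
  have q4: "integrable ?I (\<lambda>t. energy (p t - q n t))" for n
    by (rule Bochner_Integration.integrable_bound[OF int]) (use q_le in auto)
  have "(\<lambda>n. LINT t|?I. energy (p t - q n t)) \<longlonglongrightarrow> (LINT t|?I. 0)"
    by (rule integral_dominated_convergence[where w = "\<lambda>t. energy (p t)"]) (use int q_le q3 in auto)
  then have "(\<lambda>n. LINT t|?I. energy (p t - q n t)) \<longlonglongrightarrow> 0" by simp
  with q1 q2 q3 q4 show thesis by (rule that)
qed

text \<open>
  For simple \<open>p\<close> the pairing is a finite sum of products of an integrable function
  of \<open>s\<close> and an indicator in \<open>t\<close>. In general approximate
  \<open>p\<close> by simple functions; the error has a split majorant whose mass is small, by
  \<open>rescaled_bound\<close> with a large factor \<open>c\<close>, chosen before the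
  approximation.
\<close>

lemma pairing_diagonal:
  assumes dw: "diagonal_weights T \<rho>"
    and F: "\<And>s. s \<in> {0..T} \<Longrightarrow> linear_on_V (F s)"
      "\<And>v. v \<in> V_space \<Omega> \<Longrightarrow> integrable (lebesgue_on {0..T}) (\<lambda>s. F s v)"
      "\<And>s v. s \<in> {0..T} \<Longrightarrow> v \<in> V_space \<Omega> \<Longrightarrow> \<bar>F s v\<bar> \<le> A s + K * energy v"
    and A: "integrable (lebesgue_on {0..T}) A" "\<And>s. 0 \<le> A s" and K: "0 \<le> K"
    and p: "\<And>t. t \<in> {0..T} \<Longrightarrow> p t \<in> V_space \<Omega>"
    and s: "\<And>n. simple_function (lebesgue_on {0..T}) (s n)" "\<And>n t. t \<in> {0..T} \<Longrightarrow> s n t \<in> V_space \<Omega>"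
    and lim: "\<And>t. t \<in> {0..T} \<Longrightarrow> (\<lambda>n::nat. V_norm \<Omega> (p t - s n t)) \<longlonglongrightarrow> 0"
    and int: "integrable (lebesgue_on {0..T}) (\<lambda>t. energy (p t))"
  shows "diagonal_weights.diagonal_convergent T \<rho> (\<lambda>s t. F s (p t))"
proof -
  interpret D: diagonal_weights T \<rho> by (rule dw)
  let ?I = "lebesgue_on {0..T}"
  obtain q where q: "\<And>n. simple_function ?I (q n)" "\<And>n t. t \<in> {0..T} \<Longrightarrow> q n t \<in> V_space \<Omega>"
    "\<And>t. t \<in> {0..T} \<Longrightarrow> (\<lambda>n::nat. energy (p t - q n t)) \<longlonglongrightarrow> 0"
    "\<And>n. integrable ?I (\<lambda>t. energy (p t - q n t))"
    "(\<lambda>n. LINT t|?I. energy (p t - q n t)) \<longlonglongrightarrow> 0"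
    by (rule truncated_approximation[OF p s lim int], assumption+, rule that, assumption+)
  define k where "k n s t = (\<Sum>v\<in>q n ` {0..T}. F s v * indicator {t \<in> {0..T}. q n t = v} t)" for n s t
  have fin: "finite (q n ` {0..T})" for n
    using simple_functionD(1)[OF q(1)[of n]] by simp
  have k_eq: "k n s t = F s (q n t)" if "t \<in> {0..T}" for n s t
  proof -
    have "k n s t = (\<Sum>v\<in>q n ` {0..T}. if v = q n t then F s v else 0)"
      unfolding k_def using that by (intro sum.cong) (auto simp: indicator_def)
    then show ?thesis using fin[of n] that by (simp add: sum.delta)
  qed
  have kc: "D.diagonal_convergent (k n)" for n
    unfolding k_def
  proof (rule D.diagonal_convergent_sum[OF fin])
    fix v assume "v \<in> q n ` {0..T}"
    then have v: "v \<in> V_space \<Omega>" using q(2) by auto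
    have "{t \<in> {0..T}. q n t = v} \<in> sets ?I"
    proof -
      have "q n -` {v} \<inter> space ?I = {t \<in> {0..T}. q n t = v}" by auto
      then show ?thesis using simple_functionD(2)[OF q(1)[of n], of "{v}"] by (simp only:)
    qed
    then show "D.diagonal_convergent (\<lambda>s t. F s v * indicator {t \<in> {0..T}. q n t = v} t)"
      by (rule D.diagonal_convergent_indicator[OF F(2)[OF v]])
  qed
  have km [measurable]: "(\<lambda>z. k n (fst z) (snd z)) \<in> borel_measurable (?I \<Otimes>\<^sub>M ?I)" for n
    using kc[of n] by (auto simp: D.diagonal_convergent_def D.dominated_def)
  have bd: "\<bar>F s (p t) - k n s t\<bar> \<le> A s / c + K * c ^ 3 * energy (p t - q n t)"
    if "s \<in> {0..T}" "t \<in> {0..T}" "1 \<le> c" for n s t c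
  proof -
    have "F s (p t) - k n s t = F s (p t - q n t)"
      unfolding k_eq[OF that(2)]
      using linear_on_VD(1)[OF F(1)[OF that(1)] p[OF that(2)] q(2)[OF that(2)]] by simp
    then show ?thesis
      using rescaled_bound[OF F(1)[OF that(1)] F(3)[OF that(1)] V_minus[OF p[OF that(2)] q(2)[OF that(2)]] that(3) K]
      by simp
  qed
  have pm [measurable]: "(\<lambda>z. F (fst z) (p (snd z))) \<in> borel_measurable (?I \<Otimes>\<^sub>M ?I)"
  proof (rule borel_measurable_LIMSEQ_real[OF _ km])
    fix z assume "z \<in> space (?I \<Otimes>\<^sub>M ?I)"
    then have z: "fst z \<in> {0..T}" "snd z \<in> {0..T}" by (auto simp: space_pair_measure)
    show "(\<lambda>n. k n (fst z) (snd z)) \<longlonglongrightarrow> F (fst z) (p (snd z))"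
    proof (rule LIMSEQ_I)
      fix r :: real assume r: "0 < r"
      (* The factor makes the first term of the bound smaller than r/2; the second one tends to
         zero for fixed c. *)
      define c where "c = 1 + 2 * A (fst z) / r"
      have c: "1 \<le> c" using A(2) r by (simp add: c_def)
      have "A (fst z) < (r / 2) * c" using r A(2)[of "fst z"] by (simp add: c_def field_simps)
      then have small: "A (fst z) / c < r / 2" using c by (simp add: field_simps)
      have "(\<lambda>n. K * c ^ 3 * energy (p (snd z) - q n (snd z))) \<longlonglongrightarrow> 0"
        using tendsto_mult[OF tendsto_const q(3)[OF z(2)]] by simp
      from order_tendstoD(2)[OF this, of "r / 2"] r have "\<forall>\<^sub>F n in sequentially. K * c ^ 3 * energy (p (snd z) - q n (snd z)) < r / 2"
      by simp
      then obtain N where N: "\<And>n. n \<ge> N \<Longrightarrow> K * c ^ 3 * energy (p (snd z) - q n (snd z)) < r / 2"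
        unfolding eventually_sequentially by blast
      have "norm (k n (fst z) (snd z) - F (fst z) (p (snd z))) < r" if "n \<ge> N" for n
        using bd[OF z c, of n] N[OF that] small unfolding real_norm_def by linarith
      then show "\<exists>N. \<forall>n\<ge>N. norm (k n (fst z) (snd z) - F (fst z) (p (snd z))) < r" by blast
    qed
  qed
  have "D.dominated (\<lambda>s t. F s (p t)) A (\<lambda>t. K * energy (p t))"
    unfolding D.dominated_def using pm A K int F(3) p by (auto intro!: mult_nonneg_nonneg)
  then show ?thesis
  proof (rule D.diagonal_convergent_closed)
    fix r :: real assume r: "0 < r"
    define a where "a = (LINT t|?I. A t)"
    have a: "0 \<le> a" unfolding a_def using A(2) by (intro Bochner_Integration.integral_nonneg)
    define c where "c = 1 + 2 * a / r"
    have c: "1 \<le> c" using a r by (simp add: c_def)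
    have "a \<le> (r / 2) * c" using r a by (simp add: c_def field_simps)
    then have small: "a / c \<le> r / 2" using c by (simp add: field_simps)
    have "(\<lambda>n. K * c ^ 3 * (LINT t|?I. energy (p t - q n t))) \<longlonglongrightarrow> 0"
      using tendsto_mult[OF tendsto_const q(5)] by simp
    from order_tendstoD(2)[OF this, of "r / 2"] r have "\<forall>\<^sub>F n in sequentially. K * c ^ 3 * (LINT t|?I. energy (p t - q n t)) < r / 2"
      by simp
    then obtain n where n: "K * c ^ 3 * (LINT t|?I. energy (p t - q n t)) < r / 2"
      unfolding eventually_sequentially by blast
    have "D.dominated (\<lambda>s t. F s (p t) - k n s t) (\<lambda>s. A s / c) (\<lambda>t. K * c ^ 3 * energy (p t - q n t))"
      unfolding D.dominated_def
    proof (intro conjI ballI allI)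
      show "(\<lambda>z. F (fst z) (p (snd z)) - k n (fst z) (snd z)) \<in> borel_measurable (?I \<Otimes>\<^sub>M ?I)"
        by measurable
      show "\<bar>F s (p t) - k n s t\<bar> \<le> A s / c + K * c ^ 3 * energy (p t - q n t)"
        if "s \<in> {0..T}" "t \<in> {0..T}" for s t by (rule bd[OF that c])
    qed (use A q(4) c K in auto)
    moreover have "(LINT s|?I. A s / c) + (LINT t|?I. K * c ^ 3 * energy (p t - q n t)) \<le> r"
    proof -
      have "(LINT s|?I. A s / c) = a / c" by (simp add: a_def)
      moreover have "(LINT t|?I. K * c ^ 3 * energy (p t - q n t)) = K * c ^ 3 * (LINT t|?I. energy (p t - q n t))"
        by simp
      ultimately show ?thesis using small n by linarith
    qed
    ultimately show "\<exists>k' A' Q'. D.diagonal_convergent k' \<and> D.dominated (\<lambda>s t. F s (p t) - k' s t) A' Q' \<and>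
        (LINT t|?I. A' t) + (LINT t|?I. Q' t) \<le> r"
      using kc by blast
  qed
qed

end

section \<open>Weak derivatives on an interval\<close>

lemma interval_continuous:
  fixes f :: "real \<Rightarrow> real"
  assumes "continuous_on {a..b} f"
  shows "integrable (lebesgue_on {a..b}) f" "(LINT t|lebesgue_on {a..b}. f t) = integral {a..b} f"
proof -
  show i: "integrable (lebesgue_on {a..b}) f"
    using continuous_imp_integrable_real[OF assms] .
  show "(LINT t|lebesgue_on {a..b}. f t) = integral {a..b} f"
    by (rule lebesgue_integral_eq_integral[OF i]) simp
qed

text \<open>
  The weights are the derivatives of steepened smooth steps, and so an approximate identity at
  \<open>a\<close>. The offset \<open>d\<close> shifts the step so that it climbs inside the
  interval, also when \<open>a\<close> is one of the endpoints.
\<close>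

lemma concentrating_integral:
  fixes c :: "real \<Rightarrow> real"
  assumes S: "\<And>t. (S has_real_derivative s t) (at t)" "continuous_on UNIV s" "\<And>t. 0 \<le> s t"
      "\<And>t. t \<le> 0 \<Longrightarrow> S t = 0" "\<And>t. t \<ge> 1 \<Longrightarrow> S t = 1"
    and c: "continuous_on {0..T} c" and a: "a \<in> {0..T}"
    and ends: "\<forall>\<^sub>F n in sequentially. 1 \<le> real n * (T - a) + d \<and> real n * (0 - a) + d \<le> 0"
  shows "(\<lambda>n. LINT t|lebesgue_on {0..T}. (real n * s (real n * (t - a) + d)) * c t) \<longlonglongrightarrow> c a"
proof -
  let ?I = "lebesgue_on {0..T}"
  have T: "0 \<le> T" using a by simp
  define w where "w n t = real n * s (real n * (t - a) + d)" for n t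
  have wc: "continuous_on A (w n)" for n A
    unfolding w_def by (intro continuous_intros continuous_on_compose2[OF S(2)]) auto
  have w0: "0 \<le> w n t" for n t by (simp add: w_def S(3))
  have s_out: "s x = 0" if "x < 0 \<or> 1 < x" for x
  proof -
    have "(S has_real_derivative 0) (at x)"
    proof (cases "x < 0")
      case True
      show ?thesis
        by (rule has_field_derivative_transform_within_open[where f = "\<lambda>_. 0" and S = "{..<0}"])
           (use True S(4) in auto)
    next
      case False
      show ?thesis
        by (rule has_field_derivative_transform_within_open[where f = "\<lambda>_. 1" and S = "{1<..}"])
           (use False that S(5) in auto)
    qed
    then show ?thesis using S(1) DERIV_unique by blast
  qed
  have w_mass: "(LINT t|?I. w n t) = S (real n * (T - a) + d) - S (real n * (0 - a) + d)" for n
  proof -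
    have "((\<lambda>t. S (real n * (t - a) + d)) has_real_derivative w n t) (at t within {0..T})" for t
    proof -
      have "((\<lambda>t. real n * (t - a) + d) has_real_derivative real n) (at t within {0..T})"
        by (auto intro!: derivative_eq_intros)
      from DERIV_chain'[OF this S(1)] show ?thesis by (simp add: w_def mult.commute)
    qed
    then have "(w n has_integral S (real n * (T - a) + d) - S (real n * (0 - a) + d)) {0..T}"
      by (intro fundamental_theorem_of_calculus[OF T])
         (auto simp: has_real_derivative_iff_has_vector_derivative)
    then show ?thesis using interval_continuous(2)[OF wc] integral_unique by metis
  qed
  have cm: "integrable ?I c" using interval_continuous(1)[OF c] .
  have wi: "integrable ?I (w n)" "integrable ?I (\<lambda>t. w n t * c t)" for n
    by (intro interval_continuous(1) wc continuous_intros c)+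
  have "(\<lambda>n. LINT t|?I. w n t * c t) \<longlonglongrightarrow> c a"
  proof (rule LIMSEQ_I)
    fix r :: real assume r: "0 < r"
    obtain \<delta> where \<delta>: "0 < \<delta>" "\<And>t. t \<in> {0..T} \<Longrightarrow> \<bar>t - a\<bar> < \<delta> \<Longrightarrow> \<bar>c t - c a\<bar> < r / 2"
      using c a r unfolding continuous_on_iff dist_real_def by (metis half_gt_zero)
    have "\<forall>\<^sub>F n in sequentially. (1 + \<bar>d\<bar>) / \<delta> < real n"
      using filterlim_real_sequentially unfolding filterlim_at_top_dense by blast
    then have "\<forall>\<^sub>F n in sequentially. norm ((LINT t|?I. w n t * c t) - c a) < r"
      using ends
    proof eventually_elim
      case (elim n)
      have mass: "(LINT t|?I. w n t) = 1"
        unfolding w_mass using elim(2) S(4,5) by simp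
      have big: "1 + \<bar>d\<bar> < real n * \<delta>" using elim(1) \<delta>(1) by (simp add: field_simps)
      have le: "\<bar>w n t * c t - w n t * c a\<bar> \<le> (r / 2) * w n t" if t: "t \<in> {0..T}" for t
      proof (cases "w n t = 0")
        case False
        then have "\<not> (real n * (t - a) + d < 0 \<or> 1 < real n * (t - a) + d)"
          using s_out unfolding w_def by auto
        then have "real n * \<bar>t - a\<bar> \<le> 1 + \<bar>d\<bar>"
          by (cases "t \<ge> a") (auto simp: abs_mult algebra_simps)
        with big have "real n * \<bar>t - a\<bar> < real n * \<delta>" by linarith
        then have "\<bar>t - a\<bar> < \<delta>" by (simp add: mult_less_cancel_left)
        then have "\<bar>c t - c a\<bar> \<le> r / 2" using \<delta>(2)[OF t] by simp
        then have "w n t * \<bar>c t - c a\<bar> \<le> w n t * (r / 2)" by (intro mult_left_mono w0)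
        then show ?thesis using w0[of n t]
          by (simp add: abs_mult mult.commute[of r] flip: right_diff_distrib)
      qed simp
      have i1: "integrable ?I (\<lambda>t. w n t * c t - w n t * c a)" "integrable ?I (\<lambda>t. (r / 2) * w n t)"
        by (intro Bochner_Integration.integrable_diff Bochner_Integration.integrable_mult_right
            Bochner_Integration.integrable_mult_left wi)+
      have "(LINT t|?I. w n t * c t) - c a = (LINT t|?I. w n t * c t - w n t * c a)"
        using mass wi by (subst Bochner_Integration.integral_diff) simp_all
      also have "\<bar>\<dots>\<bar> \<le> (LINT t|?I. (r / 2) * w n t)"
        by (rule Bochner_Integration.integral_norm_bound_integral[OF i1, unfolded real_norm_def])
           (use le in simp)
      also have "\<dots> = r / 2" using mass by simp
      finally show ?case using r by simp
    qed
    then show "\<exists>N. \<forall>n\<ge>N. norm ((LINT t|?I. w n t * c t) - c a) < r"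
      unfolding eventually_sequentially .
  qed
  then show ?thesis by (simp add: w_def)
qed

text \<open>
  Test the distributional derivative with smooth approximations of the indicator of \<open>[a,
  b]\<close>. Up to and including the endpoints of \<open>[0, T]\<close> this is possible
  because \<open>c\<close> is continuous there.
\<close>

lemma weak_derivative_increment:
  fixes c g :: "real \<Rightarrow> real"
  assumes c: "continuous_on {0..T} c" and g: "integrable (lebesgue_on {0..T}) g"
    and weak: "\<And>\<psi>. \<psi> \<in> test_functions {0<..<T} \<Longrightarrow>
      (LINT t|lebesgue_on {0..T}. deriv \<psi> t * c t) = - (LINT t|lebesgue_on {0..T}. \<psi> t * g t)"
    and ab: "0 \<le> a" "a \<le> b" "b \<le> T"
  shows "c b - c a = (LINT t|lebesgue_on {0..T}. indicator {a..b} t * g t)"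
proof (cases "a = b")
  case True
  have "AE t in lebesgue. t \<notin> {b}" by (intro AE_not_in) (auto simp: negligible_iff_null_sets[symmetric])
  then have "AE t in lebesgue_on {0..T}. indicator {a..b} t * g t = 0"
    by (subst AE_restrict_space_iff) (auto elim!: eventually_mono simp: True indicator_def)
  then show ?thesis using True integral_eq_zero_AE by (metis diff_self)
next
  case False
  then have lt: "a < b" using ab by simp
  let ?I = "lebesgue_on {0..T}"
  obtain S s where S: "smooth S" "\<And>t. (S has_real_derivative s t) (at t)" "continuous_on UNIV s"
    "\<And>t. 0 \<le> s t" and S0: "\<And>t. t \<le> 0 \<Longrightarrow> S t = 0" and S1: "\<And>t. t \<ge> 1 \<Longrightarrow> S t = 1"
    using smooth_step by metis
  have mono: "S x \<le> S y" if "x \<le> y" for x y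
    using DERIV_nonneg_imp_nondecreasing[of x y S] S that by blast
  have S01: "0 \<le> S t \<and> S t \<le> 1" for t
    using mono[of "min 0 t" t] mono[of t "max 1 t"] S0[of "min 0 t"] S1[of "max 1 t"] by auto
  (* The offsets -1 and 2 let the rise begin at a + 1/n and the fall end at b - 1/n, so the
     support is compact in the open interval even if a = 0 or b = T. *)
  define \<theta> where "\<theta> n t = S (real n * (t - a) + (-1)) - S (real n * (t - b) + 2)" for n t
  have large: "\<forall>\<^sub>F n in sequentially. x \<le> real n * y" if "0 < y" for x y :: real
  proof -
    have "\<forall>\<^sub>F n in sequentially. x / y \<le> real n"
      using filterlim_real_sequentially unfolding filterlim_at_top by blast
    then show ?thesis by eventually_elim (use that in \<open>simp add: field_simps\<close>)
  qed
  have D: "(\<theta> n has_real_derivative real n * s (real n * (t - a) + (-1)) - real n * s (real n * (t - b) + 2)) (at t)" for n t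
  proof -
    have "((\<lambda>t. S (real n * (t - e) + d)) has_real_derivative real n * s (real n * (t - e) + d)) (at t)" for e d
    proof -
      have "((\<lambda>t. real n * (t - e) + d) has_real_derivative real n) (at t)"
        by (auto intro!: derivative_eq_intros)
      from DERIV_chain'[OF this S(2)] show ?thesis by (simp add: mult.commute)
    qed
    then show ?thesis unfolding \<theta>_def by (intro DERIV_diff)
  qed
  have sm: "smooth (\<theta> n)" for n
  proof -
    have "smooth (\<lambda>t. S ((d - real n * e) + real n * t))" for d e
      by (intro smooth_affine S(1) bounded_linear_mult_right)
    from smooth_lincomb[OF this[of "-1" a] this[of 2 b], of 1 "-1"]
    show ?thesis by (simp add: \<theta>_def[abs_def] algebra_simps)
  qed
  have \<theta>_out: "\<theta> n t = 0" if "t \<notin> {a + 1 / n..b - 1 / n}" and n3: "3 \<le> real n * (b - a)" for n t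
  proof -
    have n: "0 < real n" using n3 lt by (cases "n = 0") auto
    have e: "real n * (t - b) = real n * (t - a) - real n * (b - a)" by (simp add: algebra_simps)
    consider "t < a + 1 / n" | "t > b - 1 / n" using \<open>t \<notin> _\<close> by auto
    then show ?thesis
    proof cases
      case 1
      then have "real n * (t - a) < 1" using n by (simp add: field_simps)
      then show ?thesis unfolding \<theta>_def using S0 e n3 by simp
    next
      case 2
      then have "- 1 < real n * (t - b)" using n by (simp add: field_simps)
      then show ?thesis unfolding \<theta>_def using S1 e n3 by simp
    qed
  qed
  have test: "\<theta> n \<in> test_functions {0<..<T}" if n3: "3 \<le> real n * (b - a)" for n
  proof -
    have n: "0 < real n" using n3 lt by (cases "n = 0") auto
    have sub: "closure {t. \<theta> n t \<noteq> 0} \<subseteq> {a + 1 / n..b - 1 / n}"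
    proof (rule closure_minimal)
      show "{t. \<theta> n t \<noteq> 0} \<subseteq> {a + 1 / n..b - 1 / n}" using \<theta>_out[OF _ n3] by blast
    qed simp
    moreover have "{a + 1 / n..b - 1 / n} \<subseteq> {0<..<T}"
    proof
      fix t assume "t \<in> {a + 1 / n..b - 1 / n}"
      moreover have "0 < 1 / real n" using n by simp
      ultimately show "t \<in> {0<..<T}" using ab unfolding atLeastAtMost_iff greaterThanLessThan_iff by linarith
    qed
    ultimately show ?thesis
      using sm compact_closed_subset[OF compact_Icc closed_closure sub] by (auto simp: test_functions_def)
  qed
  have A: "(\<lambda>n. LINT t|?I. (real n * s (real n * (t - a) + (-1))) * c t) \<longlonglongrightarrow> c a"
  proof (rule concentrating_integral[OF S(2,3,4) S0 S1 c])
    show "\<forall>\<^sub>F n in sequentially. 1 \<le> real n * (T - a) + (-1) \<and> real n * (0 - a) + (-1) \<le> 0"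
    proof -
      have "0 < T - a" using lt ab by simp
      from large[OF this, of 2] show ?thesis
      proof eventually_elim
        case (elim n)
        have "real n * (0 - a) \<le> 0" using ab by (simp add: mult_nonneg_nonpos)
        then show ?case using elim by simp
      qed
    qed
  qed (use ab lt in auto)
  have B: "(\<lambda>n. LINT t|?I. (real n * s (real n * (t - b) + 2)) * c t) \<longlonglongrightarrow> c b"
  proof (rule concentrating_integral[OF S(2,3,4) S0 S1 c])
    show "\<forall>\<^sub>F n in sequentially. 1 \<le> real n * (T - b) + 2 \<and> real n * (0 - b) + 2 \<le> 0"
    proof -
      have "0 < b" using lt ab by simp
      from large[OF this, of 2] show ?thesis
      proof eventually_elim
        case (elim n)
        have "0 \<le> real n * (T - b)" using ab by simp
        then show ?case using elim by simp
      qed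
    qed
  qed (use ab lt in auto)
  have wi: "integrable ?I (\<lambda>t. (real n * s (real n * (t - e) + d)) * c t)" for n e d
    by (intro interval_continuous(1) continuous_intros c continuous_on_compose2[OF S(3)]) auto
  have L: "(LINT t|?I. deriv (\<theta> n) t * c t)
      = (LINT t|?I. (real n * s (real n * (t - a) + (-1))) * c t) - (LINT t|?I. (real n * s (real n * (t - b) + 2)) * c t)" for n
    unfolding DERIV_imp_deriv[OF D] left_diff_distrib
    by (rule Bochner_Integration.integral_diff[OF wi wi])
  have lim1: "(\<lambda>n. LINT t|?I. deriv (\<theta> n) t * c t) \<longlonglongrightarrow> c a - c b"
    unfolding L by (intro tendsto_diff A B)
  have gm [measurable]: "g \<in> borel_measurable ?I" using g by auto
  have [measurable]: "\<theta> n \<in> borel_measurable ?I" for n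
    by (intro measurable_restrict_space1 measurable_completion)
       (use borel_measurable_continuous_onI[OF smooth_continuous[OF sm]] in simp)
  have lim2: "(\<lambda>n. LINT t|?I. \<theta> n t * g t) \<longlonglongrightarrow> (LINT t|?I. indicator {a<..<b} t * g t)"
  proof (rule integral_dominated_convergence[where w = "\<lambda>t. \<bar>g t\<bar>"])
    have "(\<lambda>n. \<theta> n t) \<longlonglongrightarrow> indicator {a<..<b} t" for t
    proof -
      consider "t \<le> a" | "a < t" "t < b" | "t \<ge> b" by linarith
      then have "\<forall>\<^sub>F n in sequentially. \<theta> n t = indicator {a<..<b} t"
      proof cases
        case 1
        then have "0 < b - t" using lt by simp
        from large[OF this, of 2] show ?thesis
        proof eventually_elim
          case (elim n)
          have "real n * (t - a) \<le> 0" using 1 by (simp add: mult_nonneg_nonpos)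
          moreover have "real n * (t - b) + 2 \<le> 0" using elim by (simp add: algebra_simps)
          ultimately show ?case using 1 S0 by (simp add: \<theta>_def)
        qed
      next
        case 2
        then have "0 < b - t" "0 < t - a" by simp_all
        from eventually_conj[OF large[OF this(1), of 2] large[OF this(2), of 2]] show ?thesis
        proof eventually_elim
          case (elim n)
          have "real n * (t - b) + 2 \<le> 0" using elim by (simp add: algebra_simps)
          then show ?case using 2 S0 S1 elim by (simp add: \<theta>_def)
        qed
      next
        case 3
        then have "0 < t - a" using lt by simp
        from large[OF this, of 2] show ?thesis
        proof eventually_elim
          case (elim n)
          have "0 \<le> real n * (t - b)" using 3 by simp
          then show ?case using 3 S1 elim by (simp add: \<theta>_def)
        qed
      qed
      then show ?thesis by (rule tendsto_eventually)
    qed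
    then show "AE t in ?I. (\<lambda>n. \<theta> n t * g t) \<longlonglongrightarrow> indicator {a<..<b} t * g t"
      by (intro AE_I2 tendsto_intros)
    have "\<bar>\<theta> n t\<bar> \<le> 1" for n t
      unfolding \<theta>_def using S01[of "real n * (t - a) + (-1)"] S01[of "real n * (t - b) + 2"] by linarith
    then show "AE t in ?I. norm (\<theta> n t * g t) \<le> \<bar>g t\<bar>" for n
      by (simp add: abs_mult mult_left_le_one_le)
    have [measurable]: "{a<..<b} \<in> sets ?I" using ab by (subst sets_restrict_space_iff) auto
    show "(\<lambda>t. indicator {a<..<b} t * g t) \<in> borel_measurable ?I" by measurable
  qed (use g in auto)
  have "\<forall>\<^sub>F n in sequentially. (LINT t|?I. deriv (\<theta> n) t * c t) = - (LINT t|?I. \<theta> n t * g t)"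
    using large[of "b - a" 3] lt by (auto elim!: eventually_mono intro!: weak test)
  with lim1 have "(\<lambda>n. - (LINT t|?I. \<theta> n t * g t)) \<longlonglongrightarrow> c a - c b"
    by (rule Lim_transform_eventually)
  from LIMSEQ_unique[OF this tendsto_minus[OF lim2]]
  have "c b - c a = (LINT t|?I. indicator {a<..<b} t * g t)" by simp
  also have "\<dots> = (LINT t|?I. indicator {a..b} t * g t)"
  proof (rule integral_cong_AE)
    have "AE t in lebesgue. t \<notin> {a, b}" by (intro AE_not_in) (auto simp: negligible_iff_null_sets[symmetric])
    then have "AE t in lebesgue. t \<in> {0..T} \<longrightarrow> indicator {a<..<b} t * g t = indicator {a..b} t * g t"
      by eventually_elim (auto simp: indicator_def)
    then show "AE t in ?I. indicator {a<..<b} t * g t = indicator {a..b} t * g t"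
      by (subst AE_restrict_space_iff) simp_all
    have [measurable]: "{a<..<b} \<in> sets ?I" "{a..b} \<in> sets ?I"
      using ab by (subst sets_restrict_space_iff; auto)+
    show "(\<lambda>t. indicator {a<..<b} t * g t) \<in> borel_measurable ?I"
      "(\<lambda>t. indicator {a..b} t * g t) \<in> borel_measurable ?I" by measurable
  qed
  finally show ?thesis .
qed

context planar_domain
begin

section \<open>Evolutions with an energy bound\<close>

lemma V_dual_linear: "F \<in> V_dual \<Omega> \<Longrightarrow> linear_on_V F"
  unfolding V_dual_def linear_on_V_def by blast

lemma V_dual_bdd_above:
  assumes F: "F \<in> V_dual \<Omega>"
  shows "bdd_above ((\<lambda>v. \<bar>F v\<bar>) ` {v \<in> V_space \<Omega>. V_norm \<Omega> v \<le> 1})"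
proof -
  obtain C where C: "\<And>v. v \<in> V_space \<Omega> \<Longrightarrow> \<bar>F v\<bar> \<le> C * V_norm \<Omega> v"
    using F unfolding V_dual_def by blast
  show ?thesis
  proof (rule bdd_aboveI2)
    fix v assume "v \<in> {v \<in> V_space \<Omega>. V_norm \<Omega> v \<le> 1}"
    then have v: "v \<in> V_space \<Omega>" "V_norm \<Omega> v \<le> 1" by auto
    have "\<bar>F v\<bar> \<le> C * V_norm \<Omega> v" by (rule C[OF v(1)])
    also have "\<dots> \<le> \<bar>C\<bar> * 1" by (intro mult_mono v) simp_all
    finally show "\<bar>F v\<bar> \<le> \<bar>C\<bar> * 1" .
  qed
qed

lemma V_dual_bound:
  assumes F: "F \<in> V_dual \<Omega>" and v: "v \<in> V_space \<Omega>"
  shows "\<bar>F v\<bar> \<le> V_dual_norm \<Omega> F * V_norm \<Omega> v"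
proof -
  obtain C where C: "\<And>v. v \<in> V_space \<Omega> \<Longrightarrow> \<bar>F v\<bar> \<le> C * V_norm \<Omega> v"
    using F unfolding V_dual_def by blast
  show ?thesis
  proof (cases "V_norm \<Omega> v = 0")
    case True
    then show ?thesis using C[OF v] by simp
  next
    case False
    then have pos: "0 < V_norm \<Omega> v" using V_norm_nonneg[of v] by linarith
    let ?c = "1 / V_norm \<Omega> v"
    have "(\<lambda>x. ?c *\<^sub>R v x) \<in> {v \<in> V_space \<Omega>. V_norm \<Omega> v \<le> 1}"
      using V_scale[OF v] V_norm_scale[OF v] pos by simp
    then have "\<bar>F (\<lambda>x. ?c *\<^sub>R v x)\<bar> \<le> V_dual_norm \<Omega> F"
      unfolding V_dual_norm_def by (rule cSUP_upper[OF _ V_dual_bdd_above[OF F]])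
    moreover have "F (\<lambda>x. ?c *\<^sub>R v x) = ?c * F v"
      by (rule linear_on_VD(2)[OF V_dual_linear[OF F] v v])
    ultimately show ?thesis using pos by (simp add: abs_mult field_simps)
  qed
qed

lemma V_dual_norm_nonneg:
  assumes "F \<in> V_dual \<Omega>" shows "0 \<le> V_dual_norm \<Omega> F"
proof -
  have "(\<lambda>x. 0) \<in> {v \<in> V_space \<Omega>. V_norm \<Omega> v \<le> 1}"
    using zero_V V_norm_scale[OF zero_V, of 0] by simp
  from cSUP_upper[OF this V_dual_bdd_above[OF assms]] show ?thesis
    unfolding V_dual_norm_def by (rule order_trans[OF abs_ge_zero])
qed

lemma V_dual_minus:
  assumes "F \<in> V_dual \<Omega>" "G \<in> V_dual \<Omega>"
  shows "F - G \<in> V_dual \<Omega>"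
proof -
  obtain C where C: "\<And>v. v \<in> V_space \<Omega> \<Longrightarrow> \<bar>F v\<bar> \<le> C * V_norm \<Omega> v"
    using assms(1) unfolding V_dual_def by blast
  obtain C' where C': "\<And>v. v \<in> V_space \<Omega> \<Longrightarrow> \<bar>G v\<bar> \<le> C' * V_norm \<Omega> v"
    using assms(2) unfolding V_dual_def by blast
  have "\<bar>(F - G) v\<bar> \<le> (C + C') * V_norm \<Omega> v" if "v \<in> V_space \<Omega>" for v
    using C[OF that] C'[OF that] by (simp add: distrib_right)
  moreover have "(F - G) (\<lambda>x. a *\<^sub>R u x + b *\<^sub>R v x) = a * (F - G) u + b * (F - G) v"
    if "u \<in> V_space \<Omega>" "v \<in> V_space \<Omega>" for u v a b
    using V_dual_linear[OF assms(1)] V_dual_linear[OF assms(2)] that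
    by (simp add: linear_on_V_def algebra_simps)
  ultimately show ?thesis unfolding V_dual_def by blast
qed

lemma le_one_plus_powr:
  fixes x q :: real
  assumes "1 \<le> q" shows "x \<le> 1 + x powr q"
proof (cases "x \<le> 1")
  case True
  then show ?thesis using powr_ge_zero[of x q] by linarith
next
  case False
  then show ?thesis using powr_mono[OF assms, of x] by simp
qed

lemma dual_pairing_integrable:
  assumes F: "F \<in> Bochner_Lp q T (V_dual \<Omega>) (V_dual_norm \<Omega>)" and q: "1 \<le> q" and v: "v \<in> V_space \<Omega>"
  shows "integrable (lebesgue_on {0..T}) (\<lambda>s. F s v)"
proof -
  interpret I: finite_measure "lebesgue_on {0..T}" by (rule finite_measure_interval)
  have F': "strongly_measurable T (V_dual \<Omega>) (V_dual_norm \<Omega>) F" "AE s in lebesgue_on {0..T}. F s \<in> V_dual \<Omega>"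
    "integrable (lebesgue_on {0..T}) (\<lambda>s. V_dual_norm \<Omega> (F s) powr q)"
    using F by (auto simp: Bochner_Lp_def)
  have m: "(\<lambda>s. F s v) \<in> borel_measurable (lebesgue_on {0..T})"
  proof (rule strongly_measurable_compose[OF F'(1,2), where \<Phi> = "\<lambda>F. F v"])
    fix G Gs assume G: "G \<in> V_dual \<Omega>" "\<And>n. Gs n \<in> V_dual \<Omega>" and l: "(\<lambda>n::nat. V_dual_norm \<Omega> (G - Gs n)) \<longlonglongrightarrow> 0"
    have "(\<lambda>n. V_dual_norm \<Omega> (G - Gs n) * V_norm \<Omega> v) \<longlonglongrightarrow> 0" using tendsto_mult[OF l tendsto_const] by simp
    then have "(\<lambda>n. G v - Gs n v) \<longlonglongrightarrow> 0"
      by (rule Lim_null_comparison[rotated]) (use V_dual_bound[OF V_dual_minus[OF G] v] in \<open>simp\<close>)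
    from tendsto_diff[OF tendsto_const[of "G v"] this] show "(\<lambda>n. Gs n v) \<longlonglongrightarrow> G v" by simp
  qed
  have b: "integrable (lebesgue_on {0..T}) (\<lambda>s. (1 + V_dual_norm \<Omega> (F s) powr q) * V_norm \<Omega> v)"
    using F'(3) by simp
  show ?thesis
  proof (rule Bochner_Integration.integrable_bound[OF b m])
    show "AE s in lebesgue_on {0..T}. norm (F s v) \<le> norm ((1 + V_dual_norm \<Omega> (F s) powr q) * V_norm \<Omega> v)"
      using F'(2)
    proof eventually_elim
      case (elim s)
      have "\<bar>F s v\<bar> \<le> V_dual_norm \<Omega> (F s) * V_norm \<Omega> v" by (rule V_dual_bound[OF elim v])
      also have "\<dots> \<le> (1 + V_dual_norm \<Omega> (F s) powr q) * V_norm \<Omega> v"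
        by (intro mult_right_mono le_one_plus_powr q) simp
      finally show ?case by simp
    qed
  qed
qed

lemma H_norm_alt: "H_norm \<Omega> u = L2norm M u"
  by (simp add: H_norm_def Lp_norm2)

lemma continuous_in_sequence:
  assumes u: "u \<in> continuous_in T (H_space \<Omega>) (H_norm \<Omega>)"
    and x: "x \<in> {0..T}" "\<And>n. xs n \<in> {0..T}" "xs \<longlonglongrightarrow> x"
  shows "(\<lambda>n::nat. L2norm M (\<lambda>y. u x y - u (xs n) y)) \<longlonglongrightarrow> 0"
proof -
  let ?f = "\<lambda>s. H_norm \<Omega> (u s - u x)"
  have z: "?f x = 0" by (simp add: H_norm_alt L2norm_def)
  have "(?f \<longlongrightarrow> ?f x) (at x within {0..T})"
    unfolding z using u x(1) by (simp add: continuous_in_def)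
  then have "continuous (at x within {0..T}) ?f" by (simp add: continuous_within)
  from continuous_within_tendsto_compose'[OF this x(2) x(3)]
  have "(\<lambda>n. ?f (xs n)) \<longlonglongrightarrow> 0" using z by simp
  then show ?thesis by (simp add: H_norm_alt L2norm_def norm_minus_commute)
qed

lemma continuous_in_H: "u \<in> continuous_in T (H_space \<Omega>) N \<Longrightarrow> t \<in> {0..T} \<Longrightarrow> u t \<in> H_space \<Omega>"
  by (simp add: continuous_in_def)

lemma H_inner_continuous:
  assumes u: "u \<in> continuous_in T (H_space \<Omega>) (H_norm \<Omega>)" and v: "v \<in> continuous_in T (H_space \<Omega>) (H_norm \<Omega>)"
    and f: "continuous_on S f" "f ` S \<subseteq> {0..T}" and g: "continuous_on S g" "g ` S \<subseteq> {0..T}"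
  shows "continuous_on S (\<lambda>t :: real. H_inner \<Omega> (u (f t)) (v (g t)))"
  unfolding continuous_on_sequentially comp_def
proof (intro allI ballI impI, elim conjE)
  fix x a assume x: "\<forall>n. x n \<in> S" "x \<longlonglongrightarrow> a" and a: "a \<in> S"
  have fx: "(\<lambda>n. f (x n)) \<longlonglongrightarrow> f a" and gx: "(\<lambda>n. g (x n)) \<longlonglongrightarrow> g a"
    using f(1) g(1) x a unfolding continuous_on_sequentially comp_def by blast+
  have m: "f a \<in> {0..T}" "g a \<in> {0..T}" "f (x n) \<in> {0..T}" "g (x n) \<in> {0..T}" for n
    using f(2) g(2) x(1) a by blast+
  show "(\<lambda>n. H_inner \<Omega> (u (f (x n))) (v (g (x n)))) \<longlonglongrightarrow> H_inner \<Omega> (u (f a)) (v (g a))"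
    unfolding H_inner_def
    by (rule L2_tendsto_inner[OF H_sq_integrable[OF continuous_in_H[OF u m(3)]] H_sq_integrable[OF continuous_in_H[OF u m(1)]]
          H_sq_integrable[OF continuous_in_H[OF v m(4)]] H_sq_integrable[OF continuous_in_H[OF v m(2)]]
          continuous_in_sequence[OF u m(1) m(3) fx] continuous_in_sequence[OF v m(2) m(4) gx]])
qed

lemma constant_continuous_in: "v \<in> H_space \<Omega> \<Longrightarrow> (\<lambda>_. v) \<in> continuous_in T (H_space \<Omega>) (H_norm \<Omega>)"
  by (simp add: continuous_in_def H_norm_alt L2norm_def)

lemma H_norm_square: "(H_norm \<Omega> u)\<^sup>2 = H_inner \<Omega> u u"
  by (simp add: H_norm_alt L2norm_power2 H_inner_def power2_norm_eq_inner)

lemma continuous_in_bounded: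
  assumes u: "u \<in> continuous_in T (H_space \<Omega>) (H_norm \<Omega>)"
  obtains B where "0 \<le> B" "\<And>t. t \<in> {0..T} \<Longrightarrow> (L2norm M (u t))\<^sup>2 \<le> B"
proof -
  have "continuous_on {0..T} (\<lambda>t. H_inner \<Omega> (u t) (u t))"
    by (rule H_inner_continuous[OF u u]) (auto intro: continuous_intros)
  then have "bounded ((\<lambda>t. H_inner \<Omega> (u t) (u t)) ` {0..T})"
    by (intro compact_imp_bounded compact_continuous_image) simp_all
  then obtain B where B: "\<And>t. t \<in> {0..T} \<Longrightarrow> \<bar>H_inner \<Omega> (u t) (u t)\<bar> \<le> B"
    unfolding bounded_iff by (metis (no_types) imageI real_norm_def)
  have "(L2norm M (u t))\<^sup>2 \<le> \<bar>B\<bar>" if "t \<in> {0..T}" for t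
    using B[OF that] H_norm_square[of "u t"] by (simp add: H_norm_alt)
  then show thesis by (intro that[of "\<bar>B\<bar>"]) auto
qed

text \<open>
  By Ladyzhenskaya's inequality the fourth power of the \<open>L\<^sup>4\<close>-norm is at most
  \<open>8 \<bar>u\<bar>\<^sub>2\<^sup>2 \<bar>\<nabla>u\<bar>\<^sub>2\<^sup>2\<close>, where
  \<open>\<bar>u\<bar>\<^sub>2\<close> is bounded in time.
\<close>

lemma energy_integrable:
  assumes u: "u \<in> continuous_in T (H_space \<Omega>) (H_norm \<Omega>)"
    and v: "u \<in> Bochner_Lp 2 T (V_space \<Omega>) (V_norm \<Omega>)"
  shows "integrable (lebesgue_on {0..T}) (\<lambda>t. energy (u t))"
proof -
  have v': "strongly_measurable T (V_space \<Omega>) (V_norm \<Omega>) u" "AE t in lebesgue_on {0..T}. u t \<in> V_space \<Omega>"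
    "integrable (lebesgue_on {0..T}) (\<lambda>t. (V_norm \<Omega> (u t))\<^sup>2)"
    using v by (simp_all add: Bochner_Lp_def)
  obtain B where B: "0 \<le> B" "\<And>t. t \<in> {0..T} \<Longrightarrow> (L2norm M (u t))\<^sup>2 \<le> B"
    by (rule continuous_in_bounded[OF u], rule that)
  have m: "(\<lambda>t. energy (u t)) \<in> borel_measurable (lebesgue_on {0..T})"
    by (rule strongly_measurable_compose[OF v'(1,2) energy_tendsto(1)])
  have b: "integrable (lebesgue_on {0..T}) (\<lambda>t. (1 + 8 * B) * (V_norm \<Omega> (u t))\<^sup>2)"
    using v'(3) by simp
  have i: "AE t in lebesgue_on {0..T}. t \<in> {0..T}" by (rule AE_I2) simp
  show ?thesis
  proof (rule Bochner_Integration.integrable_bound[OF b m])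
    show "AE t in lebesgue_on {0..T}. norm (energy (u t)) \<le> norm ((1 + 8 * B) * (V_norm \<Omega> (u t))\<^sup>2)"
      using v'(2) i
    proof eventually_elim
      case (elim t)
      have "energy (u t) \<le> (V_norm \<Omega> (u t))\<^sup>2 + 8 * (L2norm M (u t))\<^sup>2 * (V_norm \<Omega> (u t))\<^sup>2"
        unfolding energy_def by (intro add_left_mono V_inequalities(3) elim)
      also have "\<dots> \<le> (V_norm \<Omega> (u t))\<^sup>2 + 8 * B * (V_norm \<Omega> (u t))\<^sup>2"
        by (intro add_left_mono mult_right_mono mult_left_mono B(2) elim) simp_all
      also have "\<dots> = (1 + 8 * B) * (V_norm \<Omega> (u t))\<^sup>2" by (simp add: distrib_right)
      finally show ?case using B(1) by simp
    qed
  qed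
qed

text \<open>
  Redefine the function as zero on a null set of times, so that the approximation holds at every
  time.
\<close>

lemma everywhere_representative:
  assumes u: "strongly_measurable T (V_space \<Omega>) (V_norm \<Omega>) u" "AE t in lebesgue_on {0..T}. u t \<in> V_space \<Omega>"
  obtains p s where "AE t in lebesgue_on {0..T}. p t = u t" "\<And>t. t \<in> {0..T} \<Longrightarrow> p t \<in> V_space \<Omega>"
    "\<And>n. simple_function (lebesgue_on {0..T}) (s n)" "\<And>n t. t \<in> {0..T} \<Longrightarrow> s n t \<in> V_space \<Omega>"
    "\<And>t. t \<in> {0..T} \<Longrightarrow> (\<lambda>n::nat. V_norm \<Omega> (p t - s n t)) \<longlonglongrightarrow> 0"
proof -
  let ?I = "lebesgue_on {0..T}"
  obtain r where r: "\<And>n. simple_function ?I (r n)" "\<And>n. r n ` {0..T} \<subseteq> V_space \<Omega>"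
    "AE t in ?I. (\<lambda>n::nat. V_norm \<Omega> (u t - r n t)) \<longlonglongrightarrow> 0"
    using u(1) unfolding strongly_measurable_def by blast
  have "AE t in ?I. u t \<in> V_space \<Omega> \<and> (\<lambda>n::nat. V_norm \<Omega> (u t - r n t)) \<longlonglongrightarrow> 0"
    using u(2) r(3) by eventually_elim simp
  then obtain N where N: "N \<in> null_sets ?I"
    "\<And>t. t \<in> space ?I - N \<Longrightarrow> u t \<in> V_space \<Omega> \<and> (\<lambda>n::nat. V_norm \<Omega> (u t - r n t)) \<longlonglongrightarrow> 0"
    by (elim AE_E3) blast
  define p where "p t = (if t \<in> N then (\<lambda>x. 0) else u t)" for t
  define s where "s n t = (if t \<in> N then (\<lambda>x. 0) else r n t)" for n t
  show thesis
  proof (rule that)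
    show "AE t in ?I. p t = u t" using AE_not_in[OF N(1)] by eventually_elim (simp add: p_def)
    show "p t \<in> V_space \<Omega>" if "t \<in> {0..T}" for t using N(2)[of t] that zero_V by (auto simp: p_def)
    show "simple_function ?I (s n)" for n
      unfolding s_def by (rule simple_function_If_set[OF simple_function_const r(1)]) (use N(1) in auto)
    show "s n t \<in> V_space \<Omega>" if "t \<in> {0..T}" for n t using r(2)[of n] that zero_V by (auto simp: s_def)
    show "(\<lambda>n. V_norm \<Omega> (p t - s n t)) \<longlonglongrightarrow> 0" if "t \<in> {0..T}" for t
    proof (cases "t \<in> N")
      case True
      have "(\<lambda>x :: plane. 0 :: real^2) - (\<lambda>x. 0) = (\<lambda>x. 0)" by (simp add: fun_eq_iff)
      moreover have "V_norm \<Omega> (\<lambda>x. 0) = 0" using V_norm_scale[OF zero_V, of 0] by simp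
      ultimately show ?thesis using True by (simp add: p_def s_def)
    next
      case False
      then show ?thesis using N(2)[of t] that by (simp add: p_def s_def)
    qed
  qed
qed

text \<open>
  A function of time with a weak time derivative \<open>F\<close>. The last condition is the
  property of \<open>F\<close> that solutions of the state and of the adjoint equation get from
  the equation, beyond the integrability of \<open>F\<close> as a function with values in
  \<open>V'\<close>; it makes the pairing of \<open>F\<close> with functions in \<open>C(0,T;H)
  \<inter> L\<^sup>2(0,T;V)\<close> integrable.
\<close>

definition evolution :: "real \<Rightarrow> (real \<Rightarrow> vfield) \<Rightarrow> (real \<Rightarrow> functional) \<Rightarrow> bool" where
  "evolution T u F \<longleftrightarrow> u \<in> continuous_in T (H_space \<Omega>) (H_norm \<Omega>) \<and>
     u \<in> Bochner_Lp 2 T (V_space \<Omega>) (V_norm \<Omega>) \<and>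
     F \<in> Bochner_Lp (4/3) T (V_dual \<Omega>) (V_dual_norm \<Omega>) \<and> has_time_deriv \<Omega> T u F \<and>
     (\<exists>A K. integrable (lebesgue_on {0..T}) A \<and> (\<forall>s. 0 \<le> A s) \<and> 0 \<le> K \<and>
        (AE s in lebesgue_on {0..T}. \<forall>v\<in>V_space \<Omega>. \<bar>F s v\<bar> \<le> A s + K * energy v))"

lemma evolution_increment:
  assumes e: "evolution T u F" and v: "v \<in> V_space \<Omega>" and ab: "0 \<le> a" "a \<le> b" "b \<le> T"
  shows "H_inner \<Omega> (u b) v - H_inner \<Omega> (u a) v = (LINT s|lebesgue_on {0..T}. indicator {a..b} s * F s v)"
proof (rule weak_derivative_increment[OF _ _ _ ab])
  have u: "u \<in> continuous_in T (H_space \<Omega>) (H_norm \<Omega>)" and td: "has_time_deriv \<Omega> T u F"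
    and F: "F \<in> Bochner_Lp (4/3) T (V_dual \<Omega>) (V_dual_norm \<Omega>)"
    using e by (simp_all add: evolution_def)
  show "continuous_on {0..T} (\<lambda>t. H_inner \<Omega> (u t) v)"
    using H_inner_continuous[OF u constant_continuous_in[OF V_H[OF v]], of "{0..T}" "\<lambda>t. t" "\<lambda>t. t"] by simp
  show "integrable (lebesgue_on {0..T}) (\<lambda>s. F s v)" by (rule dual_pairing_integrable[OF F _ v]) simp
  show "(LINT t|lebesgue_on {0..T}. deriv \<psi> t * H_inner \<Omega> (u t) v) = - (LINT t|lebesgue_on {0..T}. \<psi> t * F t v)"
    if "\<psi> \<in> test_functions {0<..<T}" for \<psi>
    using td that v by (simp add: has_time_deriv_def)
qed

text \<open>
  The convergence result for pairings requires linearity and bounds at every time, so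
  \<open>F\<close> and \<open>p\<close> are first changed on null sets.
\<close>

lemma evolution_pairing:
  assumes dw: "diagonal_weights T \<rho>" and e: "evolution T u F"
    and p: "p \<in> continuous_in T (H_space \<Omega>) (H_norm \<Omega>)" "p \<in> Bochner_Lp 2 T (V_space \<Omega>) (V_norm \<Omega>)"
  shows "integrable (lebesgue_on {0..T}) (\<lambda>t. F t (p t))"
    "(\<lambda>n. LINT t|lebesgue_on {0..T}. LINT s|lebesgue_on {0..T}. \<rho> n s t * F s (p t))
      \<longlonglongrightarrow> (LINT t|lebesgue_on {0..T}. F t (p t))"
proof -
  interpret D: diagonal_weights T \<rho> by (rule dw)
  let ?I = "lebesgue_on {0..T}"
  obtain A K where A: "integrable ?I A" "\<And>s. 0 \<le> A s" and K: "0 \<le> K"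
    and bd: "AE s in ?I. \<forall>v\<in>V_space \<Omega>. \<bar>F s v\<bar> \<le> A s + K * energy v"
    and F: "F \<in> Bochner_Lp (4/3) T (V_dual \<Omega>) (V_dual_norm \<Omega>)"
    using e unfolding evolution_def by blast
  have p': "strongly_measurable T (V_space \<Omega>) (V_norm \<Omega>) p" "AE t in ?I. p t \<in> V_space \<Omega>"
    using p(2) by (simp_all add: Bochner_Lp_def)
  obtain q s where q: "AE t in ?I. q t = p t" "\<And>t. t \<in> {0..T} \<Longrightarrow> q t \<in> V_space \<Omega>"
    "\<And>n. simple_function ?I (s n)" "\<And>n t. t \<in> {0..T} \<Longrightarrow> s n t \<in> V_space \<Omega>"
    "\<And>t. t \<in> {0..T} \<Longrightarrow> (\<lambda>n::nat. V_norm \<Omega> (q t - s n t)) \<longlonglongrightarrow> 0"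
    by (rule everywhere_representative[OF p'], rule that)
  have FV: "AE s in ?I. F s \<in> V_dual \<Omega>" using F by (simp add: Bochner_Lp_def)
  have "AE s in ?I. F s \<in> V_dual \<Omega> \<and> (\<forall>v\<in>V_space \<Omega>. \<bar>F s v\<bar> \<le> A s + K * energy v)"
    using FV bd by eventually_elim simp
  then obtain N where N: "N \<in> null_sets ?I"
    "\<And>s. s \<in> space ?I - N \<Longrightarrow> F s \<in> V_dual \<Omega> \<and> (\<forall>v\<in>V_space \<Omega>. \<bar>F s v\<bar> \<le> A s + K * energy v)"
    by (elim AE_E3) blast
  define G where "G s v = (if s \<in> N then 0 else F s v)" for s v
  have GF: "AE s in ?I. \<forall>v. G s v = F s v"
    using AE_not_in[OF N(1)] by eventually_elim (simp add: G_def)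
  have Nm [measurable]: "N \<in> sets ?I" using N(1) by auto
  have Gm: "(\<lambda>s. G s v) \<in> borel_measurable ?I" if [measurable]: "(\<lambda>s. F s v) \<in> borel_measurable ?I" for v
    unfolding G_def by measurable
  have Gi: "integrable ?I (\<lambda>s. G s v)" if v: "v \<in> V_space \<Omega>" for v
  proof -
    have Fi: "integrable ?I (\<lambda>s. F s v)" by (rule dual_pairing_integrable[OF F _ v]) simp
    show ?thesis
      by (rule Bochner_Integration.integrable_bound[OF Fi Gm]) (use Fi in \<open>auto simp: G_def\<close>)
  qed
  have qi: "integrable ?I (\<lambda>t. energy (q t))"
  proof -
    have pe: "integrable ?I (\<lambda>t. energy (p t))" by (rule energy_integrable[OF p])
    have m: "(\<lambda>t. energy (q t)) \<in> borel_measurable ?I"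
    proof (rule borel_measurable_LIMSEQ_real)
      show "(\<lambda>t. energy (s n t)) \<in> borel_measurable ?I" for n
        by (rule borel_measurable_simple_function[OF simple_function_compose1[OF q(3)]])
      show "(\<lambda>n. energy (s n t)) \<longlonglongrightarrow> energy (q t)" if "t \<in> space ?I" for t
        by (rule energy_tendsto(1)) (use that q(2,4,5) in auto)
    qed
    show ?thesis
      by (rule Bochner_Integration.integrable_bound[OF pe m]) (use q(1) in \<open>auto elim!: eventually_mono\<close>)
  qed
  have dc: "D.diagonal_convergent (\<lambda>s t. G s (q t))"
  proof (rule pairing_diagonal[OF dw _ Gi _ A K q(2-5) qi])
    show "linear_on_V (G s)" if "s \<in> {0..T}" for s
      using N(2)[of s] that V_dual_linear[of "F s"] by (auto simp: G_def linear_on_V_def)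
    show "\<bar>G s v\<bar> \<le> A s + K * energy v" if "s \<in> {0..T}" "v \<in> V_space \<Omega>" for s v
      using N(2)[of s] that A(2)[of s] K by (auto simp: G_def)
  qed
  then obtain A' Q' where dom: "D.dominated (\<lambda>s t. G s (q t)) A' Q'"
    by (auto simp: D.diagonal_convergent_def)
  have Gdi: "integrable ?I (\<lambda>t. G t (q t))" by (rule D.dominated_average(3)[OF dom])
  have tq: "AE t in ?I. G t (q t) = F t (p t)"
    using GF q(1) by eventually_elim simp
  have Fm: "(\<lambda>t. F t (p t)) \<in> borel_measurable ?I"
  proof (rule lebesgue_on_AE_limit)
    show "(\<lambda>t. G t (q t)) \<in> borel_measurable ?I" for n :: nat using Gdi by auto
    show "AE t in ?I. (\<lambda>n::nat. G t (q t)) \<longlonglongrightarrow> F t (p t)" using tq by eventually_elim simp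
  qed simp
  show "integrable ?I (\<lambda>t. F t (p t))"
    by (rule integrable_cong_AE_imp[OF Gdi Fm]) (use tq in \<open>auto elim!: eventually_mono\<close>)
  have lim_eq: "(LINT t|?I. G t (q t)) = (LINT t|?I. F t (p t))"
    by (rule integral_cong_AE[OF _ Fm tq]) (use Gdi in auto)
  have avg: "D.average n (\<lambda>s t. G s (q t)) = (LINT t|?I. LINT s|?I. \<rho> n s t * F s (p t))" for n
  proof -
    have i: "integrable (?I \<Otimes>\<^sub>M ?I) (\<lambda>(s, t). \<rho> n s t * G s (q t))"
      using D.dominated_average(1)[OF dom, of n] by (simp add: split_def)
    have "D.average n (\<lambda>s t. G s (q t)) = (LINT t|?I. LINT s|?I. \<rho> n s t * G s (q t))"
      unfolding D.average_def using D.P.integral_snd[OF i] by (simp add: split_def)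
    also have "\<dots> = (LINT t|?I. LINT s|?I. \<rho> n s t * F s (p t))"
    proof (rule integral_cong_AE)
      show m1: "(\<lambda>t. LINT s|?I. \<rho> n s t * G s (q t)) \<in> borel_measurable ?I"
        using D.P.integrable_snd[OF i] by (auto simp: split_def)
      have inner: "AE t in ?I. (LINT s|?I. \<rho> n s t * G s (q t)) = (LINT s|?I. \<rho> n s t * F s (p t))"
      proof -
        have "AE t in ?I. t \<in> {0..T}" by (rule AE_I2) simp
        with q(1) show ?thesis
        proof eventually_elim
          case (elim t)
          have v: "p t \<in> V_space \<Omega>" using elim q(2)[of t] by simp
          have [measurable]: "(\<lambda>s. F s (p t)) \<in> borel_measurable ?I"
            using dual_pairing_integrable[OF F _ v] by auto
          have "(\<lambda>s. (s, t)) \<in> ?I \<rightarrow>\<^sub>M ?I \<Otimes>\<^sub>M ?I" using elim by simp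
          from measurable_compose[OF this D.weight_measurable[of n]]
          have [measurable]: "(\<lambda>s. \<rho> n s t) \<in> borel_measurable ?I" by simp
          have [measurable]: "(\<lambda>s. G s (p t)) \<in> borel_measurable ?I" by (rule Gm) measurable
          have "(LINT s|?I. \<rho> n s t * G s (p t)) = (LINT s|?I. \<rho> n s t * F s (p t))"
            by (rule integral_cong_AE) (use GF in \<open>auto elim!: eventually_mono\<close>)
          then show ?case using elim by simp
        qed
      qed
      then show "AE t in ?I. (LINT s|?I. \<rho> n s t * G s (q t)) = (LINT s|?I. \<rho> n s t * F s (p t))" .
      show "(\<lambda>t. LINT s|?I. \<rho> n s t * F s (p t)) \<in> borel_measurable ?I"
      proof (rule lebesgue_on_AE_limit)
        show "(\<lambda>t. LINT s|?I. \<rho> n s t * G s (q t)) \<in> borel_measurable ?I" for m :: nat by (rule m1)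
        show "AE t in ?I. (\<lambda>m::nat. LINT s|?I. \<rho> n s t * G s (q t)) \<longlonglongrightarrow> (LINT s|?I. \<rho> n s t * F s (p t))"
          using inner by eventually_elim simp
      qed simp
    qed
    finally show ?thesis .
  qed
  show "(\<lambda>n. LINT t|?I. LINT s|?I. \<rho> n s t * F s (p t)) \<longlonglongrightarrow> (LINT t|?I. F t (p t))"
    using dc unfolding D.diagonal_convergent_def avg lim_eq by simp
qed

end

section \<open>Integration by parts in time\<close>

lemma lebesgue_on_integral_cong_AE:
  fixes f g :: "real \<Rightarrow> real"
  assumes f: "f \<in> borel_measurable (lebesgue_on {a..b})" and ae: "AE t in lebesgue_on {a..b}. f t = g t"
  shows "(LINT t|lebesgue_on {a..b}. f t) = (LINT t|lebesgue_on {a..b}. g t)"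
proof (rule integral_cong_AE[OF f _ ae])
  show "g \<in> borel_measurable (lebesgue_on {a..b})"
  proof (rule lebesgue_on_AE_limit)
    show "f \<in> borel_measurable (lebesgue_on {a..b})" for n :: nat by (rule f)
    show "AE t in lebesgue_on {a..b}. (\<lambda>n::nat. f t) \<longlonglongrightarrow> g t" using ae by eventually_elim simp
  qed simp
qed

lemma subinterval_integral:
  fixes k :: "real \<Rightarrow> real"
  assumes k: "continuous_on {a..b} k" and ab: "0 \<le> a" "b \<le> T"
  shows "(\<lambda>t. indicator {a..b} t * k t) \<in> borel_measurable (lebesgue_on {0..T})"
    "(LINT t|lebesgue_on {0..T}. indicator {a..b} t * k t) = integral {a..b} k"
proof -
  have S: "{a..b} \<inter> space lebesgue \<in> sets lebesgue" "{0..T} \<inter> space lebesgue \<in> sets lebesgue" by simp_all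
  have "k \<in> borel_measurable (lebesgue_on {a..b})" using interval_continuous(1)[OF k] by auto
  then have m: "(\<lambda>t. indicator {a..b} t * k t) \<in> borel_measurable lebesgue"
    by (subst (asm) borel_measurable_restrict_space_iff[OF S(1)]) simp
  then show "(\<lambda>t. indicator {a..b} t * k t) \<in> borel_measurable (lebesgue_on {0..T})"
    by (rule measurable_restrict_space1)
  have "(LINT t|lebesgue_on {0..T}. indicator {a..b} t * k t)
      = (LINT t|lebesgue. indicator {0..T} t *\<^sub>R (indicator {a..b} t * k t))"
    by (rule integral_restrict_space[OF S(2)])
  also have "\<dots> = (LINT t|lebesgue. indicator {a..b} t *\<^sub>R k t)"
    using ab by (intro Bochner_Integration.integral_cong) (auto simp: indicator_def)
  also have "\<dots> = (LINT t|lebesgue_on {a..b}. k t)"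
    by (rule integral_restrict_space[OF S(1), symmetric])
  also have "\<dots> = integral {a..b} k" by (rule interval_continuous(2)[OF k])
  finally show "(LINT t|lebesgue_on {0..T}. indicator {a..b} t * k t) = integral {a..b} k" .
qed

text \<open>
  Each of the two differences of integrals is a difference quotient of a primitive of
  \<open>\<Phi>\<close>, at the right and at the left endpoint.
\<close>

lemma boundary_layers:
  fixes \<Phi> :: "real \<Rightarrow> real"
  assumes T: "0 < T" and \<Phi>: "continuous_on {0..T} \<Phi>"
    and h: "\<And>n. 0 < h n" "\<And>n. h n < T" "h \<longlonglongrightarrow> 0"
  shows "(\<lambda>n. (integral {h n..T} \<Phi> - integral {0..T - h n} \<Phi>) / h n) \<longlonglongrightarrow> \<Phi> T - \<Phi> 0"
proof -
  define J where "J x = integral {0..x} \<Phi>" for x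
  have D: "((\<lambda>y. (J y - J x) / (y - x)) \<longlongrightarrow> \<Phi> x) (at x within {0..T})" if "x \<in> {0..T}" for x
    using integral_has_real_derivative[OF \<Phi> that] unfolding J_def has_field_derivative_iff by simp
  have seq: "(\<lambda>n. (J (y n) - J x) / (y n - x)) \<longlonglongrightarrow> \<Phi> x"
    if x: "x \<in> {0..T}" and y: "\<And>n. y n \<in> {0..T}" "\<And>n. y n \<noteq> x" "y \<longlonglongrightarrow> x" for x y
  proof (rule filterlim_compose[OF D[OF x]])
    show "filterlim y (at x within {0..T}) sequentially"
      using y by (simp add: filterlim_at)
  qed
  have h01: "h n \<in> {0..T}" "T - h n \<in> {0..T}" for n using h(1)[of n] h(2)[of n] by auto
  have "(\<lambda>n. (J (h n) - J 0) / (h n - 0)) \<longlonglongrightarrow> \<Phi> 0"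
    using h(1) less_irrefl T by (intro seq h01 h(3)) (auto simp: less_imp_neq[symmetric])
  moreover have "(\<lambda>n. (J (T - h n) - J T) / ((T - h n) - T)) \<longlonglongrightarrow> \<Phi> T"
  proof (rule seq)
    show "(\<lambda>n. T - h n) \<longlonglongrightarrow> T" using tendsto_diff[OF tendsto_const h(3), of T] by simp
    show "T - h n \<noteq> T" for n using h(1)[of n] by simp
  qed (use T h01 in auto)
  ultimately have "(\<lambda>n. (J (T - h n) - J T) / ((T - h n) - T) - (J (h n) - J 0) / (h n - 0)) \<longlonglongrightarrow> \<Phi> T - \<Phi> 0"
    by (intro tendsto_diff)
  moreover have "(J (T - h n) - J T) / ((T - h n) - T) - (J (h n) - J 0) / (h n - 0)
      = (integral {h n..T} \<Phi> - integral {0..T - h n} \<Phi>) / h n" for n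
  proof -
    have "J (h n) + integral {h n..T} \<Phi> = J T"
      unfolding J_def by (rule Henstock_Kurzweil_Integration.integral_combine)
        (use h01[of n] integrable_continuous_real[OF \<Phi>] in auto)
    then have e: "integral {h n..T} \<Phi> = J T - J (h n)" by simp
    have "J 0 = 0" "integral {0..T - h n} \<Phi> = J (T - h n)" by (simp_all add: J_def)
    then show ?thesis unfolding e using h(1)[of n] by (simp add: field_simps)
  qed
  ultimately show ?thesis by (simp only:)
qed

context planar_domain
begin

lemma H_inner_commute: "H_inner \<Omega> u v = H_inner \<Omega> v u"
  by (simp add: H_inner_def inner_commute)

text \<open>
  By the weak derivative, averaging \<open>F\<close> over \<open>[t - h, t]\<close> gives the
  difference quotient of \<open>u\<close>.
\<close>

lemma backward_average:
  assumes T: "0 < T" and e: "evolution T u F"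
    and p: "p \<in> continuous_in T (H_space \<Omega>) (H_norm \<Omega>)" "p \<in> Bochner_Lp 2 T (V_space \<Omega>) (V_norm \<Omega>)"
  defines "h \<equiv> step_size T"
  shows "(LINT t|lebesgue_on {0..T}. LINT s|lebesgue_on {0..T}. backward_weight T n s t * F s (p t))
    = integral {h n..T} (\<lambda>t. H_inner \<Omega> (u t) (p t) - H_inner \<Omega> (u (t - h n)) (p t)) / h n"
proof -
  let ?I = "lebesgue_on {0..T}"
  have h: "0 < h n" "h n < T" unfolding h_def by (rule step_size[OF T])+
  define k where "k t = (H_inner \<Omega> (u t) (p t) - H_inner \<Omega> (u (t - h n)) (p t)) / h n" for t
  have u: "u \<in> continuous_in T (H_space \<Omega>) (H_norm \<Omega>)" using e by (simp add: evolution_def)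
  have kc: "continuous_on {h n..T} k"
    unfolding k_def
    by (intro continuous_on_divide continuous_on_diff H_inner_continuous[OF u p(1)] continuous_intros)
       (use h in auto)
  have "AE t in ?I. t \<in> {0..T}" by (rule AE_I2) simp
  moreover have "AE t in ?I. p t \<in> V_space \<Omega>" using p(2) by (simp add: Bochner_Lp_def)
  ultimately have "AE t in ?I. indicator {h n..T} t * k t = (LINT s|?I. backward_weight T n s t * F s (p t))"
  proof eventually_elim
    case (elim t)
    show ?case
    proof (cases "h n \<le> t")
      case True
      have "(LINT s|?I. backward_weight T n s t * F s (p t))
          = (LINT s|?I. (1 / h n) * (indicator {t - h n..t} s * F s (p t)))"
        using True by (intro Bochner_Integration.integral_cong) (auto simp: backward_weight_def h_def indicator_def)
      also have "\<dots> = k t"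
        using evolution_increment[OF e elim(2), of "t - h n" t] True elim(1) h by (simp add: k_def)
      finally show ?thesis using True elim(1) by simp
    next
      case False
      then show ?thesis by (simp add: backward_weight_def h_def)
    qed
  qed
  then have "(LINT t|?I. LINT s|?I. backward_weight T n s t * F s (p t)) = (LINT t|?I. indicator {h n..T} t * k t)"
    using subinterval_integral(1)[OF kc] h by (intro lebesgue_on_integral_cong_AE[symmetric]) auto
  also have "\<dots> = integral {h n..T} k" using h by (intro subinterval_integral(2) kc) auto
  finally show ?thesis by (simp only: k_def[abs_def] integral_divide)
qed

lemma forward_average:
  assumes T: "0 < T" and e: "evolution T u F"
    and p: "p \<in> continuous_in T (H_space \<Omega>) (H_norm \<Omega>)" "p \<in> Bochner_Lp 2 T (V_space \<Omega>) (V_norm \<Omega>)"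
  defines "h \<equiv> step_size T"
  shows "(LINT t|lebesgue_on {0..T}. LINT s|lebesgue_on {0..T}. forward_weight T n s t * F s (p t))
    = integral {0..T - h n} (\<lambda>t. H_inner \<Omega> (u (t + h n)) (p t) - H_inner \<Omega> (u t) (p t)) / h n"
proof -
  let ?I = "lebesgue_on {0..T}"
  have h: "0 < h n" "h n < T" unfolding h_def by (rule step_size[OF T])+
  define k where "k t = (H_inner \<Omega> (u (t + h n)) (p t) - H_inner \<Omega> (u t) (p t)) / h n" for t
  have u: "u \<in> continuous_in T (H_space \<Omega>) (H_norm \<Omega>)" using e by (simp add: evolution_def)
  have kc: "continuous_on {0..T - h n} k"
    unfolding k_def
    by (intro continuous_on_divide continuous_on_diff H_inner_continuous[OF u p(1)] continuous_intros)
       (use h in auto)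
  have "AE t in ?I. t \<in> {0..T}" by (rule AE_I2) simp
  moreover have "AE t in ?I. p t \<in> V_space \<Omega>" using p(2) by (simp add: Bochner_Lp_def)
  ultimately have "AE t in ?I. indicator {0..T - h n} t * k t = (LINT s|?I. forward_weight T n s t * F s (p t))"
  proof eventually_elim
    case (elim t)
    show ?case
    proof (cases "t \<le> T - h n")
      case True
      have "(LINT s|?I. forward_weight T n s t * F s (p t))
          = (LINT s|?I. (1 / h n) * (indicator {t..t + h n} s * F s (p t)))"
        using True by (intro Bochner_Integration.integral_cong) (auto simp: forward_weight_def h_def indicator_def)
      also have "\<dots> = k t"
        using evolution_increment[OF e elim(2), of t "t + h n"] True elim(1) h by (simp add: k_def)
      finally show ?thesis using True elim(1) by simp
    next
      case False
      then show ?thesis by (simp add: forward_weight_def h_def)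
    qed
  qed
  then have "(LINT t|?I. LINT s|?I. forward_weight T n s t * F s (p t)) = (LINT t|?I. indicator {0..T - h n} t * k t)"
    using subinterval_integral(1)[OF kc] h by (intro lebesgue_on_integral_cong_AE[symmetric]) auto
  also have "\<dots> = integral {0..T - h n} k" using h by (intro subinterval_integral(2) kc) auto
  finally show ?thesis by (simp only: k_def[abs_def] integral_divide)
qed

text \<open>
  With \<open>k(t) = (u(t), p(t + h))\<close>, the backward average of \<open>\<langle>F,
  p\<rangle>\<close> is \<open>1/h\<close> times the integral of \<open>\<Phi>(t) - k(t -
  h)\<close> over \<open>[h, T]\<close>, and the forward average of \<open>\<langle>G,
  u\<rangle>\<close> is \<open>1/h\<close> times the integral of \<open>k(t) - \<Phi>(t)\<close>
  over \<open>[0, T - h]\<close>, where \<open>\<Phi> = (u, p)\<close>. In the sum the mixed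
  terms cancel and only boundary layers of \<open>\<Phi>\<close> remain. To have this
  cancellation one of the averages must look backward and the other one forward.
\<close>

theorem integration_by_parts:
  assumes T: "0 < T" and eu: "evolution T u F" and ep: "evolution T p G"
  shows "H_inner \<Omega> (u T) (p T) - H_inner \<Omega> (u 0) (p 0)
    = (LINT t|lebesgue_on {0..T}. F t (p t)) + (LINT t|lebesgue_on {0..T}. G t (u t))"
proof -
  let ?I = "lebesgue_on {0..T}"
  have u: "u \<in> continuous_in T (H_space \<Omega>) (H_norm \<Omega>)" "u \<in> Bochner_Lp 2 T (V_space \<Omega>) (V_norm \<Omega>)"
    using eu by (simp_all add: evolution_def)
  have p: "p \<in> continuous_in T (H_space \<Omega>) (H_norm \<Omega>)" "p \<in> Bochner_Lp 2 T (V_space \<Omega>) (V_norm \<Omega>)"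
    using ep by (simp_all add: evolution_def)
  define h where "h = step_size T"
  have h: "0 < h n" "h n < T" "h \<longlonglongrightarrow> 0" for n unfolding h_def by (rule step_size[OF T])+
  define \<Phi> where "\<Phi> t = H_inner \<Omega> (u t) (p t)" for t
  have \<Phi>c: "continuous_on A \<Phi>" if "A \<subseteq> {0..T}" for A
    unfolding \<Phi>_def by (rule H_inner_continuous[OF u(1) p(1)]) (use that in \<open>auto intro: continuous_intros\<close>)
  define P where "P n = (LINT t|?I. LINT s|?I. backward_weight T n s t * F s (p t))
      + (LINT t|?I. LINT s|?I. forward_weight T n s t * G s (u t))" for n
  have P_lim: "P \<longlonglongrightarrow> (LINT t|?I. F t (p t)) + (LINT t|?I. G t (u t))"
    unfolding P_def
    by (intro tendsto_add evolution_pairing(2)[OF diagonal_weights_backward[OF T] eu p]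
        evolution_pairing(2)[OF diagonal_weights_forward[OF T] ep u])
  have P_eq: "P n = (integral {h n..T} \<Phi> - integral {0..T - h n} \<Phi>) / h n" for n
  proof -
    define k where "k t = H_inner \<Omega> (u t) (p (t + h n))" for t
    have kc: "continuous_on {0..T - h n} k"
      unfolding k_def by (rule H_inner_continuous[OF u(1) p(1)])
        (use h(1,2)[of n] in \<open>auto intro!: continuous_intros\<close>)
    have k'c: "continuous_on {h n..T} (\<lambda>t. k (t - h n))"
      by (rule continuous_on_compose2[OF kc]) (auto intro!: continuous_intros)
    have "(LINT t|?I. LINT s|?I. backward_weight T n s t * F s (p t)) = integral {h n..T} (\<lambda>t. \<Phi> t - k (t - h n)) / h n"
      unfolding backward_average[OF T eu p] by (simp add: \<Phi>_def k_def h_def)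
    also have "integral {h n..T} (\<lambda>t. \<Phi> t - k (t - h n)) = integral {h n..T} \<Phi> - integral {h n..T} (\<lambda>t. k (t - h n))"
      using h(1)[of n] by (intro integral_diff integrable_continuous_real \<Phi>c k'c) auto
    also have "integral {h n..T} (\<lambda>t. k (t - h n)) = integral {0..T - h n} k"
    proof -
      have "k \<circ> (+) (- h n) = (\<lambda>t. k (t - h n))" by (simp add: fun_eq_iff)
      then show ?thesis using integral_shift_Icc_real[of "h n" T k "- h n"] by simp
    qed
    finally have 1: "(LINT t|?I. LINT s|?I. backward_weight T n s t * F s (p t))
        = (integral {h n..T} \<Phi> - integral {0..T - h n} k) / h n" .
    have "(LINT t|?I. LINT s|?I. forward_weight T n s t * G s (u t)) = integral {0..T - h n} (\<lambda>t. k t - \<Phi> t) / h n"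
      unfolding forward_average[OF T ep u] by (simp add: \<Phi>_def k_def h_def H_inner_commute)
    also have "integral {0..T - h n} (\<lambda>t. k t - \<Phi> t) = integral {0..T - h n} k - integral {0..T - h n} \<Phi>"
      using h(1)[of n] by (intro integral_diff integrable_continuous_real \<Phi>c kc) auto
    finally show ?thesis unfolding P_def 1 by (simp add: diff_divide_distrib)
  qed
  have "P \<longlonglongrightarrow> \<Phi> T - \<Phi> 0"
    unfolding P_eq[abs_def] by (rule boundary_layers[OF T \<Phi>c h]) simp
  from LIMSEQ_unique[OF this P_lim] show ?thesis by (simp only: \<Phi>_def)
qed

end

section \<open>Integrability in time\<close>

text \<open>
  The hypothesis on \<open>N\<close> is the triangle inequality, restricted to the carrier
  because the seminorms are subadditive only there.
\<close>

lemma strongly_measurable_diff: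
  assumes u: "strongly_measurable T X N u" and v: "strongly_measurable T X N v"
    and ae: "AE t in lebesgue_on {0..T}. u t \<in> X" "AE t in lebesgue_on {0..T}. v t \<in> X"
    and X: "\<And>a b. a \<in> X \<Longrightarrow> b \<in> X \<Longrightarrow> a - b \<in> X"
    and N: "\<And>a b c d. a \<in> X \<Longrightarrow> b \<in> X \<Longrightarrow> c \<in> X \<Longrightarrow> d \<in> X \<Longrightarrow>
      0 \<le> N ((a - b) - (c - d)) \<and> N ((a - b) - (c - d)) \<le> N (a - c) + N (b - d)"
  shows "strongly_measurable T X N (u - v)"
proof -
  let ?I = "lebesgue_on {0..T}"
  obtain s where s: "\<And>n. simple_function ?I (s n)" "\<And>n. s n ` {0..T} \<subseteq> X"
    "AE t in ?I. (\<lambda>n::nat. N (u t - s n t)) \<longlonglongrightarrow> 0"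
    using u unfolding strongly_measurable_def by blast
  obtain r where r: "\<And>n. simple_function ?I (r n)" "\<And>n. r n ` {0..T} \<subseteq> X"
    "AE t in ?I. (\<lambda>n::nat. N (v t - r n t)) \<longlonglongrightarrow> 0"
    using v unfolding strongly_measurable_def by blast
  have m: "s n t \<in> X" "r n t \<in> X" if "t \<in> {0..T}" for n t using s(2) r(2) that by blast+
  have "AE t in ?I. t \<in> {0..T}" by (rule AE_I2) simp
  with ae s(3) r(3) have lim: "AE t in ?I. (\<lambda>n. N ((u - v) t - (s n t - r n t))) \<longlonglongrightarrow> 0"
  proof eventually_elim
    case (elim t)
    have z: "(\<lambda>n. N (u t - s n t) + N (v t - r n t)) \<longlonglongrightarrow> 0"
      using tendsto_add[OF elim(3,4)] by simp
    show ?case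
      by (rule Lim_null_comparison[OF always_eventually z])
         (use N[OF elim(1,2) m[OF elim(5)]] in simp)
  qed
  have sf: "simple_function ?I (\<lambda>t. s n t - r n t)" for n
    using simple_function_compose1[OF simple_function_Pair[OF s(1) r(1)], of "\<lambda>z. fst z - snd z"] by simp
  have im: "(\<lambda>t. s n t - r n t) ` {0..T} \<subseteq> X" for n using m X by auto
  show ?thesis
    unfolding strongly_measurable_def
    by (intro exI[of _ "\<lambda>n t. s n t - r n t"] conjI allI sf im lim)
qed

lemma abs_le_multiple:
  fixes x k S :: real
  assumes "\<bar>x\<bar> \<le> k * S" "0 \<le> S" "k \<le> 12"
  shows "norm x \<le> norm (12 * S)"
proof -
  have "k * S \<le> 12 * S" using assms(2,3) by (intro mult_right_mono)
  then show ?thesis using assms(1,2) by simp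
qed

context planar_domain
begin

lemma H_minus: "u \<in> H_space \<Omega> \<Longrightarrow> v \<in> H_space \<Omega> \<Longrightarrow> u - v \<in> H_space \<Omega>"
  using H_lincomb[of u v 1 "-1"] by (simp add: fun_diff_def)

lemma H_norm_diff_le:
  assumes "u \<in> H_space \<Omega>" "v \<in> H_space \<Omega>"
  shows "H_norm \<Omega> (u - v) \<le> H_norm \<Omega> u + H_norm \<Omega> v"
  unfolding H_norm_alt fun_diff_def by (rule L2norm_triangle_diff(1)[OF assms[THEN H_sq_integrable]])

lemma diff_diff_swap: "(a - b) - (c - d) = (a - c) - (b - d)" for a b c d :: vfield
  by (simp add: fun_eq_iff)

lemma square_add_le: "(a + b)\<^sup>2 \<le> 2 * a\<^sup>2 + 2 * b\<^sup>2" for a b :: real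
  using sum_squares_bound[of a b] by (simp add: power2_sum)

text \<open>
  Continuity of the seminorm along sequences gives the measurability in time of the seminorm of
  the difference.
\<close>

lemma Bochner2_diff:
  fixes X :: "vfield set"
  assumes u: "u \<in> Bochner_Lp 2 T X N" and v: "v \<in> Bochner_Lp 2 T X N"
    and X: "\<And>a b. a \<in> X \<Longrightarrow> b \<in> X \<Longrightarrow> a - b \<in> X"
    and N: "\<And>a b. a \<in> X \<Longrightarrow> b \<in> X \<Longrightarrow> N (a - b) \<le> N a + N b" "\<And>a. 0 \<le> N a"
    and cont: "\<And>x xs. x \<in> X \<Longrightarrow> (\<And>n. xs n \<in> X) \<Longrightarrow> (\<lambda>n::nat. N (x - xs n)) \<longlonglongrightarrow> 0
      \<Longrightarrow> (\<lambda>n. N (xs n)) \<longlonglongrightarrow> N x"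
  shows "u - v \<in> Bochner_Lp 2 T X N"
proof -
  let ?I = "lebesgue_on {0..T}"
  have u': "strongly_measurable T X N u" "AE t in ?I. u t \<in> X" "integrable ?I (\<lambda>t. (N (u t))\<^sup>2)"
    and v': "strongly_measurable T X N v" "AE t in ?I. v t \<in> X" "integrable ?I (\<lambda>t. (N (v t))\<^sup>2)"
    using u v N(2) by (simp_all add: Bochner_Lp_def)
  have sm: "strongly_measurable T X N (u - v)"
  proof (rule strongly_measurable_diff[OF u'(1) v'(1) u'(2) v'(2) X])
    fix a b c d :: vfield assume abcd: "a \<in> X" "b \<in> X" "c \<in> X" "d \<in> X"
    have "N ((a - c) - (b - d)) \<le> N (a - c) + N (b - d)" by (intro N(1) X abcd)
    then show "0 \<le> N ((a - b) - (c - d)) \<and> N ((a - b) - (c - d)) \<le> N (a - c) + N (b - d)"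
      unfolding diff_diff_swap[of a b] using N(2) by blast
  qed
  have ae: "AE t in ?I. (u - v) t \<in> X" using u'(2) v'(2) by eventually_elim (simp add: X)
  have m: "(\<lambda>t. N ((u - v) t)) \<in> borel_measurable ?I"
    by (rule strongly_measurable_compose[OF sm ae cont])
  have b: "integrable ?I (\<lambda>t. 2 * (N (u t))\<^sup>2 + 2 * (N (v t))\<^sup>2)" using u'(3) v'(3) by simp
  have "integrable ?I (\<lambda>t. (N ((u - v) t))\<^sup>2)"
  proof (rule Bochner_Integration.integrable_bound[OF b])
    show "AE t in ?I. norm ((N ((u - v) t))\<^sup>2) \<le> norm (2 * (N (u t))\<^sup>2 + 2 * (N (v t))\<^sup>2)"
      using u'(2) v'(2)
    proof eventually_elim
      case (elim t)
      have "(N ((u - v) t))\<^sup>2 \<le> (N (u t) + N (v t))\<^sup>2"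
        using N(1)[OF elim] N(2) by (intro power_mono) simp_all
      also have "\<dots> \<le> 2 * (N (u t))\<^sup>2 + 2 * (N (v t))\<^sup>2" by (rule square_add_le)
      finally show ?case by simp
    qed
  qed (use m in simp)
  then show ?thesis using sm ae N(2) by (simp add: Bochner_Lp_def)
qed

lemma H_tendsto:
  assumes "u \<in> H_space \<Omega>" "\<And>n. us n \<in> H_space \<Omega>" "(\<lambda>n::nat. H_norm \<Omega> (u - us n)) \<longlonglongrightarrow> 0"
  shows "(\<lambda>n. H_norm \<Omega> (us n)) \<longlonglongrightarrow> H_norm \<Omega> u"
  using L2norm_tendsto[OF H_sq_integrable[OF assms(2)] H_sq_integrable[OF assms(1)]] assms(3)
  by (simp add: H_norm_alt fun_diff_def)

lemma Bochner2_H_diff: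
  assumes "u \<in> Bochner_Lp 2 T (H_space \<Omega>) (H_norm \<Omega>)" "v \<in> Bochner_Lp 2 T (H_space \<Omega>) (H_norm \<Omega>)"
  shows "u - v \<in> Bochner_Lp 2 T (H_space \<Omega>) (H_norm \<Omega>)"
proof (rule Bochner2_diff[OF assms H_minus H_norm_diff_le])
  show "(\<lambda>n. H_norm \<Omega> (xs n)) \<longlonglongrightarrow> H_norm \<Omega> x"
    if "x \<in> H_space \<Omega>" "\<And>n. xs n \<in> H_space \<Omega>" "(\<lambda>n::nat. H_norm \<Omega> (x - xs n)) \<longlonglongrightarrow> 0" for x xs
    using that by (rule H_tendsto)
qed (simp_all add: H_norm_alt)

lemma Bochner2_V_diff:
  assumes "u \<in> Bochner_Lp 2 T (V_space \<Omega>) (V_norm \<Omega>)" "v \<in> Bochner_Lp 2 T (V_space \<Omega>) (V_norm \<Omega>)"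
  shows "u - v \<in> Bochner_Lp 2 T (V_space \<Omega>) (V_norm \<Omega>)"
proof (rule Bochner2_diff[OF assms V_minus V_norm_diff_le])
  show "(\<lambda>n. V_norm \<Omega> (xs n)) \<longlonglongrightarrow> V_norm \<Omega> x"
    if "x \<in> V_space \<Omega>" "\<And>n. xs n \<in> V_space \<Omega>" "(\<lambda>n::nat. V_norm \<Omega> (x - xs n)) \<longlonglongrightarrow> 0" for x xs
    using that by (rule V_tendsto(4))
qed simp_all

lemma Linf_imp_Bochner2:
  assumes "u \<in> Bochner_Linf T (H_space \<Omega>) (H_norm \<Omega>)"
  shows "u \<in> Bochner_Lp 2 T (H_space \<Omega>) (H_norm \<Omega>)"
proof -
  interpret I: finite_measure "lebesgue_on {0..T}" by (rule finite_measure_interval)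
  obtain C where u: "strongly_measurable T (H_space \<Omega>) (H_norm \<Omega>) u"
    "AE t in lebesgue_on {0..T}. u t \<in> H_space \<Omega>" "AE t in lebesgue_on {0..T}. H_norm \<Omega> (u t) \<le> C"
    using assms unfolding Bochner_Linf_def by blast
  have m: "(\<lambda>t. H_norm \<Omega> (u t)) \<in> borel_measurable (lebesgue_on {0..T})"
    by (rule strongly_measurable_compose[OF u(1,2) H_tendsto])
  have "integrable (lebesgue_on {0..T}) (\<lambda>t. (H_norm \<Omega> (u t))\<^sup>2)"
  proof (rule I.integrable_const_bound[where B = "C\<^sup>2"])
    show "AE t in lebesgue_on {0..T}. norm ((H_norm \<Omega> (u t))\<^sup>2) \<le> C\<^sup>2"
      using u(3) by eventually_elim (simp add: H_norm_alt power_mono)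
  qed (use m in simp)
  then show ?thesis using u by (simp add: Bochner_Lp_def H_norm_alt)
qed

lemma product_le_squares: "a * b \<le> a\<^sup>2 + b\<^sup>2" for a b :: real
  using sum_squares_bound[of a b] zero_le_power2[of a] zero_le_power2[of b] by linarith

lemma null_summands:
  fixes a b :: "nat \<Rightarrow> real"
  assumes "(\<lambda>n. a n + b n) \<longlonglongrightarrow> 0" "\<And>n. 0 \<le> a n" "\<And>n. 0 \<le> b n"
  shows "a \<longlonglongrightarrow> 0" "b \<longlonglongrightarrow> 0"
  by (rule Lim_null_comparison[OF always_eventually assms(1)], use assms(2,3) in \<open>simp add: add_increasing add_increasing2\<close>)+

lemma H_inner_integrable:
  assumes u: "u \<in> Bochner_Lp 2 T (H_space \<Omega>) (H_norm \<Omega>)" and v: "v \<in> Bochner_Lp 2 T (H_space \<Omega>) (H_norm \<Omega>)"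
  shows "integrable (lebesgue_on {0..T}) (\<lambda>t. H_inner \<Omega> (u t) (v t))"
proof -
  let ?I = "lebesgue_on {0..T}" and ?H = "H_space \<Omega>"
  have u': "strongly_measurable T ?H (H_norm \<Omega>) u" "AE t in ?I. u t \<in> ?H" "integrable ?I (\<lambda>t. (H_norm \<Omega> (u t))\<^sup>2)"
    and v': "strongly_measurable T ?H (H_norm \<Omega>) v" "AE t in ?I. v t \<in> ?H" "integrable ?I (\<lambda>t. (H_norm \<Omega> (v t))\<^sup>2)"
    using u v by (simp_all add: Bochner_Lp_def H_norm_alt)
  have ae: "AE t in ?I. (u t, v t) \<in> ?H \<times> ?H" using u'(2) v'(2) by eventually_elim simp
  have "(\<lambda>t. (\<lambda>z. H_inner \<Omega> (fst z) (snd z)) (u t, v t)) \<in> borel_measurable ?I"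
  proof (rule strongly_measurable_compose[OF strongly_measurable_Pair[OF u'(1) v'(1)] ae])
    fix x :: "vfield \<times> vfield" and xs assume x: "x \<in> ?H \<times> ?H" "\<And>n. xs n \<in> ?H \<times> ?H"
      and l: "(\<lambda>n::nat. H_norm \<Omega> (fst (x - xs n)) + H_norm \<Omega> (snd (x - xs n))) \<longlonglongrightarrow> 0"
    have m: "fst x \<in> ?H" "snd x \<in> ?H" "fst (xs n) \<in> ?H" "snd (xs n) \<in> ?H" for n
      using x(1) x(2)[of n] by (auto simp: mem_Times_iff)
    have l1: "(\<lambda>n. L2norm M (\<lambda>y. fst x y - fst (xs n) y)) \<longlonglongrightarrow> 0"
      "(\<lambda>n. L2norm M (\<lambda>y. snd x y - snd (xs n) y)) \<longlonglongrightarrow> 0"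
      using null_summands[OF l] by (simp_all add: H_norm_alt fun_diff_def)
    show "(\<lambda>n. H_inner \<Omega> (fst (xs n)) (snd (xs n))) \<longlonglongrightarrow> H_inner \<Omega> (fst x) (snd x)"
      unfolding H_inner_def
      by (rule L2_tendsto_inner[OF H_sq_integrable[OF m(3)] H_sq_integrable[OF m(1)]
            H_sq_integrable[OF m(4)] H_sq_integrable[OF m(2)] l1])
  qed
  then have m: "(\<lambda>t. H_inner \<Omega> (u t) (v t)) \<in> borel_measurable ?I" by simp
  have b: "integrable ?I (\<lambda>t. (H_norm \<Omega> (u t))\<^sup>2 + (H_norm \<Omega> (v t))\<^sup>2)" using u'(3) v'(3) by simp
  show ?thesis
  proof (rule Bochner_Integration.integrable_bound[OF b m])
    show "AE t in ?I. norm (H_inner \<Omega> (u t) (v t)) \<le> norm ((H_norm \<Omega> (u t))\<^sup>2 + (H_norm \<Omega> (v t))\<^sup>2)"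
      using u'(2) v'(2)
    proof eventually_elim
      case (elim t)
      have "\<bar>H_inner \<Omega> (u t) (v t)\<bar> \<le> H_norm \<Omega> (u t) * H_norm \<Omega> (v t)"
        unfolding H_inner_def H_norm_alt by (rule L2_Cauchy_Schwarz[OF elim[THEN H_sq_integrable]])
      also have "\<dots> \<le> (H_norm \<Omega> (u t))\<^sup>2 + (H_norm \<Omega> (v t))\<^sup>2" by (rule product_le_squares)
      finally show ?case by simp
    qed
  qed
qed

text \<open>
  Measurability of a triple in the sum of the seminorms, composed with a continuous form.
\<close>

lemma V_triple_measurable:
  assumes u: "u \<in> Bochner_Lp 2 T (V_space \<Omega>) (V_norm \<Omega>)" and v: "v \<in> Bochner_Lp 2 T (V_space \<Omega>) (V_norm \<Omega>)"
    and w: "w \<in> Bochner_Lp 2 T (V_space \<Omega>) (V_norm \<Omega>)"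
    and cont: "\<And>a as b bs c cs. a \<in> V_space \<Omega> \<Longrightarrow> (\<And>n. as n \<in> V_space \<Omega>) \<Longrightarrow> (\<lambda>n::nat. V_norm \<Omega> (a - as n)) \<longlonglongrightarrow> 0
      \<Longrightarrow> b \<in> V_space \<Omega> \<Longrightarrow> (\<And>n. bs n \<in> V_space \<Omega>) \<Longrightarrow> (\<lambda>n. V_norm \<Omega> (b - bs n)) \<longlonglongrightarrow> 0
      \<Longrightarrow> c \<in> V_space \<Omega> \<Longrightarrow> (\<And>n. cs n \<in> V_space \<Omega>) \<Longrightarrow> (\<lambda>n. V_norm \<Omega> (c - cs n)) \<longlonglongrightarrow> 0
      \<Longrightarrow> (\<lambda>n. \<Phi> (as n) (bs n) (cs n)) \<longlonglongrightarrow> (\<Phi> a b c :: real)"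
  shows "(\<lambda>t. \<Phi> (u t) (v t) (w t)) \<in> borel_measurable (lebesgue_on {0..T})"
proof -
  let ?I = "lebesgue_on {0..T}" and ?V = "V_space \<Omega>" and ?N = "V_norm \<Omega>"
  have sm: "strongly_measurable T ?V ?N u" "strongly_measurable T ?V ?N v" "strongly_measurable T ?V ?N w"
    and mem: "AE t in ?I. u t \<in> ?V" "AE t in ?I. v t \<in> ?V" "AE t in ?I. w t \<in> ?V"
    using u v w by (simp_all add: Bochner_Lp_def)
  have ae: "AE t in ?I. (u t, v t, w t) \<in> ?V \<times> (?V \<times> ?V)" using mem by eventually_elim simp
  note sm3 = strongly_measurable_Pair[OF sm(1) strongly_measurable_Pair[OF sm(2,3)]]
  have "(\<lambda>t. (\<lambda>z. \<Phi> (fst z) (fst (snd z)) (snd (snd z))) (u t, v t, w t)) \<in> borel_measurable ?I"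
  proof (rule strongly_measurable_compose[OF sm3 ae])
    fix x :: "vfield \<times> vfield \<times> vfield" and xs
    assume x: "x \<in> ?V \<times> (?V \<times> ?V)" "\<And>n. xs n \<in> ?V \<times> (?V \<times> ?V)"
      and l: "(\<lambda>n::nat. ?N (fst (x - xs n)) + (?N (fst (snd (x - xs n))) + ?N (snd (snd (x - xs n))))) \<longlonglongrightarrow> 0"
    have l': "(\<lambda>n. ?N (fst (x - xs n))) \<longlonglongrightarrow> 0"
      "(\<lambda>n. ?N (fst (snd (x - xs n))) + ?N (snd (snd (x - xs n)))) \<longlonglongrightarrow> 0"
      using null_summands[OF l] by simp_all
    have l'': "(\<lambda>n. ?N (fst (snd (x - xs n)))) \<longlonglongrightarrow> 0" "(\<lambda>n. ?N (snd (snd (x - xs n)))) \<longlonglongrightarrow> 0"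
      using null_summands[OF l'(2)] by simp_all
    have m: "fst x \<in> ?V" "fst (snd x) \<in> ?V" "snd (snd x) \<in> ?V" "fst (xs n) \<in> ?V" "fst (snd (xs n)) \<in> ?V" "snd (snd (xs n)) \<in> ?V" for n
      using x(1) x(2)[of n] by (auto simp: mem_Times_iff)
    show "(\<lambda>n. \<Phi> (fst (xs n)) (fst (snd (xs n))) (snd (snd (xs n)))) \<longlonglongrightarrow> \<Phi> (fst x) (fst (snd x)) (snd (snd x))"
      by (rule cont[OF m(1,4) l'(1)[unfolded fst_diff] m(2,5) l''(1)[unfolded fst_diff snd_diff] m(3,6) l''(2)[unfolded snd_diff]])
  qed
  then show ?thesis by simp
qed

lemma A_op_energy:
  assumes "u \<in> V_space \<Omega>" "v \<in> V_space \<Omega>"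
  shows "\<bar>A_op \<Omega> u v\<bar> \<le> energy u + energy v"
proof -
  have "\<bar>A_op \<Omega> u v\<bar> \<le> V_norm \<Omega> u * V_norm \<Omega> v" by (rule A_op_bound(2)[OF assms])
  also have "\<dots> \<le> (V_norm \<Omega> u)\<^sup>2 + (V_norm \<Omega> v)\<^sup>2" by (rule product_le_squares)
  also have "\<dots> \<le> energy u + energy v" by (simp add: energy_def add_mono)
  finally show ?thesis .
qed

lemma B_op_energy:
  assumes "u \<in> V_space \<Omega>" "v \<in> V_space \<Omega>" "w \<in> V_space \<Omega>"
  shows "\<bar>B_op \<Omega> u v w\<bar> \<le> energy u + energy v + energy w"
proof -
  let ?a = "L4norm M u" and ?b = "L4norm M w"
  have "\<bar>B_op \<Omega> u v w\<bar> \<le> V_norm \<Omega> v * (?a * ?b)" by (rule B_op_bound(2)[OF assms])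
  also have "\<dots> \<le> (V_norm \<Omega> v)\<^sup>2 + (?a * ?b)\<^sup>2" by (rule product_le_squares)
  also have "(?a * ?b)\<^sup>2 \<le> (?a\<^sup>2)\<^sup>2 + (?b\<^sup>2)\<^sup>2" unfolding power_mult_distrib by (rule product_le_squares)
  also have "(V_norm \<Omega> v)\<^sup>2 + ((?a\<^sup>2)\<^sup>2 + (?b\<^sup>2)\<^sup>2) \<le> energy u + energy v + energy w"
    by (simp add: energy_def flip: power_mult)
  finally show ?thesis by simp
qed

lemma quad_energy:
  assumes "a \<in> V_space \<Omega>" "b \<in> V_space \<Omega>" "c \<in> V_space \<Omega>" "d \<in> V_space \<Omega>"
  shows "\<bar>quad a b c d\<bar> \<le> energy a + energy b + energy c + energy d"
proof -
  let ?a = "L4norm M a" and ?b = "L4norm M b" and ?c = "L4norm M c" and ?d = "L4norm M d"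
  have sq: "(x * y)\<^sup>2 \<le> x ^ 4 + y ^ 4" for x y :: real
    using product_le_squares[of "x\<^sup>2" "y\<^sup>2"] by (simp add: power_mult_distrib flip: power_mult)
  have "\<bar>quad a b c d\<bar> \<le> (?a * ?b) * (?c * ?d)" by (rule quad_bound(2)[OF assms[THEN V_L4]])
  also have "\<dots> \<le> (?a * ?b)\<^sup>2 + (?c * ?d)\<^sup>2" by (rule product_le_squares)
  also have "\<dots> \<le> (?a ^ 4 + ?b ^ 4) + (?c ^ 4 + ?d ^ 4)" by (intro add_mono sq)
  also have "\<dots> \<le> energy a + energy b + energy c + energy d"
    by (simp add: energy_def)
  finally show ?thesis .
qed

lemma H_inner_energy:
  assumes "u \<in> H_space \<Omega>" "v \<in> V_space \<Omega>"
  shows "\<bar>H_inner \<Omega> u v\<bar> \<le> (H_norm \<Omega> u)\<^sup>2 + V_const\<^sup>2 * energy v"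
proof -
  have "\<bar>H_inner \<Omega> u v\<bar> \<le> L2norm M u * L2norm M v"
    unfolding H_inner_def by (rule L2_Cauchy_Schwarz[OF H_sq_integrable[OF assms(1)] V_sq_integrable(1)[OF assms(2)]])
  also have "\<dots> \<le> L2norm M u * (V_const * V_norm \<Omega> v)"
    by (intro mult_left_mono V_embeddings(1) assms) simp
  also have "\<dots> \<le> (L2norm M u)\<^sup>2 + (V_const * V_norm \<Omega> v)\<^sup>2" by (rule product_le_squares)
  also have "\<dots> \<le> (H_norm \<Omega> u)\<^sup>2 + V_const\<^sup>2 * energy v"
    by (simp add: H_norm_alt power_mult_distrib energy_def mult_left_mono)
  finally show ?thesis .
qed

text \<open>
  All the forms are bounded by multiples of the sum of the three energies; the factor 12 is
  large enough for each of them.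
\<close>

lemma operators_integrable:
  assumes u: "u \<in> Bochner_Lp 2 T (V_space \<Omega>) (V_norm \<Omega>)" "integrable (lebesgue_on {0..T}) (\<lambda>t. energy (u t))"
    and v: "v \<in> Bochner_Lp 2 T (V_space \<Omega>) (V_norm \<Omega>)" "integrable (lebesgue_on {0..T}) (\<lambda>t. energy (v t))"
    and w: "w \<in> Bochner_Lp 2 T (V_space \<Omega>) (V_norm \<Omega>)" "integrable (lebesgue_on {0..T}) (\<lambda>t. energy (w t))"
  shows "integrable (lebesgue_on {0..T}) (\<lambda>t. B_op \<Omega> (u t) (v t) (w t))"
    "integrable (lebesgue_on {0..T}) (\<lambda>t. A_op \<Omega> (u t) (v t))"
    "integrable (lebesgue_on {0..T})
      (\<lambda>t. 2 * quad (u t) (v t) (v t) (w t) + quad (v t) (v t) (v t) (w t) + quad (v t) (v t) (u t) (w t))"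
proof -
  let ?I = "lebesgue_on {0..T}"
  have mem: "AE t in ?I. u t \<in> V_space \<Omega>" "AE t in ?I. v t \<in> V_space \<Omega>" "AE t in ?I. w t \<in> V_space \<Omega>"
    using u v w by (simp_all add: Bochner_Lp_def)
  have b: "integrable ?I (\<lambda>t. 12 * (energy (u t) + energy (v t) + energy (w t)))" using u v w by simp
  have B: "(\<lambda>t. B_op \<Omega> (u t) (v t) (w t)) \<in> borel_measurable ?I"
    by (rule V_triple_measurable[OF u(1) v(1) w(1) B_op_tendsto])
  have A: "(\<lambda>t. A_op \<Omega> (u t) (v t)) \<in> borel_measurable ?I"
    by (rule V_triple_measurable[OF u(1) v(1) w(1), where \<Phi> = "\<lambda>u v w. A_op \<Omega> u v"]) (rule A_op_tendsto)
  have Q: "(\<lambda>t. 2 * quad (u t) (v t) (v t) (w t) + quad (v t) (v t) (v t) (w t) + quad (v t) (v t) (u t) (w t)) \<in> borel_measurable ?I"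
    by (rule V_triple_measurable[OF u(1) v(1) w(1), where
          \<Phi> = "\<lambda>u v w. 2 * quad u v v w + quad v v v w + quad v v u w"])
       (intro tendsto_add tendsto_mult tendsto_const quad_tendsto)
  show "integrable ?I (\<lambda>t. B_op \<Omega> (u t) (v t) (w t))"
  proof (rule Bochner_Integration.integrable_bound[OF b B])
    show "AE t in ?I. norm (B_op \<Omega> (u t) (v t) (w t)) \<le> norm (12 * (energy (u t) + energy (v t) + energy (w t)))"
      using mem
    proof eventually_elim
      case (elim t)
      then show ?case
        by (intro abs_le_multiple[of _ 1]) (simp_all add: B_op_energy)
    qed
  qed
  show "integrable ?I (\<lambda>t. A_op \<Omega> (u t) (v t))"
  proof (rule Bochner_Integration.integrable_bound[OF b A])
    show "AE t in ?I. norm (A_op \<Omega> (u t) (v t)) \<le> norm (12 * (energy (u t) + energy (v t) + energy (w t)))"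
      using mem
    proof eventually_elim
      case (elim t)
      then show ?case
        by (intro abs_le_multiple[of _ 1]) (simp_all add: A_op_energy add_increasing2)
    qed
  qed
  show "integrable ?I (\<lambda>t. 2 * quad (u t) (v t) (v t) (w t) + quad (v t) (v t) (v t) (w t) + quad (v t) (v t) (u t) (w t))"
  proof (rule Bochner_Integration.integrable_bound[OF b Q])
    show "AE t in ?I. norm (2 * quad (u t) (v t) (v t) (w t) + quad (v t) (v t) (v t) (w t) + quad (v t) (v t) (u t) (w t))
        \<le> norm (12 * (energy (u t) + energy (v t) + energy (w t)))"
      using mem
    proof eventually_elim
      case (elim t)
      define a b c where "a = energy (u t)" and "b = energy (v t)" and "c = energy (w t)"
      have abc: "0 \<le> a" "0 \<le> b" "0 \<le> c" by (simp_all add: a_def b_def c_def)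
      have "\<bar>quad (u t) (v t) (v t) (w t)\<bar> \<le> a + b + b + c" "\<bar>quad (v t) (v t) (v t) (w t)\<bar> \<le> b + b + b + c"
        "\<bar>quad (v t) (v t) (u t) (w t)\<bar> \<le> b + b + a + c"
        unfolding a_def b_def c_def by (intro quad_energy elim)+
      with abc have "\<bar>2 * quad (u t) (v t) (v t) (w t) + quad (v t) (v t) (v t) (w t) + quad (v t) (v t) (u t) (w t)\<bar>
          \<le> 12 * (a + b + c)" by (simp add: abs_le_iff)
      then show ?case
        using abc by (intro abs_le_multiple[of _ 12]) (simp_all add: a_def b_def c_def)
    qed
  qed
qed


section \<open>State and adjoint as evolutions\<close>

text \<open>
  Solve the equation for the time derivative and apply Young's inequality to every term, so that
  the test function \<open>v\<close> enters only through its energy.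
\<close>

lemma state_derivative_bound:
  assumes V: "u \<in> V_space \<Omega>" "v \<in> V_space \<Omega>" and F: "f \<in> V_dual \<Omega>"
    and par: "0 < \<mu>" "0 < \<alpha>" "0 < \<beta>"
    and eq: "g + \<mu> * A_op \<Omega> u v + B_op \<Omega> u u v + \<alpha> * H_inner \<Omega> u v + \<beta> * H_inner \<Omega> (C_op \<Omega> u) v = f v"
  defines "K \<equiv> 3 + \<mu> + \<alpha> * V_const\<^sup>2 + 3 * \<beta>"
  shows "\<bar>g\<bar> \<le> ((V_dual_norm \<Omega> f)\<^sup>2 + \<alpha> * (H_norm \<Omega> u)\<^sup>2 + K * energy u) + K * energy v"
proof -
  have f: "\<bar>f v\<bar> \<le> (V_dual_norm \<Omega> f)\<^sup>2 + energy v"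
  proof -
    have "\<bar>f v\<bar> \<le> V_dual_norm \<Omega> f * V_norm \<Omega> v" by (rule V_dual_bound[OF F V(2)])
    also have "\<dots> \<le> (V_dual_norm \<Omega> f)\<^sup>2 + (V_norm \<Omega> v)\<^sup>2" by (rule product_le_squares)
    also have "\<dots> \<le> (V_dual_norm \<Omega> f)\<^sup>2 + energy v" by (simp add: energy_def)
    finally show ?thesis .
  qed
  have A: "\<bar>\<mu> * A_op \<Omega> u v\<bar> \<le> \<mu> * (energy u + energy v)"
    using A_op_energy[OF V] par by (simp add: abs_mult)
  have B: "\<bar>B_op \<Omega> u u v\<bar> \<le> energy u + energy u + energy v" by (rule B_op_energy[OF V(1,1,2)])
  have H: "\<bar>\<alpha> * H_inner \<Omega> u v\<bar> \<le> \<alpha> * ((H_norm \<Omega> u)\<^sup>2 + V_const\<^sup>2 * energy v)"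
    using H_inner_energy[OF V_H[OF V(1)] V(2)] par by (simp add: abs_mult)
  have C: "\<bar>\<beta> * H_inner \<Omega> (C_op \<Omega> u) v\<bar> \<le> \<beta> * (energy u + energy u + energy u + energy v)"
    using quad_energy[OF V(1,1,1,2)] par by (simp add: abs_mult C_op_inner[OF V])
  have nn: "0 \<le> energy u" "0 \<le> energy v" "0 \<le> \<alpha> * V_const\<^sup>2 * energy u" "0 \<le> \<beta> * energy v" "0 \<le> \<beta> * energy u"
    using par by simp_all
  have "\<bar>g\<bar> \<le> ((V_dual_norm \<Omega> f)\<^sup>2 + energy v) + \<mu> * (energy u + energy v) + (energy u + energy u + energy v)
      + \<alpha> * ((H_norm \<Omega> u)\<^sup>2 + V_const\<^sup>2 * energy v) + \<beta> * (energy u + energy u + energy u + energy v)"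
    using eq f A B H C by linarith
  also have "\<dots> \<le> ((V_dual_norm \<Omega> f)\<^sup>2 + \<alpha> * (H_norm \<Omega> u)\<^sup>2 + K * energy u) + K * energy v"
    using nn unfolding K_def by (simp add: algebra_simps)
  finally show ?thesis .
qed

lemma square_integrable_of_continuous:
  assumes u: "u \<in> continuous_in T (H_space \<Omega>) (H_norm \<Omega>)"
  shows "integrable (lebesgue_on {0..T}) (\<lambda>t. (H_norm \<Omega> (u t))\<^sup>2)"
  unfolding H_norm_square
  by (rule interval_continuous(1)[OF H_inner_continuous[OF u u]]) (auto intro: continuous_intros)

lemma state_evolution:
  assumes sol: "weak_solution \<Omega> T \<mu> \<alpha> \<beta> f U u" and u: "u \<in> continuous_in T (H_space \<Omega>) (H_norm \<Omega>)"
    and f: "f \<in> Bochner_Lp 2 T (V_dual \<Omega>) (V_dual_norm \<Omega>)" and par: "0 < \<mu>" "0 < \<alpha>" "0 < \<beta>"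
  obtains du where "evolution T u du"
    "AE t in lebesgue_on {0..T}. \<forall>v\<in>V_space \<Omega>. du t v + \<mu> * A_op \<Omega> (u t) v + B_op \<Omega> (u t) (u t) v
             + \<alpha> * H_inner \<Omega> (u t) v + \<beta> * H_inner \<Omega> (C_op \<Omega> (u t)) v = f t v"
proof -
  let ?I = "lebesgue_on {0..T}"
  obtain du where du: "du \<in> Bochner_Lp (4/3) T (V_dual \<Omega>) (V_dual_norm \<Omega>)" "has_time_deriv \<Omega> T u du"
    and eq: "AE t in ?I. \<forall>v\<in>V_space \<Omega>. du t v + \<mu> * A_op \<Omega> (u t) v + B_op \<Omega> (u t) (u t) v
             + \<alpha> * H_inner \<Omega> (u t) v + \<beta> * H_inner \<Omega> (C_op \<Omega> (u t)) v = f t v"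
    using sol unfolding weak_solution_def by blast
  have uV: "u \<in> Bochner_Lp 2 T (V_space \<Omega>) (V_norm \<Omega>)" using sol by (simp add: weak_solution_def)
  have mem: "AE t in ?I. u t \<in> V_space \<Omega>" "AE t in ?I. f t \<in> V_dual \<Omega>"
    using uV f by (simp_all add: Bochner_Lp_def)
  define K where "K = 3 + \<mu> + \<alpha> * V_const\<^sup>2 + 3 * \<beta>"
  have K: "0 \<le> K" using par by (simp add: K_def)
  define A where "A t = V_dual_norm \<Omega> (f t) powr 2 + \<alpha> * (H_norm \<Omega> (u t))\<^sup>2 + K * energy (u t)" for t
  have A: "integrable ?I A"
    unfolding A_def using f square_integrable_of_continuous[OF u] energy_integrable[OF u uV]
    by (simp add: Bochner_Lp_def)
  have A0: "0 \<le> A t" for t using par K by (simp add: A_def)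
  have "AE t in ?I. \<forall>v\<in>V_space \<Omega>. \<bar>du t v\<bar> \<le> A t + K * energy v"
    using mem eq
  proof eventually_elim
    case (elim t)
    have "V_dual_norm \<Omega> (f t) powr 2 = (V_dual_norm \<Omega> (f t))\<^sup>2"
      using V_dual_norm_nonneg[OF elim(2)] by simp
    then show ?case
      using state_derivative_bound[OF elim(1) _ elim(2) par] elim(3) unfolding A_def K_def by auto
  qed
  then have "evolution T u du"
    unfolding evolution_def using u uV du A A0 K by blast
  then show thesis using eq by (rule that)
qed

text \<open>
  As for the state equation; the coefficients of the adjoint equation contribute the energy of
  the reference state.
\<close>

lemma adjoint_derivative_bound:
  assumes V: "u \<in> V_space \<Omega>" "p \<in> V_space \<Omega>" "v \<in> V_space \<Omega>" and y: "y \<in> H_space \<Omega>"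
    and par: "0 < \<mu>" "0 < \<alpha>" "0 < \<beta>"
    and eq: "- g + \<mu> * A_op \<Omega> p v + B_deriv_adj \<Omega> u p v + \<alpha> * H_inner \<Omega> p v + \<beta> * H_inner \<Omega> (C_deriv \<Omega> u p) v
      = H_inner \<Omega> y v + A_op \<Omega> u v"
  defines "K \<equiv> 3 + \<mu> + (1 + \<alpha>) * V_const\<^sup>2 + 6 * \<beta>"
  shows "\<bar>g\<bar> \<le> ((H_norm \<Omega> y)\<^sup>2 + \<alpha> * (H_norm \<Omega> p)\<^sup>2 + K * (energy u + energy p)) + K * energy v"
proof -
  have A: "\<bar>\<mu> * A_op \<Omega> p v\<bar> \<le> \<mu> * (energy p + energy v)"
    using A_op_energy[OF V(2,3)] par by (simp add: abs_mult)
  have A': "\<bar>A_op \<Omega> u v\<bar> \<le> energy u + energy v" by (rule A_op_energy[OF V(1,3)])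
  have B: "\<bar>B_op \<Omega> u v p\<bar> \<le> energy u + energy v + energy p" "\<bar>B_op \<Omega> v u p\<bar> \<le> energy v + energy u + energy p"
    by (intro B_op_energy V)+
  have Y: "\<bar>H_inner \<Omega> y v\<bar> \<le> (H_norm \<Omega> y)\<^sup>2 + V_const\<^sup>2 * energy v" by (rule H_inner_energy[OF y V(3)])
  have H: "\<bar>\<alpha> * H_inner \<Omega> p v\<bar> \<le> \<alpha> * ((H_norm \<Omega> p)\<^sup>2 + V_const\<^sup>2 * energy v)"
    using H_inner_energy[OF V_H[OF V(2)] V(3)] par by (simp add: abs_mult)
  have "\<bar>quad u u p v + 2 * quad u p u v\<bar>
      \<le> (energy u + energy u + energy p + energy v) + 2 * (energy u + energy p + energy u + energy v)"
    using quad_energy[OF V(1,1,2,3)] quad_energy[OF V(1,2,1,3)] by (simp add: abs_le_iff)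
  then have C: "\<bar>\<beta> * H_inner \<Omega> (C_deriv \<Omega> u p) v\<bar>
      \<le> \<beta> * ((energy u + energy u + energy p + energy v) + 2 * (energy u + energy p + energy u + energy v))"
    using par by (simp add: abs_mult C_deriv_inner[OF V])
  have nn: "0 \<le> energy u" "0 \<le> energy v" "0 \<le> energy p" "0 \<le> V_const\<^sup>2 * energy u" "0 \<le> V_const\<^sup>2 * energy p"
     "0 \<le> \<alpha> * V_const\<^sup>2 * energy u" "0 \<le> \<alpha> * V_const\<^sup>2 * energy p"
     "0 \<le> \<mu> * energy u" "0 \<le> \<mu> * energy p" "0 \<le> \<beta> * energy v" "0 \<le> \<beta> * energy u" "0 \<le> \<beta> * energy p"
    using par by simp_all
  have "\<bar>g\<bar> \<le> \<mu> * (energy p + energy v) + ((energy u + energy v + energy p) + (energy v + energy u + energy p))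
      + \<alpha> * ((H_norm \<Omega> p)\<^sup>2 + V_const\<^sup>2 * energy v)
      + \<beta> * ((energy u + energy u + energy p + energy v) + 2 * (energy u + energy p + energy u + energy v))
      + ((H_norm \<Omega> y)\<^sup>2 + V_const\<^sup>2 * energy v) + (energy u + energy v)"
    using eq A A' B Y H C unfolding B_deriv_adj_def B_deriv_def by linarith
  also have "\<dots> \<le> ((H_norm \<Omega> y)\<^sup>2 + \<alpha> * (H_norm \<Omega> p)\<^sup>2 + K * (energy u + energy p)) + K * energy v"
    using nn unfolding K_def by (simp add: algebra_simps)
  finally show ?thesis .
qed

lemma adjoint_evolution:
  assumes sol: "adjoint_solution \<Omega> T \<mu> \<alpha> \<beta> uM uMf us p"
    and us: "us \<in> continuous_in T (H_space \<Omega>) (H_norm \<Omega>)" "us \<in> Bochner_Lp 2 T (V_space \<Omega>) (V_norm \<Omega>)"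
    and y: "us - uM \<in> Bochner_Lp 2 T (H_space \<Omega>) (H_norm \<Omega>)" and par: "0 < \<mu>" "0 < \<alpha>" "0 < \<beta>"
  obtains dp where "evolution T p dp"
    "AE t in lebesgue_on {0..T}. \<forall>v\<in>V_space \<Omega>. - dp t v + \<mu> * A_op \<Omega> (p t) v + B_deriv_adj \<Omega> (us t) (p t) v
             + \<alpha> * H_inner \<Omega> (p t) v + \<beta> * H_inner \<Omega> (C_deriv \<Omega> (us t) (p t)) v
           = H_inner \<Omega> (us t - uM t) v + A_op \<Omega> (us t) v"
proof -
  let ?I = "lebesgue_on {0..T}"
  obtain dp where dp: "dp \<in> Bochner_Lp (4/3) T (V_dual \<Omega>) (V_dual_norm \<Omega>)" "has_time_deriv \<Omega> T p dp"
    and eq: "AE t in ?I. \<forall>v\<in>V_space \<Omega>. - dp t v + \<mu> * A_op \<Omega> (p t) v + B_deriv_adj \<Omega> (us t) (p t) v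
             + \<alpha> * H_inner \<Omega> (p t) v + \<beta> * H_inner \<Omega> (C_deriv \<Omega> (us t) (p t)) v
           = H_inner \<Omega> (us t - uM t) v + A_op \<Omega> (us t) v"
    using sol unfolding adjoint_solution_def by blast
  have p: "p \<in> continuous_in T (H_space \<Omega>) (H_norm \<Omega>)" "p \<in> Bochner_Lp 2 T (V_space \<Omega>) (V_norm \<Omega>)"
    using sol by (simp_all add: adjoint_solution_def)
  have mem: "AE t in ?I. us t \<in> V_space \<Omega>" "AE t in ?I. p t \<in> V_space \<Omega>" "AE t in ?I. us t - uM t \<in> H_space \<Omega>"
    and yi: "integrable ?I (\<lambda>t. (H_norm \<Omega> (us t - uM t))\<^sup>2)"
    using us p y by (simp_all add: Bochner_Lp_def H_norm_alt)
  define K where "K = 3 + \<mu> + (1 + \<alpha>) * V_const\<^sup>2 + 6 * \<beta>"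
  have K: "0 \<le> K" using par by (simp add: K_def)
  define A where "A t = (H_norm \<Omega> (us t - uM t))\<^sup>2 + \<alpha> * (H_norm \<Omega> (p t))\<^sup>2 + K * (energy (us t) + energy (p t))" for t
  have A: "integrable ?I A"
    unfolding A_def using yi square_integrable_of_continuous[OF p(1)] energy_integrable[OF p] energy_integrable[OF us]
    by simp
  have A0: "0 \<le> A t" for t using par K by (simp add: A_def)
  have "AE t in ?I. \<forall>v\<in>V_space \<Omega>. \<bar>dp t v\<bar> \<le> A t + K * energy v"
    using mem eq
  proof eventually_elim
    case (elim t)
    then show ?case
      using adjoint_derivative_bound[OF elim(1,2) _ elim(3) par] unfolding A_def K_def by auto
  qed
  then have "evolution T p dp"
    unfolding evolution_def using p dp A A0 K by blast
  then show thesis using eq by (rule that)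
qed



section \<open>Expansion around the reference state\<close>

lemma A_op_commute: "A_op \<Omega> u v = A_op \<Omega> v u"
  by (simp add: A_op_def inner_commute)

lemma A_op_diff:
  assumes "z \<in> V_space \<Omega>" "us \<in> V_space \<Omega>" "p \<in> V_space \<Omega>"
  shows "A_op \<Omega> z p = A_op \<Omega> us p + A_op \<Omega> (z - us) p"
proof -
  let ?w = "z - us"
  have w: "?w \<in> V_space \<Omega>" by (rule V_minus[OF assms(1,2)])
  have g: "AE x in M. wgrad \<Omega> z x = wgrad \<Omega> us x + wgrad \<Omega> ?w x"
    using wgrad_diff(1)[OF assms(1,2)] by eventually_elim simp
  note i = A_op_bound(1)
  have "A_op \<Omega> z p = (LINT x|M. wgrad \<Omega> us x \<bullet> wgrad \<Omega> p x + wgrad \<Omega> ?w x \<bullet> wgrad \<Omega> p x)"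
    unfolding A_op_def
  proof (rule integral_cong_AE)
    show "AE x in M. wgrad \<Omega> z x \<bullet> wgrad \<Omega> p x = wgrad \<Omega> us x \<bullet> wgrad \<Omega> p x + wgrad \<Omega> ?w x \<bullet> wgrad \<Omega> p x"
      using g by eventually_elim (simp add: inner_add_left)
  qed (use i[OF assms(1,3)] i[OF assms(2,3)] i[OF w assms(3)] in auto)
  also have "\<dots> = A_op \<Omega> us p + A_op \<Omega> ?w p"
    unfolding A_op_def by (rule Bochner_Integration.integral_add[OF i[OF assms(2,3)] i[OF w assms(3)]])
  finally show ?thesis .
qed

text \<open>
  Taylor's formula for the quadratic map \<open>u \<mapsto> B(u, u)\<close>: the bracket is its
  derivative at \<open>us\<close> in the direction \<open>w\<close>.
\<close>

lemma B_op_expand: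
  assumes "z \<in> V_space \<Omega>" "us \<in> V_space \<Omega>" "p \<in> V_space \<Omega>"
  defines "w \<equiv> z - us"
  shows "B_op \<Omega> z z p = B_op \<Omega> us us p + (B_op \<Omega> us w p + B_op \<Omega> w us p) + B_op \<Omega> w w p"
proof -
  have w: "w \<in> V_space \<Omega>" unfolding w_def by (rule V_minus[OF assms(1,2)])
  have g: "AE x in M. wgrad \<Omega> z x = wgrad \<Omega> us x + wgrad \<Omega> w x"
    using wgrad_diff(1)[OF assms(1,2)] unfolding w_def by eventually_elim simp
  have zx: "z x = us x + w x" for x by (simp add: w_def)
  note i = B_op_bound(1)
  note ints = i[OF assms(2,2,3)] i[OF assms(2) w assms(3)] i[OF w assms(2,3)] i[OF w w assms(3)]
  have "B_op \<Omega> z z p = (LINT x|M. (wgrad \<Omega> us x *v us x) \<bullet> p x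
      + ((wgrad \<Omega> w x *v us x) \<bullet> p x + (wgrad \<Omega> us x *v w x) \<bullet> p x) + (wgrad \<Omega> w x *v w x) \<bullet> p x)"
    unfolding B_op_def
  proof (rule integral_cong_AE)
    show "AE x in M. (wgrad \<Omega> z x *v z x) \<bullet> p x = (wgrad \<Omega> us x *v us x) \<bullet> p x
      + ((wgrad \<Omega> w x *v us x) \<bullet> p x + (wgrad \<Omega> us x *v w x) \<bullet> p x) + (wgrad \<Omega> w x *v w x) \<bullet> p x"
      using g
    proof eventually_elim
      case (elim x)
      show ?case unfolding elim zx
        by (simp add: matrix_vector_mult_add_rdistrib matrix_vector_right_distrib inner_add_left)
    qed
  qed (use i[OF assms(1,1,3)] ints in auto)
  also have "\<dots> = B_op \<Omega> us us p + (B_op \<Omega> us w p + B_op \<Omega> w us p) + B_op \<Omega> w w p"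
    unfolding B_op_def using ints by simp
  finally show ?thesis .
qed

text \<open>
  Taylor's formula for the cubic map \<open>u \<mapsto> \<bar>u\<bar>\<^sup>2 u\<close>: the
  first bracket is its derivative at \<open>us\<close> in the direction \<open>w\<close>, the
  second one its remainder.
\<close>

lemma quad_expand:
  assumes "z \<in> V_space \<Omega>" "us \<in> V_space \<Omega>" "p \<in> V_space \<Omega>"
  defines "w \<equiv> z - us"
  shows "quad z z z p = quad us us us p + (quad us us p w + 2 * quad us p us w)
    + (2 * quad us w w p + quad w w w p + quad w w us p)"
proof -
  have w: "w \<in> V_space \<Omega>" unfolding w_def by (rule V_minus[OF assms(1,2)])
  have zx: "z x = us x + w x" for x by (simp add: w_def)
  note L = V_L4[OF assms(2)] V_L4[OF assms(3)] V_L4[OF w]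
  have i: "integrable M (\<lambda>x. (us x \<bullet> us x) * (us x \<bullet> p x))" "integrable M (\<lambda>x. (us x \<bullet> us x) * (p x \<bullet> w x))"
    "integrable M (\<lambda>x. (us x \<bullet> p x) * (us x \<bullet> w x))" "integrable M (\<lambda>x. (us x \<bullet> w x) * (w x \<bullet> p x))"
    "integrable M (\<lambda>x. (w x \<bullet> w x) * (w x \<bullet> p x))" "integrable M (\<lambda>x. (w x \<bullet> w x) * (us x \<bullet> p x))"
    by (intro quad_bound(1) L)+
  have "quad z z z p = (LINT x|M. (us x \<bullet> us x) * (us x \<bullet> p x) + ((us x \<bullet> us x) * (p x \<bullet> w x) + 2 * ((us x \<bullet> p x) * (us x \<bullet> w x)))
    + (2 * ((us x \<bullet> w x) * (w x \<bullet> p x)) + (w x \<bullet> w x) * (w x \<bullet> p x) + (w x \<bullet> w x) * (us x \<bullet> p x)))"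
    unfolding quad_def zx
    by (intro Bochner_Integration.integral_cong refl)
       (simp add: inner_add_left inner_add_right inner_commute algebra_simps)
  then show ?thesis unfolding quad_def using i by simp
qed

lemma cubic_remainder:
  assumes "us \<in> V_space \<Omega>" "w \<in> V_space \<Omega>" "p \<in> V_space \<Omega>"
  shows "(LINT x|M. ((2 * (us x \<bullet> w x)) *\<^sub>R w x + (norm (w x))\<^sup>2 *\<^sub>R (w x + us x)) \<bullet> p x)
    = 2 * quad us w w p + quad w w w p + quad w w us p"
proof -
  note L = assms[THEN V_L4]
  have i: "integrable M (\<lambda>x. (us x \<bullet> w x) * (w x \<bullet> p x))"
    "integrable M (\<lambda>x. (w x \<bullet> w x) * (w x \<bullet> p x))" "integrable M (\<lambda>x. (w x \<bullet> w x) * (us x \<bullet> p x))"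
    by (intro quad_bound(1) L)+
  have "(LINT x|M. ((2 * (us x \<bullet> w x)) *\<^sub>R w x + (norm (w x))\<^sup>2 *\<^sub>R (w x + us x)) \<bullet> p x)
    = (LINT x|M. 2 * ((us x \<bullet> w x) * (w x \<bullet> p x)) + (w x \<bullet> w x) * (w x \<bullet> p x) + (w x \<bullet> w x) * (us x \<bullet> p x))"
    by (intro Bochner_Integration.integral_cong refl)
       (simp add: power2_norm_eq_inner inner_add_left algebra_simps)
  then show ?thesis unfolding quad_def using i by simp
qed

lemma H_inner_diff:
  assumes "u \<in> H_space \<Omega>" "v \<in> H_space \<Omega>" "w \<in> H_space \<Omega>"
  shows "H_inner \<Omega> (u - v) w = H_inner \<Omega> u w - H_inner \<Omega> v w"
  unfolding H_inner_def minus_apply inner_diff_left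
  by (rule Bochner_Integration.integral_diff)
     (intro sq_integrable_inner(1) assms[THEN H_sq_integrable])+

text \<open>
  The solution attains its initial value weakly, tested with elements of \<open>V\<close>, and
  it is continuous in \<open>H\<close>, so \<open>u(0) - U\<close> is orthogonal to
  \<open>V\<close>; but \<open>V\<close> contains the solenoidal test functions, which are dense
  in \<open>H\<close>.
\<close>

lemma initial_value:
  assumes sol: "weak_solution \<Omega> T \<mu> \<alpha> \<beta> f U u" and u: "u \<in> continuous_in T (H_space \<Omega>) (H_norm \<Omega>)"
    and U: "U \<in> H_space \<Omega>" and T: "0 < T"
  shows "AE x in M. u 0 x = U x"
proof -
  have u0: "u 0 \<in> H_space \<Omega>" using continuous_in_H[OF u] T by simp
  have d: "u 0 - U \<in> H_space \<Omega>" by (rule H_minus[OF u0 U])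
  have orth: "H_inner \<Omega> (u 0 - U) v = 0" if v: "v \<in> V_space \<Omega>" for v
  proof -
    define s where "s n = T / (real n + 2)" for n
    have s: "s n \<in> {0..T}" "0 < s n" for n
      using step_size(1,2)[OF T, of n] by (auto simp: s_def step_size_def less_imp_le)
    have s0: "s \<longlonglongrightarrow> 0" using step_size(3)[OF T] by (simp add: s_def[abs_def] step_size_def[abs_def])
    have "((\<lambda>t. H_inner \<Omega> (u t) v) \<longlongrightarrow> H_inner \<Omega> U v) (at_right 0)"
      using sol v by (simp add: weak_solution_def)
    moreover have "filterlim s (at_right 0) sequentially"
      using s0 s(2) less_imp_neq[OF s(2), symmetric] by (simp add: filterlim_at)
    ultimately have 1: "(\<lambda>n. H_inner \<Omega> (u (s n)) v) \<longlonglongrightarrow> H_inner \<Omega> U v"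
      by (rule filterlim_compose)
    have "continuous_on {0..T} (\<lambda>t. H_inner \<Omega> (u t) v)"
      using H_inner_continuous[OF u constant_continuous_in[OF V_H[OF v]], of "{0..T}" "\<lambda>t. t" "\<lambda>t. t"] by simp
    from continuous_on_tendsto_compose[OF this s0] have 2: "(\<lambda>n. H_inner \<Omega> (u (s n)) v) \<longlonglongrightarrow> H_inner \<Omega> (u 0) v"
      using s T by simp
    show ?thesis
      using LIMSEQ_unique[OF 1 2] H_inner_diff[OF u0 U V_H[OF v]] by simp
  qed
  have "(H_norm \<Omega> (u 0 - U))\<^sup>2 = 0"
  proof -
    obtain \<phi> where \<phi>: "\<And>n::nat. \<phi> n \<in> solenoidal_tests \<Omega>" "(\<lambda>n. L2norm M (\<lambda>x. (u 0 - U) x - \<phi> n x)) \<longlonglongrightarrow> 0"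
      by (rule norm_closureE[OF d[unfolded H_space_def]], rule that) (auto simp: Lp_norm2 fun_diff_def)
    note sq = H_sq_integrable[OF d] test_sq_integrable(1)[OF solenoidal_test[OF \<phi>(1)]]
    have "(\<lambda>n. L2norm M (\<lambda>x. (u 0 - U) x - (u 0 - U) x)) \<longlonglongrightarrow> 0" by (simp add: L2norm_def)
    from L2_tendsto_inner[OF sq(1) sq(1) sq(2) sq(1) this \<phi>(2)]
    have "(\<lambda>n. H_inner \<Omega> (u 0 - U) (\<phi> n)) \<longlonglongrightarrow> H_inner \<Omega> (u 0 - U) (u 0 - U)" by (simp add: H_inner_def)
    then have "H_inner \<Omega> (u 0 - U) (u 0 - U) = 0"
      using orth[OF solenoidal_V[OF \<phi>(1)]] by (simp add: LIMSEQ_const_iff)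
    then show ?thesis by (simp add: H_norm_square)
  qed
  then have "L2norm M (u 0 - U) = 0" by (simp add: H_norm_alt)
  then have "AE x in M. (u 0 - U) x = 0" using L2norm_eq_0_iff[OF H_sq_integrable[OF d]] by simp
  then show ?thesis by eventually_elim simp
qed

lemma H_norm_add_square:
  assumes "y \<in> H_space \<Omega>" "w \<in> H_space \<Omega>" "\<And>x. z x = y x + w x"
  shows "(H_norm \<Omega> z)\<^sup>2 = H_inner \<Omega> y y + 2 * H_inner \<Omega> y w + H_inner \<Omega> w w"
proof -
  have "z = (\<lambda>x. 1 *\<^sub>R y x + 1 *\<^sub>R w x)" using assms(3) by (simp add: fun_eq_iff)
  then show ?thesis
    using sq_integrable_lincomb(2)[OF assms(1,2)[THEN H_sq_integrable], of 1 1]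
    by (simp only: H_norm_square[symmetric] H_norm_alt)
       (simp add: L2norm_power2 H_inner_def)
qed

lemma V_norm_square: "(V_norm \<Omega> u)\<^sup>2 = A_op \<Omega> u u"
  by (simp add: V_norm_alt L2norm_power2 A_op_def power2_norm_eq_inner)


lemma continuous_in_diff:
  assumes u: "u \<in> continuous_in T (H_space \<Omega>) (H_norm \<Omega>)" and v: "v \<in> continuous_in T (H_space \<Omega>) (H_norm \<Omega>)"
  shows "u - v \<in> continuous_in T (H_space \<Omega>) (H_norm \<Omega>)"
proof -
  have "((\<lambda>s. H_norm \<Omega> ((u - v) s - (u - v) t)) \<longlongrightarrow> 0) (at t within {0..T})" if t: "t \<in> {0..T}" for t
  proof (rule Lim_null_comparison)
    show "((\<lambda>s. H_norm \<Omega> (u s - u t) + H_norm \<Omega> (v s - v t)) \<longlongrightarrow> 0) (at t within {0..T})"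
      by (rule tendsto_add_zero) (use u v t in \<open>simp_all add: continuous_in_def\<close>)
    show "\<forall>\<^sub>F s in at t within {0..T}. norm (H_norm \<Omega> ((u - v) s - (u - v) t)) \<le> H_norm \<Omega> (u s - u t) + H_norm \<Omega> (v s - v t)"
      unfolding eventually_at_filter
    proof (intro always_eventually allI impI)
      fix s assume s: "s \<in> {0..T}"
      note H = continuous_in_H[OF u s] continuous_in_H[OF u t] continuous_in_H[OF v s] continuous_in_H[OF v t]
      have "H_norm \<Omega> ((u s - u t) - (v s - v t)) \<le> H_norm \<Omega> (u s - u t) + H_norm \<Omega> (v s - v t)"
        by (intro H_norm_diff_le H_minus H)
      then show "norm (H_norm \<Omega> ((u - v) s - (u - v) t)) \<le> H_norm \<Omega> (u s - u t) + H_norm \<Omega> (v s - v t)"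
        by (simp add: diff_diff_swap H_norm_alt)
    qed
  qed
  then show ?thesis using u v unfolding continuous_in_def by (simp add: H_minus)
qed

section \<open>Comparison of the costs\<close>

text \<open>
  Derivatives of the nonlinear terms at \<open>us\<close> occur twice: in the expansion of the
  state equation for \<open>z\<close>, tested with \<open>p\<close>, and, transposed, in the
  adjoint equation, tested with \<open>w\<close>. They cancel, and so do the viscous and the
  damping terms.
\<close>

lemma remainder_identity:
  assumes V: "z \<in> V_space \<Omega>" "us \<in> V_space \<Omega>" "p \<in> V_space \<Omega>" and lin: "linear_on_V dp"
    and z: "\<forall>v\<in>V_space \<Omega>. dz v + \<mu> * A_op \<Omega> z v + B_op \<Omega> z z v + \<alpha> * H_inner \<Omega> z v
      + \<beta> * H_inner \<Omega> (C_op \<Omega> z) v = f v"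
    and us: "\<forall>v\<in>V_space \<Omega>. dus v + \<mu> * A_op \<Omega> us v + B_op \<Omega> us us v + \<alpha> * H_inner \<Omega> us v
      + \<beta> * H_inner \<Omega> (C_op \<Omega> us) v = f v"
    and adj: "\<forall>v\<in>V_space \<Omega>. - dp v + \<mu> * A_op \<Omega> p v + B_deriv_adj \<Omega> us p v + \<alpha> * H_inner \<Omega> p v
      + \<beta> * H_inner \<Omega> (C_deriv \<Omega> us p) v = H_inner \<Omega> y v + A_op \<Omega> us v"
  defines "w \<equiv> z - us"
  shows "(dz p - dus p) + (dp z - dp us)
    = - B_op \<Omega> w w p - \<beta> * (2 * quad us w w p + quad w w w p + quad w w us p) - H_inner \<Omega> y w - A_op \<Omega> us w"
proof -
  have w: "w \<in> V_space \<Omega>" unfolding w_def by (rule V_minus[OF V(1,2)])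
  have dw: "dp z - dp us = dp w" unfolding w_def by (rule linear_on_VD(1)[OF lin V(1,2), symmetric])
  define q where "q = quad us us us p"
  define ql where "ql = quad us us p w + 2 * quad us p us w"
  define qr where "qr = 2 * quad us w w p + quad w w w p + quad w w us p"
  define b where "b = B_op \<Omega> us us p"
  define bl where "bl = B_op \<Omega> us w p + B_op \<Omega> w us p"
  define ap where "ap = A_op \<Omega> us p"
  define hp where "hp = H_inner \<Omega> us p"
  have A: "A_op \<Omega> z p = ap + A_op \<Omega> p w"
    unfolding ap_def w_def using A_op_diff[OF V] by (simp add: A_op_commute)
  have H: "H_inner \<Omega> z p = hp + H_inner \<Omega> p w"
    unfolding hp_def w_def using H_inner_diff[OF V_H[OF V(1)] V_H[OF V(2)] V_H[OF V(3)]]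
    by (simp add: H_inner_commute)
  have B: "B_op \<Omega> z z p = b + bl + B_op \<Omega> w w p"
    unfolding b_def bl_def w_def by (rule B_op_expand[OF V])
  have C: "H_inner \<Omega> (C_op \<Omega> z) p = q + ql + qr"
    unfolding C_op_inner[OF V(1,3)] q_def ql_def qr_def w_def by (rule quad_expand[OF V])
  have C0: "H_inner \<Omega> (C_op \<Omega> us) p = q" unfolding q_def by (rule C_op_inner[OF V(2,3)])
  have C1: "H_inner \<Omega> (C_deriv \<Omega> us p) w = ql" unfolding ql_def by (rule C_deriv_inner[OF V(2,3) w])
  have 1: "dz p = f p - \<mu> * (ap + A_op \<Omega> p w) - (b + bl + B_op \<Omega> w w p) - \<alpha> * (hp + H_inner \<Omega> p w) - \<beta> * (q + ql + qr)"
    using bspec[OF z V(3)] unfolding A H B C by linarith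
  have 2: "dus p = f p - \<mu> * ap - b - \<alpha> * hp - \<beta> * q"
    using bspec[OF us V(3)] unfolding C0 ap_def b_def hp_def by linarith
  have 3: "dp w = \<mu> * A_op \<Omega> p w + bl + \<alpha> * H_inner \<Omega> p w + \<beta> * ql - H_inner \<Omega> y w - A_op \<Omega> us w"
    using bspec[OF adj w] unfolding C1 B_deriv_adj_def B_deriv_def bl_def by linarith
  show ?thesis unfolding dw 1 2 3 qr_def[symmetric] by (simp add: algebra_simps)
qed

text \<open>
  Integrate the pointwise identity over time. Integration by parts is applied to the pairs
  \<open>(z, p)\<close> and \<open>(us, p)\<close> separately, which avoids introducing a time
  derivative of their difference.
\<close>

lemma duality_identity:
  assumes T: "0 < T" and par: "0 < \<mu>" "0 < \<alpha>" "0 < \<beta>"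
    and f: "f \<in> Bochner_Lp 2 T (V_dual \<Omega>) (V_dual_norm \<Omega>)"
    and z: "weak_solution \<Omega> T \<mu> \<alpha> \<beta> f W z" "z \<in> continuous_in T (H_space \<Omega>) (H_norm \<Omega>)"
    and us: "weak_solution \<Omega> T \<mu> \<alpha> \<beta> f Us us" "us \<in> continuous_in T (H_space \<Omega>) (H_norm \<Omega>)"
    and uM: "uM \<in> Bochner_Lp 2 T (H_space \<Omega>) (H_norm \<Omega>)"
    and p: "adjoint_solution \<Omega> T \<mu> \<alpha> \<beta> uM uMf us p"
  defines "I \<equiv> lebesgue_on {0..T}" and "w \<equiv> z - us"
  shows "(LINT t|I. H_inner \<Omega> (us t - uM t) (w t)) + (LINT t|I. A_op \<Omega> (us t) (w t))
    = - (LINT t|I. B_op \<Omega> (w t) (w t) (p t))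
      - \<beta> * (LINT t|I. 2 * quad (us t) (w t) (w t) (p t) + quad (w t) (w t) (w t) (p t) + quad (w t) (w t) (us t) (p t))
      - H_inner \<Omega> (w T) (p T) + H_inner \<Omega> (w 0) (p 0)"
    "integrable I (\<lambda>t. H_inner \<Omega> (us t - uM t) (w t))" "integrable I (\<lambda>t. A_op \<Omega> (us t) (w t))"
    "integrable I (\<lambda>t. A_op \<Omega> (us t) (us t))" "integrable I (\<lambda>t. A_op \<Omega> (w t) (w t))"
    "integrable I (\<lambda>t. 2 * quad (us t) (w t) (w t) (p t) + quad (w t) (w t) (w t) (p t) + quad (w t) (w t) (us t) (p t))"
proof -
  have pc: "p \<in> continuous_in T (H_space \<Omega>) (H_norm \<Omega>)" "p \<in> Bochner_Lp 2 T (V_space \<Omega>) (V_norm \<Omega>)"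
    using p by (simp_all add: adjoint_solution_def)
  have zB: "z \<in> Bochner_Lp 2 T (V_space \<Omega>) (V_norm \<Omega>)" "z \<in> Bochner_Linf T (H_space \<Omega>) (H_norm \<Omega>)"
    using z(1) by (simp_all add: weak_solution_def)
  have uB: "us \<in> Bochner_Lp 2 T (V_space \<Omega>) (V_norm \<Omega>)" "us \<in> Bochner_Linf T (H_space \<Omega>) (H_norm \<Omega>)"
    using us(1) by (simp_all add: weak_solution_def)
  have y: "us - uM \<in> Bochner_Lp 2 T (H_space \<Omega>) (H_norm \<Omega>)"
    by (rule Bochner2_H_diff[OF Linf_imp_Bochner2[OF uB(2)] uM])
  have wH: "w \<in> Bochner_Lp 2 T (H_space \<Omega>) (H_norm \<Omega>)"
    unfolding w_def by (rule Bochner2_H_diff[OF zB(2)[THEN Linf_imp_Bochner2] uB(2)[THEN Linf_imp_Bochner2]])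
  have wV: "w \<in> Bochner_Lp 2 T (V_space \<Omega>) (V_norm \<Omega>)"
    unfolding w_def by (rule Bochner2_V_diff[OF zB(1) uB(1)])
  have wc: "w \<in> continuous_in T (H_space \<Omega>) (H_norm \<Omega>)"
    unfolding w_def by (rule continuous_in_diff[OF z(2) us(2)])
  note en = energy_integrable[OF wc wV] energy_integrable[OF us(2) uB(1)] energy_integrable[OF pc]
  show yi: "integrable I (\<lambda>t. H_inner \<Omega> (us t - uM t) (w t))"
    using H_inner_integrable[OF y wH] by (simp add: I_def)
  show Ai: "integrable I (\<lambda>t. A_op \<Omega> (us t) (w t))"
    unfolding I_def by (rule operators_integrable(2)[OF uB(1) en(2) wV en(1) pc(2) en(3)])
  show "integrable I (\<lambda>t. A_op \<Omega> (us t) (us t))" "integrable I (\<lambda>t. A_op \<Omega> (w t) (w t))"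
    unfolding I_def
    by (rule operators_integrable(2)[OF uB(1) en(2) uB(1) en(2) pc(2) en(3)],
        rule operators_integrable(2)[OF wV en(1) wV en(1) pc(2) en(3)])
  have Bi: "integrable I (\<lambda>t. B_op \<Omega> (w t) (w t) (p t))"
    unfolding I_def by (rule operators_integrable(1)[OF wV en(1) wV en(1) pc(2) en(3)])
  define Q where "Q t = 2 * quad (us t) (w t) (w t) (p t) + quad (w t) (w t) (w t) (p t) + quad (w t) (w t) (us t) (p t)" for t
  show "integrable I (\<lambda>t. 2 * quad (us t) (w t) (w t) (p t) + quad (w t) (w t) (w t) (p t) + quad (w t) (w t) (us t) (p t))"
    unfolding I_def by (rule operators_integrable(3)[OF uB(1) en(2) wV en(1) pc(2) en(3)])
  then have Qi: "integrable I Q" unfolding Q_def .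
  obtain dz where dz: "evolution T z dz"
    "AE t in I. \<forall>v\<in>V_space \<Omega>. dz t v + \<mu> * A_op \<Omega> (z t) v + B_op \<Omega> (z t) (z t) v
             + \<alpha> * H_inner \<Omega> (z t) v + \<beta> * H_inner \<Omega> (C_op \<Omega> (z t)) v = f t v"
    unfolding I_def by (rule state_evolution[OF z f par])
  obtain dus where dus: "evolution T us dus"
    "AE t in I. \<forall>v\<in>V_space \<Omega>. dus t v + \<mu> * A_op \<Omega> (us t) v + B_op \<Omega> (us t) (us t) v
             + \<alpha> * H_inner \<Omega> (us t) v + \<beta> * H_inner \<Omega> (C_op \<Omega> (us t)) v = f t v"
    unfolding I_def by (rule state_evolution[OF us f par])
  obtain dp where dp: "evolution T p dp"
    "AE t in I. \<forall>v\<in>V_space \<Omega>. - dp t v + \<mu> * A_op \<Omega> (p t) v + B_deriv_adj \<Omega> (us t) (p t) v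
             + \<alpha> * H_inner \<Omega> (p t) v + \<beta> * H_inner \<Omega> (C_deriv \<Omega> (us t) (p t)) v
           = H_inner \<Omega> (us t - uM t) v + A_op \<Omega> (us t) v"
    unfolding I_def by (rule adjoint_evolution[OF p us(2) uB(1) y par])
  note pair = evolution_pairing(1)[OF diagonal_weights_backward[OF T], folded I_def]
  note pi = pair[OF dz(1) pc] pair[OF dus(1) pc] pair[OF dp(1) z(2) zB(1)] pair[OF dp(1) us(2) uB(1)]
  have mem: "AE t in I. z t \<in> V_space \<Omega>" "AE t in I. us t \<in> V_space \<Omega>" "AE t in I. p t \<in> V_space \<Omega>"
    "AE t in I. dp t \<in> V_dual \<Omega>"
    unfolding I_def using zB(1) uB(1) pc(2) dp(1) by (simp_all add: Bochner_Lp_def evolution_def)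
  define R where "R t = - B_op \<Omega> (w t) (w t) (p t) - \<beta> * Q t - H_inner \<Omega> (us t - uM t) (w t) - A_op \<Omega> (us t) (w t)" for t
  have Ri: "integrable I R" unfolding R_def using Bi Qi yi Ai by simp
  have ae: "AE t in I. (dz t (p t) - dus t (p t)) + (dp t (z t) - dp t (us t)) = R t"
    using mem dz(2) dus(2) dp(2)
  proof eventually_elim
    case (elim t)
    show ?case
      using remainder_identity[OF elim(1-3) V_dual_linear[OF elim(4)] elim(5-7)]
      by (simp add: R_def Q_def w_def)
  qed
  have H: "z t \<in> H_space \<Omega>" "us t \<in> H_space \<Omega>" "p t \<in> H_space \<Omega>" if "t \<in> {0..T}" for t
    using that continuous_in_H[OF z(2)] continuous_in_H[OF us(2)] continuous_in_H[OF pc(1)] by blast+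
  have Hw: "H_inner \<Omega> (w t) (p t) = H_inner \<Omega> (z t) (p t) - H_inner \<Omega> (us t) (p t)" if "t \<in> {0..T}" for t
    unfolding w_def using H_inner_diff[OF H[OF that]] by simp
  have "H_inner \<Omega> (w T) (p T) - H_inner \<Omega> (w 0) (p 0)
      = ((LINT t|I. dz t (p t)) + (LINT t|I. dp t (z t))) - ((LINT t|I. dus t (p t)) + (LINT t|I. dp t (us t)))"
    using integration_by_parts[OF T dz(1) dp(1)] integration_by_parts[OF T dus(1) dp(1)] Hw[of 0] Hw[of T] T
    by (simp add: I_def)
  also have "\<dots> = (LINT t|I. (dz t (p t) - dus t (p t)) + (dp t (z t) - dp t (us t)))"
    using pi by simp
  also have "\<dots> = (LINT t|I. R t)"
    using ae Ri pi by (intro integral_cong_AE) auto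
  also have "\<dots> = - (LINT t|I. B_op \<Omega> (w t) (w t) (p t)) - \<beta> * (LINT t|I. Q t)
      - (LINT t|I. H_inner \<Omega> (us t - uM t) (w t)) - (LINT t|I. A_op \<Omega> (us t) (w t))"
    unfolding R_def using Bi Qi yi Ai by simp
  finally show "(LINT t|I. H_inner \<Omega> (us t - uM t) (w t)) + (LINT t|I. A_op \<Omega> (us t) (w t))
    = - (LINT t|I. B_op \<Omega> (w t) (w t) (p t))
      - \<beta> * (LINT t|I. 2 * quad (us t) (w t) (w t) (p t) + quad (w t) (w t) (w t) (p t) + quad (w t) (w t) (us t) (p t))
      - H_inner \<Omega> (w T) (p T) + H_inner \<Omega> (w 0) (p 0)"
    unfolding Q_def by linarith
qed

text \<open>
  The initial and final conditions hold almost everywhere only.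
\<close>

lemma H_inner_cong_AE:
  assumes "a \<in> H_space \<Omega>" "b \<in> H_space \<Omega>" "c \<in> H_space \<Omega>" "d \<in> H_space \<Omega>"
    and "AE x in M. a x = b x" "AE x in M. c x = d x"
  shows "H_inner \<Omega> a c = H_inner \<Omega> b d"
  unfolding H_inner_def
proof (rule integral_cong_AE)
  show "AE x in M. a x \<bullet> c x = b x \<bullet> d x" using assms(5,6) by eventually_elim simp
qed (use sq_integrable_inner(1)[OF assms(1,3)[THEN H_sq_integrable]]
      sq_integrable_inner(1)[OF assms(2,4)[THEN H_sq_integrable]] in auto)

end

theorem theorem6p4:
  fixes \<Omega> :: "plane set" and T \<mu> \<alpha> \<beta> :: real
    and f :: "real \<Rightarrow> functional"
    and uM us p :: "real \<Rightarrow> vfield" and uMf Us :: vfield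
  assumes domain: "smooth_bounded_domain \<Omega>"
    and params: "T > 0" "\<mu> > 0" "\<alpha> > 0" "\<beta> > 0"
    and forcing: "f \<in> Bochner_Lp 2 T (V_dual \<Omega>) (V_dual_norm \<Omega>)"
    and target: "uM \<in> Bochner_Lp 2 T (H_space \<Omega>) (H_norm \<Omega>)" "uMf \<in> H_space \<Omega>"
    and feasible: "(us, Us) \<in> admissible \<Omega> T \<mu> \<alpha> \<beta> f"
    and adjoint: "adjoint_solution \<Omega> T \<mu> \<alpha> \<beta> uM uMf us p"
    and first_order: "AE x in lebesgue_on \<Omega>. Us x = - p 0 x"
    and second_order: "\<And>u U. (u, U) \<in> feasible_differences \<Omega> T \<mu> \<alpha> \<beta> f us Us \<Longrightarrow>
          1/2 * (LINT t|lebesgue_on {0..T}.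
                   (H_norm \<Omega> (u t))\<^sup>2 + (Lp_norm 2 \<Omega> (wgrad \<Omega> (u t)))\<^sup>2)
          + 1/2 * (H_norm \<Omega> U)\<^sup>2 + 1/2 * (H_norm \<Omega> (u T))\<^sup>2
          - (LINT t|lebesgue_on {0..T}. B_op \<Omega> (u t) (u t) (p t))
          - \<beta> * (LINT t|lebesgue_on {0..T}. LINT x|lebesgue_on \<Omega>.
                   ((2 * (us t x \<bullet> u t x)) *\<^sub>R u t x
                     + (norm (u t x))\<^sup>2 *\<^sub>R (u t x + us t x)) \<bullet> p t x)
          \<ge> 0"
  shows "optimal_pair \<Omega> T \<mu> \<alpha> \<beta> f uM uMf us Us"
proof -
  interpret planar_domain \<Omega>
    using domain by unfold_locales (simp_all add: smooth_bounded_domain_def)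
  let ?I = "lebesgue_on {0..T}"
  have us: "Us \<in> H_space \<Omega>" "weak_solution \<Omega> T \<mu> \<alpha> \<beta> f Us us" "us \<in> continuous_in T (H_space \<Omega>) (H_norm \<Omega>)"
    using feasible by (simp_all add: admissible_def)
  have uB: "us \<in> Bochner_Lp 2 T (V_space \<Omega>) (V_norm \<Omega>)" "us \<in> Bochner_Linf T (H_space \<Omega>) (H_norm \<Omega>)"
    using us(2) by (simp_all add: weak_solution_def)
  have p: "p \<in> continuous_in T (H_space \<Omega>) (H_norm \<Omega>)" "p \<in> Bochner_Lp 2 T (V_space \<Omega>) (V_norm \<Omega>)"
    "AE x in M. p T x = us T x - uMf x"
    using adjoint by (simp_all add: adjoint_solution_def)
  have y: "us - uM \<in> Bochner_Lp 2 T (H_space \<Omega>) (H_norm \<Omega>)"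
    by (rule Bochner2_H_diff[OF Linf_imp_Bochner2[OF uB(2)] target(1)])
  have "cost \<Omega> T uM uMf us Us \<le> cost \<Omega> T uM uMf z W" if zW: "(z, W) \<in> admissible \<Omega> T \<mu> \<alpha> \<beta> f" for z W
  proof -
    have z: "W \<in> H_space \<Omega>" "weak_solution \<Omega> T \<mu> \<alpha> \<beta> f W z" "z \<in> continuous_in T (H_space \<Omega>) (H_norm \<Omega>)"
      using zW by (simp_all add: admissible_def)
    have zB: "z \<in> Bochner_Lp 2 T (V_space \<Omega>) (V_norm \<Omega>)" "z \<in> Bochner_Linf T (H_space \<Omega>) (H_norm \<Omega>)"
      using z(2) by (simp_all add: weak_solution_def)
    define w where "w = z - us"
    define D where "D = W - Us"
    have D: "D \<in> H_space \<Omega>" unfolding D_def by (rule H_minus[OF z(1) us(1)])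
    have wH: "w \<in> Bochner_Lp 2 T (H_space \<Omega>) (H_norm \<Omega>)"
      unfolding w_def by (rule Bochner2_H_diff[OF zB(2)[THEN Linf_imp_Bochner2] uB(2)[THEN Linf_imp_Bochner2]])
    have mem: "AE t in ?I. us t - uM t \<in> H_space \<Omega>" "AE t in ?I. w t \<in> H_space \<Omega>"
      "AE t in ?I. us t \<in> V_space \<Omega>" "AE t in ?I. z t \<in> V_space \<Omega>" "AE t in ?I. p t \<in> V_space \<Omega>"
      using y wH uB(1) zB(1) p(2) by (simp_all add: Bochner_Lp_def)
    note dual = duality_identity[OF params forcing z(2,3) us(2,3) target(1) adjoint, folded w_def]
    have yy: "integrable ?I (\<lambda>t. H_inner \<Omega> (us t - uM t) (us t - uM t))"
      and ww: "integrable ?I (\<lambda>t. H_inner \<Omega> (w t) (w t))"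
      using H_inner_integrable[OF y y] H_inner_integrable[OF wH wH] by simp_all
    note split = dual(2-5) yy ww
    have ends: "z T \<in> H_space \<Omega>" "us T \<in> H_space \<Omega>" "p T \<in> H_space \<Omega>" "z 0 \<in> H_space \<Omega>" "us 0 \<in> H_space \<Omega>"
      "p 0 \<in> H_space \<Omega>"
      using params(1) by (auto intro: continuous_in_H[OF z(3)] continuous_in_H[OF us(3)] continuous_in_H[OF p(1)])
    have wT: "w T \<in> H_space \<Omega>" "w 0 \<in> H_space \<Omega>" unfolding w_def using H_minus ends by simp_all
    have yT: "us T - uMf \<in> H_space \<Omega>" by (rule H_minus[OF ends(2) target(2)])
    (* The final condition of the adjoint system turns the boundary term at T into the derivative
       of the final cost. *)
    have "H_inner \<Omega> (p T) (w T) = H_inner \<Omega> (us T - uMf) (w T)"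
      by (rule H_inner_cong_AE[OF ends(3) yT wT(1) wT(1)]) (use p(3) in simp_all)
    then have final: "H_inner \<Omega> (w T) (p T) = H_inner \<Omega> (us T - uMf) (w T)" by (simp add: H_inner_commute)
    (* The first order condition turns the boundary term at 0 into the derivative of the control
       cost. *)
    have "H_inner \<Omega> (w 0) (p 0) = - H_inner \<Omega> Us D"
    proof -
      have m: "- Us \<in> H_space \<Omega>" using H_lincomb[OF us(1,1), of "-1" 0] by (simp add: fun_Compl_def)
      have "AE x in M. w 0 x = D x"
        using initial_value[OF z(2,3,1) params(1)] initial_value[OF us(2,3,1) params(1)]
        by eventually_elim (simp add: w_def D_def)
      moreover have "AE x in M. p 0 x = (- Us) x" using first_order by eventually_elim simp
      ultimately have "H_inner \<Omega> (w 0) (p 0) = H_inner \<Omega> D (- Us)"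
        by (intro H_inner_cong_AE wT D ends m)
      also have "\<dots> = - H_inner \<Omega> Us D" by (simp add: H_inner_def inner_commute)
      finally show ?thesis .
    qed
    note initial = this
    (* Coefficients of order 0, 1 and 2 of the distributed costs in w. *)
    define a b where "a = (LINT t|?I. H_inner \<Omega> (us t - uM t) (us t - uM t))"
      and "b = (LINT t|?I. A_op \<Omega> (us t) (us t))"
    define a1 b1 where "a1 = (LINT t|?I. H_inner \<Omega> (us t - uM t) (w t))" and "b1 = (LINT t|?I. A_op \<Omega> (us t) (w t))"
    define a2 b2 where "a2 = (LINT t|?I. H_inner \<Omega> (w t) (w t))" and "b2 = (LINT t|?I. A_op \<Omega> (w t) (w t))"
    have misfit: "(LINT t|?I. (H_norm \<Omega> (z t - uM t))\<^sup>2) = a + 2 * a1 + a2"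
    proof -
      have "(LINT t|?I. (H_norm \<Omega> (z t - uM t))\<^sup>2) = (LINT t|?I. H_inner \<Omega> (us t - uM t) (us t - uM t)
          + 2 * H_inner \<Omega> (us t - uM t) (w t) + H_inner \<Omega> (w t) (w t))"
      proof (rule lebesgue_on_integral_cong_AE[symmetric])
        show "AE t in ?I. H_inner \<Omega> (us t - uM t) (us t - uM t) + 2 * H_inner \<Omega> (us t - uM t) (w t)
            + H_inner \<Omega> (w t) (w t) = (H_norm \<Omega> (z t - uM t))\<^sup>2"
          using mem(1,2)
        proof eventually_elim
          case (elim t)
          show ?case by (rule H_norm_add_square[OF elim, symmetric]) (simp add: w_def)
        qed
      qed (use split in auto)
      then show ?thesis using split by (simp add: a_def a1_def a2_def)
    qed
    have gradient: "(LINT t|?I. (V_norm \<Omega> (z t))\<^sup>2) = b + 2 * b1 + b2"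
    proof -
      have "(LINT t|?I. (V_norm \<Omega> (z t))\<^sup>2)
          = (LINT t|?I. A_op \<Omega> (us t) (us t) + 2 * A_op \<Omega> (us t) (w t) + A_op \<Omega> (w t) (w t))"
      proof (rule lebesgue_on_integral_cong_AE[symmetric])
        show "AE t in ?I. A_op \<Omega> (us t) (us t) + 2 * A_op \<Omega> (us t) (w t) + A_op \<Omega> (w t) (w t) = (V_norm \<Omega> (z t))\<^sup>2"
          using mem(3,4)
        proof eventually_elim
          case (elim t)
          have w: "w t \<in> V_space \<Omega>" unfolding w_def using V_minus[OF elim(2,1)] by simp
          have e: "A_op \<Omega> (z t) v = A_op \<Omega> (us t) v + A_op \<Omega> (w t) v" if "v \<in> V_space \<Omega>" for v
            using A_op_diff[OF elim(2,1) that] by (simp add: w_def)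
          show ?case
            unfolding V_norm_square using e[OF elim(2)] e[OF elim(1)] e[OF w]
              A_op_commute[of "us t" "z t"] A_op_commute[of "w t" "z t"] A_op_commute[of "w t" "us t"]
            by linarith
        qed
      qed (use split in auto)
      then show ?thesis using split by (simp add: b_def b1_def b2_def)
    qed
    have remainder: "(LINT t|?I. LINT x|M. ((2 * (us t x \<bullet> w t x)) *\<^sub>R w t x
          + (norm (w t x))\<^sup>2 *\<^sub>R (w t x + us t x)) \<bullet> p t x)
        = (LINT t|?I. 2 * quad (us t) (w t) (w t) (p t) + quad (w t) (w t) (w t) (p t) + quad (w t) (w t) (us t) (p t))"
    proof (rule lebesgue_on_integral_cong_AE[symmetric, OF borel_measurable_integrable[OF dual(6)]])
      show "AE t in ?I. 2 * quad (us t) (w t) (w t) (p t) + quad (w t) (w t) (w t) (p t) + quad (w t) (w t) (us t) (p t)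
          = (LINT x|M. ((2 * (us t x \<bullet> w t x)) *\<^sub>R w t x + (norm (w t x))\<^sup>2 *\<^sub>R (w t x + us t x)) \<bullet> p t x)"
        using mem(3-5)
      proof eventually_elim
        case (elim t)
        have "w t \<in> V_space \<Omega>" unfolding w_def using V_minus[OF elim(2,1)] by simp
        from cubic_remainder[OF elim(1) this elim(3)] show ?case by simp
      qed
    qed
    have initial_cost: "(H_norm \<Omega> W)\<^sup>2 = H_inner \<Omega> Us Us + 2 * H_inner \<Omega> Us D + H_inner \<Omega> D D"
      by (rule H_norm_add_square[OF us(1) D]) (simp add: D_def)
    have final_cost: "(H_norm \<Omega> (z T - uMf))\<^sup>2
        = H_inner \<Omega> (us T - uMf) (us T - uMf) + 2 * H_inner \<Omega> (us T - uMf) (w T) + H_inner \<Omega> (w T) (w T)"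
      by (rule H_norm_add_square[OF yT wT(1)]) (simp add: w_def)
    have "(w, D) \<in> feasible_differences \<Omega> T \<mu> \<alpha> \<beta> f us Us"
      unfolding feasible_differences_def w_def D_def using zW by blast
    note so = second_order[OF this, unfolded remainder, folded V_norm_def]
    have "(LINT t|?I. (H_norm \<Omega> (w t))\<^sup>2 + (V_norm \<Omega> (w t))\<^sup>2) = a2 + b2"
      unfolding H_norm_square V_norm_square a2_def b2_def using split by simp
    note so' = so[unfolded this, unfolded H_norm_square]
    have "cost \<Omega> T uM uMf us Us = 1/2 * H_inner \<Omega> Us Us + 1/2 * a + 1/2 * b + 1/2 * H_inner \<Omega> (us T - uMf) (us T - uMf)"
      by (simp add: cost_def a_def b_def H_norm_square V_norm_square flip: V_norm_def)
    moreover have "cost \<Omega> T uM uMf z W = 1/2 * (H_inner \<Omega> Us Us + 2 * H_inner \<Omega> Us D + H_inner \<Omega> D D)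
        + 1/2 * (a + 2 * a1 + a2) + 1/2 * (b + 2 * b1 + b2)
        + 1/2 * (H_inner \<Omega> (us T - uMf) (us T - uMf) + 2 * H_inner \<Omega> (us T - uMf) (w T) + H_inner \<Omega> (w T) (w T))"
      by (simp only: cost_def V_norm_def[symmetric] misfit gradient initial_cost final_cost)
    ultimately show ?thesis
      using so' dual(1)[folded a1_def b1_def] final initial by argo
  qed
  then show ?thesis using feasible unfolding optimal_pair_def by blast
qed

end
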